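(* Let $\nu>-1$ be fixed. Given $F\in A^2_\nu$, there exists $\tau\in \mathcal{L}^2_\nu$ such that, for every $\zeta\in\mathcal{U}$, with $(z,t,h)=\Psi(\zeta)$, $$ F(\zeta)=\frac{1}{(2\pi)^{n+1}}\int_{-\infty}^0 e^{h\lambda}\,\operatorname{tr}\big(\tau(\lambda)\sigma_\lambda[z,t]^*\big)\,|\lambda|^n\,d\lambda \qquad ( * ) $$ and $$ \|F\|_{A^2_\nu}^2=\frac{\Gamma(\nu+1)}{2^{\nu+1}}\,\|\tau\|_{\mathcal{L}^2_\nu}^2. \qquad ( ** ) $$ Conversely, given $\tau\in\mathcal{L}^2_\nu$, let $F$ be defined by $( * )$. Then $F\in A^2_\nu$ and $( ** )$ holds.
   Context: Fix an integer $n\ge 1$. For $a,b\in\mathbb{C}^n$ write $a\cdot b=\sum_{j=1}^n a_jb_j$ (so $a\cdot\bar b$ is the Hermitian inner product). The Siegel upper half-space is $\mathcal{U}=\{\zeta=(\zeta',\zeta_{n+1})\in\mathbb{C}^n\times\mathbb{C}:\ \operatorname{Im}\zeta_{n+1}>\frac14|\zeta'|^2\}$, and $\varrho(\zeta)=\operatorname{Im}\zeta_{n+1}-\frac14|\zeta'|^2$. $\operatorname{Hol}(\mathcal{U})$ is the space of holomorphic functions on $\mathcal{U}$, and $d\zeta$ is Lebesgue measure on $\mathbb{C}^{n+1}$. For $\nu>-1$ the weighted Bergman space is $A^2_\nu=\{F\in\operatorname{Hol}(\mathcal{U}):\ \|F\|_{A^2_\nu}^2:=\int_{\mathcal{U}}|F(\zeta)|^2\varrho(\zeta)^\nu\,d\zeta<+\infty\}$.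 The map $\Psi:\mathcal{U}\to\mathbb{C}^n\times\mathbb{R}\times(0,+\infty)$ is $\Psi(\zeta',\zeta_{n+1})=(z,t,h)$ with $z=\zeta'$, $t=\operatorname{Re}\zeta_{n+1}$, $h=\operatorname{Im}\zeta_{n+1}-\frac14|\zeta'|^2$. The Heisenberg group $\mathbb{H}_n$ is $\mathbb{C}^n\times\mathbb{R}$ with product $[w,s][z,t]=[w+z,\,s+t-\frac12\operatorname{Im}(w\cdot\bar z)]$. For $\lambda\in\mathbb{R}\setminus\{0\}$ the Fock space $\mathcal{F}^\lambda$ is the Hilbert space of entire functions $G$ on $\mathbb{C}^n$ with $\big(\frac{|\lambda|}{2\pi}\big)^n\int_{\mathbb{C}^n}|G(w)|^2e^{-\frac{|\lambda|}{2}|w|^2}\,dw<+\infty$ (this quantity being the squared norm). For $[z,t]\in\mathbb{H}_n$ the Bargmann representation $\sigma_\lambda[z,t]$ is the operator on $\mathcal{F}^\lambda$ given by $\sigma_\lambda[z,t]G(w)=e^{i\lambda t-\frac{\lambda}{2}w\cdot\bar z-\frac{\lambda}{4}|z|^2}G(w+z)$ if $\lambda>0$, and $\sigma_\lambda[z,t]G(w)=e^{i\lambda t+\frac{\lambda}{2}w\cdot z+\frac{\lambda}{4}|z|^2}G(w+\bar z)$ if $\lambda<0$. $\operatorname{tr}$ denotes the trace of operators on $\mathcal{F}^\lambda$. For $\nu\in\mathbb{R}$, $\mathcal{L}^2_\nu$ is the space of functions $\tau$ on $\mathbb{R}\setminus\{0\}$ such that: (i) $\tau(\lambda):\mathcal{F}^\lambda\to\mathcal{F}^\lambda$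 is a Hilbert–Schmidt operator for every $\lambda$; (ii) $\tau(\lambda)=0$ for $\lambda>0$; (iii) $\operatorname{ran}(\tau(\lambda))\subseteq\operatorname{span}\{1\}$; (iv) $\|\tau\|_{\mathcal{L}^2_\nu}^2:=\frac{1}{(2\pi)^{n+1}}\int_{-\infty}^0\|\tau(\lambda)\|_{HS}^2\,|\lambda|^{n-(\nu+1)}\,d\lambda<+\infty$, where $\|\cdot\|_{HS}$ is the Hilbert–Schmidt norm on $\mathcal{F}^\lambda$. As usual, $\tau$ is a measurable field of operators: $\lambda\mapsto\langle\tau(\lambda)w^\alpha,w^\beta\rangle_{\mathcal{F}^\lambda}$ is measurable for all multiindices $\alpha,\beta$, and functions agreeing a.e. are identified. *)

theory Defs
  imports "HOL-Analysis.Analysis"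
begin

text \<open>
  The dimension is \<open>n = CARD('n)\<close>, so \<open>n \<ge> 1\<close> holds automatically. Functions on a domain are
  total functions of which only the values on the domain matter; likewise, operators on the
  Fock space are total maps on functions, constrained only on the carrier \<open>fock_space l\<close>.
\<close>

definition cdot :: "complex ^ 'n \<Rightarrow> complex ^ 'n \<Rightarrow> complex" where
  "cdot a b = (\<Sum>j\<in>UNIV. a $ j * b $ j)"

definition vcnj :: "complex ^ 'n \<Rightarrow> complex ^ 'n" where
  "vcnj a = (\<chi> j. cnj (a $ j))"

definition monomial :: "('n \<Rightarrow> nat) \<Rightarrow> complex ^ 'n \<Rightarrow> complex" where
  "monomial \<alpha> w = (\<Prod>j\<in>UNIV. w $ j ^ \<alpha> j)"


subsection \<open>Weighted Bergman spaces on the Siegel upper half-space\<close>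

definition siegel_rho :: "(complex ^ 'n) \<times> complex \<Rightarrow> real" where
  "siegel_rho \<zeta> = Im (snd \<zeta>) - (norm (fst \<zeta>))\<^sup>2 / 4"

definition siegel_space :: "((complex ^ 'n) \<times> complex) set" where
  "siegel_space = {\<zeta>. Im (snd \<zeta>) > (norm (fst \<zeta>))\<^sup>2 / 4}"

definition siegel_coords :: "(complex ^ 'n) \<times> complex \<Rightarrow> (complex ^ 'n) \<times> real \<times> real" where
  "siegel_coords \<zeta> = (fst \<zeta>, Re (snd \<zeta>), Im (snd \<zeta>) - (norm (fst \<zeta>))\<^sup>2 / 4)"

text \<open>
  The library's \<open>holomorphic_on\<close> covers one complex variable only. In several variables a function
  is holomorphic if at each point it has a (real Frechet) derivative that is complex-linear.
\<close>

definition siegel_holomorphic :: "((complex ^ 'n) \<times> complex \<Rightarrow> complex) \<Rightarrow> bool" where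
  "siegel_holomorphic F \<longleftrightarrow>
     (\<forall>\<zeta>\<in>siegel_space. \<exists>D. (F has_derivative D) (at \<zeta>) \<and>
        (\<forall>c u v. D (c *s u, c * v) = c * D (u, v)))"

definition bergman_space :: "real \<Rightarrow> ((complex ^ 'n) \<times> complex \<Rightarrow> complex) set" where
  "bergman_space \<nu> =
     {F. siegel_holomorphic F \<and>
         set_integrable lborel siegel_space (\<lambda>\<zeta>. (norm (F \<zeta>))\<^sup>2 * siegel_rho \<zeta> powr \<nu>)}"

definition bergman_norm :: "real \<Rightarrow> ((complex ^ 'n) \<times> complex \<Rightarrow> complex) \<Rightarrow> real" where
  "bergman_norm \<nu> F =
     sqrt (LINT \<zeta>:siegel_space|lborel. (norm (F \<zeta>))\<^sup>2 * siegel_rho \<zeta> powr \<nu>)"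


subsection \<open>The Fock space and operators on it\<close>

definition entire :: "(complex ^ 'n \<Rightarrow> complex) \<Rightarrow> bool" where
  "entire G \<longleftrightarrow>
     (\<forall>w. \<exists>D. (G has_derivative D) (at w) \<and> (\<forall>c v. D (c *s v) = c * D v))"

definition fock_space :: "real \<Rightarrow> (complex ^ 'n \<Rightarrow> complex) set" where
  "fock_space l =
     {G. entire G \<and> integrable lborel (\<lambda>w. (norm (G w))\<^sup>2 * exp (- \<bar>l\<bar> / 2 * (norm w)\<^sup>2))}"

definition fock_inner ::
    "real \<Rightarrow> (complex ^ 'n \<Rightarrow> complex) \<Rightarrow> (complex ^ 'n \<Rightarrow> complex) \<Rightarrow> complex" where
  "fock_inner l G H =
     of_real ((\<bar>l\<bar> / (2 * pi)) ^ CARD('n)) *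
     (LINT w|lborel. G w * cnj (H w) * of_real (exp (- \<bar>l\<bar> / 2 * (norm w)\<^sup>2)))"

definition fock_norm :: "real \<Rightarrow> (complex ^ 'n \<Rightarrow> complex) \<Rightarrow> real" where
  "fock_norm l G =
     sqrt ((\<bar>l\<bar> / (2 * pi)) ^ CARD('n) *
           (LINT w|lborel. (norm (G w))\<^sup>2 * exp (- \<bar>l\<bar> / 2 * (norm w)\<^sup>2)))"

definition fock_onb :: "real \<Rightarrow> (complex ^ 'n \<Rightarrow> complex) set \<Rightarrow> bool" where
  "fock_onb l B \<longleftrightarrow>
     B \<subseteq> fock_space l \<and>
     (\<forall>e\<in>B. \<forall>f\<in>B. fock_inner l e f = (if e = f then 1 else 0)) \<and>
     (\<forall>G\<in>fock_space l. \<forall>\<epsilon>>0. \<exists>S c. finite S \<and> S \<subseteq> B \<and>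
        fock_norm l (\<lambda>w. G w - (\<Sum>e\<in>S. c e * e w)) < \<epsilon>)"

definition fock_bounded_operator ::
    "real \<Rightarrow> ((complex ^ 'n \<Rightarrow> complex) \<Rightarrow> (complex ^ 'n \<Rightarrow> complex)) \<Rightarrow> bool" where
  "fock_bounded_operator l T \<longleftrightarrow>
     T ` fock_space l \<subseteq> fock_space l \<and>
     (\<forall>G\<in>fock_space l. \<forall>H\<in>fock_space l. \<forall>a b.
        T (\<lambda>w. a * G w + b * H w) = (\<lambda>w. a * T G w + b * T H w)) \<and>
     (\<exists>C. \<forall>G\<in>fock_space l. fock_norm l (T G) \<le> C * fock_norm l G)"

definition fock_hilbert_schmidt ::
    "real \<Rightarrow> ((complex ^ 'n \<Rightarrow> complex) \<Rightarrow> (complex ^ 'n \<Rightarrow> complex)) \<Rightarrow> bool" where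
  "fock_hilbert_schmidt l T \<longleftrightarrow>
     fock_bounded_operator l T \<and>
     (\<exists>B. fock_onb l B \<and> (\<lambda>e. (fock_norm l (T e))\<^sup>2) summable_on B)"

text \<open>
  The Hilbert-Schmidt norm (of a Hilbert-Schmidt operator) and the trace (of a trace class
  operator) do not depend on the orthonormal basis, so an arbitrary one is chosen.
\<close>

definition fock_hs_norm ::
    "real \<Rightarrow> ((complex ^ 'n \<Rightarrow> complex) \<Rightarrow> (complex ^ 'n \<Rightarrow> complex)) \<Rightarrow> real" where
  "fock_hs_norm l T = sqrt (\<Sum>\<^sub>\<infinity>e\<in>(SOME B. fock_onb l B). (fock_norm l (T e))\<^sup>2)"

definition fock_trace ::
    "real \<Rightarrow> ((complex ^ 'n \<Rightarrow> complex) \<Rightarrow> (complex ^ 'n \<Rightarrow> complex)) \<Rightarrow> complex" where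
  "fock_trace l T = (\<Sum>\<^sub>\<infinity>e\<in>(SOME B. fock_onb l B). fock_inner l (T e) e)"

definition fock_adjoint ::
    "real \<Rightarrow> ((complex ^ 'n \<Rightarrow> complex) \<Rightarrow> (complex ^ 'n \<Rightarrow> complex)) \<Rightarrow>
     (complex ^ 'n \<Rightarrow> complex) \<Rightarrow> (complex ^ 'n \<Rightarrow> complex)" where
  "fock_adjoint l T H =
     (THE K. K \<in> fock_space l \<and> (\<forall>G\<in>fock_space l. fock_inner l (T G) H = fock_inner l G K))"


subsection \<open>The Bargmann representation and operator-valued fields\<close>

definition bargmann_rep ::
    "real \<Rightarrow> complex ^ 'n \<Rightarrow> real \<Rightarrow> (complex ^ 'n \<Rightarrow> complex) \<Rightarrow> (complex ^ 'n \<Rightarrow> complex)" where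
  "bargmann_rep l z t G =
     (if l > 0
      then (\<lambda>w. exp (\<i> * of_real (l * t) - of_real (l / 2) * cdot w (vcnj z)
                      - of_real (l / 4 * (norm z)\<^sup>2)) * G (w + z))
      else (\<lambda>w. exp (\<i> * of_real (l * t) + of_real (l / 2) * cdot w z
                      + of_real (l / 4 * (norm z)\<^sup>2)) * G (w + vcnj z)))"

text \<open>
  Measurability of a field is Lebesgue measurability: unlike Borel measurability, it is
  invariant under changing the field on a null set.
\<close>

definition op_field_space ::
    "real \<Rightarrow> (real \<Rightarrow> (complex ^ 'n \<Rightarrow> complex) \<Rightarrow> (complex ^ 'n \<Rightarrow> complex)) set" where
  "op_field_space \<nu> =
     {\<tau>. (\<forall>\<alpha> \<beta>. (\<lambda>l. fock_inner l (\<tau> l (monomial \<alpha>)) (monomial \<beta>))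
                \<in> borel_measurable (lebesgue_on (UNIV - {0}))) \<and>
         (\<forall>l. l \<noteq> 0 \<longrightarrow> fock_hilbert_schmidt l (\<tau> l)) \<and>
         (\<forall>l>0. \<forall>G\<in>fock_space l. \<tau> l G = (\<lambda>_. 0)) \<and>
         (\<forall>l. l \<noteq> 0 \<longrightarrow> \<tau> l ` fock_space l \<subseteq> {(\<lambda>_. c) | c. True}) \<and>
         set_integrable lebesgue {..<0}
           (\<lambda>l. (fock_hs_norm l (\<tau> l))\<^sup>2 * \<bar>l\<bar> powr (real CARD('n) - (\<nu> + 1)))}"

definition op_field_norm ::
    "real \<Rightarrow> (real \<Rightarrow> (complex ^ 'n \<Rightarrow> complex) \<Rightarrow> (complex ^ 'n \<Rightarrow> complex)) \<Rightarrow> real" where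
  "op_field_norm \<nu> \<tau> =
     sqrt (1 / (2 * pi) ^ (CARD('n) + 1) *
           (LINT l:{..<0}|lebesgue.
              (fock_hs_norm l (\<tau> l))\<^sup>2 * \<bar>l\<bar> powr (real CARD('n) - (\<nu> + 1))))"

definition inversion_integrand ::
    "(real \<Rightarrow> (complex ^ 'n \<Rightarrow> complex) \<Rightarrow> (complex ^ 'n \<Rightarrow> complex)) \<Rightarrow>
     (complex ^ 'n) \<times> complex \<Rightarrow> real \<Rightarrow> complex" where
  "inversion_integrand \<tau> \<zeta> l =
     (case siegel_coords \<zeta> of (z, t, h) \<Rightarrow>
        of_real (exp (h * l)) *
        fock_trace l (\<tau> l \<circ> fock_adjoint l (bargmann_rep l z t)) *
        of_real (\<bar>l\<bar> ^ CARD('n)))"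

definition inversion_integral ::
    "(real \<Rightarrow> (complex ^ 'n \<Rightarrow> complex) \<Rightarrow> (complex ^ 'n \<Rightarrow> complex)) \<Rightarrow>
     (complex ^ 'n) \<times> complex \<Rightarrow> complex" where
  "inversion_integral \<tau> \<zeta> =
     of_real (1 / (2 * pi) ^ (CARD('n) + 1)) *
     (LINT l:{..<0}|lebesgue. inversion_integrand \<tau> \<zeta> l)"

end

theory Submission
  imports Defs "HOL-Complex_Analysis.Complex_Analysis" "HOL-Probability.Probability"
begin

text \<open>
  Why the theorem is true.  A field of operators \<open>\<tau>(\<lambda>)\<close> into the constants is determined by its
  values on the monomial basis of the Fock space, that is, by a square-summable family \<open>a(\<alpha>, \<lambda>)\<close>.
  The trace of \<open>\<tau>(\<lambda>)\<close> composed with the adjoint of the Bargmann representation then evaluates to the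
  Fock series with coefficients \<open>a(\<cdot>, \<lambda>)\<close>, up to an exponential (\<open>trace_formula\<close>), and the
  Hilbert-Schmidt norm is the \<open>\<ell>\<^sup>2\<close> norm (\<open>hs_norm\<close>).  Hence the inversion integral is a synthesis
  integral \<open>a \<mapsto> \<integral> a(y) cnj (\<kappa>(\<zeta>, y)) dy\<close> with an explicit feature map \<open>\<kappa>\<close>
  (\<open>siegel_synthesis_eq\<close>), and the claim is that this synthesis is a unitary operator from an
  \<open>L\<^sup>2\<close> space onto the Bergman space.

  Unitarity comes from a general principle about feature maps (\<open>synthesis_unitary\<close>).  If the kernel
  \<open>K(x, y) = \<langle>\<kappa>(y), \<kappa>(x)\<rangle>\<close> reproduces its own sections in \<open>L\<^sup>2(M)\<close> and the synthesis is injective, then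
  the synthesis is unitary onto the space of all functions of \<open>L\<^sup>2(M)\<close> reproduced by \<open>K\<close>.  It is used
  twice: for the expansion of Fock functions into monomials, and for the Bergman space.  In both
  cases no Plancherel theorem and no density argument is involved; what has to be verified is
  a reproducing formula and injectivity.

  For the half-space the kernel is a Gamma integral of exponentials and evaluates to the Bergman kernel
  (\<open>feature_inner\<close>).  Its reproducing formula holds for every holomorphic \<open>L\<^sup>2\<close> function
  (\<open>bergman_reproducing\<close>): a Heisenberg translation moves the point to \<open>(0, \<i> h)\<close>, where
  the kernel is independent of the first variables, so that averaging over rotations leaves an integral
  over the upper half-plane, and a Cayley transform turns that into the mean value property on a disc.
  Injectivity (\<open>siegel_synthesis_injective\<close>) is uniqueness of the Fourier transform on horizontal
  lines followed by uniqueness of the Fock expansion.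

  Holomorphy in several variables means complex-linear derivative.  The facts used about it (the
  mean value over circles, differentiation under the integral) are one-variable statements on complex
  lines, and are obtained uniformly for the spaces at hand.
\<close>

section \<open>Square-integrable functions\<close>

definition sq_integrable :: "'a measure \<Rightarrow> ('a \<Rightarrow> complex) set" where
  "sq_integrable M = {f \<in> borel_measurable M. integrable M (\<lambda>x. (cmod (f x))\<^sup>2)}"

definition sq_norm :: "'a measure \<Rightarrow> ('a \<Rightarrow> complex) \<Rightarrow> real" where
  "sq_norm M f = (\<integral>x. (cmod (f x))\<^sup>2 \<partial>M)"

lemma sq_integrable_measurable[measurable_dest]: "f \<in> sq_integrable M \<Longrightarrow> f \<in> borel_measurable M"
  by (simp add: sq_integrable_def)

lemma sq_integrableD: "f \<in> sq_integrable M \<Longrightarrow> integrable M (\<lambda>x. (cmod (f x))\<^sup>2)"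
  by (simp add: sq_integrable_def)

lemma sq_norm_nonneg[simp]: "0 \<le> sq_norm M f"
  by (simp add: sq_norm_def)

lemma sq_integrable_cong:
  "(\<And>x. x \<in> space M \<Longrightarrow> f x = g x) \<Longrightarrow> f \<in> sq_integrable M \<longleftrightarrow> g \<in> sq_integrable M"
  unfolding sq_integrable_def by (auto cong: measurable_cong Bochner_Integration.integrable_cong)

lemma sq_integrable_dominated:
  assumes g: "g \<in> sq_integrable M" and [measurable]: "f \<in> borel_measurable M"
    and le: "\<And>x. x \<in> space M \<Longrightarrow> cmod (f x) \<le> cmod (g x)"
  shows "f \<in> sq_integrable M" "sq_norm M f \<le> sq_norm M g"
proof -
  have [measurable]: "g \<in> borel_measurable M" using g by measurable
  show f: "f \<in> sq_integrable M"
    unfolding sq_integrable_def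
    by (auto intro!: Bochner_Integration.integrable_bound[OF sq_integrableD[OF g]] AE_I2 power_mono le)
  show "sq_norm M f \<le> sq_norm M g" unfolding sq_norm_def
    by (intro integral_mono sq_integrableD f g power_mono le) auto
qed

lemma borel_measurable_cnj[measurable (raw)]:
  "f \<in> borel_measurable M \<Longrightarrow> (\<lambda>x. cnj (f x)) \<in> borel_measurable M"
  by (rule measurable_compose[OF _ borel_measurable_continuous_onI]) (auto intro: continuous_intros)

lemma sq_integrable_cnj: "f \<in> sq_integrable M \<Longrightarrow> (\<lambda>x. cnj (f x)) \<in> sq_integrable M"
  by (rule sq_integrable_dominated(1)[of f]) (auto simp: sq_integrable_def)

lemma sq_integrable_cmult: 
  assumes "f \<in> sq_integrable M" shows "(\<lambda>x. c * f x) \<in> sq_integrable M"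
proof -
  note [measurable] = sq_integrable_measurable[OF assms]
  show ?thesis using sq_integrableD[OF assms]
    by (simp add: sq_integrable_def norm_mult power_mult_distrib)
qed

lemma sq_integrable_zero[simp]: "(\<lambda>x. 0) \<in> sq_integrable M"
  by (simp add: sq_integrable_def)

lemma cmod_add_sq_le: "(cmod (a + b))\<^sup>2 \<le> 2 * (cmod a)\<^sup>2 + 2 * (cmod b)\<^sup>2"
proof -
  have "(cmod (a + b))\<^sup>2 \<le> (cmod a + cmod b)\<^sup>2" by (intro power_mono norm_triangle_ineq) auto
  also have "\<dots> \<le> 2 * (cmod a)\<^sup>2 + 2 * (cmod b)\<^sup>2"
    using zero_le_power2[of "cmod a - cmod b"] by (simp add: power2_eq_square algebra_simps)
  finally show ?thesis .
qed

lemma sq_integrable_add: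
  assumes f: "f \<in> sq_integrable M" and g: "g \<in> sq_integrable M"
  shows "(\<lambda>x. f x + g x) \<in> sq_integrable M"
proof -
  note [measurable] = sq_integrable_measurable[OF f] sq_integrable_measurable[OF g]
  have "integrable M (\<lambda>x. 2 * (cmod (f x))\<^sup>2 + 2 * (cmod (g x))\<^sup>2)"
    using sq_integrableD[OF f] sq_integrableD[OF g] by auto
  then have "integrable M (\<lambda>x. (cmod (f x + g x))\<^sup>2)"
    by (rule Bochner_Integration.integrable_bound) (auto intro!: AE_I2 cmod_add_sq_le)
  then show ?thesis by (simp add: sq_integrable_def)
qed

lemma sq_integrable_diff:
  assumes f: "f \<in> sq_integrable M" and g: "g \<in> sq_integrable M"
  shows "(\<lambda>x. f x - g x) \<in> sq_integrable M"
  using sq_integrable_add[OF f sq_integrable_cmult[OF g, of "-1"]] by simp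

lemma sq_integrable_product:
  assumes f: "f \<in> sq_integrable M" and g: "g \<in> sq_integrable M"
  shows "integrable M (\<lambda>x. f x * g x)" "integrable M (\<lambda>x. cmod (f x) * cmod (g x))"
proof -
  note [measurable] = sq_integrable_measurable[OF f] sq_integrable_measurable[OF g]
  have *: "integrable M (\<lambda>x. (cmod (f x))\<^sup>2 + (cmod (g x))\<^sup>2)"
    using sq_integrableD[OF f] sq_integrableD[OF g] by auto
  have le: "u * v \<le> u\<^sup>2 + v\<^sup>2" if "0 \<le> u" "0 \<le> v" for u v :: real
  proof -
    have "2 * (u * v) \<le> u\<^sup>2 + v\<^sup>2"
      using zero_le_power2[of "u - v"] by (simp add: power2_eq_square algebra_simps)
    moreover have "0 \<le> u * v" using that by simp
    ultimately show ?thesis by linarith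
  qed
  show "integrable M (\<lambda>x. f x * g x)" "integrable M (\<lambda>x. cmod (f x) * cmod (g x))"
    by (rule Bochner_Integration.integrable_bound[OF *]; auto intro!: AE_I2 simp: norm_mult le)+
qed

lemma Cauchy_Schwarz_cmod:
  assumes f: "f \<in> sq_integrable M" and g: "g \<in> sq_integrable M"
  shows "(\<integral>x. cmod (f x) * cmod (g x) \<partial>M)\<^sup>2 \<le> sq_norm M f * sq_norm M g"
proof -
  define A B C where "A = sq_norm M f" and "B = sq_norm M g"
    and "C = (\<integral>x. cmod (f x) * cmod (g x) \<partial>M)"
  have C0: "0 \<le> C" unfolding C_def by simp
  have quad: "2 * t * C \<le> t\<^sup>2 * A + B" for t
  proof -
    have "2 * t * C = (\<integral>x. 2 * t * (cmod (f x) * cmod (g x)) \<partial>M)" by (simp add: C_def)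
    also have "\<dots> \<le> (\<integral>x. t\<^sup>2 * (cmod (f x))\<^sup>2 + (cmod (g x))\<^sup>2 \<partial>M)"
    proof (intro integral_mono)
      show "integrable M (\<lambda>x. 2 * t * (cmod (f x) * cmod (g x)))"
        using sq_integrable_product(2)[OF f g] by simp
      show "integrable M (\<lambda>x. t\<^sup>2 * (cmod (f x))\<^sup>2 + (cmod (g x))\<^sup>2)"
        using sq_integrableD[OF f] sq_integrableD[OF g] by simp
      show "2 * t * (cmod (f x) * cmod (g x)) \<le> t\<^sup>2 * (cmod (f x))\<^sup>2 + (cmod (g x))\<^sup>2" for x
        using zero_le_power2[of "t * cmod (f x) - cmod (g x)"]
        by (simp add: power2_eq_square algebra_simps)
    qed
    also have "\<dots> = t\<^sup>2 * A + B"
      using sq_integrableD[OF f] sq_integrableD[OF g] by (simp add: A_def B_def sq_norm_def)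
    finally show ?thesis .
  qed
  have "C\<^sup>2 \<le> A * B"
  proof (cases "A = 0")
    case True
    have "C = 0"
    proof (rule ccontr)
      assume "C \<noteq> 0"
      then have "C > 0" using C0 by simp
      then show False using quad[of "(B + 1) / (2 * C)"] True by (simp add: field_simps)
    qed
    then show ?thesis using True by simp
  next
    case False
    then have "A > 0" using sq_norm_nonneg[of M f] unfolding A_def by linarith
    then show ?thesis using quad[of "C / A"] by (simp add: field_simps power2_eq_square)
  qed
  then show ?thesis by (simp add: A_def B_def C_def)
qed

lemma Cauchy_Schwarz_integral:
  assumes f: "f \<in> sq_integrable M" and g: "g \<in> sq_integrable M"
  shows "(cmod (\<integral>x. f x * g x \<partial>M))\<^sup>2 \<le> sq_norm M f * sq_norm M g"
proof -
  have "cmod (\<integral>x. f x * g x \<partial>M) \<le> (\<integral>x. cmod (f x) * cmod (g x) \<partial>M)"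
    using integral_norm_bound[of M "\<lambda>x. f x * g x"] by (simp add: norm_mult)
  then have "(cmod (\<integral>x. f x * g x \<partial>M))\<^sup>2 \<le> (\<integral>x. cmod (f x) * cmod (g x) \<partial>M)\<^sup>2"
    by (intro power_mono) auto
  with Cauchy_Schwarz_cmod[OF f g] show ?thesis by linarith
qed

lemma Cauchy_Schwarz_integral_cnj:
  assumes f: "f \<in> sq_integrable M" and g: "g \<in> sq_integrable M"
  shows "(cmod (\<integral>x. f x * cnj (g x) \<partial>M))\<^sup>2 \<le> sq_norm M f * sq_norm M g"
  using Cauchy_Schwarz_integral[OF f sq_integrable_cnj[OF g]] by (simp add: sq_norm_def)

lemma of_real_sq_norm: "complex_of_real (sq_norm M f) = (\<integral>x. f x * cnj (f x) \<partial>M)"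
  unfolding sq_norm_def by (simp add: complex_norm_square[symmetric] flip: integral_complex_of_real)

text \<open>
  Completeness of \<open>L\<^sup>2\<close> in the form of a telescoping sequence: with weights \<open>2^j\<close> the squared
  increments stay summable in \<open>L\<^sup>1\<close>, so that at almost every point the increments are dominated by
  a geometric series.  Fatou's lemma then bounds the distance to the limit.
\<close>

lemma sq_integrable_complete:
  fixes a :: "nat \<Rightarrow> 'a \<Rightarrow> complex"
  assumes a: "\<And>j. a j \<in> sq_integrable M"
    and cauchy: "\<And>i j. i \<le> j \<Longrightarrow> sq_norm M (\<lambda>y. a j y - a i y) \<le> (1/4) ^ i"
  obtains b where "b \<in> sq_integrable M" "\<And>i. sq_norm M (\<lambda>y. b y - a i y) \<le> (1/4) ^ i"
proof -
  have [measurable]: "a j \<in> borel_measurable M" for j using a by measurable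
  define d where "d j y = a (Suc j) y - a j y" for j y
  have [measurable]: "d j \<in> borel_measurable M" for j unfolding d_def by measurable
  have d2: "integrable M (\<lambda>y. (cmod (d j y))\<^sup>2)" for j
    unfolding d_def by (intro sq_integrableD sq_integrable_diff a)
  have "(\<integral>\<^sup>+y. (\<Sum>j. ennreal (2 ^ j * (cmod (d j y))\<^sup>2)) \<partial>M)
      = (\<Sum>j. \<integral>\<^sup>+y. ennreal (2 ^ j * (cmod (d j y))\<^sup>2) \<partial>M)"
    by (intro nn_integral_suminf) measurable
  also have "\<dots> \<le> (\<Sum>j. ennreal ((1/2) ^ j))"
  proof (intro suminf_le)
    fix j
    have "(\<integral>\<^sup>+y. ennreal (2 ^ j * (cmod (d j y))\<^sup>2) \<partial>M) = ennreal (\<integral>y. 2 ^ j * (cmod (d j y))\<^sup>2 \<partial>M)"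
      by (intro nn_integral_eq_integral) (use d2 in auto)
    also have "(\<integral>y. 2 ^ j * (cmod (d j y))\<^sup>2 \<partial>M) \<le> 2 ^ j * (1/4) ^ j"
      using cauchy[of j "Suc j"] by (simp add: sq_norm_def d_def)
    also have "\<dots> = (1/2) ^ j" by (simp flip: power_mult_distrib)
    finally show "(\<integral>\<^sup>+y. ennreal (2 ^ j * (cmod (d j y))\<^sup>2) \<partial>M) \<le> ennreal ((1/2) ^ j)"
      by (simp add: ennreal_leI)
  qed auto
  also have "\<dots> < \<infinity>"
    by (subst suminf_ennreal2) (auto intro: summable_geometric)
  finally have "AE y in M. (\<Sum>j. ennreal (2 ^ j * (cmod (d j y))\<^sup>2)) \<noteq> \<infinity>"
    by (intro nn_integral_PInf_AE) auto
  then have conv: "AE y in M. convergent (\<lambda>j. a j y)"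
  proof eventually_elim
    case (elim y)
    then have "summable (\<lambda>j. 2 ^ j * (cmod (d j y))\<^sup>2)"
      by (intro summable_suminf_not_top) (auto simp: top_unique)
    then have "(\<lambda>j. 2 ^ j * (cmod (d j y))\<^sup>2) \<longlonglongrightarrow> 0" by (rule summable_LIMSEQ_zero)
    then have "Bseq (\<lambda>j. 2 ^ j * (cmod (d j y))\<^sup>2)" by (intro convergent_imp_Bseq convergentI)
    then obtain C where C: "C > 0" "\<And>j. norm (2 ^ j * (cmod (d j y))\<^sup>2) \<le> C" by (rule BseqE) auto
    have dle: "cmod (d j y) \<le> sqrt C * sqrt (1/2) ^ j" for j
    proof -
      have "(cmod (d j y))\<^sup>2 \<le> C * (1/2) ^ j" using C(2)[of j]
        by (simp add: norm_mult norm_power field_simps)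
      then have "cmod (d j y) \<le> sqrt (C * (1/2) ^ j)" by (rule real_le_rsqrt)
      then show ?thesis by (simp add: real_sqrt_mult real_sqrt_power)
    qed
    have "summable (\<lambda>j. d j y)"
    proof (rule summable_comparison_test'[where N = 0])
      show "summable (\<lambda>j. sqrt C * sqrt (1/2) ^ j)"
        by (intro summable_mult summable_geometric) (simp add: real_sqrt_lt_1_iff)
      show "norm (d j y) \<le> sqrt C * sqrt (1/2) ^ j" for j using dle[of j] by simp
    qed
    then have "convergent (\<lambda>n. (\<Sum>j<n. d j y) + a 0 y)"
      by (intro convergent_add convergent_const) (simp add: summable_iff_convergent)
    moreover have "(\<Sum>j<n. d j y) + a 0 y = a n y" for n
      unfolding d_def by (simp add: sum_lessThan_telescope[of "\<lambda>j. a j y"])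
    ultimately show "convergent (\<lambda>j. a j y)" by simp
  qed
  define b where "b y = lim (\<lambda>j. a j y)" for y
  have [measurable]: "b \<in> borel_measurable M" unfolding b_def by measurable
  have lim: "AE y in M. (\<lambda>j. a j y) \<longlonglongrightarrow> b y"
    using conv by eventually_elim (simp add: b_def convergent_LIMSEQ_iff)
  have main: "(\<lambda>y. b y - a i y) \<in> sq_integrable M \<and> sq_norm M (\<lambda>y. b y - a i y) \<le> (1/4) ^ i" for i
  proof -
    have "(\<integral>\<^sup>+y. ennreal ((cmod (b y - a i y))\<^sup>2) \<partial>M)
        = (\<integral>\<^sup>+y. liminf (\<lambda>j. ennreal ((cmod (a j y - a i y))\<^sup>2)) \<partial>M)"
    proof (rule nn_integral_cong_AE)
      show "AE y in M. ennreal ((cmod (b y - a i y))\<^sup>2) = liminf (\<lambda>j. ennreal ((cmod (a j y - a i y))\<^sup>2))"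
        using lim
      proof eventually_elim
        case (elim y)
        have "(\<lambda>j. ennreal ((cmod (a j y - a i y))\<^sup>2)) \<longlonglongrightarrow> ennreal ((cmod (b y - a i y))\<^sup>2)"
          by (intro tendsto_intros elim)
        then show ?case by (intro lim_imp_Liminf[symmetric]) auto
      qed
    qed
    also have "\<dots> \<le> liminf (\<lambda>j. \<integral>\<^sup>+y. ennreal ((cmod (a j y - a i y))\<^sup>2) \<partial>M)"
      by (intro nn_integral_liminf) measurable
    also have "\<dots> \<le> ennreal ((1/4) ^ i)"
    proof -
      have "\<forall>\<^sub>F j in sequentially. (\<integral>\<^sup>+y. ennreal ((cmod (a j y - a i y))\<^sup>2) \<partial>M) \<le> ennreal ((1/4) ^ i)"
        using eventually_ge_at_top[of i]
      proof eventually_elim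
        case (elim j)
        have "(\<integral>\<^sup>+y. ennreal ((cmod (a j y - a i y))\<^sup>2) \<partial>M) = ennreal (sq_norm M (\<lambda>y. a j y - a i y))"
          unfolding sq_norm_def
          by (intro nn_integral_eq_integral sq_integrableD sq_integrable_diff a) auto
        then show ?case using cauchy[OF elim] by (simp add: ennreal_leI)
      qed
      then have "limsup (\<lambda>j. \<integral>\<^sup>+y. ennreal ((cmod (a j y - a i y))\<^sup>2) \<partial>M) \<le> ennreal ((1/4) ^ i)"
        by (rule Limsup_bounded)
      then show ?thesis
        by (rule order_trans[OF Liminf_le_Limsup, rotated]) auto
    qed
    finally have le: "(\<integral>\<^sup>+y. ennreal ((cmod (b y - a i y))\<^sup>2) \<partial>M) \<le> ennreal ((1/4) ^ i)" .
    then have int: "integrable M (\<lambda>y. (cmod (b y - a i y))\<^sup>2)"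
      by (intro integrableI_bounded) (auto intro: le_less_trans)
    then have "ennreal (sq_norm M (\<lambda>y. b y - a i y)) \<le> ennreal ((1/4) ^ i)"
      using le unfolding sq_norm_def by (subst (asm) nn_integral_eq_integral) auto
    with int show ?thesis by (simp add: sq_integrable_def)
  qed
  have "b \<in> sq_integrable M" using sq_integrable_add[OF conjunct1[OF main[of 0]] a[of 0]] by simp
  with main show ?thesis by (intro that) auto
qed

section \<open>Transforms given by a reproducing kernel\<close>

text \<open>
  A family of vectors \<open>\<kappa> x\<close> of \<open>L\<^sup>2(N)\<close>, indexed by the points \<open>x\<close> of \<open>M\<close>, gives a synthesis map
  \<open>a \<mapsto> \<langle>a, \<kappa> x\<rangle>\<close> from \<open>L\<^sup>2(N)\<close> to functions on \<open>M\<close>, the adjoint analysis map, and the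
  positive kernel \<open>ker x y = \<langle>\<kappa> y, \<kappa> x\<rangle>\<close>.  No boundedness is assumed; analysis is applied to
  functions supported on a tame set only, where all double integrals converge absolutely.
\<close>

locale feature_map = pair_sigma_finite M N for M :: "'a measure" and N :: "'b measure" +
  fixes \<kappa> :: "'a \<Rightarrow> 'b \<Rightarrow> complex"
  assumes feature_measurable[measurable]: "(\<lambda>(x, b). \<kappa> x b) \<in> borel_measurable (M \<Otimes>\<^sub>M N)"
    and feature_sq_integrable: "x \<in> space M \<Longrightarrow> \<kappa> x \<in> sq_integrable N"
begin

definition ker :: "'a \<Rightarrow> 'a \<Rightarrow> complex" where
  "ker x y = (\<integral>b. \<kappa> y b * cnj (\<kappa> x b) \<partial>N)"

definition synthesis :: "('b \<Rightarrow> complex) \<Rightarrow> 'a \<Rightarrow> complex" where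
  "synthesis a x = (\<integral>b. a b * cnj (\<kappa> x b) \<partial>N)"

definition analysis :: "('a \<Rightarrow> complex) \<Rightarrow> 'b \<Rightarrow> complex" where
  "analysis g b = (\<integral>x. g x * \<kappa> x b \<partial>M)"

definition tame :: "'a set \<Rightarrow> bool" where
  "tame C \<longleftrightarrow> C \<in> sets M \<and> emeasure M C < \<infinity> \<and> (\<exists>B. \<forall>x\<in>C. sq_norm N (\<kappa> x) \<le> B)"

definition tame_fun :: "('a \<Rightarrow> complex) \<Rightarrow> bool" where
  "tame_fun g \<longleftrightarrow> g \<in> sq_integrable M \<and> (\<exists>C. tame C \<and> (\<forall>x\<in>space M - C. g x = 0))"

lemma sq_norm_feature_measurable[measurable]: "(\<lambda>x. sq_norm N (\<kappa> x)) \<in> borel_measurable M"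
  unfolding sq_norm_def by measurable

lemma ker_measurable[measurable]: "(\<lambda>(x, y). ker x y) \<in> borel_measurable (M \<Otimes>\<^sub>M M)"
  unfolding ker_def by measurable

lemma synthesis_measurable[measurable]:
  assumes [measurable]: "a \<in> borel_measurable N" shows "synthesis a \<in> borel_measurable M"
  unfolding synthesis_def by measurable

lemma analysis_measurable[measurable]:
  assumes [measurable]: "g \<in> borel_measurable M" shows "analysis g \<in> borel_measurable N"
  unfolding analysis_def by measurable

lemma cnj_ker: "cnj (ker x y) = ker y x"
  unfolding ker_def by (subst Bochner_Integration.integral_cnj[symmetric]) (simp add: mult.commute)

lemma synthesis_feature: "synthesis (\<kappa> y) x = ker x y"
  by (simp add: synthesis_def ker_def)

lemma ker_diagonal: "ker x x = of_real (sq_norm N (\<kappa> x))"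
  by (simp add: ker_def of_real_sq_norm)

lemma synthesis_diff:
  assumes "a \<in> sq_integrable N" "b \<in> sq_integrable N" "x \<in> space M"
  shows "synthesis (\<lambda>y. a y - b y) x = synthesis a x - synthesis b x"
  unfolding synthesis_def using assms
  by (simp add: algebra_simps sq_integrable_product sq_integrable_cnj feature_sq_integrable)

lemma synthesis_bound:
  assumes "a \<in> sq_integrable N" "x \<in> space M"
  shows "(cmod (synthesis a x))\<^sup>2 \<le> sq_norm N a * sq_norm N (\<kappa> x)"
  unfolding synthesis_def by (intro Cauchy_Schwarz_integral_cnj assms feature_sq_integrable)

lemma tame_fun_bound:
  assumes "tame_fun g"
  obtains B where "B \<ge> 0" "\<And>x. x \<in> space M \<Longrightarrow> cmod (g x) * sq_norm N (\<kappa> x) \<le> cmod (g x) * B"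
proof -
  obtain C B where C: "\<forall>x\<in>C. sq_norm N (\<kappa> x) \<le> B" "\<forall>x\<in>space M - C. g x = 0"
    using assms unfolding tame_fun_def tame_def by blast
  have "cmod (g x) * sq_norm N (\<kappa> x) \<le> cmod (g x) * max B 0" if "x \<in> space M" for x
  proof (cases "x \<in> C")
    case True
    then have "sq_norm N (\<kappa> x) \<le> max B 0" using C(1) by (auto simp: le_max_iff_disj)
    then show ?thesis by (intro mult_left_mono) auto
  qed (use C(2) that in auto)
  then show ?thesis by (intro that[of "max B 0"]) auto
qed

lemma tame_fun_integrable:
  assumes "tame_fun g" shows "integrable M g"
proof -
  obtain C where C: "tame C" "\<forall>x\<in>space M - C. g x = 0" and g: "g \<in> sq_integrable M"
    using assms unfolding tame_fun_def by blast
  have [measurable]: "C \<in> sets M" "g \<in> borel_measurable M" using C(1) g by (auto simp: tame_def sq_integrable_def)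
  have "integrable M (\<lambda>x. indicator C x + (cmod (g x))\<^sup>2)"
    using C(1) by (intro Bochner_Integration.integrable_add sq_integrableD g)
      (auto simp: tame_def integrable_indicator_iff)
  then show ?thesis
  proof (rule Bochner_Integration.integrable_bound)
    show "AE x in M. norm (g x) \<le> norm (indicator C x + (cmod (g x))\<^sup>2)"
    proof (rule AE_I2)
      fix x assume x: "x \<in> space M"
      have "u \<le> 1 + u\<^sup>2" for u :: real
        using zero_le_power2[of "u - 1/2"] by (simp add: power2_eq_square algebra_simps)
      then show "norm (g x) \<le> norm (indicator C x + (cmod (g x))\<^sup>2)"
        using C(2) x by (cases "x \<in> C") (auto simp: abs_of_nonneg)
    qed
  qed measurable
qed

lemma Fubini_analysis:
  assumes g: "tame_fun g" and a: "a \<in> sq_integrable N"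
  shows "integrable (M \<Otimes>\<^sub>M N) (\<lambda>(x, b). g x * \<kappa> x b * cnj (a b))"
proof (rule Fubini_integrable)
  have gm[measurable]: "g \<in> borel_measurable M" using g by (auto simp: tame_fun_def sq_integrable_def)
  have am[measurable]: "a \<in> borel_measurable N" using a by (auto simp: sq_integrable_def)
  show "(\<lambda>(x, b). g x * \<kappa> x b * cnj (a b)) \<in> borel_measurable (M \<Otimes>\<^sub>M N)" by measurable
  show "AE x in M. integrable N (\<lambda>y. case (x, y) of (x, b) \<Rightarrow> g x * \<kappa> x b * cnj (a b))"
    using sq_integrable_product[OF feature_sq_integrable sq_integrable_cnj[OF a]]
    by (auto intro!: AE_I2 simp: mult.assoc)
  obtain B where B: "B \<ge> 0" "\<And>x. x \<in> space M \<Longrightarrow> cmod (g x) * sq_norm N (\<kappa> x) \<le> cmod (g x) * B"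
    using tame_fun_bound[OF g] by blast
  have "integrable M (\<lambda>x. cmod (g x) * sqrt (B * sq_norm N a))"
    using tame_fun_integrable[OF g] by simp
  then show "integrable M (\<lambda>x. \<integral>y. norm (case (x, y) of (x, b) \<Rightarrow> g x * \<kappa> x b * cnj (a b)) \<partial>N)"
  proof (rule Bochner_Integration.integrable_bound)
    show "(\<lambda>x. \<integral>y. norm (case (x, y) of (x, b) \<Rightarrow> g x * \<kappa> x b * cnj (a b)) \<partial>N) \<in> borel_measurable M"
      by measurable
    show "AE x in M. norm (\<integral>y. norm (case (x, y) of (x, b) \<Rightarrow> g x * \<kappa> x b * cnj (a b)) \<partial>N)
        \<le> norm (cmod (g x) * sqrt (B * sq_norm N a))"
    proof (rule AE_I2)
      fix x assume x: "x \<in> space M"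
      have "(\<integral>y. norm (case (x, y) of (x, b) \<Rightarrow> g x * \<kappa> x b * cnj (a b)) \<partial>N)
          = cmod (g x) * (\<integral>y. cmod (\<kappa> x y) * cmod (a y) \<partial>N)"
        by (simp add: norm_mult mult.assoc)
      moreover have "cmod (g x) * (\<integral>y. cmod (\<kappa> x y) * cmod (a y) \<partial>N) \<le> cmod (g x) * sqrt (B * sq_norm N a)"
      proof (cases "g x = 0")
        case False
        then have "sq_norm N (\<kappa> x) \<le> B" using B(2)[OF x] by simp
        then have "sq_norm N (\<kappa> x) * sq_norm N a \<le> B * sq_norm N a" by (intro mult_right_mono) auto
        with Cauchy_Schwarz_cmod[OF feature_sq_integrable[OF x] a]
        have "(\<integral>y. cmod (\<kappa> x y) * cmod (a y) \<partial>N) \<le> sqrt (B * sq_norm N a)"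
          by (intro real_le_rsqrt) linarith
        then show ?thesis by (intro mult_left_mono) auto
      qed simp
      ultimately show "norm (\<integral>y. norm (case (x, y) of (x, b) \<Rightarrow> g x * \<kappa> x b * cnj (a b)) \<partial>N)
        \<le> norm (cmod (g x) * sqrt (B * sq_norm N a))" using B(1) by simp
    qed
  qed
qed

lemma analysis_sq_integrable:
  assumes g: "tame_fun g"
  shows "analysis g \<in> sq_integrable N" "AE b in N. integrable M (\<lambda>x. g x * \<kappa> x b)"
proof -
  obtain C B where C: "C \<in> sets M" "emeasure M C < \<infinity>" "\<And>x. x \<in> C \<Longrightarrow> sq_norm N (\<kappa> x) \<le> B"
     "\<And>x. x \<in> space M \<Longrightarrow> x \<notin> C \<Longrightarrow> g x = 0" and g2: "g \<in> sq_integrable M"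
    using g unfolding tame_fun_def tame_def by blast
  have [measurable]: "C \<in> sets M" "g \<in> borel_measurable M" using C(1) g2 by (auto simp: sq_integrable_def)
  define h where "h x b = indicator C x * \<kappa> x b" for x b
  have hm[measurable]: "(\<lambda>(x, b). h x b) \<in> borel_measurable (M \<Otimes>\<^sub>M N)" unfolding h_def by measurable
  have h2: "integrable (M \<Otimes>\<^sub>M N) (\<lambda>(x, b). (cmod (h x b))\<^sup>2)"
  proof (rule Fubini_integrable)
    have eq: "(cmod (h x b))\<^sup>2 = indicator C x * (cmod (\<kappa> x b))\<^sup>2" for x b
      by (simp add: h_def norm_mult power_mult_distrib indicator_def)
    show "AE x in M. integrable N (\<lambda>y. case (x, y) of (x, b) \<Rightarrow> (cmod (h x b))\<^sup>2)"
      by (auto intro!: AE_I2 simp: eq sq_integrableD feature_sq_integrable)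
    have "integrable M (\<lambda>x. indicator C x * sq_norm N (\<kappa> x))"
    proof (rule Bochner_Integration.integrable_bound[where f = "\<lambda>x. B * indicator C x"])
      show "integrable M (\<lambda>x. B * indicator C x :: real)"
        using C by (intro integrable_mult_right) (auto simp: integrable_indicator_iff)
      show "AE x in M. norm (indicator C x * sq_norm N (\<kappa> x)) \<le> norm (B * indicator C x)"
        using C(3) by (auto intro!: AE_I2 simp: indicator_def abs_of_nonneg order_trans[OF _ abs_ge_self])
    qed measurable
    then show "integrable M (\<lambda>x. \<integral>y. norm (case (x, y) of (x, b) \<Rightarrow> (cmod (h x b))\<^sup>2) \<partial>N)"
      by (simp add: eq sq_norm_def)
  qed measurable
  have hsq: "AE b in N. (\<lambda>x. h x b) \<in> sq_integrable M"
    using AE_integrable_snd[OF h2] AE_space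
  proof eventually_elim
    case (elim b)
    then have "(\<lambda>x. h x b) \<in> borel_measurable M" using measurable_Pair2[OF hm] by simp
    with elim show ?case by (simp add: sq_integrable_def)
  qed
  have gh: "g x * \<kappa> x b = g x * h x b" if "x \<in> space M" for x b
    using C(4)[OF that] by (auto simp: h_def indicator_def)
  show "AE b in N. integrable M (\<lambda>x. g x * \<kappa> x b)"
    using hsq
  proof eventually_elim
    case (elim b)
    from sq_integrable_product(1)[OF g2 elim] show ?case
      by (subst Bochner_Integration.integrable_cong[OF refl gh]) auto
  qed
  have "integrable N (\<lambda>b. sq_norm M g * (\<integral>x. (cmod (h x b))\<^sup>2 \<partial>M))"
    using integrable_snd[OF h2] by simp
  then have "integrable N (\<lambda>b. (cmod (analysis g b))\<^sup>2)"
  proof (rule Bochner_Integration.integrable_bound)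
    show "AE b in N. norm ((cmod (analysis g b))\<^sup>2) \<le> norm (sq_norm M g * (\<integral>x. (cmod (h x b))\<^sup>2 \<partial>M))"
      using hsq
    proof eventually_elim
      case (elim b)
      have "analysis g b = (\<integral>x. g x * h x b \<partial>M)" unfolding analysis_def
        by (intro Bochner_Integration.integral_cong gh refl)
      then show ?case using Cauchy_Schwarz_integral[OF g2 elim] by (simp add: sq_norm_def)
    qed
  qed measurable
  then show "analysis g \<in> sq_integrable N" by (simp add: sq_integrable_def)
qed

lemma analysis_adjoint:
  assumes g: "tame_fun g" and a: "a \<in> sq_integrable N"
  shows "(\<integral>b. analysis g b * cnj (a b) \<partial>N) = (\<integral>x. g x * cnj (synthesis a x) \<partial>M)"
proof -
  have "(\<integral>b. analysis g b * cnj (a b) \<partial>N) = (\<integral>b. (\<integral>x. g x * \<kappa> x b * cnj (a b) \<partial>M) \<partial>N)"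
    by (simp add: analysis_def)
  also have "\<dots> = (\<integral>x. (\<integral>b. g x * \<kappa> x b * cnj (a b) \<partial>N) \<partial>M)"
    by (intro Fubini_integral Fubini_analysis g a)
  also have "\<dots> = (\<integral>x. g x * cnj (synthesis a x) \<partial>M)"
    unfolding synthesis_def
    by (subst Bochner_Integration.integral_cnj[symmetric]) (simp add: mult_ac)
  finally show ?thesis .
qed

lemma synthesis_analysis:
  assumes g: "tame_fun g" and x: "x \<in> space M"
  shows "synthesis (analysis g) x = (\<integral>y. g y * ker x y \<partial>M)"
  using analysis_adjoint[OF g feature_sq_integrable[OF x]]
  by (simp add: synthesis_def[of "analysis g"] synthesis_feature cnj_ker)

lemma tame_exhaustion:
  obtains C :: "nat \<Rightarrow> 'a set" where "\<And>i. tame (C i)" "incseq C" "\<And>x. x \<in> space M \<Longrightarrow> \<exists>i. x \<in> C i"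
proof -
  obtain A :: "nat \<Rightarrow> 'a set" where A: "range A \<subseteq> sets M" "(\<Union>i. A i) = space M"
    "\<And>i. emeasure M (A i) \<noteq> \<infinity>" "incseq A"
    using M1.sigma_finite_incseq by blast
  define C where "C i = A i \<inter> {x \<in> space M. sq_norm N (\<kappa> x) \<le> real i}" for i
  have [measurable]: "A i \<in> sets M" for i using A(1) by auto
  have "tame (C i)" for i
  proof -
    have "C i \<in> sets M" unfolding C_def by measurable
    moreover have "emeasure M (C i) \<le> emeasure M (A i)"
      by (rule emeasure_mono) (auto simp: C_def)
    then have "emeasure M (C i) < \<infinity>" using A(3)[of i] by (simp add: less_top le_less_trans)
    ultimately show ?thesis unfolding tame_def by (auto simp: C_def)
  qed
  moreover have "incseq C"
    using A(4) unfolding C_def incseq_def by (fastforce intro: order_trans)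
  moreover have "\<exists>i. x \<in> C i" if x: "x \<in> space M" for x
  proof -
    obtain i where i: "x \<in> A i" using A(2) x by blast
    obtain j where j: "sq_norm N (\<kappa> x) \<le> real j" using real_arch_simple by blast
    have "x \<in> A (max i j)" using A(4) i unfolding incseq_def by (meson max.cobounded1 subsetD)
    moreover have "sq_norm N (\<kappa> x) \<le> real (max i j)" using j by simp
    ultimately show ?thesis using x unfolding C_def by blast
  qed
  ultimately show ?thesis by (rule that)
qed

lemma tame_fun_indicator:
  assumes "f \<in> borel_measurable M" "tame C"
    and "\<And>x. x \<in> C \<Longrightarrow> (cmod (f x))\<^sup>2 \<le> B"
  shows "tame_fun (\<lambda>x. indicator C x * f x)"
proof -
  have [measurable]: "C \<in> sets M" "f \<in> borel_measurable M" using assms by (auto simp: tame_def)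
  have "integrable M (\<lambda>x. B * indicator C x :: real)"
    using assms(2) by (intro integrable_mult_right) (auto simp: integrable_indicator_iff tame_def)
  then have "integrable M (\<lambda>x. (cmod (indicator C x * f x))\<^sup>2)"
    by (rule Bochner_Integration.integrable_bound)
       (auto intro!: AE_I2 order_trans[OF assms(3) abs_ge_self] simp: indicator_def)
  with assms(2) show ?thesis unfolding tame_fun_def sq_integrable_def
    by (auto intro!: exI[of _ C] simp: indicator_def)
qed

lemma tame_fun_indicator':
  assumes f: "f \<in> sq_integrable M" and C: "tame C" and D: "D \<in> sets M" "D \<subseteq> C"
  shows "tame_fun (\<lambda>x. indicator D x * f x)"
proof -
  have [measurable]: "D \<in> sets M" "f \<in> borel_measurable M" using assms by (auto simp: sq_integrable_def)
  have "(\<lambda>x. indicator D x * f x) \<in> sq_integrable M"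
    by (rule sq_integrable_dominated(1)[OF f]) (auto simp: norm_mult indicator_def)
  with C D(2) show ?thesis unfolding tame_fun_def
    by (auto intro!: exI[of _ C] simp: indicator_def)
qed

definition reproduced :: "('a \<Rightarrow> complex) set" where
  "reproduced = {f \<in> sq_integrable M. \<forall>x\<in>space M. f x = (\<integral>y. f y * ker x y \<partial>M)}"

end


text \<open>
  If the kernel functions themselves satisfy the reproducing formula in \<open>L\<^sup>2(M)\<close>, then the kernel
  is also the feature map of a transform from \<open>L\<^sup>2(M)\<close> to itself with the same kernel.  Comparing
  the two shows that analysis is a contraction; injectivity of synthesis then forces synthesis to
  be unitary onto the space of reproduced functions.
\<close>

locale reproducing_feature_map = feature_map +
  assumes ker_reproduced: "x \<in> space M \<Longrightarrow> (\<lambda>y. ker y x) \<in> reproduced"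
begin

lemma ker_sq_integrable: "x \<in> space M \<Longrightarrow> (\<lambda>y. ker y x) \<in> sq_integrable M"
  using ker_reproduced by (simp add: reproduced_def)

lemma ker_ker:
  assumes "x \<in> space M" "y \<in> space M"
  shows "(\<integral>b. ker b y * cnj (ker b x) \<partial>M) = ker x y"
  using ker_reproduced[OF assms(2)] assms(1) by (simp add: reproduced_def cnj_ker)

lemma sq_norm_ker:
  assumes "x \<in> space M" shows "sq_norm M (\<lambda>y. ker y x) = sq_norm N (\<kappa> x)"
proof -
  have "complex_of_real (sq_norm M (\<lambda>y. ker y x)) = of_real (sq_norm N (\<kappa> x))"
    by (simp only: of_real_sq_norm[of M] ker_ker[OF assms assms] ker_diagonal)
  then show ?thesis by simp
qed

sublocale K: feature_map M M "\<lambda>x y. ker y x"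
proof unfold_locales
  show "(\<lambda>(x, b). ker b x) \<in> borel_measurable (M \<Otimes>\<^sub>M M)"
    using measurable_compose[OF measurable_pair_swap' ker_measurable] by (simp add: split_beta')
qed (rule ker_sq_integrable)

lemma K_tame_fun:
  assumes "tame_fun g" shows "K.tame_fun g"
proof -
  obtain C where C: "g \<in> sq_integrable M" "tame C" "\<forall>x\<in>space M - C. g x = 0"
    using assms unfolding tame_fun_def by blast
  have "C \<subseteq> space M" using C(2) by (auto simp: tame_def dest: sets.sets_into_space)
  then have "K.tame C" using C(2) unfolding tame_def K.tame_def
    by (metis sq_norm_ker subsetD)
  with C show ?thesis unfolding K.tame_fun_def by blast
qed

lemma analysis_contraction:
  assumes g: "tame_fun g"
  shows "sq_norm N (analysis g) \<le> sq_norm M g"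
proof -
  define P where "P = K.analysis g"
  have gK: "K.tame_fun g" by (rule K_tame_fun[OF g])
  have g2: "g \<in> sq_integrable M" using g by (simp add: tame_fun_def)
  have P2: "P \<in> sq_integrable M" unfolding P_def by (rule K.analysis_sq_integrable(1)[OF gK])
  have P: "P x = (\<integral>y. g y * ker x y \<partial>M)" for x
    by (simp add: P_def K.analysis_def)
  have 1: "synthesis (analysis g) x = P x" if "x \<in> space M" for x
    using synthesis_analysis[OF g that] by (simp add: P)
  have 2: "K.synthesis P x = P x" if x: "x \<in> space M" for x
  proof -
    have "K.synthesis P x = (\<integral>y. g y * K.ker x y \<partial>M)"
      unfolding P_def by (rule K.synthesis_analysis[OF gK x])
    also have "\<dots> = (\<integral>y. g y * ker x y \<partial>M)"
      by (intro Bochner_Integration.integral_cong refl) (simp add: K.ker_def ker_ker x)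
    finally show ?thesis by (simp add: P)
  qed
  have "complex_of_real (sq_norm N (analysis g)) = (\<integral>x. g x * cnj (synthesis (analysis g) x) \<partial>M)"
    by (simp only: of_real_sq_norm analysis_adjoint[OF g analysis_sq_integrable(1)[OF g]])
  also have "\<dots> = (\<integral>x. g x * cnj (P x) \<partial>M)"
    by (intro Bochner_Integration.integral_cong refl) (simp add: 1)
  finally have eq: "complex_of_real (sq_norm N (analysis g)) = (\<integral>x. g x * cnj (P x) \<partial>M)" .
  have "complex_of_real (sq_norm M P) = (\<integral>x. g x * cnj (K.synthesis P x) \<partial>M)"
    using K.analysis_adjoint[OF gK P2] by (simp only: of_real_sq_norm P_def)
  also have "\<dots> = (\<integral>x. g x * cnj (P x) \<partial>M)"
    by (intro Bochner_Integration.integral_cong refl) (simp add: 2)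
  finally have eq2: "complex_of_real (sq_norm M P) = (\<integral>x. g x * cnj (P x) \<partial>M)" .
  have PN: "sq_norm N (analysis g) = sq_norm M P" using eq eq2 by (metis of_real_eq_iff)
  have "(sq_norm M P)\<^sup>2 \<le> sq_norm M g * sq_norm M P"
    using Cauchy_Schwarz_integral_cnj[OF g2 P2] by (simp flip: eq2)
  then have "sq_norm M P \<le> sq_norm M g"
    using sq_norm_nonneg[of M P] sq_norm_nonneg[of M g]
    by (cases "sq_norm M P = 0") (auto simp: power2_eq_square)
  then show ?thesis by (simp add: PN)
qed

lemma synthesis_contraction:
  assumes a: "a \<in> sq_integrable N"
  shows "synthesis a \<in> sq_integrable M" "sq_norm M (synthesis a) \<le> sq_norm N a"
proof -
  have [measurable]: "a \<in> borel_measurable N" using a by (simp add: sq_integrable_def)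
  obtain C :: "nat \<Rightarrow> 'a set" where C: "\<And>i. tame (C i)" "incseq C" "\<And>x. x \<in> space M \<Longrightarrow> \<exists>i. x \<in> C i"
    using tame_exhaustion by blast
  define h where "h i x = indicator (C i) x * synthesis a x" for i x
  have h: "tame_fun (h i)" for i
  proof -
    obtain B where B: "\<forall>x\<in>C i. sq_norm N (\<kappa> x) \<le> B" using C(1)[of i] by (auto simp: tame_def)
    have sub: "C i \<subseteq> space M" using C(1)[of i] by (auto simp: tame_def dest: sets.sets_into_space)
    have "(cmod (synthesis a x))\<^sup>2 \<le> sq_norm N a * B" if "x \<in> C i" for x
      using synthesis_bound[OF a, of x] B sub that mult_left_mono[of "sq_norm N (\<kappa> x)" B "sq_norm N a"]
      by fastforce
    then show ?thesis unfolding h_def by (intro tame_fun_indicator C) auto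
  qed
  have le: "sq_norm M (h i) \<le> sq_norm N a" for i
  proof -
    have "complex_of_real (sq_norm M (h i)) = (\<integral>x. h i x * cnj (synthesis a x) \<partial>M)"
      unfolding of_real_sq_norm by (intro Bochner_Integration.integral_cong refl) (simp add: h_def indicator_def)
    also have "\<dots> = (\<integral>b. analysis (h i) b * cnj (a b) \<partial>N)" by (rule analysis_adjoint[OF h a, symmetric])
    finally have "(sq_norm M (h i))\<^sup>2 \<le> sq_norm N (analysis (h i)) * sq_norm N a"
      using Cauchy_Schwarz_integral_cnj[OF analysis_sq_integrable(1)[OF h[of i]] a]
      by (metis norm_of_real power2_abs)
    also have "\<dots> \<le> sq_norm M (h i) * sq_norm N a"
      by (intro mult_right_mono analysis_contraction h) auto
    finally show ?thesis using sq_norm_nonneg[of M "h i"]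
      by (cases "sq_norm M (h i) = 0") (auto simp: power2_eq_square)
  qed
  have "(\<integral>\<^sup>+x. ennreal ((cmod (synthesis a x))\<^sup>2) \<partial>M)
      = (\<integral>\<^sup>+x. liminf (\<lambda>i. ennreal ((cmod (h i x))\<^sup>2)) \<partial>M)"
  proof (rule nn_integral_cong)
    fix x assume x: "x \<in> space M"
    obtain i where i: "x \<in> C i" using C(3)[OF x] by blast
    have "\<forall>\<^sub>F j in sequentially. ennreal ((cmod (h j x))\<^sup>2) = ennreal ((cmod (synthesis a x))\<^sup>2)"
      using eventually_ge_at_top[of i]
    proof eventually_elim
      case (elim j)
      then have "x \<in> C j" using i C(2) unfolding incseq_def by blast
      then show ?case by (simp add: h_def)
    qed
    then have "(\<lambda>j. ennreal ((cmod (h j x))\<^sup>2)) \<longlonglongrightarrow> ennreal ((cmod (synthesis a x))\<^sup>2)"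
      by (rule tendsto_eventually)
    then show "ennreal ((cmod (synthesis a x))\<^sup>2) = liminf (\<lambda>i. ennreal ((cmod (h i x))\<^sup>2))"
      by (intro lim_imp_Liminf[symmetric]) auto
  qed
  also have "\<dots> \<le> liminf (\<lambda>i. \<integral>\<^sup>+x. ennreal ((cmod (h i x))\<^sup>2) \<partial>M)"
  proof (intro nn_integral_liminf)
    fix i
    have [measurable]: "h i \<in> borel_measurable M" using h[of i] by (auto simp: tame_fun_def sq_integrable_def)
    show "(\<lambda>x. ennreal ((cmod (h i x))\<^sup>2)) \<in> borel_measurable M" by measurable
  qed
  also have "(\<lambda>i. \<integral>\<^sup>+x. ennreal ((cmod (h i x))\<^sup>2) \<partial>M) = (\<lambda>i. ennreal (sq_norm M (h i)))"
    unfolding sq_norm_def using h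
    by (intro ext nn_integral_eq_integral sq_integrableD) (auto simp: tame_fun_def)
  also have "liminf (\<lambda>i. ennreal (sq_norm M (h i))) \<le> ennreal (sq_norm N a)"
    by (rule order_trans[OF Liminf_le_Limsup Limsup_bounded]) (auto intro!: always_eventually ennreal_leI le)
  finally have fin: "(\<integral>\<^sup>+x. ennreal ((cmod (synthesis a x))\<^sup>2) \<partial>M) \<le> ennreal (sq_norm N a)" .
  then have int: "integrable M (\<lambda>x. (cmod (synthesis a x))\<^sup>2)"
    by (intro integrableI_bounded) (auto intro: le_less_trans)
  then show "synthesis a \<in> sq_integrable M" by (simp add: sq_integrable_def)
  show "sq_norm M (synthesis a) \<le> sq_norm N a"
    using fin int unfolding sq_norm_def by (subst (asm) nn_integral_eq_integral) auto
qed

lemma reproduced_eq_synthesis: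
  assumes f: "f \<in> reproduced"
  obtains b g where "b \<in> sq_integrable N" "\<And>x. x \<in> space M \<Longrightarrow> f x = synthesis b x"
    "\<And>i :: nat. tame_fun (g i)" "\<And>i. sq_norm N (\<lambda>y. b y - analysis (g i) y) \<le> (1/4) ^ i"
    "\<And>i x. cmod (g i x) \<le> cmod (f x)" "\<And>x. x \<in> space M \<Longrightarrow> (\<lambda>i. g i x) \<longlonglongrightarrow> f x"
proof -
  have f2: "f \<in> sq_integrable M" and frep: "\<And>x. x \<in> space M \<Longrightarrow> f x = (\<integral>y. f y * ker x y \<partial>M)"
    using f by (auto simp: reproduced_def)
  have [measurable]: "f \<in> borel_measurable M" using f2 by (simp add: sq_integrable_def)
  obtain C :: "nat \<Rightarrow> 'a set" where C: "\<And>i. tame (C i)" "incseq C" "\<And>x. x \<in> space M \<Longrightarrow> \<exists>i. x \<in> C i"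
    using tame_exhaustion by blast
  have Cm[measurable]: "C i \<in> sets M" for i using C(1)[of i] by (simp add: tame_def)
  have ev: "\<forall>\<^sub>F j in sequentially. x \<in> C j" if x: "x \<in> space M" for x
  proof -
    obtain i where i: "x \<in> C i" using C(3)[OF x] by blast
    show ?thesis using eventually_ge_at_top[of i]
      by eventually_elim (use i C(2) in \<open>auto simp: incseq_def\<close>)
  qed
  define t where "t i = (\<integral>x. indicator (space M - C i) x * (cmod (f x))\<^sup>2 \<partial>M)" for i
  have "t \<longlonglongrightarrow> (\<integral>x. 0 \<partial>M)" unfolding t_def
  proof (rule integral_dominated_convergence[where w = "\<lambda>x. (cmod (f x))\<^sup>2"])
    show "AE x in M. (\<lambda>i. indicator (space M - C i) x * (cmod (f x))\<^sup>2) \<longlonglongrightarrow> 0"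
    proof (rule AE_I2)
      fix x assume "x \<in> space M"
      from ev[OF this] show "(\<lambda>i. indicator (space M - C i) x * (cmod (f x))\<^sup>2) \<longlonglongrightarrow> 0"
        by (intro tendsto_eventually) (auto elim: eventually_mono)
    qed
  qed (auto intro: sq_integrableD f2 simp: indicator_def)
  then have t0: "t \<longlonglongrightarrow> 0" by simp
  have "\<exists>n. \<forall>m\<ge>n. t m \<le> (1/4) ^ i" for i :: nat
  proof -
    have "\<forall>\<^sub>F m in sequentially. t m < (1/4) ^ i" by (rule order_tendstoD(2)[OF t0]) simp
    then show ?thesis unfolding eventually_sequentially by (auto intro: less_imp_le)
  qed
  then obtain n :: "nat \<Rightarrow> nat" where n: "\<And>i m. m \<ge> n i \<Longrightarrow> t m \<le> (1/4) ^ i" by metis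
  define r where "r i = (\<Sum>k\<le>i. n k) + i" for i
  have rn: "n i \<le> r i" for i unfolding r_def using member_le_sum[of i "{..i}" n] by simp
  have ri: "i \<le> r i" for i by (simp add: r_def)
  have rmono: "i \<le> j \<Longrightarrow> r i \<le> r j" for i j unfolding r_def by (intro add_mono sum_mono2) auto
  define g where "g i x = indicator (C (r i)) x * f x" for i x
  have tg: "tame_fun (g i)" for i unfolding g_def by (rule tame_fun_indicator'[OF f2 C(1)]) auto
  have cauchy: "sq_norm N (\<lambda>y. analysis (g j) y - analysis (g i) y) \<le> (1/4) ^ i" if ij: "i \<le> j" for i j
  proof -
    define d where "d x = indicator (C (r j) - C (r i)) x * f x" for x
    have dg: "d x = g j x - g i x" for x
      using C(2) rmono[OF ij] by (auto simp: d_def g_def indicator_def incseq_def)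
    have td: "tame_fun d" unfolding d_def by (rule tame_fun_indicator'[OF f2 C(1)[of "r j"]]) auto
    have "sq_norm N (\<lambda>y. analysis (g j) y - analysis (g i) y) = sq_norm N (analysis d)"
      unfolding sq_norm_def
    proof (rule integral_cong_AE)
      have [measurable]: "g i \<in> borel_measurable M" "g j \<in> borel_measurable M" "d \<in> borel_measurable M"
        unfolding g_def d_def by measurable
      show "(\<lambda>x. (cmod (analysis (g j) x - analysis (g i) x))\<^sup>2) \<in> borel_measurable N" by measurable
      show "(\<lambda>x. (cmod (analysis d x))\<^sup>2) \<in> borel_measurable N" by measurable
      show "AE x in N. (cmod (analysis (g j) x - analysis (g i) x))\<^sup>2 = (cmod (analysis d x))\<^sup>2"
        using analysis_sq_integrable(2)[OF tg[of i]] analysis_sq_integrable(2)[OF tg[of j]]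
      proof eventually_elim
        case (elim b)
        then have "analysis (g j) b - analysis (g i) b = analysis d b"
          unfolding analysis_def dg by (simp add: algebra_simps)
        then show ?case by simp
      qed
    qed
    also have "\<dots> \<le> sq_norm M d" by (rule analysis_contraction[OF td])
    also have "\<dots> \<le> t (r i)" unfolding sq_norm_def t_def
    proof (rule integral_mono)
      show "integrable M (\<lambda>x. indicator (space M - C (r i)) x * (cmod (f x))\<^sup>2)"
        by (rule Bochner_Integration.integrable_bound[OF sq_integrableD[OF f2]])
           (auto intro!: AE_I2 simp: indicator_def)
      show "integrable M (\<lambda>x. (cmod (d x))\<^sup>2)" using td by (auto simp: tame_fun_def sq_integrableD)
    qed (auto simp: d_def norm_mult indicator_def)
    also have "\<dots> \<le> (1/4) ^ i" by (rule n[OF rn])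
    finally show ?thesis .
  qed
  obtain b where b: "b \<in> sq_integrable N" "\<And>i. sq_norm N (\<lambda>y. b y - analysis (g i) y) \<le> (1/4) ^ i"
    by (rule sq_integrable_complete[of "\<lambda>i. analysis (g i)" N, OF analysis_sq_integrable(1)[OF tg] cauchy]) blast+
  have gle: "cmod (g i x) \<le> cmod (f x)" for i x by (auto simp: g_def indicator_def)
  have glim: "(\<lambda>i. g i x) \<longlonglongrightarrow> f x" if x: "x \<in> space M" for x
  proof (rule tendsto_eventually)
    obtain j where j: "\<And>m. m \<ge> j \<Longrightarrow> x \<in> C m" using ev[OF x] unfolding eventually_sequentially by blast
    show "\<forall>\<^sub>F i in sequentially. g i x = f x"
      using eventually_ge_at_top[of j]
    proof eventually_elim
      case (elim i)
      then have "x \<in> C (r i)" using j[of "r i"] ri[of i] by simp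
      then show ?case by (simp add: g_def)
    qed
  qed
  have "f x = synthesis b x" if x: "x \<in> space M" for x
  proof (rule LIMSEQ_unique)
    have "(\<lambda>i. \<integral>y. g i y * ker x y \<partial>M) \<longlonglongrightarrow> (\<integral>y. f y * ker x y \<partial>M)"
    proof (rule integral_dominated_convergence[where w = "\<lambda>y. cmod (f y) * cmod (ker y x)"])
      have [measurable]: "(\<lambda>y. ker x y) \<in> borel_measurable M"
        using measurable_Pair2[OF ker_measurable x] by simp
      show "(\<lambda>y. f y * ker x y) \<in> borel_measurable M" by measurable
      show "(\<lambda>y. g i y * ker x y) \<in> borel_measurable M" for i unfolding g_def by measurable
      show "integrable M (\<lambda>y. cmod (f y) * cmod (ker y x))"
        by (rule sq_integrable_product(2)[OF f2 ker_sq_integrable[OF x]])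
      show "AE y in M. (\<lambda>i. g i y * ker x y) \<longlonglongrightarrow> f y * ker x y"
        by (auto intro!: AE_I2 tendsto_intros glim)
      have "cmod (ker x y) = cmod (ker y x)" for y by (metis cnj_ker complex_mod_cnj)
      then show "AE y in M. cmod (g i y * ker x y) \<le> cmod (f y) * cmod (ker y x)" for i
        by (auto intro!: AE_I2 mult_right_mono gle simp: norm_mult)
    qed
    then show "(\<lambda>i. synthesis (analysis (g i)) x) \<longlonglongrightarrow> f x"
      by (simp add: synthesis_analysis[OF tg x] frep[OF x, symmetric])
    have "(\<lambda>i. synthesis b x - synthesis (analysis (g i)) x) \<longlonglongrightarrow> 0"
    proof (rule tendsto_norm_zero_cancel, rule tendsto_sandwich[where f = "\<lambda>_. 0"])
      show "\<forall>\<^sub>F i in sequentially. norm (synthesis b x - synthesis (analysis (g i)) x)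
          \<le> sqrt ((1/4) ^ i * sq_norm N (\<kappa> x))"
      proof (intro always_eventually allI real_le_rsqrt)
        fix i
        have d2: "(\<lambda>y. b y - analysis (g i) y) \<in> sq_integrable N"
          by (intro sq_integrable_diff b analysis_sq_integrable tg)
        have "(cmod (synthesis b x - synthesis (analysis (g i)) x))\<^sup>2
            = (cmod (synthesis (\<lambda>y. b y - analysis (g i) y) x))\<^sup>2"
          by (simp add: synthesis_diff[OF b(1) analysis_sq_integrable(1)[OF tg] x])
        also have "\<dots> \<le> sq_norm N (\<lambda>y. b y - analysis (g i) y) * sq_norm N (\<kappa> x)"
          by (rule synthesis_bound[OF d2 x])
        also have "\<dots> \<le> (1/4) ^ i * sq_norm N (\<kappa> x)" by (intro mult_right_mono b) auto
        finally show "(cmod (synthesis b x - synthesis (analysis (g i)) x))\<^sup>2 \<le> (1/4) ^ i * sq_norm N (\<kappa> x)" .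
      qed
      have "(\<lambda>i. sqrt ((1/4) ^ i * sq_norm N (\<kappa> x))) \<longlonglongrightarrow> sqrt (0 * sq_norm N (\<kappa> x))"
        by (intro tendsto_intros LIMSEQ_power_zero) auto
      then show "(\<lambda>i. sqrt ((1/4) ^ i * sq_norm N (\<kappa> x))) \<longlonglongrightarrow> 0" by simp
    qed auto
    from tendsto_diff[OF tendsto_const[of "synthesis b x"] this]
    show "(\<lambda>i. synthesis (analysis (g i)) x) \<longlonglongrightarrow> synthesis b x" by simp
  qed
  then show thesis by (rule that[OF b(1) _ tg b(2) gle glim])
qed

lemma analysis_limit_adjoint:
  assumes f: "f \<in> sq_integrable M" and b: "b \<in> sq_integrable N" and a: "a \<in> sq_integrable N"
    and g: "\<And>i :: nat. tame_fun (g i)" "\<And>i. sq_norm N (\<lambda>y. b y - analysis (g i) y) \<le> (1/4) ^ i"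
      "\<And>i x. cmod (g i x) \<le> cmod (f x)" "\<And>x. x \<in> space M \<Longrightarrow> (\<lambda>i. g i x) \<longlonglongrightarrow> f x"
  shows "(\<integral>x. f x * cnj (synthesis a x) \<partial>M) = (\<integral>y. b y * cnj (a y) \<partial>N)"
proof (rule LIMSEQ_unique)
  have [measurable]: "f \<in> borel_measurable M" "a \<in> borel_measurable N"  using f a by (auto simp: sq_integrable_def)
  have [measurable]: "g i \<in> borel_measurable M" for i using g(1)[of i] by (auto simp: tame_fun_def sq_integrable_def)
  show "(\<lambda>i. \<integral>x. g i x * cnj (synthesis a x) \<partial>M) \<longlonglongrightarrow> (\<integral>x. f x * cnj (synthesis a x) \<partial>M)"
  proof (rule integral_dominated_convergence[where w = "\<lambda>y. cmod (f y) * cmod (synthesis a y)"])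
    show "integrable M (\<lambda>y. cmod (f y) * cmod (synthesis a y))"
      by (rule sq_integrable_product(2)[OF f synthesis_contraction(1)[OF a]])
    show "AE x in M. (\<lambda>i. g i x * cnj (synthesis a x)) \<longlonglongrightarrow> f x * cnj (synthesis a x)"
      by (auto intro!: AE_I2 tendsto_intros g)
    show "AE x in M. norm (g i x * cnj (synthesis a x)) \<le> cmod (f x) * cmod (synthesis a x)" for i
      by (auto intro!: AE_I2 mult_right_mono g simp: norm_mult)
  qed measurable
  have "(\<lambda>i. (\<integral>y. b y * cnj (a y) \<partial>N) - (\<integral>x. g i x * cnj (synthesis a x) \<partial>M)) \<longlonglongrightarrow> 0"
  proof (rule tendsto_norm_zero_cancel, rule tendsto_sandwich[where f = "\<lambda>_. 0"])
    show "\<forall>\<^sub>F i in sequentially. norm ((\<integral>y. b y * cnj (a y) \<partial>N) - (\<integral>x. g i x * cnj (synthesis a x) \<partial>M))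
        \<le> sqrt ((1/4) ^ i * sq_norm N a)"
    proof (intro always_eventually allI real_le_rsqrt)
      fix i
      note an = analysis_sq_integrable(1)[OF g(1)[of i]]
      have d2: "(\<lambda>y. b y - analysis (g i) y) \<in> sq_integrable N"
        by (intro sq_integrable_diff b an)
      have "(\<integral>y. b y * cnj (a y) \<partial>N) - (\<integral>x. g i x * cnj (synthesis a x) \<partial>M)
          = (\<integral>y. (b y - analysis (g i) y) * cnj (a y) \<partial>N)"
        using sq_integrable_product(1)[OF b sq_integrable_cnj[OF a]]
          sq_integrable_product(1)[OF an sq_integrable_cnj[OF a]]
        by (simp add: algebra_simps flip: analysis_adjoint[OF g(1) a])
      then have "(norm ((\<integral>y. b y * cnj (a y) \<partial>N) - (\<integral>x. g i x * cnj (synthesis a x) \<partial>M)))\<^sup>2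
          \<le> sq_norm N (\<lambda>y. b y - analysis (g i) y) * sq_norm N a"
        using Cauchy_Schwarz_integral_cnj[OF d2 a] by simp
      also have "\<dots> \<le> (1/4) ^ i * sq_norm N a" by (intro mult_right_mono g) auto
      finally show "(norm ((\<integral>y. b y * cnj (a y) \<partial>N) - (\<integral>x. g i x * cnj (synthesis a x) \<partial>M)))\<^sup>2
          \<le> (1/4) ^ i * sq_norm N a" .
    qed
    have "(\<lambda>i. sqrt ((1/4) ^ i * sq_norm N a)) \<longlonglongrightarrow> sqrt (0 * sq_norm N a)"
      by (intro tendsto_intros LIMSEQ_power_zero) auto
    then show "(\<lambda>i. sqrt ((1/4) ^ i * sq_norm N a)) \<longlonglongrightarrow> 0" by simp
  qed auto
  from tendsto_diff[OF tendsto_const[of "\<integral>y. b y * cnj (a y) \<partial>N"] this]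
  show "(\<lambda>i. \<integral>x. g i x * cnj (synthesis a x) \<partial>M) \<longlonglongrightarrow> (\<integral>y. b y * cnj (a y) \<partial>N)" by simp
qed

theorem synthesis_unitary:
  assumes inj: "\<And>a. a \<in> sq_integrable N \<Longrightarrow> (\<And>x. x \<in> space M \<Longrightarrow> synthesis a x = 0) \<Longrightarrow> AE y in N. a y = 0"
  shows "a \<in> sq_integrable N \<Longrightarrow> sq_norm M (synthesis a) = sq_norm N a"
    and "f \<in> reproduced \<Longrightarrow> \<exists>a\<in>sq_integrable N. \<forall>x\<in>space M. f x = synthesis a x"
proof -
  show "\<exists>a\<in>sq_integrable N. \<forall>x\<in>space M. f x = synthesis a x" if f: "f \<in> reproduced"
    by (rule reproduced_eq_synthesis[OF f]) blast
  assume a: "a \<in> sq_integrable N"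
  note S2 = synthesis_contraction(1)[OF a]
  have unique: "AE y in N. b y = c y" if b: "b \<in> sq_integrable N" and c: "c \<in> sq_integrable N"
    and eq: "\<And>x. x \<in> space M \<Longrightarrow> synthesis b x = synthesis c x" for b c
    using inj[OF sq_integrable_diff[OF b c]] by (simp add: synthesis_diff[OF b c] eq)
  have "synthesis a x = (\<integral>y. synthesis a y * ker x y \<partial>M)" if x: "x \<in> space M" for x
  proof -
    obtain b g where bg: "b \<in> sq_integrable N" "\<And>y. y \<in> space M \<Longrightarrow> ker y x = synthesis b y"
      "\<And>i :: nat. tame_fun (g i)" "\<And>i. sq_norm N (\<lambda>y. b y - analysis (g i) y) \<le> (1/4) ^ i"
      "\<And>i y. cmod (g i y) \<le> cmod (ker y x)" "\<And>y. y \<in> space M \<Longrightarrow> (\<lambda>i. g i y) \<longlonglongrightarrow> ker y x"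
      by (rule reproduced_eq_synthesis[OF ker_reproduced[OF x]]) blast
    have "AE y in N. b y = \<kappa> x y"
      by (rule unique[OF bg(1) feature_sq_integrable[OF x]]) (simp add: bg(2)[symmetric] synthesis_feature)
    have [measurable]: "a \<in> borel_measurable N" "b \<in> borel_measurable N" "\<kappa> x \<in> borel_measurable N"
      using a bg(1) feature_sq_integrable[OF x] by (auto simp: sq_integrable_def)
    have "(\<integral>y. ker y x * cnj (synthesis a y) \<partial>M) = (\<integral>y. b y * cnj (a y) \<partial>N)"
      by (rule analysis_limit_adjoint[OF ker_sq_integrable[OF x] bg(1) a bg(3-6)])
    also have "\<dots> = (\<integral>y. \<kappa> x y * cnj (a y) \<partial>N)"
      by (rule integral_cong_AE) (use \<open>AE y in N. b y = \<kappa> x y\<close> in auto)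
    finally have "cnj (\<integral>y. ker y x * cnj (synthesis a y) \<partial>M) = cnj (\<integral>y. \<kappa> x y * cnj (a y) \<partial>N)" by simp
    then show ?thesis
      by (simp add: synthesis_def[of a x] cnj_ker mult.commute flip: Bochner_Integration.integral_cnj)
  qed
  with S2 have rep: "synthesis a \<in> reproduced" by (simp add: reproduced_def)
  obtain b g where bg: "b \<in> sq_integrable N" "\<And>y. y \<in> space M \<Longrightarrow> synthesis a y = synthesis b y"
      "\<And>i :: nat. tame_fun (g i)" "\<And>i. sq_norm N (\<lambda>y. b y - analysis (g i) y) \<le> (1/4) ^ i"
      "\<And>i y. cmod (g i y) \<le> cmod (synthesis a y)" "\<And>y. y \<in> space M \<Longrightarrow> (\<lambda>i. g i y) \<longlonglongrightarrow> synthesis a y"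
    by (rule reproduced_eq_synthesis[OF rep]) blast
  have ab: "AE y in N. b y = a y" by (rule unique[OF bg(1) a]) (simp add: bg(2))
  have [measurable]: "a \<in> borel_measurable N" "b \<in> borel_measurable N"
    using a bg(1) by (auto simp: sq_integrable_def)
  have "complex_of_real (sq_norm M (synthesis a)) = (\<integral>y. b y * cnj (a y) \<partial>N)"
    unfolding of_real_sq_norm by (rule analysis_limit_adjoint[OF S2 bg(1) a bg(3-6)])
  also have "\<dots> = of_real (sq_norm N a)"
    unfolding of_real_sq_norm by (rule integral_cong_AE) (use ab in auto)
  finally show "sq_norm M (synthesis a) = sq_norm N a" by simp
qed

end

section \<open>Lebesgue measure: isometries and radial integrals\<close>

lemma nn_integral_lborel_translate:
  fixes f :: "'a::euclidean_space \<Rightarrow> ennreal"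
  assumes [measurable]: "f \<in> borel_measurable borel"
  shows "(\<integral>\<^sup>+x. f (x + c) \<partial>lborel) = (\<integral>\<^sup>+x. f x \<partial>lborel)"
proof -
  have "(\<integral>\<^sup>+x. f x \<partial>lborel) = (\<integral>\<^sup>+x. f x \<partial>distr lborel borel ((+) c))" by (simp add: lborel_distr_plus)
  also have "\<dots> = (\<integral>\<^sup>+x. f (c + x) \<partial>lborel)" by (rule nn_integral_distr) simp_all
  finally show ?thesis by (simp add: add.commute)
qed

text \<open>
  This is the uniqueness proof for Haar measure, applied to Lebesgue measure and its image under
  \<open>T\<close>: the double integral of \<open>f(T x) g(y)\<close> is computed in two ways using translation invariance
  only.  With the unit ball for \<open>g\<close>, which \<open>T\<close> preserves, the two normalizations agree.
\<close>

lemma nn_integral_lborel_isometry: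
  fixes T :: "'a::euclidean_space \<Rightarrow> 'a" and f :: "'a \<Rightarrow> ennreal"
  assumes T: "linear T" "\<And>x. norm (T x) = norm x" and f[measurable]: "f \<in> borel_measurable borel"
  shows "(\<integral>\<^sup>+x. f (T x) \<partial>lborel) = (\<integral>\<^sup>+x. f x \<partial>lborel)"
proof -
  have [measurable]: "T \<in> borel_measurable borel"
    by (intro borel_measurable_continuous_onI linear_continuous_on linear_conv_bounded_linear[THEN iffD1] T)
  have "inj T" using T by (metis linear_injective_0 norm_eq_zero)
  then have "surj T" using T(1) eucl.linear_inj_imp_surj by blast
  define g where "g = (indicator (ball 0 1) :: 'a \<Rightarrow> ennreal)"
  have [measurable]: "g \<in> borel_measurable borel" unfolding g_def by (intro borel_measurable_indicator) simp
  have gneg: "g (- T x) = g x" for x by (simp add: g_def indicator_def T(2))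
  define c where "c = emeasure lborel (ball 0 1 :: 'a set)"
  have c: "(\<integral>\<^sup>+x. g x \<partial>lborel) = c" by (simp add: g_def c_def)
  have c0: "c \<noteq> 0" "c \<noteq> \<top>"
  proof -
    have "unit_ball_vol (real DIM('a)) \<noteq> 0" by (metis less_irrefl of_nat_0_le_iff unit_ball_vol_pos)
    then show "c \<noteq> 0" by (simp add: c_def emeasure_ball)
    show "c \<noteq> \<top>" by (simp add: c_def emeasure_ball)
  qed
  have shift: "(\<integral>\<^sup>+x. h (T x + y) \<partial>lborel) = (\<integral>\<^sup>+x. h (T x) \<partial>lborel)"
    if [measurable]: "h \<in> borel_measurable borel" for h :: "'a \<Rightarrow> ennreal" and y
  proof -
    obtain b where b: "y = T b" using \<open>surj T\<close> by (metis surjD)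
    have "(\<integral>\<^sup>+x. h (T (x + b)) \<partial>lborel) = (\<integral>\<^sup>+x. h (T x) \<partial>lborel)"
      by (rule nn_integral_lborel_translate) measurable
    then show ?thesis by (simp add: b linear_add[OF T(1)])
  qed
  have "c * (\<integral>\<^sup>+x. f (T x) \<partial>lborel) = (\<integral>\<^sup>+y. g y * (\<integral>\<^sup>+x. f (T x + y) \<partial>lborel) \<partial>lborel)"
    by (simp add: shift nn_integral_multc c)
  also have "\<dots> = (\<integral>\<^sup>+y. (\<integral>\<^sup>+x. g y * f (T x + y) \<partial>lborel) \<partial>lborel)" by (simp add: nn_integral_cmult)
  also have "\<dots> = (\<integral>\<^sup>+x. (\<integral>\<^sup>+y. g y * f (T x + y) \<partial>lborel) \<partial>lborel)"
    by (rule lborel_pair.Fubini'[symmetric]) measurable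
  also have "\<dots> = (\<integral>\<^sup>+x. (\<integral>\<^sup>+y. g (y - T x) * f y \<partial>lborel) \<partial>lborel)"
  proof (rule nn_integral_cong)
    fix x
    have "(\<integral>\<^sup>+y. g ((y + T x) - T x) * f (y + T x) \<partial>lborel) = (\<integral>\<^sup>+y. g (y - T x) * f y \<partial>lborel)"
      by (rule nn_integral_lborel_translate) measurable
    then show "(\<integral>\<^sup>+y. g y * f (T x + y) \<partial>lborel) = (\<integral>\<^sup>+y. g (y - T x) * f y \<partial>lborel)"
      by (simp only: add_diff_cancel add.commute[of "T x"])
  qed
  also have "\<dots> = (\<integral>\<^sup>+y. (\<integral>\<^sup>+x. g (y - T x) * f y \<partial>lborel) \<partial>lborel)"
    by (rule lborel_pair.Fubini') measurable
  also have "\<dots> = (\<integral>\<^sup>+y. c * f y \<partial>lborel)"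
  proof (intro nn_integral_cong)
    fix y
    have "(\<integral>\<^sup>+x. g (y - T x) \<partial>lborel) = (\<integral>\<^sup>+x. g (- (T x + (- y))) \<partial>lborel)" by simp
    also have "\<dots> = (\<integral>\<^sup>+x. g (- T x) \<partial>lborel)" by (rule shift[of "\<lambda>v. g (- v)"]) measurable
    finally show "(\<integral>\<^sup>+x. g (y - T x) * f y \<partial>lborel) = c * f y" by (simp add: nn_integral_multc gneg c)
  qed
  also have "\<dots> = c * (\<integral>\<^sup>+y. f y \<partial>lborel)" by (simp add: nn_integral_cmult)
  finally show ?thesis using c0 by (simp add: ennreal_mult_cancel_left)
qed

lemma lborel_distr_isometry:
  fixes T :: "'a::euclidean_space \<Rightarrow> 'a"
  assumes T: "linear T" "\<And>x. norm (T x) = norm x"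
  shows "distr lborel borel T = lborel"
proof (rule measure_eqI)
  have [measurable]: "T \<in> borel_measurable borel"
    by (intro borel_measurable_continuous_onI linear_continuous_on linear_conv_bounded_linear[THEN iffD1] T)
  fix A assume "A \<in> sets (distr lborel borel T)"
  then have [measurable]: "A \<in> sets borel" by simp
  have "emeasure (distr lborel borel T) A = (\<integral>\<^sup>+x. indicator A x \<partial>distr lborel borel T)" by simp
  also have "\<dots> = (\<integral>\<^sup>+x. indicator A (T x) \<partial>lborel)" by (rule nn_integral_distr) measurable
  also have "\<dots> = emeasure lborel A" by (subst nn_integral_lborel_isometry[OF T]) auto
  finally show "emeasure (distr lborel borel T) A = emeasure lborel A" .
qed simp

lemma
  fixes T :: "'a::euclidean_space \<Rightarrow> 'a" and f :: "'a \<Rightarrow> 'b::{banach, second_countable_topology}"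
  assumes T: "linear T" "\<And>x. norm (T x) = norm x" and [measurable]: "f \<in> borel_measurable borel"
  shows integral_lborel_isometry: "(\<integral>x. f (T x) \<partial>lborel) = (\<integral>x. f x \<partial>lborel)"
    and integrable_lborel_isometry: "integrable lborel (\<lambda>x. f (T x)) \<longleftrightarrow> integrable lborel f"
proof -
  have [measurable]: "T \<in> borel_measurable borel"
    by (intro borel_measurable_continuous_onI linear_continuous_on linear_conv_bounded_linear[THEN iffD1] T)
  show "(\<integral>x. f (T x) \<partial>lborel) = (\<integral>x. f x \<partial>lborel)"
    by (subst (2) lborel_distr_isometry[OF T, symmetric]) (simp add: integral_distr)
  show "integrable lborel (\<lambda>x. f (T x)) \<longleftrightarrow> integrable lborel f"
    by (subst (2) lborel_distr_isometry[OF T, symmetric]) (simp add: integrable_distr_eq)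
qed

lemma nn_integral_lborel_scale:
  fixes f :: "'a::euclidean_space \<Rightarrow> ennreal"
  assumes c: "c \<noteq> 0" and [measurable]: "f \<in> borel_measurable borel"
  shows "(\<integral>\<^sup>+x. f x \<partial>lborel) = ennreal (\<bar>c\<bar> ^ DIM('a)) * (\<integral>\<^sup>+x. f (c *\<^sub>R x) \<partial>lborel)"
  by (subst lborel_affine[OF c, of 0])
     (simp add: nn_integral_density nn_integral_distr nn_integral_cmult ennreal_power)

lemma ennreal_eq_divideI:
  assumes "ennreal b * x = ennreal a" "b > 0" "a \<ge> 0"
  shows "x = ennreal (a / b)"
proof (cases x)
  case (real r)
  then have "b * r = a" using assms by (simp flip: ennreal_mult)
  then show ?thesis using real assms(2) by (auto simp: field_simps)
next
  case top
  then show ?thesis using assms by (simp add: ennreal_mult_top split: if_splits)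
qed

lemma nn_integral_Gamma:
  assumes p: "p > -1" and c: "c > (0::real)"
  shows "(\<integral>\<^sup>+t. ennreal (indicator {0<..} t * (t powr p * exp (- c * t))) \<partial>lborel)
      = ennreal (Gamma (p + 1) / c powr (p + 1))"
proof -
  let ?G = "\<lambda>t::real. indicator {0<..} t * (t powr p * exp (- t))"
  have "((\<lambda>t. t powr ((p + 1) - 1) / exp t) has_integral Gamma (p + 1)) {0..}"
    using p by (intro Gamma_integral_real) simp
  then have "((\<lambda>t. t powr p * exp (- t)) has_integral Gamma (p + 1)) {0..}"
    by (simp add: exp_minus field_simps)
  then have "(\<integral>\<^sup>+t. ennreal (indicator {0..} t * (t powr p * exp (- t))) \<partial>lborel) = ennreal (Gamma (p + 1))"
    by (intro nn_integral_has_integral_lebesgue) auto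
  moreover have "(\<integral>\<^sup>+t. ennreal (indicator {0..} t * (t powr p * exp (- t))) \<partial>lborel) = (\<integral>\<^sup>+t. ennreal (?G t) \<partial>lborel)"
    by (intro nn_integral_cong_AE AE_I[where N="{0}"]) (auto split: split_indicator)
  ultimately have G: "(\<integral>\<^sup>+t. ennreal (?G t) \<partial>lborel) = ennreal (Gamma (p + 1))" by simp
  have eq: "indicator {0<..} (c * t) * ((c * t) powr p * exp (- (c * t)))
      = c powr p * (indicator {0<..} t * (t powr p * exp (- c * t)))" for t
    using c by (auto simp: indicator_def zero_less_mult_iff powr_mult)
  have "ennreal (Gamma (p + 1)) = ennreal c * (\<integral>\<^sup>+t. ennreal (?G (c * t)) \<partial>lborel)"
    using nn_integral_lborel_scale[of c "\<lambda>t. ennreal (?G t)"] c by (simp add: G)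
  also have "\<dots> = ennreal c * (ennreal (c powr p) * (\<integral>\<^sup>+t. ennreal (indicator {0<..} t * (t powr p * exp (- c * t))) \<partial>lborel))"
    unfolding eq by (subst ennreal_mult) (auto simp: nn_integral_cmult)
  also have "\<dots> = ennreal (c powr (p + 1)) * (\<integral>\<^sup>+t. ennreal (indicator {0<..} t * (t powr p * exp (- c * t))) \<partial>lborel)"
    using c by (simp add: powr_add ennreal_mult mult_ac)
  finally show ?thesis
    using c p by (intro ennreal_eq_divideI) (auto simp: Gamma_real_pos less_imp_le)
qed

lemma nn_integral_Gauss_real:
  assumes c: "c > (0::real)"
  shows "(\<integral>\<^sup>+x. ennreal (exp (- c * x\<^sup>2)) \<partial>lborel) = ennreal (sqrt (pi / c))"
proof -
  define s where "s = sqrt (1 / (2 * c))"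
  have s: "s > 0" "s\<^sup>2 = 1 / (2 * c)" using c by (auto simp: s_def)
  interpret prob_space "density lborel (\<lambda>x. ennreal (normal_density 0 s x))"
    by (rule prob_space_normal_density) (use s in simp)
  have 1: "(\<integral>\<^sup>+x. ennreal (normal_density 0 s x) \<partial>lborel) = 1"
    using emeasure_space_1 by (simp add: emeasure_density)
  have "exp (- c * x\<^sup>2) = sqrt (pi / c) * normal_density 0 s x" for x
    using c by (simp add: normal_density_def s real_sqrt_divide real_sqrt_mult field_simps)
  then have "(\<integral>\<^sup>+x. ennreal (exp (- c * x\<^sup>2)) \<partial>lborel)
      = (\<integral>\<^sup>+x. ennreal (sqrt (pi / c)) * ennreal (normal_density 0 s x) \<partial>lborel)"
    using c by (simp add: ennreal_mult)
  also have "\<dots> = ennreal (sqrt (pi / c))" by (simp add: nn_integral_cmult 1)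
  finally show ?thesis .
qed

lemma nn_integral_Gauss:
  assumes c: "c > (0::real)" and d: "DIM('a::euclidean_space) = 2 * d"
  shows "(\<integral>\<^sup>+x. ennreal (exp (- c * (norm x)\<^sup>2)) \<partial>(lborel :: 'a measure)) = ennreal ((pi / c) ^ d)"
proof -
  have "exp (- c * (norm x)\<^sup>2) = (\<Prod>b\<in>Basis. exp (- c * (x \<bullet> b)\<^sup>2))" for x :: 'a
  proof -
    have "(norm x)\<^sup>2 = (\<Sum>b\<in>Basis. (x \<bullet> b)\<^sup>2)"
      unfolding power2_norm_eq_inner by (subst euclidean_inner) (simp add: power2_eq_square)
    then show ?thesis by (simp add: exp_sum sum_distrib_left flip: sum_negf)
  qed
  then have "(\<integral>\<^sup>+x. ennreal (exp (- c * (norm x)\<^sup>2)) \<partial>(lborel :: 'a measure))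
      = (\<integral>\<^sup>+x. (\<Prod>b\<in>Basis. ennreal (exp (- c * (x \<bullet> b)\<^sup>2))) \<partial>(lborel :: 'a measure))"
    by (simp add: prod_ennreal)
  also have "\<dots> = (\<Prod>b\<in>(Basis::'a set). ennreal (sqrt (pi / c)))"
    by (subst nn_integral_lborel_prod) (simp_all add: nn_integral_Gauss_real[OF c, simplified])
  also have "\<dots> = ennreal (sqrt (pi / c) ^ (2 * d))" using c by (simp add: ennreal_power d)
  also have "sqrt (pi / c) ^ (2 * d) = (pi / c) ^ d" using c by (simp add: power_mult)
  finally show ?thesis .
qed

text \<open>
  The value is found by a Laplace transform in \<open>Y\<close>: integrating both sides against \<open>exp (- Y)\<close>
  turns the left-hand side into a Gaussian integral, and homogeneity in \<open>Y\<close> does the rest.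
\<close>

lemma nn_integral_truncated_power:
  assumes p: "p > (-1::real)" and Y: "Y > 0" and d: "DIM('a::euclidean_space) = 2 * d"
  shows "(\<integral>\<^sup>+z. ennreal (indicator {z. (norm z)\<^sup>2 / 4 < Y} z * (Y - (norm z)\<^sup>2 / 4) powr p) \<partial>(lborel :: 'a measure))
      = ennreal ((4 * pi) ^ d * Gamma (p + 1) / Gamma (d + p + 1) * Y powr (d + p))"
proof -
  define u where "u Y z = indicator {0<..} (Y - (norm z)\<^sup>2 / 4) * (Y - (norm z)\<^sup>2 / 4) powr p" for Y and z :: 'a
  define J where "J Y = (\<integral>\<^sup>+z. ennreal (u Y z) \<partial>lborel)" for Y
  have [measurable]: "(\<lambda>(y, z). u y z) \<in> borel_measurable (borel \<Otimes>\<^sub>M borel)"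
    unfolding u_def by measurable
  have [measurable]: "u y \<in> borel_measurable borel" "(\<lambda>y. u y z) \<in> borel_measurable borel" for y z
    unfolding u_def by measurable
  have u0: "0 \<le> u y z" for y z by (simp add: u_def)
  have scale: "J y = ennreal (y powr (d + p)) * J 1" if y: "y > 0" for y
  proof -
    have um: "(\<lambda>z. ennreal (u y z)) \<in> borel_measurable borel" by measurable
    have "J y = ennreal (sqrt y ^ DIM('a)) * (\<integral>\<^sup>+z. ennreal (u y (sqrt y *\<^sub>R z)) \<partial>lborel)"
      unfolding J_def using nn_integral_lborel_scale[OF _ um, of "sqrt y"] y by simp
    also have "(\<lambda>z::'a. ennreal (u y (sqrt y *\<^sub>R z))) = (\<lambda>z. ennreal (y powr p) * ennreal (u 1 z))"
    proof
      fix z :: 'a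
      have "y - (norm (sqrt y *\<^sub>R z))\<^sup>2 / 4 = y * (1 - (norm z)\<^sup>2 / 4)"
        using y by (simp add: power_mult_distrib field_simps)
      then have "u y (sqrt y *\<^sub>R z) = y powr p * u 1 z"
        using y by (simp only: u_def) (simp add: indicator_def zero_less_mult_iff powr_mult)
      then show "ennreal (u y (sqrt y *\<^sub>R z)) = ennreal (y powr p) * ennreal (u 1 z)"
        by (simp add: ennreal_mult u0)
    qed
    also have "(\<integral>\<^sup>+z. ennreal (y powr p) * ennreal (u 1 z) \<partial>lborel) = ennreal (y powr p) * J 1"
      unfolding J_def by (rule nn_integral_cmult) measurable
    also have "sqrt y ^ DIM('a) = y powr d"
      using y by (simp add: d power_mult powr_realpow)
    finally show ?thesis using y by (simp add: powr_add ennreal_mult mult_ac)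
  qed
  have "(\<integral>\<^sup>+y. ennreal (indicator {0<..} y * exp (- y)) * J y \<partial>lborel)
      = (\<integral>\<^sup>+y. ennreal (indicator {0<..} y * (y powr (d + p) * exp (- 1 * y))) * J 1 \<partial>lborel)"
  proof (intro nn_integral_cong)
    fix y :: real
    show "ennreal (indicator {0<..} y * exp (- y)) * J y
        = ennreal (indicator {0<..} y * (y powr (d + p) * exp (- 1 * y))) * J 1"
      by (cases "y > 0") (simp_all add: scale[of y] ennreal_mult mult.assoc mult.left_commute)
  qed
  also have "\<dots> = ennreal (Gamma (d + p + 1)) * J 1"
    using p by (subst nn_integral_multc) (use nn_integral_Gamma[of "d + p" 1] in simp_all)
  finally have 1: "(\<integral>\<^sup>+y. ennreal (indicator {0<..} y * exp (- y)) * J y \<partial>lborel) = ennreal (Gamma (d + p + 1)) * J 1" .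
  have "(\<integral>\<^sup>+y. ennreal (indicator {0<..} y * exp (- y)) * J y \<partial>lborel)
      = (\<integral>\<^sup>+y. \<integral>\<^sup>+z. ennreal (indicator {0<..} y * exp (- y)) * ennreal (u y z) \<partial>lborel \<partial>lborel)"
    unfolding J_def by (intro nn_integral_cong nn_integral_cmult[symmetric]) measurable
  also have "\<dots> = (\<integral>\<^sup>+z. \<integral>\<^sup>+y. ennreal (indicator {0<..} y * exp (- y)) * ennreal (u y z) \<partial>lborel \<partial>lborel)"
    by (rule lborel_pair.Fubini') measurable
  also have "\<dots> = (\<integral>\<^sup>+z. ennreal (Gamma (p + 1)) * ennreal (exp (- (1/4) * (norm z)\<^sup>2)) \<partial>(lborel :: 'a measure))"
  proof (intro nn_integral_cong)
    fix z :: 'a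
    let ?c = "(norm z)\<^sup>2 / 4"
    have "(\<integral>\<^sup>+y. ennreal (indicator {0<..} y * exp (- y)) * ennreal (u y z) \<partial>lborel)
        = (\<integral>\<^sup>+y. ennreal (indicator {0<..} (y + ?c) * exp (- (y + ?c))) * ennreal (u (y + ?c) z) \<partial>lborel)"
      by (rule nn_integral_lborel_translate[symmetric]) measurable
    also have "\<dots> = (\<integral>\<^sup>+y. ennreal (exp (- ?c)) * ennreal (indicator {0<..} y * (y powr p * exp (- 1 * y))) \<partial>lborel)"
    proof (intro nn_integral_cong)
      fix y :: real
      have e: "exp (- (y + ?c)) = exp (- ?c) * exp (- 1 * y)" by (simp flip: exp_add)
      have "0 \<le> ?c" by simp
      then have "indicator {0<..} (y + ?c) * exp (- (y + ?c)) * u (y + ?c) z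
          = exp (- ?c) * (indicator {0<..} y * (y powr p * exp (- 1 * y)))"
        unfolding e by (auto simp: u_def indicator_def add_pos_nonneg)
      then show "ennreal (indicator {0<..} (y + ?c) * exp (- (y + ?c))) * ennreal (u (y + ?c) z)
         = ennreal (exp (- ?c)) * ennreal (indicator {0<..} y * (y powr p * exp (- 1 * y)))"
        by (simp add: u0 flip: ennreal_mult)
    qed
    also have "\<dots> = ennreal (exp (- ?c)) * ennreal (Gamma (p + 1))"
      using nn_integral_Gamma[OF p, of 1] by (subst nn_integral_cmult) auto
    finally show "(\<integral>\<^sup>+y. ennreal (indicator {0<..} y * exp (- y)) * ennreal (u y z) \<partial>lborel)
      = ennreal (Gamma (p + 1)) * ennreal (exp (- (1/4) * (norm z)\<^sup>2))" by (simp add: mult.commute)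
  qed
  also have "\<dots> = ennreal (Gamma (p + 1)) * ennreal ((4 * pi) ^ d)"
    using nn_integral_Gauss[of "1/4", OF _ d] by (subst nn_integral_cmult) (auto simp: mult.commute)
  finally have "ennreal (Gamma (d + p + 1)) * J 1 = ennreal (Gamma (p + 1)) * ennreal ((4 * pi) ^ d)"
    using 1 by simp
  moreover have "Gamma (real d + p + 1) > 0" "Gamma (p + 1) > 0" using p by (auto intro!: Gamma_real_pos)
  ultimately have J1: "J 1 = ennreal ((4 * pi) ^ d * Gamma (p + 1) / Gamma (d + p + 1))"
    by (intro ennreal_eq_divideI) (auto simp: mult.commute simp flip: ennreal_mult)
  have "(\<integral>\<^sup>+z. ennreal (indicator {z. (norm z)\<^sup>2 / 4 < Y} z * (Y - (norm z)\<^sup>2 / 4) powr p) \<partial>(lborel :: 'a measure)) = J Y"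
    unfolding J_def u_def by (intro nn_integral_cong) (auto simp: indicator_def)
  then show ?thesis using \<open>Gamma (real d + p + 1) > 0\<close> \<open>Gamma (p + 1) > 0\<close> scale[OF Y]
    by (simp add: J1 mult.commute flip: ennreal_mult)
qed

section \<open>Holomorphic functions of several variables\<close>

text \<open>
  A Euclidean space with a compatible multiplication by complex scalars; the cases that matter are
  complex vectors and pairs of a complex vector and a complex number.
\<close>

locale complex_scaling =
  fixes sc :: "complex \<Rightarrow> 'a::euclidean_space \<Rightarrow> 'a"
  assumes bounded_bilinear_sc: "bounded_bilinear sc"
    and sc_sc: "sc a (sc b v) = sc (a * b) v"
    and sc_one: "sc 1 v = v"
    and norm_sc: "norm (sc c v) = cmod c * norm v"
begin

definition hol_on :: "'a set \<Rightarrow> ('a \<Rightarrow> complex) \<Rightarrow> bool" where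
  "hol_on S f \<longleftrightarrow> (\<forall>x\<in>S. \<exists>D. (f has_derivative D) (at x) \<and> (\<forall>c v. D (sc c v) = c * D v))"

sublocale sc: bounded_bilinear sc by (rule bounded_bilinear_sc)

lemma sc_zero_left[simp]: "sc 0 v = 0"
  by (rule sc.zero_left)

lemma hol_onI:
  assumes "\<And>x. x \<in> S \<Longrightarrow> (f has_derivative D x) (at x)" "\<And>x c v. x \<in> S \<Longrightarrow> D x (sc c v) = c * D x v"
  shows "hol_on S f"
  using assms unfolding hol_on_def by blast

lemma hol_on_subset: "hol_on S f \<Longrightarrow> T \<subseteq> S \<Longrightarrow> hol_on T f"
  unfolding hol_on_def by blast

lemma hol_on_continuous: "hol_on S f \<Longrightarrow> continuous_on S f"
  unfolding hol_on_def by (meson continuous_at_imp_continuous_on has_derivative_continuous)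

lemma hol_on_cong:
  assumes "hol_on S f" "open S" "\<And>x. x \<in> S \<Longrightarrow> f x = g x"
  shows "hol_on S g"
proof -
  have "\<exists>D. (g has_derivative D) (at x) \<and> (\<forall>c v. D (sc c v) = c * D v)" if x: "x \<in> S" for x
  proof -
    obtain D where D: "(f has_derivative D) (at x)" "\<forall>c v. D (sc c v) = c * D v"
      using assms(1) x unfolding hol_on_def by blast
    have "(g has_derivative D) (at x)"
      by (rule has_derivative_transform_within_open[OF D(1) assms(2) x assms(3)])
    with D(2) show ?thesis by blast
  qed
  then show ?thesis by (auto simp: hol_on_def)
qed

lemma slice_has_field_derivative:
  assumes "(f has_derivative D) (at (p + sc \<zeta> v))" "\<And>c v. D (sc c v) = c * D v"
  shows "((\<lambda>\<zeta>. f (p + sc \<zeta> v)) has_field_derivative D v) (at \<zeta>)"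
proof -
  have "((\<lambda>\<zeta>. p + sc \<zeta> v) has_derivative (\<lambda>h. sc h v)) (at \<zeta>)"
    by (auto intro!: derivative_eq_intros bounded_linear.has_derivative[OF sc.bounded_linear_left])
  from has_derivative_compose[OF this assms(1)]
  have "((\<lambda>\<zeta>. f (p + sc \<zeta> v)) has_derivative (\<lambda>h. h * D v)) (at \<zeta>)" by (simp add: assms(2))
  moreover have "(\<lambda>h. h * D v) = (*) (D v)" by (simp add: fun_eq_iff mult.commute)
  ultimately show ?thesis by (simp add: has_field_derivative_def)
qed

lemma slice_holomorphic:
  assumes "hol_on S f"
  shows "(\<lambda>\<zeta>. f (p + sc \<zeta> v)) holomorphic_on {\<zeta>. p + sc \<zeta> v \<in> S}"
  unfolding holomorphic_on_def
proof
  fix \<zeta> assume "\<zeta> \<in> {\<zeta>. p + sc \<zeta> v \<in> S}"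
  then obtain D where D: "(f has_derivative D) (at (p + sc \<zeta> v))" "\<forall>c v. D (sc c v) = c * D v"
    using assms unfolding hol_on_def by blast
  have "((\<lambda>\<zeta>. f (p + sc \<zeta> v)) has_field_derivative D v) (at \<zeta>)"
    by (rule slice_has_field_derivative) (use D in auto)
  then show "(\<lambda>\<zeta>. f (p + sc \<zeta> v)) field_differentiable at \<zeta> within {\<zeta>. p + sc \<zeta> v \<in> S}"
    using field_differentiable_at_within field_differentiable_def by blast
qed

subsection \<open>Averages over rotations\<close>

definition rot :: "real \<Rightarrow> complex" where
  "rot t = exp (2 * of_real pi * \<i> * of_real t)"

lemma cmod_rot[simp]: "cmod (rot t) = 1"
  by (simp add: rot_def)

lemma circle_mean:
  assumes f: "hol_on S f" and S: "open S" "\<And>\<zeta>. cmod \<zeta> \<le> 1 \<Longrightarrow> sc \<zeta> w \<in> S"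
  shows "(LINT t:{0..1}|lborel. f (sc (rot t) w)) = f 0"
proof -
  define \<phi> where "\<phi> \<zeta> = f (0 + sc \<zeta> w)" for \<zeta>
  have hol: "\<phi> holomorphic_on {\<zeta>. 0 + sc \<zeta> w \<in> S}" unfolding \<phi>_def by (rule slice_holomorphic[OF f])
  have sub: "cball 0 1 \<subseteq> {\<zeta>. 0 + sc \<zeta> w \<in> S}" using S(2) by auto
  have hol1: "\<phi> holomorphic_on cball 0 1" using hol sub by (rule holomorphic_on_subset)
  have "((\<lambda>u. \<phi> u / (u - 0)) has_contour_integral (2 * of_real pi * \<i> * \<phi> 0)) (circlepath 0 1)"
    by (rule Cauchy_integral_circlepath_simple[OF hol1]) simp
  then have hi: "((\<lambda>t. \<phi> (circlepath 0 1 t) / circlepath 0 1 t * vector_derivative (circlepath 0 1) (at t within {0..1}))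
      has_integral (2 * of_real pi * \<i> * \<phi> 0)) {0..1}"
    by (simp add: has_contour_integral_def)
  have eq: "\<phi> (circlepath 0 1 t) / circlepath 0 1 t * vector_derivative (circlepath 0 1) (at t within {0..1})
      = (2 * of_real pi * \<i>) * f (sc (rot t) w)" if "t \<in> {0..1}" for t
  proof -
    have "vector_derivative (circlepath 0 1) (at t within {0..1}) = 2 * of_real pi * \<i> * rot t"
      using that by (simp add: vector_derivative_circlepath01 rot_def)
    moreover have "circlepath 0 1 t = rot t" by (simp add: circlepath rot_def)
    moreover have "rot t \<noteq> 0" by (simp add: rot_def)
    ultimately show ?thesis by (simp add: \<phi>_def)
  qed
  have "((\<lambda>t. (2 * of_real pi * \<i>) * f (sc (rot t) w)) has_integral (2 * of_real pi * \<i> * \<phi> 0)) {0..1}"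
    by (rule has_integral_eq[OF eq hi])
  from has_integral_mult_right[OF this, of "1 / (2 * of_real pi * \<i>)"]
  have int: "((\<lambda>t. f (sc (rot t) w)) has_integral f 0) {0..1}" by (simp add: \<phi>_def)
  have "continuous_on {0..1} (\<lambda>t. f (sc (rot t) w))"
    by (rule continuous_on_compose2[OF hol_on_continuous[OF f]])
       (auto intro!: continuous_intros sc.continuous_on S(2) simp: rot_def)
  then have "set_integrable lborel {0..1} (\<lambda>t. f (sc (rot t) w))" by (rule borel_integrable_atLeastAtMost')
  from set_borel_integral_eq_integral(2)[OF this] show ?thesis using int by (simp add: integral_unique)
qed

lemma linear_sc: "linear (sc c)"
  using sc.bounded_linear_right by (simp add: bounded_linear.linear)

lemma sc_measurable[measurable]: "(\<lambda>(c, v). sc c v) \<in> borel_measurable (borel \<Otimes>\<^sub>M borel)"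
  unfolding borel_prod split_beta
  by (intro borel_measurable_continuous_onI sc.continuous_on continuous_intros)

lemma rot_measurable[measurable]: "rot \<in> borel_measurable borel"
  unfolding rot_def by (intro borel_measurable_continuous_onI continuous_intros)

text \<open>
  Lebesgue measure is invariant under the rotations \<open>v \<mapsto> e\<^sup>i\<^sup>\<theta> v\<close>, so an integral against a
  rotation-invariant weight does not change when the integrand is averaged over all of them.
\<close>

lemma rotation_mean:
  fixes f :: "'a \<Rightarrow> complex" and w :: "'a \<Rightarrow> real"
  assumes [measurable]: "f \<in> borel_measurable borel" "w \<in> borel_measurable borel"
    and w: "\<And>c v. cmod c = 1 \<Longrightarrow> w (sc c v) = w v"
    and int: "integrable lborel (\<lambda>x. w x *\<^sub>R f x)" and intw: "integrable lborel w"
    and mean: "\<And>x. w x \<noteq> 0 \<Longrightarrow> (LINT t:{0..1}|lborel. f (sc (rot t) x)) = m"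
  shows "(\<integral>x. w x *\<^sub>R f x \<partial>lborel) = (\<integral>x. w x \<partial>lborel) *\<^sub>R m"
proof -
  define I where "I = restrict_space (lborel :: real measure) {0..1}"
  have I1: "emeasure I (space I) = 1" unfolding I_def by (simp add: emeasure_restrict_space space_restrict_space)
  interpret I: finite_measure I by standard (simp add: I1)
  have [measurable]: "rot \<in> borel_measurable I" unfolding I_def
    by (rule measurable_restrict_space1) measurable
  have mI: "measure I (space I) = 1" by (simp add: measure_def I1)
  interpret P: pair_sigma_finite I "lborel :: 'a measure" ..
  have iso: "(\<integral>x. h (sc (rot t) x) \<partial>lborel) = (\<integral>x. h x \<partial>lborel)"
    "integrable lborel (\<lambda>x. h (sc (rot t) x)) \<longleftrightarrow> integrable lborel h"
    if "h \<in> borel_measurable borel" for h :: "'a \<Rightarrow> 'c::{banach, second_countable_topology}" and t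
    by (rule integral_lborel_isometry[OF linear_sc] integrable_lborel_isometry[OF linear_sc]; simp add: norm_sc that)+
  define g where "g t x = w (sc (rot t) x) *\<^sub>R f (sc (rot t) x)" for t x
  have gw: "g t x = w x *\<^sub>R f (sc (rot t) x)" for t x by (simp add: g_def w)
  have g: "integrable (I \<Otimes>\<^sub>M lborel) (\<lambda>(t, x). g t x)"
  proof (rule P.Fubini_integrable)
    show "(\<lambda>(t, x). g t x) \<in> borel_measurable (I \<Otimes>\<^sub>M lborel)" unfolding g_def by measurable
    have "(\<integral>x. norm (g t x) \<partial>lborel) = (\<integral>x. norm (w x *\<^sub>R f x) \<partial>lborel)" for t
      unfolding g_def by (rule iso(1)[of "\<lambda>x. norm (w x *\<^sub>R f x)"]) measurable
    then show "integrable I (\<lambda>t. \<integral>x. norm (case (t, x) of (t, x) \<Rightarrow> g t x) \<partial>lborel)" by simp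
    have "integrable lborel (g t)" for t
      unfolding g_def using iso(2)[of "\<lambda>x. w x *\<^sub>R f x" t] int by simp
    then show "AE t in I. integrable lborel (\<lambda>x. case (t, x) of (t, x) \<Rightarrow> g t x)" by simp
  qed
  have "(\<integral>x. w x *\<^sub>R f x \<partial>lborel) = (\<integral>t. (\<integral>x. g t x \<partial>lborel) \<partial>I)"
    unfolding g_def by (subst iso(1)[of "\<lambda>x. w x *\<^sub>R f x"]) (simp_all add: mI)
  also have "\<dots> = (\<integral>x. (\<integral>t. g t x \<partial>I) \<partial>lborel)"
    by (rule P.Fubini_integral[OF g, symmetric])
  also have "\<dots> = (\<integral>x. w x *\<^sub>R m \<partial>lborel)"
  proof (rule Bochner_Integration.integral_cong[OF refl])
    fix x
    have "(\<integral>t. f (sc (rot t) x) \<partial>I) = m" if "w x \<noteq> 0"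
      using mean[OF that] unfolding I_def set_lebesgue_integral_def by (subst integral_restrict_space) auto
    then show "(\<integral>t. g t x \<partial>I) = w x *\<^sub>R m" by (cases "w x = 0") (simp_all add: gw)
  qed
  also have "\<dots> = (\<integral>x. w x \<partial>lborel) *\<^sub>R m"
    using intw by simp
  finally show ?thesis .
qed

subsection \<open>Integrals depending holomorphically on a parameter\<close>

text \<open>
  Cauchy's estimates on the complex lines through \<open>p\<close> bound the linear part and the remainder of
  each \<open>f q y\<close> by its majorant \<open>B y\<close> alone, so the first-order expansion can be integrated.
\<close>

lemma Cauchy_remainder:
  assumes f: "hol_on (ball p r) f" and B: "\<And>q. q \<in> ball p r \<Longrightarrow> cmod (f q) \<le> B" and r: "r > 0"
    and D: "(f has_derivative D) (at p)" "\<And>c v. D (sc c v) = c * D v"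
  shows "norm h < r / 2 \<Longrightarrow> cmod (f (p + h) - f p - D h) \<le> (8 * B / r\<^sup>2) * (norm h)\<^sup>2"
    and "cmod (D h) \<le> 2 * B / r * norm h"
proof -
  have slice: "cmod (D v) \<le> 2 * B / r \<and> (\<forall>\<zeta>. cmod \<zeta> < r/2 \<longrightarrow>
     cmod (f (p + sc \<zeta> v) - f p - \<zeta> * D v) \<le> 8 * B / r\<^sup>2 * (cmod \<zeta>)\<^sup>2)" if v: "norm v = 1" for v
  proof -
    define \<phi> where "\<phi> \<zeta> = f (p + sc \<zeta> v)" for \<zeta>
    have "ball 0 r \<subseteq> {\<zeta>. p + sc \<zeta> v \<in> ball p r}" by (auto simp: dist_norm norm_sc v)
    with slice_holomorphic[OF f] have hol: "\<phi> holomorphic_on ball 0 r"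
      unfolding \<phi>_def by (rule holomorphic_on_subset)
    have bound: "cmod (\<phi> \<zeta>) \<le> B" if "\<zeta> \<in> ball 0 r" for \<zeta>
      unfolding \<phi>_def by (rule B) (use that in \<open>auto simp: dist_norm norm_sc v\<close>)
    have derivs: "cmod ((deriv ^^ n) \<phi> \<zeta>) \<le> fact n * B / (r / 2) ^ n" if "cmod \<zeta> < r / 2" for n \<zeta>
    proof (rule Cauchy_inequality)
      have sub: "cball \<zeta> (r / 2) \<subseteq> ball 0 r"
      proof
        fix x assume "x \<in> cball \<zeta> (r / 2)"
        then have "cmod (x - \<zeta>) \<le> r / 2" by (simp add: dist_norm norm_minus_commute)
        with norm_triangle_ineq[of "x - \<zeta>" \<zeta>] that show "x \<in> ball 0 r" by simp
      qed
      then show "\<phi> holomorphic_on ball \<zeta> (r / 2)" using hol by (meson ball_subset_cball holomorphic_on_subset)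
      show "continuous_on (cball \<zeta> (r / 2)) \<phi>"
        using hol sub by (meson continuous_on_subset holomorphic_on_imp_continuous_on)
      show "cmod (\<phi> x) \<le> B" if "cmod (\<zeta> - x) = r / 2" for x
        using that sub by (intro bound) (auto simp: dist_norm)
    qed (use r in auto)
    have D0: "deriv \<phi> 0 = D v"
      unfolding \<phi>_def by (rule DERIV_imp_deriv, rule slice_has_field_derivative) (use D in simp_all)
    have 1: "cmod (D v) \<le> 2 * B / r"
      using derivs[of 0 1] r by (simp add: D0 field_simps)
    have "cmod (\<phi> \<zeta> - \<phi> 0 - \<zeta> * D v) \<le> 8 * B / r\<^sup>2 * (cmod \<zeta>)\<^sup>2" if \<zeta>: "cmod \<zeta> < r / 2" for \<zeta>
    proof -
      have "cmod (\<phi> \<zeta> - (\<Sum>i\<le>1. (deriv ^^ i) \<phi> 0 * (\<zeta> - 0) ^ i / fact i)) \<le> 8 * B / r\<^sup>2 * cmod (\<zeta> - 0) ^ Suc 1 / fact 1"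
      proof (rule complex_Taylor[where S = "ball 0 (r/2)" and f = "\<lambda>i. (deriv ^^ i) \<phi>", simplified funpow_0])
        show "((deriv ^^ i) \<phi> has_field_derivative (deriv ^^ Suc i) \<phi> x) (at x within ball 0 (r / 2))"
          if "x \<in> ball 0 (r / 2)" "i \<le> 1" for i x
        proof -
          have "(deriv ^^ i) \<phi> holomorphic_on ball 0 r" by (intro holomorphic_higher_deriv hol) auto
          moreover have "x \<in> ball 0 r" using that r by auto
          ultimately show ?thesis
            by (metis funpow.simps(2) comp_apply has_field_derivative_at_within holomorphic_derivI open_ball)
        qed
        show "cmod ((deriv ^^ Suc 1) \<phi> x) \<le> 8 * B / r\<^sup>2" if "x \<in> ball 0 (r / 2)" for x
        proof -
          have "fact (Suc 1) * B / (r / 2) ^ Suc 1 = 8 * B / r\<^sup>2"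
            using r by (simp add: field_simps power2_eq_square)
          with derivs[of x "Suc 1"] that show ?thesis by (simp only:) simp
        qed
      qed (use \<zeta> r in auto)
      then show ?thesis by (simp add: D0 algebra_simps power2_eq_square)
    qed
    with 1 show ?thesis by (simp add: \<phi>_def)
  qed
  have "D 0 = 0" using D(2)[of 0 0] by simp
  obtain v where v: "norm v = 1" "h = sc (of_real (norm h)) v"
  proof (cases "h = 0")
    case True
    obtain b :: 'a where "b \<in> Basis" using nonempty_Basis by blast
    then show thesis using True by (intro that[of b]) auto
  next
    case False
    show thesis
      by (rule that[of "sc (of_real (1 / norm h)) h"])
         (use False in \<open>simp_all add: norm_sc sc_sc sc_one norm_divide flip: of_real_mult\<close>)
  qed
  show "cmod (D h) \<le> 2 * B / r * norm h"
  proof -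
    have "cmod (D h) = norm h * cmod (D v)" by (subst v(2)) (simp add: D(2) norm_mult)
    also have "\<dots> \<le> norm h * (2 * B / r)" using slice[OF v(1)] by (intro mult_left_mono) auto
    finally show ?thesis by (simp add: mult.commute)
  qed
  show "cmod (f (p + h) - f p - D h) \<le> (8 * B / r\<^sup>2) * (norm h)\<^sup>2" if "norm h < r / 2"
  proof -
    have "D h = of_real (norm h) * D v" by (subst v(2)) (simp add: D(2))
    with slice[OF v(1), THEN conjunct2, rule_format, of "of_real (norm h)"] that
    show ?thesis by (simp flip: v(2))
  qed
qed

lemma hol_integral:
  fixes f :: "'a \<Rightarrow> 'b \<Rightarrow> complex"
  assumes r: "r > 0" and f: "\<And>y. y \<in> space N \<Longrightarrow> hol_on (ball p r) (\<lambda>q. f q y)"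
    and meas: "\<And>q. q \<in> ball p r \<Longrightarrow> f q \<in> borel_measurable N"
    and B: "integrable N B" "\<And>q y. q \<in> ball p r \<Longrightarrow> y \<in> space N \<Longrightarrow> cmod (f q y) \<le> B y"
  shows "\<exists>D. ((\<lambda>q. \<integral>y. f q y \<partial>N) has_derivative D) (at p) \<and> (\<forall>c v. D (sc c v) = c * D v)"
proof -
  have p: "p \<in> ball p r" using r by simp
  have "\<exists>D. y \<in> space N \<longrightarrow> ((\<lambda>q. f q y) has_derivative D) (at p) \<and> (\<forall>c v. D (sc c v) = c * D v)" for y
    using f p unfolding hol_on_def by blast
  then obtain D where D: "\<And>y. y \<in> space N \<Longrightarrow> ((\<lambda>q. f q y) has_derivative D y) (at p)"
    "\<And>y c v. y \<in> space N \<Longrightarrow> D y (sc c v) = c * D y v" by metis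
  have int_f: "integrable N (f q)" if "q \<in> ball p r" for q
    by (rule Bochner_Integration.integrable_bound[OF B(1) meas[OF that]])
       (auto intro!: AE_I2 order_trans[OF B(2)[OF that]])
  have rem: "cmod (f (p + h) y - f p y - D y h) \<le> (8 * B y / r\<^sup>2) * (norm h)\<^sup>2"
    if "norm h < r / 2" "y \<in> space N" for h y
    by (rule Cauchy_remainder(1)[OF f[OF that(2)] B(2)[OF _ that(2)] r D(1)[OF that(2)] D(2)[OF that(2)] that(1)])
  have Db: "cmod (D y h) \<le> 2 * B y / r * norm h" if "y \<in> space N" for h y
    by (rule Cauchy_remainder(2)[OF f[OF that(1)] B(2)[OF _ that(1)] r D(1)[OF that(1)] D(2)[OF that(1)]])
  have Dmeas: "(\<lambda>y. D y h) \<in> borel_measurable N" for h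
  proof -
    obtain k :: nat where k: "norm h * (1 / real (Suc k)) < r / 2"
    proof -
      obtain k :: nat where "2 * norm h / r < real k" using reals_Archimedean2 by blast
      then have "2 * norm h < r * real (Suc k)" using r by (simp add: field_simps)
      then show thesis by (intro that[of k]) (simp add: field_simps)
    qed
    define e where "e i = 1 / real (Suc (k + i))" for i
    have e0: "e i > 0" for i by (simp add: e_def)
    have e: "norm (e i *\<^sub>R h) < r / 2" for i
    proof -
      have "e i \<le> 1 / real (Suc k)" by (simp add: e_def field_simps)
      then have "e i * norm h \<le> norm h * (1 / real (Suc k))" by (subst mult.commute) (intro mult_left_mono, auto)
      moreover have "norm (e i *\<^sub>R h) = e i * norm h" using e0[of i] by simp
      ultimately show ?thesis using k by linarith
    qed
    have eb: "p + e i *\<^sub>R h \<in> ball p r" for i using e[of i] r by (simp add: dist_norm)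
    have elim: "e \<longlonglongrightarrow> 0"
      unfolding e_def using LIMSEQ_ignore_initial_segment[OF LIMSEQ_inverse_real_of_nat, of k]
      by (simp add: inverse_eq_divide add.commute)
    show ?thesis
    proof (rule borel_measurable_LIMSEQ_metric[where f = "\<lambda>i y. (f (p + e i *\<^sub>R h) y - f p y) /\<^sub>R e i"])
      show "(\<lambda>y. (f (p + e i *\<^sub>R h) y - f p y) /\<^sub>R e i) \<in> borel_measurable N" for i
        using meas[OF eb[of i]] meas[OF p] by measurable
      fix y assume y: "y \<in> space N"
      have lin: "linear (D y)" using D(1)[OF y] by (rule has_derivative_linear)
      have "(\<lambda>i. (f (p + e i *\<^sub>R h) y - f p y) /\<^sub>R e i - D y h) \<longlonglongrightarrow> 0"
      proof (rule tendsto_norm_zero_cancel, rule tendsto_sandwich[where f = "\<lambda>_. 0"])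
        show "\<forall>\<^sub>F i in sequentially. norm ((f (p + e i *\<^sub>R h) y - f p y) /\<^sub>R e i - D y h)
            \<le> (8 * B y / r\<^sup>2) * (norm h)\<^sup>2 * e i"
        proof (intro always_eventually allI)
          fix i
          have "(f (p + e i *\<^sub>R h) y - f p y) /\<^sub>R e i - D y h
              = (f (p + e i *\<^sub>R h) y - f p y - D y (e i *\<^sub>R h)) /\<^sub>R e i"
            using e0[of i] by (simp add: linear_scale[OF lin] scaleR_diff_right)
          then have "norm ((f (p + e i *\<^sub>R h) y - f p y) /\<^sub>R e i - D y h)
              = cmod (f (p + e i *\<^sub>R h) y - f p y - D y (e i *\<^sub>R h)) / e i"
            using e0[of i] by (simp add: divide_inverse)
          also have "\<dots> \<le> (8 * B y / r\<^sup>2) * (norm (e i *\<^sub>R h))\<^sup>2 / e i"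
            using rem[OF e y, of i] e0[of i] by (intro divide_right_mono) auto
          also have "\<dots> = (8 * B y / r\<^sup>2) * (norm h)\<^sup>2 * e i"
            using e0[of i] by (simp add: power_mult_distrib power2_eq_square)
          finally show "norm ((f (p + e i *\<^sub>R h) y - f p y) /\<^sub>R e i - D y h)
              \<le> (8 * B y / r\<^sup>2) * (norm h)\<^sup>2 * e i" .
        qed
        show "(\<lambda>i. (8 * B y / r\<^sup>2) * (norm h)\<^sup>2 * e i) \<longlonglongrightarrow> 0"
          by (rule tendsto_mult_right_zero[OF elim])
      qed auto
      from tendsto_add[OF this tendsto_const[of "D y h"]]
      show "(\<lambda>i. (f (p + e i *\<^sub>R h) y - f p y) /\<^sub>R e i) \<longlonglongrightarrow> D y h" by simp
    qed
  qed
  have Dint: "integrable N (\<lambda>y. D y h)" for h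
  proof (rule Bochner_Integration.integrable_bound[where f = "\<lambda>y. 2 * B y / r * norm h"])
    show "integrable N (\<lambda>y. 2 * B y / r * norm h)" using B(1) by simp
    show "AE y in N. norm (D y h) \<le> norm (2 * B y / r * norm h)"
    proof (rule AE_I2)
      fix y assume "y \<in> space N"
      from order_trans[OF Db[OF this] abs_ge_self] show "norm (D y h) \<le> norm (2 * B y / r * norm h)"
        by (simp only: real_norm_def)
    qed
  qed (rule Dmeas)
  define E where "E h = (\<integral>y. D y h \<partial>N)" for h
  have "linear E"
  proof (rule linearI)
    have lin: "linear (D y)" if "y \<in> space N" for y using D(1)[OF that] by (rule has_derivative_linear)
    show "E (u + v) = E u + E v" for u v
      unfolding E_def Bochner_Integration.integral_add[OF Dint Dint, symmetric]
      by (intro Bochner_Integration.integral_cong refl) (simp add: linear_add[OF lin])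
    show "E (c *\<^sub>R v) = c *\<^sub>R E v" for c v
      unfolding E_def integral_scaleR_right[symmetric]
      by (intro Bochner_Integration.integral_cong refl) (simp add: linear_scale[OF lin])
  qed
  have Esc: "E (sc c v) = c * E v" for c v
    unfolding E_def integral_mult_right_zero[symmetric]
    by (intro Bochner_Integration.integral_cong refl D(2))
  define C where "C = (\<integral>y. 8 * B y / r\<^sup>2 \<partial>N)"
  have "((\<lambda>q. \<integral>y. f q y \<partial>N) has_derivative E) (at p)"
  proof (rule has_derivativeI_sandwich[where e = "r / 2" and H = "\<lambda>q. C * norm (q - p)"])
    show "bounded_linear E" using \<open>linear E\<close> by (simp add: linear_conv_bounded_linear)
    show "((\<lambda>q. C * norm (q - p)) \<longlongrightarrow> 0) (at p)"
      by (auto intro!: tendsto_eq_intros)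
    fix q assume q: "q \<noteq> p" "dist q p < r / 2"
    then have qb: "q \<in> ball p r" using r by (simp add: dist_commute)
    have "cmod ((\<integral>y. f q y \<partial>N) - (\<integral>y. f p y \<partial>N) - E (q - p))
        = cmod (\<integral>y. f q y - f p y - D y (q - p) \<partial>N)"
      using int_f[OF qb] int_f[OF p] Dint by (simp add: E_def)
    also have "\<dots> \<le> (\<integral>y. cmod (f q y - f p y - D y (q - p)) \<partial>N)" by (rule integral_norm_bound)
    also have "\<dots> \<le> (\<integral>y. (8 * B y / r\<^sup>2) * (norm (q - p))\<^sup>2 \<partial>N)"
    proof (rule integral_mono)
      show "integrable N (\<lambda>y. cmod (f q y - f p y - D y (q - p)))"
        using int_f[OF qb] int_f[OF p] Dint by simp
      show "integrable N (\<lambda>y. (8 * B y / r\<^sup>2) * (norm (q - p))\<^sup>2)" using B(1) by simp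
      show "cmod (f q y - f p y - D y (q - p)) \<le> (8 * B y / r\<^sup>2) * (norm (q - p))\<^sup>2" if "y \<in> space N" for y
        using rem[of "q - p" y] q that by (simp add: dist_norm)
    qed
    also have "\<dots> = C * norm (q - p) * norm (q - p)" by (simp add: C_def power2_eq_square)
    finally show "norm ((\<integral>y. f q y \<partial>N) - (\<integral>y. f p y \<partial>N) - E (q - p)) / norm (q - p) \<le> C * norm (q - p)"
      using q by (simp add: divide_le_eq)
  qed (use r in auto)
  with Esc show ?thesis by blast
qed

end


lemma norm_vector_scalar_mult:
  fixes v :: "complex ^ 'n" shows "norm (c *s v) = cmod c * norm v"
  by (simp add: norm_vec_def norm_mult L2_set_right_distrib)

interpretation vec: complex_scaling "(*s) :: complex \<Rightarrow> complex ^ 'n \<Rightarrow> complex ^ 'n"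
proof
  show "(a + a') *s b = a *s b + a' *s b" for a a' and b :: "complex ^ 'n"
    by (simp add: vec_eq_iff algebra_simps)
  show "a *s (b + b') = a *s b + a *s b'" for a and b b' :: "complex ^ 'n"
    by (simp add: vec_eq_iff algebra_simps)
  show "(r *\<^sub>R a) *s b = r *\<^sub>R (a *s b)" for r a and b :: "complex ^ 'n"
    by (simp add: vec_eq_iff)
  show "a *s (r *\<^sub>R b) = r *\<^sub>R (a *s b)" for r a and b :: "complex ^ 'n"
    by (simp add: vec_eq_iff)
  show "\<exists>K. \<forall>a (b :: complex ^ 'n). norm (a *s b) \<le> norm a * norm b * K"
    by (rule exI[of _ 1]) (simp add: norm_vector_scalar_mult)
qed (simp_all add: vec_eq_iff norm_vector_scalar_mult)

definition pair_scale :: "complex \<Rightarrow> (complex ^ 'n) \<times> complex \<Rightarrow> (complex ^ 'n) \<times> complex" where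
  "pair_scale c p = (c *s fst p, c * snd p)"

lemma norm_pair_scale: "norm (pair_scale c p) = cmod c * norm p"
proof -
  have "(cmod c * norm (fst p))\<^sup>2 + (cmod c * cmod (snd p))\<^sup>2
      = (cmod c)\<^sup>2 * ((norm (fst p))\<^sup>2 + (cmod (snd p))\<^sup>2)"
    by (simp add: power_mult_distrib algebra_simps)
  then show ?thesis
    by (simp add: pair_scale_def norm_Pair norm_prod_def norm_vector_scalar_mult norm_mult real_sqrt_mult)
qed

interpretation pair: complex_scaling "pair_scale :: complex \<Rightarrow> (complex ^ 'n) \<times> complex \<Rightarrow> _"
proof
  show "\<exists>K. \<forall>a (b :: (complex ^ 'n) \<times> complex). norm (pair_scale a b) \<le> norm a * norm b * K"
    by (rule exI[of _ 1]) (simp add: norm_pair_scale)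
qed (simp_all add: pair_scale_def vec_eq_iff prod_eq_iff norm_pair_scale[unfolded pair_scale_def] algebra_simps)

interpretation cplx: complex_scaling "(*) :: complex \<Rightarrow> complex \<Rightarrow> complex"
  by (rule complex_scaling.intro[OF bounded_bilinear_mult]) (simp_all add: norm_mult)

lemma entire_iff_hol_on: "entire G \<longleftrightarrow> vec.hol_on UNIV G"
  by (simp add: entire_def vec.hol_on_def)

lemma siegel_holomorphic_iff_hol_on: "siegel_holomorphic F \<longleftrightarrow> pair.hol_on siegel_space F"
  by (auto simp: siegel_holomorphic_def pair.hol_on_def pair_scale_def)

context complex_scaling
begin

lemma hol_on_const: "hol_on S (\<lambda>_. c)"
  by (rule hol_onI[where D = "\<lambda>_ _. 0"]) auto

lemma hol_on_add: "hol_on S f \<Longrightarrow> hol_on S g \<Longrightarrow> hol_on S (\<lambda>x. f x + g x)"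
proof -
  assume f: "hol_on S f" and g: "hol_on S g"
  have "\<exists>D. ((\<lambda>x. f x + g x) has_derivative D) (at x) \<and> (\<forall>c v. D (sc c v) = c * D v)" if x: "x \<in> S" for x
  proof -
    obtain D where D: "(f has_derivative D) (at x)" "\<forall>c v. D (sc c v) = c * D v"
      using f x unfolding hol_on_def by blast
    obtain E where E: "(g has_derivative E) (at x)" "\<forall>c v. E (sc c v) = c * E v"
      using g x unfolding hol_on_def by blast
    show ?thesis using has_derivative_add[OF D(1) E(1)] D(2) E(2)
      by (intro exI[of _ "\<lambda>h. D h + E h"]) (simp add: algebra_simps)
  qed
  then show "hol_on S (\<lambda>x. f x + g x)" by (simp add: hol_on_def)
qed

lemma hol_on_mult:
  assumes "hol_on S f" "hol_on S g" shows "hol_on S (\<lambda>x. f x * g x)"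
  unfolding hol_on_def
proof
  fix x assume x: "x \<in> S"
  obtain D where D: "(f has_derivative D) (at x)" "\<forall>c v. D (sc c v) = c * D v"
    using assms(1) x unfolding hol_on_def by blast
  obtain E where E: "(g has_derivative E) (at x)" "\<forall>c v. E (sc c v) = c * E v"
    using assms(2) x unfolding hol_on_def by blast
  show "\<exists>D. ((\<lambda>x. f x * g x) has_derivative D) (at x) \<and> (\<forall>c v. D (sc c v) = c * D v)"
    using has_derivative_mult[OF D(1) E(1)] D(2) E(2)
    by (intro exI[of _ "\<lambda>h. f x * E h + D h * g x"]) (simp add: algebra_simps)
qed

lemma hol_on_power: "hol_on S f \<Longrightarrow> hol_on S (\<lambda>x. f x ^ k)"
  by (induction k) (auto intro: hol_on_const hol_on_mult)

lemma hol_on_prod: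
  "(\<And>i. i \<in> I \<Longrightarrow> hol_on S (f i)) \<Longrightarrow> hol_on S (\<lambda>x. \<Prod>i\<in>I. f i x)"
  by (induction I rule: infinite_finite_induct) (auto intro: hol_on_const hol_on_mult)

lemma hol_on_linear:
  assumes "bounded_linear L" "\<And>c v. L (sc c v) = c * L v" shows "hol_on S L"
  by (rule hol_onI[where D = "\<lambda>_. L"]) (use assms in \<open>auto intro: bounded_linear_imp_has_derivative\<close>)

lemma hol_on_compose:
  assumes f: "hol_on S f" and \<phi>: "\<And>x. x \<in> S \<Longrightarrow> (\<phi> has_field_derivative \<phi>' x) (at (f x))"
  shows "hol_on S (\<lambda>x. \<phi> (f x))"
  unfolding hol_on_def
proof
  fix x assume x: "x \<in> S"
  obtain D where D: "(f has_derivative D) (at x)" "\<forall>c v. D (sc c v) = c * D v"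
    using f x unfolding hol_on_def by blast
  have "((\<lambda>x. \<phi> (f x)) has_derivative (\<lambda>h. \<phi>' x * D h)) (at x)"
    using has_derivative_compose[OF D(1) \<phi>[OF x, unfolded has_field_derivative_def]] .
  with D(2) show "\<exists>D. ((\<lambda>x. \<phi> (f x)) has_derivative D) (at x) \<and> (\<forall>c v. D (sc c v) = c * D v)"
    by (intro exI[of _ "\<lambda>h. \<phi>' x * D h"]) (simp add: algebra_simps)
qed

lemma hol_on_exp: "hol_on S f \<Longrightarrow> hol_on S (\<lambda>x. exp (f x))"
  by (rule hol_on_compose[of S f exp "\<lambda>x. exp (f x)"]) auto

lemma hol_on_translate:
  assumes "hol_on ((+) a ` S) f" shows "hol_on S (\<lambda>x. f (x + a))"
  unfolding hol_on_def
proof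
  fix x assume "x \<in> S"
  then have "x + a \<in> (+) a ` S" by (auto simp: add.commute)
  then obtain D where D: "(f has_derivative D) (at (x + a))" "\<forall>c v. D (sc c v) = c * D v"
    using assms unfolding hol_on_def by blast
  have "((\<lambda>x. x + a) has_derivative (\<lambda>h. h)) (at x)" by (auto intro!: derivative_eq_intros)
  from has_derivative_compose[OF this D(1)] D(2)
  show "\<exists>D. ((\<lambda>x. f (x + a)) has_derivative D) (at x) \<and> (\<forall>c v. D (sc c v) = c * D v)" by blast
qed

end

lemma complex_mult_cnj_cmod: "z * cnj z = of_real ((cmod z)\<^sup>2)"
  by (simp add: complex_norm_square[symmetric])

section \<open>Orthonormal bases and functionals in an inner product space\<close>

text \<open>
  A complex inner product space of functions, not assumed complete: the Fock space enters only
  through its inner product, through density of the span of a basis and through bounded functionals.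
\<close>

locale pre_hilbert =
  fixes V :: "('x \<Rightarrow> complex) set" and ip :: "('x \<Rightarrow> complex) \<Rightarrow> ('x \<Rightarrow> complex) \<Rightarrow> complex"
  assumes lincomb: "G \<in> V \<Longrightarrow> H \<in> V \<Longrightarrow> (\<lambda>x. a * G x + b * H x) \<in> V"
    and zero: "(\<lambda>x. 0) \<in> V"
    and ip_lincomb: "G \<in> V \<Longrightarrow> H \<in> V \<Longrightarrow> K \<in> V \<Longrightarrow> ip (\<lambda>x. a * G x + b * H x) K = a * ip G K + b * ip H K"
    and ip_cnj: "G \<in> V \<Longrightarrow> H \<in> V \<Longrightarrow> ip H G = cnj (ip G H)"
    and ip_nonneg: "G \<in> V \<Longrightarrow> 0 \<le> Re (ip G G)"
begin

definition nsq :: "('x \<Rightarrow> complex) \<Rightarrow> real" where "nsq G = Re (ip G G)"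

definition orthonormal :: "('x \<Rightarrow> complex) set \<Rightarrow> bool" where
  "orthonormal B \<longleftrightarrow> B \<subseteq> V \<and> (\<forall>e\<in>B. \<forall>f\<in>B. ip e f = (if e = f then 1 else 0))"

definition onb :: "('x \<Rightarrow> complex) set \<Rightarrow> bool" where
  "onb B \<longleftrightarrow> orthonormal B \<and>
     (\<forall>G\<in>V. \<forall>\<epsilon>>0. \<exists>S c. finite S \<and> S \<subseteq> B \<and> sqrt (nsq (\<lambda>w. G w - (\<Sum>e\<in>S. c e * e w))) < \<epsilon>)"

definition bounded_functional :: "(('x \<Rightarrow> complex) \<Rightarrow> complex) \<Rightarrow> bool" where
  "bounded_functional c \<longleftrightarrow>
     (\<forall>G\<in>V. \<forall>H\<in>V. \<forall>a b. c (\<lambda>x. a * G x + b * H x) = a * c G + b * c H) \<and>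
     (\<exists>C. \<forall>G\<in>V. cmod (c G) \<le> C * sqrt (nsq G))"

lemma nsq_nonneg: "G \<in> V \<Longrightarrow> 0 \<le> nsq G"
  by (simp add: nsq_def ip_nonneg)

lemma sum_in: "finite S \<Longrightarrow> S \<subseteq> V \<Longrightarrow> (\<lambda>x. \<Sum>e\<in>S. c e * e x) \<in> V"
proof (induction S rule: finite_induct)
  case (insert f S)
  then show ?case using lincomb[of f "\<lambda>x. \<Sum>e\<in>S. c e * e x" "c f" 1] by simp
qed (simp add: zero)

lemma diff_in: "G \<in> V \<Longrightarrow> H \<in> V \<Longrightarrow> (\<lambda>x. G x - H x) \<in> V"
  using lincomb[of G H 1 "-1"] by simp

lemma ip_diff: "G \<in> V \<Longrightarrow> H \<in> V \<Longrightarrow> K \<in> V \<Longrightarrow> ip (\<lambda>x. G x - H x) K = ip G K - ip H K"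
  using ip_lincomb[of G H K 1 "-1"] by simp

lemma functional_sum:
  assumes "\<And>G H a b. G \<in> V \<Longrightarrow> H \<in> V \<Longrightarrow> c (\<lambda>x. a * G x + b * H x) = a * c G + b * c H"
  shows "finite S \<Longrightarrow> S \<subseteq> V \<Longrightarrow> c (\<lambda>x. \<Sum>e\<in>S. a e * e x) = (\<Sum>e\<in>S. a e * c e)"
proof (induction S rule: finite_induct)
  case empty
  show ?case using assms[OF zero zero, of 0 0] by simp
next
  case (insert f S)
  then show ?case using assms[of f "\<lambda>x. \<Sum>e\<in>S. a e * e x" "a f" 1] sum_in[of S a] by simp
qed

lemma ip_sum: "finite S \<Longrightarrow> S \<subseteq> V \<Longrightarrow> K \<in> V \<Longrightarrow> ip (\<lambda>x. \<Sum>e\<in>S. a e * e x) K = (\<Sum>e\<in>S. a e * ip e K)"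
  by (rule functional_sum) (auto intro: ip_lincomb)

lemma ip_orthonormal_sum:
  assumes "orthonormal B" "finite S" "S \<subseteq> B" "f \<in> S"
  shows "ip (\<lambda>x. \<Sum>e\<in>S. a e * e x) f = a f"
proof -
  have "ip (\<lambda>x. \<Sum>e\<in>S. a e * e x) f = (\<Sum>e\<in>S. a e * ip e f)"
    by (rule ip_sum) (use assms in \<open>auto simp: orthonormal_def\<close>)
  also have "\<dots> = (\<Sum>e\<in>S. if e = f then a e else 0)"
  proof (intro sum.cong refl)
    fix e assume "e \<in> S"
    then have "ip e f = (if e = f then 1 else 0)" using assms by (simp add: orthonormal_def subset_eq)
    then show "a e * ip e f = (if e = f then a e else 0)" by simp
  qed
  finally show ?thesis using assms by simp
qed

lemma nsq_orthonormal_sum: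
  assumes B: "orthonormal B" and S: "finite S" "S \<subseteq> B"
  shows "nsq (\<lambda>x. \<Sum>e\<in>S. a e * e x) = (\<Sum>e\<in>S. (cmod (a e))\<^sup>2)"
proof -
  have SV: "S \<subseteq> V" using B S by (auto simp: orthonormal_def)
  let ?P = "\<lambda>x. \<Sum>e\<in>S. a e * e x"
  have "ip ?P ?P = (\<Sum>e\<in>S. a e * ip e ?P)" by (rule ip_sum[OF S(1) SV sum_in[OF S(1) SV]])
  also have "\<dots> = (\<Sum>e\<in>S. a e * cnj (a e))"
  proof (intro sum.cong refl)
    fix e assume e: "e \<in> S"
    have "ip e ?P = cnj (ip ?P e)" by (rule ip_cnj) (use SV e sum_in[OF S(1) SV] in auto)
    then show "a e * ip e ?P = a e * cnj (a e)" by (simp add: ip_orthonormal_sum[OF B S e])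
  qed
  finally show ?thesis by (simp add: nsq_def complex_mult_cnj_cmod)
qed

lemma nsq_minus_orthonormal_sum:
  assumes B: "orthonormal B" and S: "finite S" "S \<subseteq> B" and G: "G \<in> V"
  shows "nsq (\<lambda>x. G x - (\<Sum>e\<in>S. a e * e x))
    = nsq G - (\<Sum>e\<in>S. (cmod (ip G e))\<^sup>2) + (\<Sum>e\<in>S. (cmod (a e - ip G e))\<^sup>2)"
proof -
  have SV: "S \<subseteq> V" using B S by (auto simp: orthonormal_def)
  define P where "P = (\<lambda>x. \<Sum>e\<in>S. a e * e x)"
  have P: "P \<in> V" unfolding P_def by (rule sum_in[OF S(1) SV])
  have PG: "ip P G = (\<Sum>e\<in>S. a e * cnj (ip G e))"
    unfolding P_def ip_sum[OF S(1) SV G] by (intro sum.cong refl) (use SV G ip_cnj in auto)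
  have "ip (\<lambda>x. G x - P x) (\<lambda>x. G x - P x) = ip G (\<lambda>x. G x - P x) - ip P (\<lambda>x. G x - P x)"
    by (rule ip_diff[OF G P diff_in[OF G P]])
  also have "ip G (\<lambda>x. G x - P x) = cnj (ip G G - ip P G)"
    using ip_cnj[OF diff_in[OF G P] G] by (simp add: ip_diff[OF G P G])
  also have "ip P (\<lambda>x. G x - P x) = cnj (ip G P - ip P P)"
    using ip_cnj[OF diff_in[OF G P] P] by (simp add: ip_diff[OF G P P])
  finally have "nsq (\<lambda>x. G x - P x) = nsq G - 2 * Re (ip P G) + nsq P"
    using ip_cnj[OF G P] by (simp add: nsq_def)
  also have "nsq P = (\<Sum>e\<in>S. (cmod (a e))\<^sup>2)" unfolding P_def by (rule nsq_orthonormal_sum[OF B S])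
  also have "nsq G - 2 * Re (ip P G) + (\<Sum>e\<in>S. (cmod (a e))\<^sup>2)
      = nsq G + (\<Sum>e\<in>S. (cmod (a e))\<^sup>2 - 2 * Re (a e * cnj (ip G e)))"
    by (simp add: PG sum_subtractf sum_distrib_left)
  also have "(\<Sum>e\<in>S. (cmod (a e))\<^sup>2 - 2 * Re (a e * cnj (ip G e)))
      = (\<Sum>e\<in>S. (cmod (a e - ip G e))\<^sup>2 - (cmod (ip G e))\<^sup>2)"
    unfolding cmod_power2 by (intro sum.cong refl) (simp add: power2_eq_square algebra_simps)
  finally show ?thesis by (simp add: P_def sum_subtractf)
qed

text \<open>
  By Pythagoras, enlarging the finite set of basis vectors only decreases the distance to the
  span, so the density of the span controls all sufficiently large partial sums.
\<close>

lemma onb_expansion: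
  assumes B: "onb B" and c: "bounded_functional c" and G: "G \<in> V"
  shows "((\<lambda>e. ip G e * c e) has_sum c G) B"
  unfolding has_sum_def
proof (rule tendstoI)
  fix \<epsilon> :: real assume \<epsilon>: "\<epsilon> > 0"
  have ortho: "orthonormal B" and BV: "B \<subseteq> V" using B by (auto simp: onb_def orthonormal_def)
  have clin: "\<And>G H a b. G \<in> V \<Longrightarrow> H \<in> V \<Longrightarrow> c (\<lambda>x. a * G x + b * H x) = a * c G + b * c H"
    using c by (simp add: bounded_functional_def)
  obtain C0 where C0: "\<And>G. G \<in> V \<Longrightarrow> cmod (c G) \<le> C0 * sqrt (nsq G)"
    using c unfolding bounded_functional_def by blast
  define C where "C = max C0 1"
  have C: "C > 0" "cmod (c G) \<le> C * sqrt (nsq G)" if "G \<in> V" for G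
  proof -
    show "C > 0" by (simp add: C_def)
    have "C0 * sqrt (nsq G) \<le> C * sqrt (nsq G)"
      using nsq_nonneg[OF that] by (intro mult_right_mono) (auto simp: C_def)
    with C0[OF that] show "cmod (c G) \<le> C * sqrt (nsq G)" by linarith
  qed
  obtain S a where S: "finite S" "S \<subseteq> B" "sqrt (nsq (\<lambda>w. G w - (\<Sum>e\<in>S. a e * e w))) < \<epsilon> / C"
    using B G \<epsilon> C(1)[OF G] unfolding onb_def by (meson divide_pos_pos)
  show "\<forall>\<^sub>F T in finite_subsets_at_top B. dist (\<Sum>e\<in>T. ip G e * c e) (c G) < \<epsilon>"
    unfolding eventually_finite_subsets_at_top
  proof (intro exI[of _ S] conjI allI impI S(1,2))
    fix T assume "finite T \<and> S \<subseteq> T \<and> T \<subseteq> B"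
    then have T: "finite T" "S \<subseteq> T" "T \<subseteq> B" by auto
    let ?P = "\<lambda>x. \<Sum>e\<in>T. ip G e * e x"
    have P: "?P \<in> V" by (rule sum_in) (use T BV in auto)
    have "(\<Sum>e\<in>S. (cmod (ip G e))\<^sup>2) \<le> (\<Sum>e\<in>T. (cmod (ip G e))\<^sup>2)" by (intro sum_mono2 T) auto
    moreover have "0 \<le> (\<Sum>e\<in>S. (cmod (a e - ip G e))\<^sup>2)" by (intro sum_nonneg) auto
    ultimately have "nsq (\<lambda>x. G x - ?P x) \<le> nsq (\<lambda>w. G w - (\<Sum>e\<in>S. a e * e w))"
      unfolding nsq_minus_orthonormal_sum[OF ortho T(1,3) G] nsq_minus_orthonormal_sum[OF ortho S(1,2) G]
      by simp
    then have "sqrt (nsq (\<lambda>x. G x - ?P x)) < \<epsilon> / C" using S(3) by (meson le_less_trans real_sqrt_le_mono)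
    then have "C * sqrt (nsq (\<lambda>x. G x - ?P x)) < \<epsilon>" using C(1)[OF G] by (simp add: field_simps)
    moreover have "c G - (\<Sum>e\<in>T. ip G e * c e) = c (\<lambda>x. G x - ?P x)"
    proof -
      have "c (\<lambda>x. G x - ?P x) = c G - c ?P" using clin[OF G P, of 1 "-1"] by simp
      also have "c ?P = (\<Sum>e\<in>T. ip G e * c e)" by (rule functional_sum[OF clin]) (use T BV in auto)
      finally show ?thesis by simp
    qed
    ultimately show "dist (\<Sum>e\<in>T. ip G e * c e) (c G) < \<epsilon>"
      using C(2)[OF diff_in[OF G P]] by (simp add: dist_norm norm_minus_commute)
  qed
qed

lemma functional_norm_le:
  assumes B: "onb B" "orthonormal B'" and c: "bounded_functional c"
    and sm: "(\<lambda>e. (cmod (c e))\<^sup>2) summable_on B"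
  shows "(\<lambda>e. (cmod (c e))\<^sup>2) summable_on B'" "(\<Sum>\<^sub>\<infinity>e\<in>B'. (cmod (c e))\<^sup>2) \<le> (\<Sum>\<^sub>\<infinity>e\<in>B. (cmod (c e))\<^sup>2)"
proof -
  define N where "N = (\<Sum>\<^sub>\<infinity>e\<in>B. (cmod (c e))\<^sup>2)"
  have N0: "0 \<le> N" unfolding N_def by (rule infsum_nonneg) auto
  have ortho: "orthonormal B" using B(1) by (simp add: onb_def)
  have clin: "\<And>G H a b. G \<in> V \<Longrightarrow> H \<in> V \<Longrightarrow> c (\<lambda>x. a * G x + b * H x) = a * c G + b * c H"
    using c by (simp add: bounded_functional_def)
  have fin: "(\<Sum>f\<in>S. (cmod (c f))\<^sup>2) \<le> N" if S: "finite S" "S \<subseteq> B'" for S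
  proof -
    have SV: "S \<subseteq> V" using S B(2) by (auto simp: orthonormal_def)
    define s where "s = (\<Sum>f\<in>S. (cmod (c f))\<^sup>2)"
    define G where "G = (\<lambda>x. \<Sum>f\<in>S. cnj (c f) * f x)"
    have G: "G \<in> V" unfolding G_def by (rule sum_in[OF S(1) SV])
    have nG: "nsq G = s" unfolding G_def s_def by (simp add: nsq_orthonormal_sum[OF B(2) S])
    have "c G = (\<Sum>f\<in>S. cnj (c f) * c f)" unfolding G_def by (rule functional_sum[OF clin S(1) SV])
    also have "\<dots> = of_real s" unfolding s_def of_real_sum
      by (intro sum.cong refl) (metis complex_mult_cnj_cmod mult.commute)
    finally have cG: "c G = of_real s" .
    have part: "cmod (\<Sum>e\<in>T. ip G e * c e) \<le> sqrt (s * N)" if T: "finite T" "T \<subseteq> B" for T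
    proof -
      have "cmod (\<Sum>e\<in>T. ip G e * c e) \<le> (\<Sum>e\<in>T. cmod (ip G e) * cmod (c e))"
        by (rule order_trans[OF norm_sum]) (simp add: norm_mult)
      moreover have "(\<Sum>e\<in>T. cmod (ip G e) * cmod (c e))\<^sup>2 \<le> (\<Sum>e\<in>T. (cmod (ip G e))\<^sup>2) * (\<Sum>e\<in>T. (cmod (c e))\<^sup>2)"
        by (rule Cauchy_Schwarz_ineq_sum)
      moreover have "(\<Sum>e\<in>T. (cmod (ip G e))\<^sup>2) \<le> s"
      proof -
        have "(\<lambda>x. G x - (\<Sum>e\<in>T. ip G e * e x)) \<in> V"
          by (intro diff_in G sum_in) (use T ortho in \<open>auto simp: orthonormal_def\<close>)
        from nsq_nonneg[OF this] show ?thesis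
          unfolding nsq_minus_orthonormal_sum[OF ortho T G] nG by simp
      qed
      moreover have "(\<Sum>e\<in>T. (cmod (c e))\<^sup>2) \<le> N"
        unfolding N_def by (rule finite_sum_le_infsum[OF sm T]) auto
      ultimately have "(\<Sum>e\<in>T. cmod (ip G e) * cmod (c e))\<^sup>2 \<le> s * N"
        by (meson mult_mono order_trans sum_nonneg zero_le_power2 s_def nG nsq_nonneg[OF G])
      then have "(\<Sum>e\<in>T. cmod (ip G e) * cmod (c e)) \<le> sqrt (s * N)" by (rule real_le_rsqrt)
      with \<open>cmod (\<Sum>e\<in>T. ip G e * c e) \<le> _\<close> show ?thesis by linarith
    qed
    have "((\<lambda>T. cmod (\<Sum>e\<in>T. ip G e * c e)) \<longlongrightarrow> cmod (c G)) (finite_subsets_at_top B)"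
      using onb_expansion[OF B(1) c G] unfolding has_sum_def by (rule tendsto_norm)
    then have "cmod (c G) \<le> sqrt (s * N)"
      by (rule tendsto_upperbound) (use part in \<open>auto intro!: eventually_finite_subsets_at_top_weakI\<close>)
    moreover have s0: "0 \<le> s" unfolding s_def by (intro sum_nonneg) auto
    ultimately have "s \<le> sqrt (s * N)" by (simp add: cG)
    then have "s\<^sup>2 \<le> s * N" using s0 N0 by (metis abs_of_nonneg power_mono real_sqrt_pow2 mult_nonneg_nonneg)
    then show ?thesis unfolding s_def[symmetric] using s0 N0
      by (cases "s = 0") (auto simp: power2_eq_square)
  qed
  show sm': "(\<lambda>e. (cmod (c e))\<^sup>2) summable_on B'"
    by (rule nonneg_bdd_above_summable_on) (use fin in \<open>auto intro!: bdd_aboveI[of _ N]\<close>)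
  show "(\<Sum>\<^sub>\<infinity>e\<in>B'. (cmod (c e))\<^sup>2) \<le> (\<Sum>\<^sub>\<infinity>e\<in>B. (cmod (c e))\<^sup>2)"
    by (rule infsum_le_finite_sums[OF sm']) (use fin in \<open>auto simp: N_def\<close>)
qed

lemma functional_norm_unique:
  assumes "onb B" "onb B'" "bounded_functional c" "(\<lambda>e. (cmod (c e))\<^sup>2) summable_on B"
  shows "(\<Sum>\<^sub>\<infinity>e\<in>B'. (cmod (c e))\<^sup>2) = (\<Sum>\<^sub>\<infinity>e\<in>B. (cmod (c e))\<^sup>2)"
  using functional_norm_le[OF assms(1) _ assms(3,4), of B'] functional_norm_le[OF assms(2) _ assms(3), of B] assms
  by (auto simp: onb_def intro!: antisym)

end

section \<open>The Fock space\<close>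

lemma DIM_complex_vec: "DIM(complex ^ 'n) = 2 * CARD('n)"
  by simp

lemma
  fixes f :: "'a::euclidean_space \<Rightarrow> 'b::{banach, second_countable_topology}"
  assumes [measurable]: "f \<in> borel_measurable borel"
  shows integral_lborel_translate: "(\<integral>x. f (x + c) \<partial>lborel) = (\<integral>x. f x \<partial>lborel)"
    and integrable_lborel_translate: "integrable lborel (\<lambda>x. f (x + c)) \<longleftrightarrow> integrable lborel f"
proof -
  show "(\<integral>x. f (x + c) \<partial>lborel) = (\<integral>x. f x \<partial>lborel)"
    by (subst (2) lborel_distr_plus[of c, symmetric]) (simp add: integral_distr add.commute)
  show "integrable lborel (\<lambda>x. f (x + c)) \<longleftrightarrow> integrable lborel f"
    by (subst (2) lborel_distr_plus[of c, symmetric]) (simp add: integrable_distr_eq add.commute)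
qed

definition gauss :: "real \<Rightarrow> complex ^ 'n \<Rightarrow> real" where
  "gauss m w = (m / (2 * pi)) ^ CARD('n) * exp (- m / 2 * (norm w)\<^sup>2)"

definition fock_measure :: "real \<Rightarrow> (complex ^ 'n) measure" where
  "fock_measure m = density lborel (\<lambda>w. ennreal (gauss m w))"

lemma gauss_nonneg: "m > 0 \<Longrightarrow> 0 \<le> gauss m w"
  by (simp add: gauss_def)

lemma gauss_measurable[measurable]: "gauss m \<in> borel_measurable borel"
  unfolding gauss_def by measurable

lemma sets_fock_measure[measurable_cong, simp]: "sets (fock_measure m) = sets borel"
  by (simp add: fock_measure_def)

lemma space_fock_measure[simp]: "space (fock_measure m) = UNIV"
  by (simp add: fock_measure_def)

lemma nn_integral_gauss:
  assumes m: "m > 0"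
  shows "(\<integral>\<^sup>+w. ennreal (gauss m w) \<partial>(lborel :: (complex ^ 'n) measure)) = 1"
proof -
  have "(\<integral>\<^sup>+w. ennreal (gauss m w) \<partial>(lborel :: (complex ^ 'n) measure))
      = (\<integral>\<^sup>+w. ennreal ((m / (2 * pi)) ^ CARD('n)) * ennreal (exp (- (m / 2) * (norm w)\<^sup>2)) \<partial>(lborel :: (complex ^ 'n) measure))"
    using m by (intro nn_integral_cong) (simp add: gauss_def flip: ennreal_mult)
  also have "\<dots> = ennreal ((m / (2 * pi)) ^ CARD('n)) * ennreal ((pi / (m / 2)) ^ CARD('n))"
    using m by (subst nn_integral_cmult) (simp_all only: nn_integral_Gauss[OF _ DIM_complex_vec] half_gt_zero, measurable)
  also have "\<dots> = ennreal ((m / (2 * pi)) ^ CARD('n) * (pi / (m / 2)) ^ CARD('n))"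
    using m by (intro ennreal_mult[symmetric]) auto
  also have "(m / (2 * pi)) ^ CARD('n) * (pi / (m / 2)) ^ CARD('n) = 1"
    unfolding power_mult_distrib[symmetric] using m by simp
  finally show ?thesis by simp
qed

lemma prob_space_fock_measure: "m > 0 \<Longrightarrow> prob_space (fock_measure m)"
  by standard (simp add: fock_measure_def emeasure_density nn_integral_gauss)

lemma integral_fock_measure:
  fixes f :: "complex ^ 'n \<Rightarrow> 'b::{banach, second_countable_topology}"
  assumes "m > 0" and [measurable]: "f \<in> borel_measurable borel"
  shows "(\<integral>w. f w \<partial>fock_measure m) = (\<integral>w. gauss m w *\<^sub>R f w \<partial>lborel)"
  unfolding fock_measure_def by (rule integral_density) (auto simp: gauss_nonneg assms(1))

lemma integrable_fock_measure:
  fixes f :: "complex ^ 'n \<Rightarrow> 'b::{banach, second_countable_topology}"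
  assumes "m > 0" and [measurable]: "f \<in> borel_measurable borel"
  shows "integrable (fock_measure m) f \<longleftrightarrow> integrable lborel (\<lambda>w. gauss m w *\<^sub>R f w)"
  unfolding fock_measure_def by (rule integrable_density) (auto simp: gauss_nonneg assms(1))

lemma gauss_rot: "cmod c = 1 \<Longrightarrow> gauss m (c *s v) = gauss m v"
  by (simp add: gauss_def norm_vector_scalar_mult)

definition fock_set :: "real \<Rightarrow> (complex ^ 'n \<Rightarrow> complex) set" where
  "fock_set m = {G. entire G \<and> G \<in> sq_integrable (fock_measure m)}"

lemma entire_measurable: "entire G \<Longrightarrow> G \<in> borel_measurable borel"
  unfolding entire_iff_hol_on by (intro borel_measurable_continuous_onI vec.hol_on_continuous)

lemma fock_set_measurable: "G \<in> fock_set m \<Longrightarrow> G \<in> borel_measurable borel"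
  by (auto simp: fock_set_def entire_measurable)

lemma fock_space_eq_fock_set:
  assumes "l \<noteq> 0" shows "fock_space l = fock_set \<bar>l\<bar>"
proof -
  have "integrable lborel (\<lambda>w. (norm (G w))\<^sup>2 * exp (- \<bar>l\<bar> / 2 * (norm w)\<^sup>2)) \<longleftrightarrow> G \<in> sq_integrable (fock_measure \<bar>l\<bar>)"
    if "entire G" for G :: "complex ^ 'n \<Rightarrow> complex"
  proof -
    note [measurable] = entire_measurable[OF that]
    have "G \<in> sq_integrable (fock_measure \<bar>l\<bar>)
        \<longleftrightarrow> integrable lborel (\<lambda>w. (\<bar>l\<bar> / (2 * pi)) ^ CARD('n) * ((norm (G w))\<^sup>2 * exp (- \<bar>l\<bar> / 2 * (norm w)\<^sup>2)))"
      using assms by (simp add: sq_integrable_def integrable_fock_measure gauss_def mult_ac)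
    also have "\<dots> \<longleftrightarrow> integrable lborel (\<lambda>w. (norm (G w))\<^sup>2 * exp (- \<bar>l\<bar> / 2 * (norm w)\<^sup>2))"
      using assms by (intro integrable_mult_left_iff[THEN trans]) simp_all
    finally show ?thesis by simp
  qed
  then show ?thesis by (auto simp: fock_space_def fock_set_def)
qed

definition finner :: "real \<Rightarrow> (complex ^ 'n \<Rightarrow> complex) \<Rightarrow> (complex ^ 'n \<Rightarrow> complex) \<Rightarrow> complex" where
  "finner m G H = (\<integral>w. G w * cnj (H w) \<partial>fock_measure m)"

lemma fock_inner_eq:
  fixes G H :: "complex ^ 'n \<Rightarrow> complex"
  assumes "l \<noteq> 0" "G \<in> borel_measurable borel" "H \<in> borel_measurable borel"
  shows "fock_inner l G H = finner \<bar>l\<bar> G H"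
proof -
  note [measurable] = assms(2,3)
  have "finner \<bar>l\<bar> G H = (\<integral>w. of_real ((\<bar>l\<bar> / (2 * pi)) ^ CARD('n)) * (G w * cnj (H w) * of_real (exp (- \<bar>l\<bar> / 2 * (norm w)\<^sup>2))) \<partial>lborel)"
    using assms(1) unfolding finner_def
    by (subst integral_fock_measure) (simp_all add: gauss_def scaleR_conv_of_real mult_ac)
  then show ?thesis unfolding fock_inner_def by (simp only: integral_mult_right_zero)
qed

lemma fock_norm_eq:
  fixes G :: "complex ^ 'n \<Rightarrow> complex"
  assumes "l \<noteq> 0" "G \<in> borel_measurable borel"
  shows "fock_norm l G = sqrt (sq_norm (fock_measure \<bar>l\<bar>) G)"
proof -
  note [measurable] = assms(2)
  have "sq_norm (fock_measure \<bar>l\<bar>) G = (\<integral>w. (\<bar>l\<bar> / (2 * pi)) ^ CARD('n) * ((norm (G w))\<^sup>2 * exp (- \<bar>l\<bar> / 2 * (norm w)\<^sup>2)) \<partial>lborel)"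
    using assms(1) unfolding sq_norm_def
    by (subst integral_fock_measure) (simp_all add: gauss_def mult_ac)
  then show ?thesis unfolding fock_norm_def by (simp only: integral_mult_right_zero)
qed

lemma fock_mean:
  fixes G :: "complex ^ 'n \<Rightarrow> complex"
  assumes m: "m > 0" and G: "G \<in> fock_set m"
  shows "(\<integral>w. G w \<partial>fock_measure m) = G 0"
proof -
  note [measurable] = fock_set_measurable[OF G]
  interpret prob_space "fock_measure m :: (complex ^ 'n) measure" by (rule prob_space_fock_measure[OF m])
  have hol: "vec.hol_on UNIV G" and G2: "G \<in> sq_integrable (fock_measure m)"
    using G by (auto simp: fock_set_def entire_iff_hol_on)
  have "(\<lambda>_ :: complex ^ 'n. 1) \<in> sq_integrable (fock_measure m)"
    using integrable_const[of "1::real"] by (simp add: sq_integrable_def)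
  from sq_integrable_product(1)[OF G2 this] have "integrable (fock_measure m) G" by simp
  then have i1: "integrable lborel (\<lambda>w. gauss m w *\<^sub>R G w)" using m by (simp add: integrable_fock_measure)
  have i2: "integrable lborel (gauss m :: complex ^ 'n \<Rightarrow> real)"
    using integrable_fock_measure[OF m, of "\<lambda>_ :: complex ^ 'n. 1::real"] integrable_const[of "1::real"] by simp
  have mean: "(\<integral>w. gauss m w *\<^sub>R G w \<partial>lborel) = (\<integral>w. gauss m w \<partial>(lborel :: (complex ^ 'n) measure)) *\<^sub>R G 0"
  proof (rule vec.rotation_mean[OF _ _ gauss_rot])
    show "(LINT t:{0..1}|lborel. G (vec.rot t *s w)) = G 0" for w
      by (rule vec.circle_mean[OF hol]) auto
  qed (simp_all add: i1 i2)
  have "(\<integral>w. gauss m w \<partial>(lborel :: (complex ^ 'n) measure)) = (\<integral>w. 1 \<partial>(fock_measure m :: (complex ^ 'n) measure))"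
    using m by (subst integral_fock_measure) auto
  also have "\<dots> = 1" using prob_space by simp
  finally show ?thesis using m mean by (simp add: integral_fock_measure)
qed

lemma cdot_simps:
  "cdot (a + b) c = cdot a c + cdot b c" "cdot (- a) c = - cdot a c"
  "cdot a (vcnj (- c)) = - cdot a (vcnj c)" "cdot (s *s a) c = s * cdot a c" "cdot 0 c = 0"
  by (simp_all add: cdot_def vcnj_def algebra_simps sum.distrib sum_negf sum_distrib_left)

lemma Re_cdot: "Re (cdot w (vcnj z)) = w \<bullet> z"
  by (simp add: cdot_def vcnj_def inner_vec_def inner_complex_def)

lemma cnj_cdot: "cnj (cdot w (vcnj z)) = cdot z (vcnj w)"
  by (simp add: cdot_def vcnj_def mult.commute)

lemma cdot_self: "cdot z (vcnj z) = of_real ((norm z)\<^sup>2)"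
  by (simp add: complex_eq_iff Re_cdot power2_norm_eq_inner) (simp add: cdot_def vcnj_def)

lemma bounded_linear_cdot: "bounded_linear (\<lambda>w. cdot w c)"
  unfolding linear_conv_bounded_linear[symmetric]
  by (rule linearI) (simp_all add: cdot_def algebra_simps sum.distrib scaleR_sum_right)

lemma entire_cdot: "vec.hol_on S (\<lambda>w. cdot w c)"
  by (rule vec.hol_on_linear[OF bounded_linear_cdot]) (rule cdot_simps)

lemma cdot_measurable[measurable]: "(\<lambda>w. cdot w c) \<in> borel_measurable borel"
  by (intro borel_measurable_continuous_onI linear_continuous_on bounded_linear_cdot)

text \<open>
  Weyl translations are the unitary operators of the Bargmann representation, normalized to have
  no central character.  The exponential factor compensates the shift of the Gaussian weight.
\<close>

definition weyl :: "real \<Rightarrow> complex ^ 'n \<Rightarrow> (complex ^ 'n \<Rightarrow> complex) \<Rightarrow> complex ^ 'n \<Rightarrow> complex" where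
  "weyl m z G w = exp (- (of_real (m / 2) * cdot w (vcnj z)) - of_real (m / 4 * (norm z)\<^sup>2)) * G (w + z)"

definition fock_kernel :: "real \<Rightarrow> complex ^ 'n \<Rightarrow> complex ^ 'n \<Rightarrow> complex" where
  "fock_kernel m z w = exp (of_real (m / 2) * cdot w (vcnj z))"

lemma weyl_measurable[measurable]:
  assumes [measurable]: "G \<in> borel_measurable borel" shows "weyl m z G \<in> borel_measurable borel"
  unfolding weyl_def by measurable

lemma weyl_weyl: "weyl m z (weyl m (- z) G) = G"
proof
  fix w
  define A B where "A = - (of_real (m / 2) * cdot w (vcnj z)) - complex_of_real (m / 4 * (norm z)\<^sup>2)"
    and "B = - (of_real (m / 2) * cdot (w + z) (vcnj (- z))) - complex_of_real (m / 4 * (norm (- z))\<^sup>2)"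
  have "cdot (w + z) (vcnj (- z)) = - cdot w (vcnj z) - of_real ((norm z)\<^sup>2)"
    by (simp add: cdot_simps cdot_self)
  then have "A + B = 0" unfolding A_def B_def by (simp only:) (simp add: algebra_simps)
  then have AB: "exp A * exp B = 1" by (metis exp_add exp_zero)
  have "weyl m z (weyl m (- z) G) w = exp A * (exp B * G (w + z + - z))"
    by (simp only: weyl_def A_def B_def)
  also have "\<dots> = (exp A * exp B) * G w" by simp
  finally show "weyl m z (weyl m (- z) G) w = G w" by (simp add: AB)
qed

lemma norm_add_sq: "(norm (w + z))\<^sup>2 = (norm w)\<^sup>2 + 2 * (w \<bullet> z) + (norm (z :: 'a::real_inner))\<^sup>2"
  by (simp add: power2_norm_eq_inner inner_add_left inner_add_right inner_commute)

lemma weyl_inner_pointwise: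
  "gauss m w *\<^sub>R (weyl m z G w * cnj (H w)) = gauss m (w + z) *\<^sub>R (G (w + z) * cnj (weyl m (- z) H (w + z)))"
proof -
  let ?c = "cdot w (vcnj z)"
  have cc: "cnj ?c + ?c = of_real (2 * (w \<bullet> z))" by (simp add: complex_eq_iff Re_cdot)
  have eq: "complex_of_real (- m / 2 * (norm w)\<^sup>2) + (- (of_real (m / 2) * ?c) - of_real (m / 4 * (norm z)\<^sup>2))
    = of_real (- m / 2 * (norm (w + z))\<^sup>2)
      + cnj (- (of_real (m / 2) * cdot (w + z) (vcnj (- z))) - of_real (m / 4 * (norm (- z))\<^sup>2))"
  proof -
    have "cnj (cdot (w + z) (vcnj (- z))) = - cnj ?c - of_real ((norm z)\<^sup>2)"
      by (simp add: cdot_simps cdot_self)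
    moreover have "complex_of_real ((norm (w + z))\<^sup>2) = of_real ((norm w)\<^sup>2) + (cnj ?c + ?c) + of_real ((norm z)\<^sup>2)"
      unfolding cc by (simp add: norm_add_sq)
    moreover have "cnj (- (of_real (m / 2) * cdot (w + z) (vcnj (- z))) - of_real (m / 4 * (norm (- z))\<^sup>2))
        = - (of_real (m / 2) * cnj (cdot (w + z) (vcnj (- z)))) - of_real (m / 4 * (norm z)\<^sup>2)"
      by simp
    ultimately show ?thesis
      by (simp only: of_real_mult[of "- m / 2"]) (simp add: algebra_simps)
  qed
  have "complex_of_real (exp (- m / 2 * (norm w)\<^sup>2)) * exp (- (of_real (m / 2) * ?c) - of_real (m / 4 * (norm z)\<^sup>2))
    = of_real (exp (- m / 2 * (norm (w + z))\<^sup>2))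
      * cnj (exp (- (of_real (m / 2) * cdot (w + z) (vcnj (- z))) - of_real (m / 4 * (norm (- z))\<^sup>2)))"
    unfolding exp_of_real[symmetric] exp_cnj exp_add[symmetric] by (rule arg_cong[OF eq])
  then show ?thesis
    by (simp add: weyl_def gauss_def scaleR_conv_of_real)
qed

lemma weyl_adjoint:
  assumes m: "m > 0" and [measurable]: "G \<in> borel_measurable borel" "H \<in> borel_measurable borel"
  shows "finner m (weyl m z G) H = finner m G (weyl m (- z) H)"
proof -
  have "finner m (weyl m z G) H = (\<integral>w. gauss m (w + z) *\<^sub>R (G (w + z) * cnj (weyl m (- z) H (w + z))) \<partial>lborel)"
    unfolding finner_def using m by (subst integral_fock_measure) (simp_all add: weyl_inner_pointwise)
  also have "\<dots> = (\<integral>w. gauss m w *\<^sub>R (G w * cnj (weyl m (- z) H w)) \<partial>lborel)"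
    by (rule integral_lborel_translate) measurable
  also have "\<dots> = finner m G (weyl m (- z) H)"
    unfolding finner_def using m by (subst integral_fock_measure) simp_all
  finally show ?thesis .
qed

lemma weyl_sq_integrable:
  assumes m: "m > 0" and G: "G \<in> sq_integrable (fock_measure m)"
  shows "weyl m z G \<in> sq_integrable (fock_measure m)"
proof -
  have [measurable]: "G \<in> borel_measurable borel" using G by (auto simp: sq_integrable_def)
  have eq: "gauss m w *\<^sub>R (cmod (weyl m z G w))\<^sup>2 = gauss m (w + z) *\<^sub>R (cmod (G (w + z)))\<^sup>2" for w
  proof -
    have "weyl m (- z) (weyl m z G) = G" using weyl_weyl[of m "- z" G] by simp
    then have "complex_of_real (gauss m w *\<^sub>R (cmod (weyl m z G w))\<^sup>2) = of_real (gauss m (w + z) *\<^sub>R (cmod (G (w + z)))\<^sup>2)"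
      using weyl_inner_pointwise[of m w z G "weyl m z G"]
      by (simp add: complex_mult_cnj_cmod scaleR_conv_of_real)
    then show ?thesis using of_real_eq_iff by blast
  qed
  have "integrable lborel (\<lambda>w. gauss m w *\<^sub>R (cmod (G w))\<^sup>2)"
    using G m by (simp add: sq_integrable_def integrable_fock_measure)
  then have "integrable lborel (\<lambda>w. gauss m (w + z) *\<^sub>R (cmod (G (w + z)))\<^sup>2)"
    by (subst integrable_lborel_translate[of "\<lambda>w. gauss m w *\<^sub>R (cmod (G w))\<^sup>2"]) simp_all
  then have "integrable lborel (\<lambda>w. gauss m w *\<^sub>R (cmod (weyl m z G w))\<^sup>2)" by (simp only: eq)
  then show ?thesis using m by (simp add: sq_integrable_def integrable_fock_measure)
qed

lemma weyl_fock_set: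
  assumes m: "m > 0" and G: "G \<in> fock_set m" shows "weyl m z G \<in> fock_set m"
proof -
  have "vec.hol_on UNIV (weyl m z G)"
  proof -
    have "vec.hol_on UNIV (\<lambda>w. - of_real (m / 2) * cdot w (vcnj z) + - of_real (m / 4 * (norm z)\<^sup>2))"
      by (intro vec.hol_on_add vec.hol_on_mult vec.hol_on_const entire_cdot)
    moreover have "vec.hol_on UNIV (\<lambda>w. G (w + z))"
      using G by (intro vec.hol_on_translate) (auto simp: fock_set_def entire_iff_hol_on intro: vec.hol_on_subset)
    ultimately have "vec.hol_on UNIV (\<lambda>w. exp (- of_real (m / 2) * cdot w (vcnj z) + - of_real (m / 4 * (norm z)\<^sup>2)) * G (w + z))"
      by (intro vec.hol_on_mult vec.hol_on_exp)
    then show ?thesis by (simp add: weyl_def[abs_def])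
  qed
  then show ?thesis using G weyl_sq_integrable[OF m, of G z] by (simp add: fock_set_def entire_iff_hol_on)
qed

lemma one_fock_set: "m > 0 \<Longrightarrow> (\<lambda>_. 1) \<in> fock_set m"
proof -
  assume "m > 0"
  interpret prob_space "fock_measure m :: (complex ^ 'a) measure" by (rule prob_space_fock_measure) fact
  show ?thesis by (simp add: fock_set_def entire_iff_hol_on vec.hol_on_const sq_integrable_def)
qed

lemma fock_set_cmult: "G \<in> fock_set m \<Longrightarrow> (\<lambda>w. c * G w) \<in> fock_set m"
  by (auto simp: fock_set_def entire_iff_hol_on intro: vec.hol_on_mult vec.hol_on_const sq_integrable_cmult)

lemma fock_set_add: "G \<in> fock_set m \<Longrightarrow> H \<in> fock_set m \<Longrightarrow> (\<lambda>w. G w + H w) \<in> fock_set m"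
  by (auto simp: fock_set_def entire_iff_hol_on intro: vec.hol_on_add sq_integrable_add)

lemma fock_kernel_weyl: "fock_kernel m z w = exp (of_real (m / 4 * (norm z)\<^sup>2)) * weyl m (- z) (\<lambda>_. 1) w"
  by (simp add: fock_kernel_def weyl_def cdot_simps flip: exp_add)

lemma fock_kernel_fock_set: "m > 0 \<Longrightarrow> fock_kernel m z \<in> fock_set m"
  unfolding fock_kernel_weyl[abs_def] by (intro fock_set_cmult weyl_fock_set one_fock_set)

lemma fock_reproducing:
  assumes m: "m > 0" and G: "G \<in> fock_set m"
  shows "finner m G (fock_kernel m z) = G z"
proof -
  note [measurable] = fock_set_measurable[OF G]
  have "finner m (weyl m z G) (\<lambda>_. 1) = weyl m z G 0"
    using fock_mean[OF m weyl_fock_set[OF m G]] by (simp add: finner_def)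
  then have "finner m G (weyl m (- z) (\<lambda>_. 1)) = exp (- of_real (m / 4 * (norm z)\<^sup>2)) * G z"
    by (subst (asm) weyl_adjoint[OF m]) (simp_all add: weyl_def cdot_simps)
  moreover have "finner m G (fock_kernel m z) = exp (of_real (m / 4 * (norm z)\<^sup>2)) * finner m G (weyl m (- z) (\<lambda>_. 1))"
    unfolding finner_def fock_kernel_weyl[abs_def] integral_mult_right_zero[symmetric]
    by (intro Bochner_Integration.integral_cong refl) (simp add: exp_cnj)
  ultimately show ?thesis by (simp add: mult.assoc[symmetric] flip: exp_add)
qed

definition fock_basis :: "real \<Rightarrow> ('n \<Rightarrow> nat) \<Rightarrow> complex ^ 'n \<Rightarrow> complex" where
  "fock_basis m \<alpha> x = of_real (sqrt (\<Prod>j\<in>UNIV. (m / 2) ^ \<alpha> j / fact (\<alpha> j))) * monomial \<alpha> x"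

lemma fock_basis_product:
  assumes "m > 0"
  shows "fock_basis m \<alpha> x * cnj (fock_basis m \<alpha> y)
    = (\<Prod>j\<in>UNIV. (of_real (m / 2) * x $ j * cnj (y $ j)) ^ \<alpha> j / fact (\<alpha> j))"
proof -
  let ?P = "\<Prod>j\<in>UNIV. (m / 2) ^ \<alpha> j / fact (\<alpha> j)"
  have "?P \<ge> 0" using assms by (intro prod_nonneg) auto
  then have "complex_of_real (sqrt ?P) * of_real (sqrt ?P) = of_real ?P"
    by (simp only: of_real_mult[symmetric] real_sqrt_mult_self abs_of_nonneg)
  then have "fock_basis m \<alpha> x * cnj (fock_basis m \<alpha> y) = of_real ?P * (monomial \<alpha> x * cnj (monomial \<alpha> y))"
    by (simp add: fock_basis_def mult_ac)
  also have "\<dots> = (\<Prod>j\<in>UNIV. of_real ((m / 2) ^ \<alpha> j / fact (\<alpha> j)) * (x $ j ^ \<alpha> j * cnj (y $ j ^ \<alpha> j)))"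
    unfolding monomial_def of_real_prod cnj_prod by (simp only: prod.distrib)
  also have "\<dots> = (\<Prod>j\<in>UNIV. (of_real (m / 2) * x $ j * cnj (y $ j)) ^ \<alpha> j / fact (\<alpha> j))"
    by (intro prod.cong refl) (simp add: power_mult_distrib field_simps)
  finally show ?thesis .
qed

text \<open>The multinomial expansion of the exponential, as a product of one-variable exponential series.\<close>

lemma
  fixes x y :: "complex ^ 'n"
  assumes m: "m > 0"
  shows fock_basis_summable: "integrable (count_space UNIV) (\<lambda>\<alpha>. fock_basis m \<alpha> x * cnj (fock_basis m \<alpha> y))"
    and fock_basis_sum: "(\<integral>\<alpha>. fock_basis m \<alpha> x * cnj (fock_basis m \<alpha> y) \<partial>count_space UNIV) = fock_kernel m y x"
proof -
  define f where "f j k = (of_real (m / 2) * x $ j * cnj (y $ j)) ^ k / fact k" for j :: 'n and k :: nat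
  have exp_term: "u ^ k / fact k = u ^ k /\<^sub>R fact k" for u :: complex and k
    by (simp add: scaleR_conv_of_real field_simps)
  have f: "Infinite_Set_Sum.abs_summable_on (f j) UNIV" for j
    unfolding abs_summable_on_nat_iff' f_def exp_term by (rule summable_norm_exp)
  have fs: "infsetsum (f j) UNIV = exp (of_real (m / 2) * x $ j * cnj (y $ j))" for j
    unfolding infsetsum_nat'[OF f] unfolding f_def exp_term by (simp only: exp_def)
  have U: "PiE UNIV (\<lambda>_ :: 'n. UNIV :: nat set) = UNIV" by auto
  have "Infinite_Set_Sum.abs_summable_on (\<lambda>g. \<Prod>j\<in>UNIV. f j (g j)) (PiE UNIV (\<lambda>_ :: 'n. UNIV))"
    by (rule abs_summable_on_prod_PiE) (auto intro: f)
  then show "integrable (count_space UNIV) (\<lambda>\<alpha>. fock_basis m \<alpha> x * cnj (fock_basis m \<alpha> y))"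
    by (simp add: U abs_summable_on_def fock_basis_product[OF m] f_def)
  have "infsetsum (\<lambda>g. \<Prod>j\<in>UNIV. f j (g j)) (PiE UNIV (\<lambda>_ :: 'n. UNIV)) = (\<Prod>j\<in>UNIV. infsetsum (f j) UNIV)"
    by (rule infsetsum_prod_PiE) (auto intro: f)
  also have "\<dots> = exp (\<Sum>j\<in>UNIV. of_real (m / 2) * x $ j * cnj (y $ j))"
    by (simp add: fs exp_sum)
  also have "\<dots> = fock_kernel m y x"
    by (simp add: fock_kernel_def cdot_def vcnj_def sum_distrib_left mult.assoc)
  finally show "(\<integral>\<alpha>. fock_basis m \<alpha> x * cnj (fock_basis m \<alpha> y) \<partial>count_space UNIV) = fock_kernel m y x"
    by (simp add: U infsetsum_def fock_basis_product[OF m] f_def)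
qed

lemma entire_monomial: "vec.hol_on UNIV (monomial \<alpha>)"
proof -
  have "vec.hol_on UNIV (\<lambda>w. w $ j)" for j :: 'a
    by (rule vec.hol_on_linear[OF bounded_linear_vec_nth]) simp
  then show ?thesis unfolding monomial_def[abs_def] by (intro vec.hol_on_prod vec.hol_on_power)
qed

lemma entire_fock_basis: "vec.hol_on UNIV (fock_basis m \<alpha>)"
  unfolding fock_basis_def[abs_def] by (intro vec.hol_on_mult vec.hol_on_const entire_monomial)

lemma fock_basis_measurable[measurable]: "fock_basis m \<alpha> \<in> borel_measurable borel"
  by (rule entire_measurable) (simp add: entire_iff_hol_on entire_fock_basis)

lemma fock_basis_sq_integrable:
  assumes "m > 0" shows "(\<lambda>\<alpha>. fock_basis m \<alpha> x) \<in> sq_integrable (count_space UNIV)"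
proof -
  have "integrable (count_space UNIV) (\<lambda>\<alpha>. complex_of_real ((cmod (fock_basis m \<alpha> x))\<^sup>2))"
    using fock_basis_summable[OF assms, of x x] by (simp only: complex_mult_cnj_cmod)
  then show ?thesis unfolding complex_of_real_integrable_eq by (simp add: sq_integrable_def)
qed

lemma fock_feature_map:
  assumes m: "m > 0"
  shows "feature_map (fock_measure m :: (complex ^ 'n) measure) (count_space UNIV) (\<lambda>x \<alpha>. cnj (fock_basis m \<alpha> x))"
proof -
  interpret M: prob_space "fock_measure m :: (complex ^ 'n) measure" by (rule prob_space_fock_measure[OF m])
  interpret N: sigma_finite_measure "count_space (UNIV :: ('n \<Rightarrow> nat) set)"
    by (rule sigma_finite_measure_count_space_countable) simp
  show ?thesis
  proof
    have "(\<lambda>(\<alpha>, x). cnj (fock_basis m \<alpha> x)) \<in> borel_measurable (count_space (UNIV :: ('n \<Rightarrow> nat) set) \<Otimes>\<^sub>M fock_measure m)"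
      by (rule measurable_pair_measure_countable1) auto
    from measurable_compose[OF measurable_pair_swap' this]
    show "(\<lambda>(x, b). cnj (fock_basis m b x)) \<in> borel_measurable (fock_measure m \<Otimes>\<^sub>M count_space (UNIV :: ('n \<Rightarrow> nat) set))"
      by (simp add: split_beta')
    show "(\<lambda>\<alpha>. cnj (fock_basis m \<alpha> x)) \<in> sq_integrable (count_space UNIV)" for x :: "complex ^ 'n"
      by (intro sq_integrable_cnj fock_basis_sq_integrable m)
  qed
qed

lemma fock_ker:
  assumes m: "m > 0"
  shows "feature_map.ker (count_space UNIV) (\<lambda>x \<alpha>. cnj (fock_basis m \<alpha> x)) x y = fock_kernel m y x"
  unfolding feature_map.ker_def[OF fock_feature_map[OF m]]
  using fock_basis_sum[OF m, of x y] by (simp add: mult.commute)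

lemma cnj_fock_kernel: "cnj (fock_kernel m x y) = fock_kernel m y x"
  by (simp add: fock_kernel_def exp_cnj cnj_cdot)

lemma fock_set_reproduced:
  assumes m: "m > 0" and G: "G \<in> fock_set m"
  shows "G \<in> feature_map.reproduced (fock_measure m) (count_space UNIV) (\<lambda>x \<alpha>. cnj (fock_basis m \<alpha> x))"
  using fock_reproducing[OF m G] G
  by (simp add: feature_map.reproduced_def[OF fock_feature_map[OF m]] fock_ker[OF m] finner_def
      cnj_fock_kernel fock_set_def)

lemma fock_reproducing_feature_map:
  assumes m: "m > 0"
  shows "reproducing_feature_map (fock_measure m :: (complex ^ 'n) measure) (count_space UNIV) (\<lambda>x \<alpha>. cnj (fock_basis m \<alpha> x))"
  by (intro reproducing_feature_map.intro fock_feature_map m reproducing_feature_map_axioms.intro)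
     (simp add: fock_ker[OF m] fock_set_reproduced[OF m] fock_kernel_fock_set[OF m])

text \<open>The function with Taylor coefficients \<open>a\<close> relative to the normalized monomials.\<close>

definition fock_series :: "real \<Rightarrow> (('n \<Rightarrow> nat) \<Rightarrow> complex) \<Rightarrow> complex ^ 'n \<Rightarrow> complex" where
  "fock_series m a x = (\<integral>\<alpha>. a \<alpha> * fock_basis m \<alpha> x \<partial>count_space UNIV)"

lemma fock_synthesis:
  "m > 0 \<Longrightarrow> feature_map.synthesis (count_space UNIV) (\<lambda>x \<alpha>. cnj (fock_basis m \<alpha> x)) = fock_series m"
  by (intro ext) (simp add: feature_map.synthesis_def[OF fock_feature_map] fock_series_def)

lemma fock_series_contraction:
  assumes "m > 0" "a \<in> sq_integrable (count_space UNIV)"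
  shows "fock_series m a \<in> sq_integrable (fock_measure m)"
    "sq_norm (fock_measure m) (fock_series m a) \<le> sq_norm (count_space UNIV) a"
  using reproducing_feature_map.synthesis_contraction[OF fock_reproducing_feature_map assms(2)] assms(1)
  by (simp_all add: fock_synthesis)

lemma fock_series_finite:
  assumes "finite S"
  shows "fock_series m (\<lambda>\<alpha>. if \<alpha> \<in> S then a \<alpha> else 0) x = (\<Sum>\<alpha>\<in>S. a \<alpha> * fock_basis m \<alpha> x)"
proof -
  have "fock_series m (\<lambda>\<alpha>. if \<alpha> \<in> S then a \<alpha> else 0) x
      = (\<integral>\<alpha>. indicator S \<alpha> *\<^sub>R (a \<alpha> * fock_basis m \<alpha> x) \<partial>count_space UNIV)"
    unfolding fock_series_def by (intro Bochner_Integration.integral_cong) auto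
  also have "\<dots> = infsetsum (\<lambda>\<alpha>. a \<alpha> * fock_basis m \<alpha> x) S"
    by (simp add: infsetsum_altdef set_lebesgue_integral_def)
  finally show ?thesis using assms by simp
qed

lemma fock_basis_fock_set:
  assumes m: "m > 0" shows "fock_basis m \<alpha> \<in> fock_set m"
proof -
  have "(\<lambda>\<beta>. if \<beta> \<in> {\<alpha>} then 1 else 0) \<in> sq_integrable (count_space UNIV)"
  proof -
    have "(\<lambda>\<beta>. (cmod (if \<beta> \<in> {\<alpha>} then 1 else 0))\<^sup>2) = indicator {\<alpha>}" by (auto simp: indicator_def)
    then show ?thesis by (simp add: sq_integrable_def integrable_indicator_iff)
  qed
  moreover have "fock_series m (\<lambda>\<beta>. if \<beta> \<in> {\<alpha>} then 1 else 0) = fock_basis m \<alpha>"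
    using fock_series_finite[of "{\<alpha>}" m "\<lambda>_. 1"] by (intro ext) simp
  ultimately have "fock_basis m \<alpha> \<in> sq_integrable (fock_measure m)"
    using fock_series_contraction(1)[OF m] by metis
  then show ?thesis by (simp add: fock_set_def entire_iff_hol_on entire_fock_basis)
qed

text \<open>
  Rotating one coordinate multiplies the inner product of two monomials by a phase, which is not
  trivial when the exponents of that coordinate differ.
\<close>

lemma fock_basis_orthogonal:
  fixes \<alpha> \<beta> :: "'n::finite \<Rightarrow> nat"
  assumes m: "m > 0" and ne: "\<alpha> \<noteq> \<beta>"
  shows "finner m (fock_basis m \<alpha>) (fock_basis m \<beta>) = 0"
proof -
  obtain j where j: "\<alpha> j \<noteq> \<beta> j" using ne by blast
  define \<theta> where "\<theta> = pi / (real (\<alpha> j) - real (\<beta> j))"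
  have \<theta>: "real (\<alpha> j) * \<theta> - real (\<beta> j) * \<theta> = pi" using j by (simp add: \<theta>_def flip: diff_divide_distrib left_diff_distrib)
  define T where "T w = (\<chi> i. (if i = j then cis \<theta> else 1) * w $ i)" for w :: "complex ^ 'n"
  have linT: "linear T" by (rule linearI) (simp_all add: T_def vec_eq_iff algebra_simps)
  have "norm (T w $ i) = norm (w $ i)" for w i by (simp add: T_def norm_mult)
  then have normT: "norm (T w) = norm w" for w by (simp add: norm_vec_def)
  have monT: "fock_basis m \<gamma> (T w) = cis \<theta> ^ \<gamma> j * fock_basis m \<gamma> w" for \<gamma> w
  proof -
    have "monomial \<gamma> (T w) = (\<Prod>i\<in>UNIV. (if i = j then cis \<theta> ^ \<gamma> j else 1) * w $ i ^ \<gamma> i)"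
      unfolding monomial_def T_def by (intro prod.cong refl) (simp add: power_mult_distrib)
    then show ?thesis by (simp add: fock_basis_def prod.distrib monomial_def)
  qed
  have ph: "cis \<theta> ^ \<alpha> j * cnj (cis \<theta> ^ \<beta> j) = -1"
    using \<theta> by (simp add: Complex.DeMoivre cis_cnj cis_mult flip: cis_pi)
  have eq: "finner m (fock_basis m \<alpha>) (fock_basis m \<beta>)
      = (\<integral>w. gauss m w *\<^sub>R (fock_basis m \<alpha> w * cnj (fock_basis m \<beta> w)) \<partial>lborel)"
    unfolding finner_def by (rule integral_fock_measure[OF m]) measurable
  also have "\<dots> = (\<integral>w. gauss m (T w) *\<^sub>R (fock_basis m \<alpha> (T w) * cnj (fock_basis m \<beta> (T w))) \<partial>lborel)"
    by (rule integral_lborel_isometry[OF linT normT, symmetric]) measurable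
  also have "\<dots> = (\<integral>w. (-1) * (gauss m w *\<^sub>R (fock_basis m \<alpha> w * cnj (fock_basis m \<beta> w))) \<partial>lborel)"
  proof (intro Bochner_Integration.integral_cong refl)
    fix w
    have "gauss m (T w) = gauss m w" by (simp add: gauss_def normT)
    moreover have "fock_basis m \<alpha> (T w) * cnj (fock_basis m \<beta> (T w))
        = (cis \<theta> ^ \<alpha> j * cnj (cis \<theta> ^ \<beta> j)) * (fock_basis m \<alpha> w * cnj (fock_basis m \<beta> w))"
      by (simp add: monT)
    ultimately show "gauss m (T w) *\<^sub>R (fock_basis m \<alpha> (T w) * cnj (fock_basis m \<beta> (T w)))
       = (-1) * (gauss m w *\<^sub>R (fock_basis m \<alpha> w * cnj (fock_basis m \<beta> w)))"
      unfolding ph by simp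
  qed
  also have "\<dots> = - finner m (fock_basis m \<alpha>) (fock_basis m \<beta>)" by (simp add: eq)
  finally show ?thesis by simp
qed

lemma sq_integrable_count_tail:
  fixes a :: "'c::countable \<Rightarrow> complex"
  assumes a: "a \<in> sq_integrable (count_space UNIV)" and \<epsilon>: "\<epsilon> > 0"
  obtains S where "finite S" "\<And>T. S \<subseteq> T \<Longrightarrow> sq_norm (count_space UNIV) (\<lambda>\<alpha>. if \<alpha> \<in> T then 0 else a \<alpha>) < \<epsilon>"
proof -
  let ?N = "count_space (UNIV :: 'c set)"
  define S where "S n = {\<alpha>::'c. to_nat \<alpha> < n}" for n
  have "finite (S n)" for n
  proof -
    have "S n = to_nat -` {..<n}" by (auto simp: S_def)
    then show ?thesis by (simp add: finite_vimageI)
  qed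
  have "(\<lambda>n. sq_norm ?N (\<lambda>\<alpha>. if \<alpha> \<in> S n then 0 else a \<alpha>)) \<longlonglongrightarrow> (\<integral>\<alpha>. 0 \<partial>?N)"
    unfolding sq_norm_def
  proof (rule integral_dominated_convergence[where w = "\<lambda>\<alpha>. (cmod (a \<alpha>))\<^sup>2"])
    show "AE \<alpha> in ?N. (\<lambda>n. (cmod (if \<alpha> \<in> S n then 0 else a \<alpha>))\<^sup>2) \<longlonglongrightarrow> 0"
    proof (rule AE_I2)
      fix \<alpha>
      have "\<forall>\<^sub>F n in sequentially. (cmod (if \<alpha> \<in> S n then 0 else a \<alpha>))\<^sup>2 = 0"
        using eventually_gt_at_top[of "to_nat \<alpha>"] by eventually_elim (simp add: S_def)
      then show "(\<lambda>n. (cmod (if \<alpha> \<in> S n then 0 else a \<alpha>))\<^sup>2) \<longlonglongrightarrow> 0" by (rule tendsto_eventually)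
    qed
  qed (use a in \<open>auto simp: sq_integrable_def\<close>)
  then have "\<forall>\<^sub>F n in sequentially. sq_norm ?N (\<lambda>\<alpha>. if \<alpha> \<in> S n then 0 else a \<alpha>) < \<epsilon>"
    by (intro order_tendstoD(2)) (use \<epsilon> in simp_all)
  then obtain n where n: "sq_norm ?N (\<lambda>\<alpha>. if \<alpha> \<in> S n then 0 else a \<alpha>) < \<epsilon>"
    by (auto simp: eventually_sequentially)
  have tail: "(\<lambda>\<alpha>. if \<alpha> \<in> T then 0 else a \<alpha>) \<in> sq_integrable ?N" for T
    by (rule sq_integrable_dominated(1)[OF a]) auto
  show thesis
  proof (rule that[of "S n"])
    fix T assume "S n \<subseteq> T"
    then have "sq_norm ?N (\<lambda>\<alpha>. if \<alpha> \<in> T then 0 else a \<alpha>) \<le> sq_norm ?N (\<lambda>\<alpha>. if \<alpha> \<in> S n then 0 else a \<alpha>)"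
      by (intro sq_integrable_dominated(2)[OF tail]) auto
    with n show "sq_norm ?N (\<lambda>\<alpha>. if \<alpha> \<in> T then 0 else a \<alpha>) < \<epsilon>" by linarith
  qed fact
qed

lemma fock_series_tail:
  assumes m: "m > 0" and a: "a \<in> sq_integrable (count_space UNIV)" and S: "finite S"
  shows "fock_series m (\<lambda>\<alpha>. if \<alpha> \<in> S then 0 else a \<alpha>) x = fock_series m a x - (\<Sum>\<alpha>\<in>S. a \<alpha> * fock_basis m \<alpha> x)"
proof -
  have s: "(\<lambda>\<alpha>. if \<alpha> \<in> S then a \<alpha> else 0) \<in> sq_integrable (count_space UNIV)"
    by (rule sq_integrable_dominated(1)[OF a]) auto
  interpret feature_map "fock_measure m" "count_space UNIV" "\<lambda>x \<alpha>. cnj (fock_basis m \<alpha> x)"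
    by (rule fock_feature_map[OF m])
  have "(\<lambda>\<alpha>. if \<alpha> \<in> S then 0 else a \<alpha>) = (\<lambda>\<alpha>. a \<alpha> - (if \<alpha> \<in> S then a \<alpha> else 0))" by auto
  then show ?thesis
    using synthesis_diff[OF a s, of x] by (simp add: fock_synthesis[OF m] fock_series_finite[OF S])
qed

lemma fock_series_coefficient:
  assumes m: "m > 0" and a: "a \<in> sq_integrable (count_space UNIV)"
  shows "finner m (fock_series m a) (fock_basis m \<beta>) = a \<beta> * finner m (fock_basis m \<beta>) (fock_basis m \<beta>)"
proof -
  let ?M = "fock_measure m" and ?e = "fock_basis m"
  have e2: "?e \<gamma> \<in> sq_integrable ?M" for \<gamma> using fock_basis_fock_set[OF m, of \<gamma>] by (simp add: fock_set_def)
  define d where "d = cmod (finner m (fock_series m a) (?e \<beta>) - a \<beta> * finner m (?e \<beta>) (?e \<beta>))"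
  have "d\<^sup>2 \<le> \<epsilon> * sq_norm ?M (?e \<beta>)" if \<epsilon>: "\<epsilon> > 0" for \<epsilon>
  proof -
    obtain S where S: "finite S" "\<And>T. S \<subseteq> T \<Longrightarrow> sq_norm (count_space UNIV) (\<lambda>\<alpha>. if \<alpha> \<in> T then 0 else a \<alpha>) < \<epsilon>"
      using sq_integrable_count_tail[OF a \<epsilon>] by blast
    define T where "T = insert \<beta> S"
    have T: "finite T" "\<beta> \<in> T" "S \<subseteq> T" using S by (auto simp: T_def)
    have t: "(\<lambda>\<alpha>. if \<alpha> \<in> T then 0 else a \<alpha>) \<in> sq_integrable (count_space UNIV)"
      by (rule sq_integrable_dominated(1)[OF a]) auto
    define R where "R = fock_series m (\<lambda>\<alpha>. if \<alpha> \<in> T then 0 else a \<alpha>)"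
    have R: "R \<in> sq_integrable ?M" "sq_norm ?M R \<le> \<epsilon>"
      using fock_series_contraction[OF m t] S(2)[OF T(3)] by (simp_all add: R_def)
    have eq: "fock_series m a x = R x + (\<Sum>\<alpha>\<in>T. a \<alpha> * ?e \<alpha> x)" for x
      unfolding R_def fock_series_tail[OF m a T(1)] by simp
    have int: "integrable ?M (\<lambda>x. ?e \<alpha> x * cnj (?e \<beta> x))" for \<alpha>
      by (rule sq_integrable_product(1)[OF e2 sq_integrable_cnj[OF e2]])
    have "finner m (fock_series m a) (?e \<beta>) = finner m R (?e \<beta>) + (\<Sum>\<alpha>\<in>T. a \<alpha> * finner m (?e \<alpha>) (?e \<beta>))"
      using int sq_integrable_product(1)[OF R(1) sq_integrable_cnj[OF e2]]
      unfolding finner_def eq by (simp add: distrib_right sum_distrib_right mult.assoc)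
    also have "(\<Sum>\<alpha>\<in>T. a \<alpha> * finner m (?e \<alpha>) (?e \<beta>)) = (\<Sum>\<alpha>\<in>T. if \<alpha> = \<beta> then a \<beta> * finner m (?e \<beta>) (?e \<beta>) else 0)"
      by (intro sum.cong refl) (simp add: fock_basis_orthogonal[OF m])
    also have "\<dots> = a \<beta> * finner m (?e \<beta>) (?e \<beta>)" using T by simp
    finally have "d\<^sup>2 = (cmod (finner m R (?e \<beta>)))\<^sup>2" by (simp add: d_def)
    also have "\<dots> \<le> sq_norm ?M R * sq_norm ?M (?e \<beta>)"
      unfolding finner_def by (rule Cauchy_Schwarz_integral_cnj[OF R(1) e2])
    also have "\<dots> \<le> \<epsilon> * sq_norm ?M (?e \<beta>)" by (intro mult_right_mono R) auto
    finally show ?thesis .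
  qed
  note bound = this
  have "d\<^sup>2 \<le> 0 + \<epsilon>" if \<epsilon>: "\<epsilon> > 0" for \<epsilon>
  proof -
    define s where "s = sq_norm ?M (?e \<beta>)"
    have s: "0 \<le> s" by (simp add: s_def)
    have "0 < \<epsilon> / (s + 1)" using s \<epsilon> by simp
    from bound[OF this] have "d\<^sup>2 \<le> \<epsilon> / (s + 1) * s" by (simp only: s_def)
    also have "\<dots> \<le> \<epsilon>" using s \<epsilon> by (simp add: field_simps)
    finally show ?thesis by simp
  qed
  then have "d\<^sup>2 \<le> 0" by (rule field_le_epsilon)
  then show ?thesis by (simp add: d_def)
qed

lemma finner_cnj: "finner m H G = cnj (finner m G H)"
  unfolding finner_def by (subst Bochner_Integration.integral_cnj[symmetric]) (simp add: mult.commute)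

lemma finner_self: "finner m G G = of_real (sq_norm (fock_measure m) G)"
  by (simp add: finner_def of_real_sq_norm)

text \<open>
  The norms of the monomials need not be computed: expanding the reproducing kernel at a point
  where \<open>w\<^sup>\<beta>\<close> does not vanish and pairing with \<open>w\<^sup>\<beta>\<close> shows that the normalization is right.
\<close>

lemma fock_basis_norm:
  fixes \<beta> :: "'n::finite \<Rightarrow> nat"
  assumes m: "m > 0" shows "finner m (fock_basis m \<beta>) (fock_basis m \<beta>) = 1"
proof -
  define x :: "complex ^ 'n" where "x = (\<chi> j. 1)"
  have P: "(\<Prod>j\<in>UNIV. (m / 2) ^ \<beta> j / fact (\<beta> j)) > 0" using m by (intro prod_pos) auto
  have ne: "fock_basis m \<beta> x \<noteq> 0" using P m by (simp add: fock_basis_def monomial_def x_def)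
  have a: "(\<lambda>\<alpha>. cnj (fock_basis m \<alpha> x)) \<in> sq_integrable (count_space UNIV)"
    by (intro sq_integrable_cnj fock_basis_sq_integrable m)
  have "fock_series m (\<lambda>\<alpha>. cnj (fock_basis m \<alpha> x)) = fock_kernel m x"
    using fock_basis_sum[OF m, of _ x] by (intro ext) (simp add: fock_series_def mult.commute)
  with fock_series_coefficient[OF m a, of \<beta>]
  have "finner m (fock_kernel m x) (fock_basis m \<beta>) = cnj (fock_basis m \<beta> x) * finner m (fock_basis m \<beta>) (fock_basis m \<beta>)"
    by simp
  moreover have "finner m (fock_kernel m x) (fock_basis m \<beta>) = cnj (fock_basis m \<beta> x)"
    by (subst finner_cnj) (simp add: fock_reproducing[OF m fock_basis_fock_set[OF m]])
  ultimately show ?thesis using ne by simp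
qed

lemma fock_series_unitary:
  assumes m: "m > 0" and a: "a \<in> sq_integrable (count_space UNIV)"
  shows "sq_norm (fock_measure m) (fock_series m a) = sq_norm (count_space UNIV) a"
    and "G \<in> fock_set m \<Longrightarrow> (\<lambda>\<alpha>. finner m G (fock_basis m \<alpha>)) \<in> sq_integrable (count_space UNIV) \<and>
          G = fock_series m (\<lambda>\<alpha>. finner m G (fock_basis m \<alpha>))"
proof -
  interpret reproducing_feature_map "fock_measure m" "count_space UNIV" "\<lambda>x \<alpha>. cnj (fock_basis m \<alpha> x)"
    by (rule fock_reproducing_feature_map[OF m])
  have coeff: "finner m (fock_series m b) (fock_basis m \<beta>) = b \<beta>" if "b \<in> sq_integrable (count_space UNIV)" for b \<beta>
    by (simp add: fock_series_coefficient[OF m that] fock_basis_norm[OF m])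
  have inj: "AE \<alpha> in count_space UNIV. b \<alpha> = 0"
    if b: "b \<in> sq_integrable (count_space UNIV)" "\<And>x. x \<in> space (fock_measure m) \<Longrightarrow> synthesis b x = 0" for b
  proof (rule AE_I2)
    fix \<alpha>
    have "fock_series m b = (\<lambda>_. 0)" using b(2) by (simp add: fock_synthesis[OF m] fun_eq_iff)
    with coeff[OF b(1), of \<alpha>] show "b \<alpha> = 0" by (simp add: finner_def)
  qed
  show "sq_norm (fock_measure m) (fock_series m a) = sq_norm (count_space UNIV) a"
    using synthesis_unitary(1)[OF inj a] by (simp add: fock_synthesis[OF m])
  assume G: "G \<in> fock_set m"
  obtain b where b: "b \<in> sq_integrable (count_space UNIV)" "G = fock_series m b"
    using synthesis_unitary(2)[OF inj fock_set_reproduced[OF m G]] by (auto simp: fock_synthesis[OF m] fun_eq_iff)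
  have "(\<lambda>\<alpha>. finner m G (fock_basis m \<alpha>)) = b" unfolding b(2) by (intro ext coeff b(1))
  then show "(\<lambda>\<alpha>. finner m G (fock_basis m \<alpha>)) \<in> sq_integrable (count_space UNIV) \<and>
      G = fock_series m (\<lambda>\<alpha>. finner m G (fock_basis m \<alpha>))" using b by simp
qed

lemma fock_pre_hilbert:
  assumes m: "m > 0" shows "pre_hilbert (fock_set m) (finner m)"
proof
  show "(\<lambda>x. a * G x + b * H x) \<in> fock_set m" if "G \<in> fock_set m" "H \<in> fock_set m" for a b G H
    by (intro fock_set_add fock_set_cmult that)
  show "(\<lambda>x. 0) \<in> fock_set m" by (simp add: fock_set_def entire_iff_hol_on vec.hol_on_const)
  show "finner m (\<lambda>x. a * G x + b * H x) K = a * finner m G K + b * finner m H K"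
    if "G \<in> fock_set m" "H \<in> fock_set m" "K \<in> fock_set m" for a b G H K
  proof -
    have "integrable (fock_measure m) (\<lambda>x. G x * cnj (K x))" "integrable (fock_measure m) (\<lambda>x. H x * cnj (K x))"
      using that by (auto simp: fock_set_def intro!: sq_integrable_product sq_integrable_cnj)
    then show ?thesis by (simp add: finner_def algebra_simps)
  qed
  show "finner m H G = cnj (finner m G H)" for G H by (rule finner_cnj)
  show "0 \<le> Re (finner m G G)" for G by (simp add: finner_self)
qed

lemma fock_nsq: "m > 0 \<Longrightarrow> pre_hilbert.nsq (finner m) G = sq_norm (fock_measure m) G"
  by (simp add: pre_hilbert.nsq_def[OF fock_pre_hilbert] finner_self)

lemma fock_basis_inner: "m > 0 \<Longrightarrow> finner m (fock_basis m \<alpha>) (fock_basis m \<beta>) = (if \<alpha> = \<beta> then 1 else 0)"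
  by (simp add: fock_basis_norm fock_basis_orthogonal)

lemma inj_fock_basis: assumes "m > 0" shows "inj (fock_basis m)"
proof (rule injI)
  fix \<alpha> \<beta> assume "fock_basis m \<alpha> = fock_basis m \<beta>"
  then have "finner m (fock_basis m \<alpha>) (fock_basis m \<beta>) = 1" using assms by (simp add: fock_basis_norm)
  then show "\<alpha> = \<beta>" using fock_basis_inner[OF assms, of \<alpha> \<beta>] by (simp split: if_splits)
qed

lemma fock_basis_onb:
  assumes m: "m > 0" shows "pre_hilbert.onb (fock_set m) (finner m) (range (fock_basis m :: ('n::finite \<Rightarrow> nat) \<Rightarrow> _))"
proof -
  interpret pre_hilbert "fock_set m :: (complex ^ 'n \<Rightarrow> complex) set" "finner m" by (rule fock_pre_hilbert[OF m])
  have "fock_basis m \<alpha> = fock_basis m \<beta> \<longleftrightarrow> \<alpha> = \<beta>" for \<alpha> \<beta> :: "'n \<Rightarrow> nat"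
    using inj_fock_basis[OF m] by (auto dest: injD)
  then have "orthonormal (range (fock_basis m))"
    by (auto simp: orthonormal_def fock_basis_fock_set[OF m] fock_basis_inner[OF m])
  moreover have "\<exists>S c. finite S \<and> S \<subseteq> range (fock_basis m :: ('n \<Rightarrow> nat) \<Rightarrow> _) \<and> sqrt (nsq (\<lambda>w. G w - (\<Sum>e\<in>S. c e * e w))) < \<epsilon>"
    if G: "G \<in> fock_set m" and \<epsilon>: "\<epsilon> > 0" for G \<epsilon>
  proof -
    have z: "(\<lambda>_. 0) \<in> sq_integrable (count_space UNIV)" by simp
    define a where "a \<alpha> = finner m G (fock_basis m \<alpha>)" for \<alpha>
    have a: "a \<in> sq_integrable (count_space UNIV)" and Ga: "G = fock_series m a"
      using fock_series_unitary(2)[OF m z G] by (simp_all add: a_def[abs_def])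
    obtain S where S: "finite S" "\<And>T. S \<subseteq> T \<Longrightarrow> sq_norm (count_space UNIV) (\<lambda>\<alpha>. if \<alpha> \<in> T then 0 else a \<alpha>) < \<epsilon>\<^sup>2"
      using sq_integrable_count_tail[OF a, of "\<epsilon>\<^sup>2"] \<epsilon> by auto
    have t: "(\<lambda>\<alpha>. if \<alpha> \<in> S then 0 else a \<alpha>) \<in> sq_integrable (count_space UNIV)"
      by (rule sq_integrable_dominated(1)[OF a]) auto
    have eq: "(\<lambda>w. G w - (\<Sum>e\<in>fock_basis m ` S. a (inv (fock_basis m) e) * e w))
        = fock_series m (\<lambda>\<alpha>. if \<alpha> \<in> S then 0 else a \<alpha>)"
    proof
      fix w
      have "inj_on (fock_basis m) S" using inj_fock_basis[OF m] by (rule inj_on_subset) simp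
      then have "(\<Sum>e\<in>fock_basis m ` S. a (inv (fock_basis m) e) * e w) = (\<Sum>\<alpha>\<in>S. a \<alpha> * fock_basis m \<alpha> w)"
        by (simp add: sum.reindex inv_f_f[OF inj_fock_basis[OF m]])
      then show "G w - (\<Sum>e\<in>fock_basis m ` S. a (inv (fock_basis m) e) * e w)
          = fock_series m (\<lambda>\<alpha>. if \<alpha> \<in> S then 0 else a \<alpha>) w"
        by (simp add: fock_series_tail[OF m a S(1)] Ga)
    qed
    have "nsq (\<lambda>w. G w - (\<Sum>e\<in>fock_basis m ` S. a (inv (fock_basis m) e) * e w)) < \<epsilon>\<^sup>2"
      unfolding eq fock_nsq[OF m] using fock_series_contraction(2)[OF m t] S(2)[of S] by simp
    then have "sqrt (nsq (\<lambda>w. G w - (\<Sum>e\<in>fock_basis m ` S. a (inv (fock_basis m) e) * e w))) < \<epsilon>"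
      using \<epsilon> by (simp add: real_less_lsqrt)
    with S(1) show ?thesis
      by (intro exI[of _ "fock_basis m ` S"] exI[of _ "\<lambda>e. a (inv (fock_basis m) e)"]) auto
  qed
  ultimately show ?thesis by (simp add: onb_def)
qed

section \<open>Rank-one operators on the Fock space\<close>

lemma fock_onb_iff:
  assumes l: "l \<noteq> 0"
  shows "fock_onb l B \<longleftrightarrow> pre_hilbert.onb (fock_set \<bar>l\<bar>) (finner \<bar>l\<bar>) (B :: (complex ^ 'n \<Rightarrow> complex) set)"
proof -
  have m: "\<bar>l\<bar> > 0" using l by simp
  interpret pre_hilbert "fock_set \<bar>l\<bar> :: (complex ^ 'n \<Rightarrow> complex) set" "finner \<bar>l\<bar>" by (rule fock_pre_hilbert[OF m])
  have eq: "fock_norm l (\<lambda>w. G w - (\<Sum>e\<in>S. c e * e w)) = sqrt (nsq (\<lambda>w. G w - (\<Sum>e\<in>S. c e * e w)))"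
    if "B \<subseteq> fock_set \<bar>l\<bar>" "G \<in> fock_set \<bar>l\<bar>" "finite S" "S \<subseteq> B" for G S c
  proof -
    have "(\<lambda>w. G w - (\<Sum>e\<in>S. c e * e w)) \<in> fock_set \<bar>l\<bar>"
      by (intro diff_in sum_in) (use that in auto)
    then show ?thesis by (simp add: fock_norm_eq[OF l fock_set_measurable] fock_nsq[OF m])
  qed
  have ip: "fock_inner l e f = finner \<bar>l\<bar> e f" if "B \<subseteq> fock_set \<bar>l\<bar>" "e \<in> B" "f \<in> B" for e f
    using that by (intro fock_inner_eq l fock_set_measurable) auto
  show ?thesis
  proof (cases "B \<subseteq> fock_set \<bar>l\<bar>")
    case True
    have "(\<exists>S c. finite S \<and> S \<subseteq> B \<and> fock_norm l (\<lambda>w. G w - (\<Sum>e\<in>S. c e * e w)) < \<epsilon>) \<longleftrightarrow>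
        (\<exists>S c. finite S \<and> S \<subseteq> B \<and> sqrt (nsq (\<lambda>w. G w - (\<Sum>e\<in>S. c e * e w))) < \<epsilon>)"
      if G: "G \<in> fock_set \<bar>l\<bar>" for G \<epsilon>
      by (rule iff_exI, rule iff_exI, rule conj_cong[OF refl], rule conj_cong[OF refl]) (simp only: eq[OF True G])
    moreover have "(\<forall>e\<in>B. \<forall>f\<in>B. fock_inner l e f = (if e = f then 1 else 0)) \<longleftrightarrow>
        (\<forall>e\<in>B. \<forall>f\<in>B. finner \<bar>l\<bar> e f = (if e = f then 1 else 0))"
      by (intro ball_cong refl) (simp only: ip[OF True])
    ultimately show ?thesis
      unfolding fock_onb_def onb_def orthonormal_def fock_space_eq_fock_set[OF l] by simp
  qed (simp add: fock_onb_def onb_def orthonormal_def fock_space_eq_fock_set[OF l])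
qed

lemma fock_onb_basis: "l \<noteq> 0 \<Longrightarrow> fock_onb l (range (fock_basis \<bar>l\<bar>))"
  by (simp add: fock_onb_iff fock_basis_onb)

lemma fock_onb_some: "l \<noteq> 0 \<Longrightarrow> fock_onb l (SOME B. fock_onb l (B :: (complex ^ 'n \<Rightarrow> complex) set))"
  by (rule someI_ex) (use fock_onb_basis in blast)

lemma fock_norm_const: "l \<noteq> 0 \<Longrightarrow> fock_norm l (\<lambda>_ :: complex ^ 'n. c) = cmod c"
proof -
  assume l: "l \<noteq> 0"
  interpret prob_space "fock_measure \<bar>l\<bar> :: (complex ^ 'n) measure" by (rule prob_space_fock_measure) (use l in simp)
  have "prob UNIV = 1" using prob_space by simp
  then show ?thesis using l by (simp add: fock_norm_eq sq_norm_def)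
qed

lemma sq_integrable_count_iff:
  "a \<in> sq_integrable (count_space (UNIV :: 'c set)) \<longleftrightarrow> (\<lambda>\<alpha>. (cmod (a \<alpha>))\<^sup>2) summable_on UNIV"
proof -
  have "a \<in> sq_integrable (count_space UNIV) \<longleftrightarrow> Infinite_Set_Sum.abs_summable_on (\<lambda>\<alpha>. (cmod (a \<alpha>))\<^sup>2) UNIV"
    by (simp add: sq_integrable_def abs_summable_on_def)
  also have "\<dots> \<longleftrightarrow> (\<lambda>\<alpha>. (cmod (a \<alpha>))\<^sup>2) summable_on UNIV"
    by (simp flip: abs_summable_equivalent)
  finally show ?thesis .
qed

lemma sq_norm_count:
  "a \<in> sq_integrable (count_space UNIV) \<Longrightarrow> sq_norm (count_space UNIV) a = (\<Sum>\<^sub>\<infinity>\<alpha>. (cmod (a \<alpha>))\<^sup>2)"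
  unfolding sq_norm_def infsetsum_def[symmetric]
  by (rule infsetsum_infsum) (simp add: sq_integrable_def abs_summable_on_def)

text \<open>
  An operator with values in the constants is given by a bounded functional \<open>c\<close>.  Its
  Hilbert-Schmidt norm in any orthonormal basis is the norm of \<open>c\<close>.
\<close>

locale constant_valued =
  fixes l :: real and T :: "(complex ^ 'n \<Rightarrow> complex) \<Rightarrow> (complex ^ 'n \<Rightarrow> complex)"
    and c :: "(complex ^ 'n \<Rightarrow> complex) \<Rightarrow> complex"
  assumes l: "l \<noteq> 0" and hs: "fock_hilbert_schmidt l T"
    and T: "\<And>G. G \<in> fock_set \<bar>l\<bar> \<Longrightarrow> T G = (\<lambda>_. c G)"
begin

lemma m: "\<bar>l\<bar> > 0" using l by simp

sublocale pre_hilbert "fock_set \<bar>l\<bar> :: (complex ^ 'n \<Rightarrow> complex) set" "finner \<bar>l\<bar>"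
  by (rule fock_pre_hilbert[OF m])

lemma bounded_functional: "bounded_functional c"
proof -
  have b: "fock_bounded_operator l T" using hs by (simp add: fock_hilbert_schmidt_def)
  have lin: "T (\<lambda>w. a * G w + b * H w) = (\<lambda>w. a * T G w + b * T H w)"
    if "G \<in> fock_set \<bar>l\<bar>" "H \<in> fock_set \<bar>l\<bar>" for G H a b
    using b that unfolding fock_bounded_operator_def fock_space_eq_fock_set[OF l] by blast
  have "c (\<lambda>x. a * G x + b * H x) = a * c G + b * c H"
    if "G \<in> fock_set \<bar>l\<bar>" "H \<in> fock_set \<bar>l\<bar>" for G H a b
    using lin[OF that, of a b] T[OF lincomb[OF that]] T[OF that(1)] T[OF that(2)] by (metis (no_types))
  moreover obtain C where "\<forall>G\<in>fock_set \<bar>l\<bar>. fock_norm l (T G) \<le> C * fock_norm l G"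
    using b unfolding fock_bounded_operator_def fock_space_eq_fock_set[OF l] by blast
  then have "\<forall>G\<in>fock_set \<bar>l\<bar>. cmod (c G) \<le> C * sqrt (nsq G)"
    by (simp add: T fock_norm_const[OF l] fock_norm_eq[OF l fock_set_measurable] fock_nsq[OF m])
  ultimately show ?thesis unfolding bounded_functional_def by blast
qed

lemma hs_sum: "B \<subseteq> fock_set \<bar>l\<bar> \<Longrightarrow> e \<in> B \<Longrightarrow> (fock_norm l (T e))\<^sup>2 = (cmod (c e))\<^sup>2"
  by (subst T) (auto simp: fock_norm_const[OF l])

lemma summable: "onb B \<Longrightarrow> (\<lambda>e. (cmod (c e))\<^sup>2) summable_on B"
proof -
  assume B: "onb B"
  obtain B0 where B0: "fock_onb l B0" "(\<lambda>e. (fock_norm l (T e))\<^sup>2) summable_on B0"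
    using hs by (auto simp: fock_hilbert_schmidt_def)
  have o: "onb B0" using B0(1) by (simp add: fock_onb_iff[OF l])
  then have "B0 \<subseteq> fock_set \<bar>l\<bar>" by (auto simp: onb_def orthonormal_def)
  then have "(\<lambda>e. (cmod (c e))\<^sup>2) summable_on B0"
    using B0(2) by (subst (asm) summable_on_cong[OF hs_sum]) auto
  from functional_norm_le(1)[OF o _ bounded_functional this, of B] B show ?thesis by (simp add: onb_def)
qed

lemma coefficients_sq_integrable: "(\<lambda>\<alpha>. c (fock_basis \<bar>l\<bar> \<alpha>)) \<in> sq_integrable (count_space UNIV)"
  using summable[OF fock_basis_onb[OF m]]
  by (simp add: sq_integrable_count_iff summable_on_reindex[OF inj_fock_basis[OF m]] o_def)

lemma hs_norm: "(fock_hs_norm l T)\<^sup>2 = sq_norm (count_space UNIV) (\<lambda>\<alpha>. c (fock_basis \<bar>l\<bar> \<alpha>))"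
proof -
  define B where "B = (SOME B. fock_onb l (B :: (complex ^ 'n \<Rightarrow> complex) set))"
  have B: "onb B" using fock_onb_some[OF l] by (simp add: B_def fock_onb_iff[OF l])
  then have BV: "B \<subseteq> fock_set \<bar>l\<bar>" by (auto simp: onb_def orthonormal_def)
  have "(fock_hs_norm l T)\<^sup>2 = (\<Sum>\<^sub>\<infinity>e\<in>B. (fock_norm l (T e))\<^sup>2)"
    by (simp add: fock_hs_norm_def B_def infsum_nonneg)
  also have "\<dots> = (\<Sum>\<^sub>\<infinity>e\<in>B. (cmod (c e))\<^sup>2)" by (intro infsum_cong hs_sum[OF BV])
  also have "\<dots> = (\<Sum>\<^sub>\<infinity>e\<in>range (fock_basis \<bar>l\<bar>). (cmod (c e))\<^sup>2)"
    by (intro functional_norm_unique fock_basis_onb[OF m] B bounded_functional summable)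
  also have "\<dots> = (\<Sum>\<^sub>\<infinity>\<alpha>. (cmod (c (fock_basis \<bar>l\<bar> \<alpha>)))\<^sup>2)"
    by (subst infsum_reindex[OF inj_fock_basis[OF m]]) (simp add: o_def)
  finally show ?thesis by (simp add: sq_norm_count[OF coefficients_sq_integrable])
qed

text \<open>
  The trace against the adjoint representation evaluates \<open>c\<close> at the translate of the vacuum
  vector, which is a multiple of a reproducing kernel; expanding that kernel in the monomials
  gives a power series.
\<close>

lemma cnj_fock_basis: "cnj (fock_basis k \<alpha> (vcnj z)) = fock_basis k \<alpha> z"
  by (simp add: fock_basis_def monomial_def vcnj_def)

lemma functional_kernel: "c (fock_kernel \<bar>l\<bar> (vcnj z)) = fock_series \<bar>l\<bar> (\<lambda>\<alpha>. c (fock_basis \<bar>l\<bar> \<alpha>)) z"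
proof -
  let ?K = "fock_kernel \<bar>l\<bar> (vcnj z)"
  have K: "?K \<in> fock_set \<bar>l\<bar>" by (rule fock_kernel_fock_set[OF m])
  have "((\<lambda>e. finner \<bar>l\<bar> ?K e * c e) has_sum c ?K) (range (fock_basis \<bar>l\<bar>))"
    by (rule onb_expansion[OF fock_basis_onb[OF m] bounded_functional K])
  then have "((\<lambda>\<alpha>. finner \<bar>l\<bar> ?K (fock_basis \<bar>l\<bar> \<alpha>) * c (fock_basis \<bar>l\<bar> \<alpha>)) has_sum c ?K) UNIV"
    by (subst (asm) has_sum_reindex[OF inj_fock_basis[OF m]]) (simp add: o_def)
  moreover have "finner \<bar>l\<bar> ?K (fock_basis \<bar>l\<bar> \<alpha>) = fock_basis \<bar>l\<bar> \<alpha> z" for \<alpha>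
    by (subst finner_cnj) (simp add: fock_reproducing[OF m fock_basis_fock_set[OF m]] cnj_fock_basis)
  ultimately have "((\<lambda>\<alpha>. c (fock_basis \<bar>l\<bar> \<alpha>) * fock_basis \<bar>l\<bar> \<alpha> z) has_sum c ?K) UNIV"
    by (simp add: mult.commute)
  then have "(\<Sum>\<^sub>\<infinity>\<alpha>. c (fock_basis \<bar>l\<bar> \<alpha>) * fock_basis \<bar>l\<bar> \<alpha> z) = c ?K" by (rule infsumI)
  moreover have "Infinite_Set_Sum.abs_summable_on (\<lambda>\<alpha>. c (fock_basis \<bar>l\<bar> \<alpha>) * fock_basis \<bar>l\<bar> \<alpha> z) UNIV"
    unfolding abs_summable_on_def
    by (intro sq_integrable_product(1) coefficients_sq_integrable fock_basis_sq_integrable m)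
  ultimately show ?thesis
    unfolding fock_series_def infsetsum_def[symmetric] by (simp add: infsetsum_infsum)
qed

lemma bargmann_adjoint:
  fixes H :: "complex ^ 'n \<Rightarrow> complex"
  assumes neg: "l < 0" and H: "H \<in> fock_set \<bar>l\<bar>"
  shows "fock_adjoint l (bargmann_rep l z t) H = (\<lambda>w. exp (- (\<i> * of_real (l * t))) * weyl \<bar>l\<bar> (- vcnj z) H w)"
proof -
  define K where "K = (\<lambda>w. exp (- (\<i> * of_real (l * t))) * weyl \<bar>l\<bar> (- vcnj z) H w)"
  have K: "K \<in> fock_set \<bar>l\<bar>" unfolding K_def by (intro fock_set_cmult weyl_fock_set m H)
  have nv: "norm (vcnj z) = norm z" by (simp add: norm_vec_def vcnj_def)
  have vv: "vcnj (vcnj z) = z" by (simp add: vcnj_def)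
  have \<sigma>: "bargmann_rep l z t G = (\<lambda>w. exp (\<i> * of_real (l * t)) * weyl \<bar>l\<bar> (vcnj z) G w)" for G
    using neg by (simp add: bargmann_rep_def weyl_def vv nv fun_eq_iff abs_of_neg add.assoc flip: exp_add mult.assoc)
  have adj: "fock_inner l (bargmann_rep l z t G) H = fock_inner l G K" if G: "G \<in> fock_set \<bar>l\<bar>" for G
  proof -
    have [measurable]: "G \<in> borel_measurable borel" "H \<in> borel_measurable borel" "K \<in> borel_measurable borel"
      using G H K by (auto intro: fock_set_measurable)
    have "fock_inner l (bargmann_rep l z t G) H = exp (\<i> * of_real (l * t)) * finner \<bar>l\<bar> (weyl \<bar>l\<bar> (vcnj z) G) H"
      unfolding \<sigma> by (subst fock_inner_eq[OF l]) (simp_all add: finner_def mult.assoc)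
    also have "\<dots> = exp (\<i> * of_real (l * t)) * finner \<bar>l\<bar> G (weyl \<bar>l\<bar> (- vcnj z) H)"
      by (simp add: weyl_adjoint[OF m])
    also have "\<dots> = finner \<bar>l\<bar> G K"
      unfolding finner_def K_def integral_mult_right_zero[symmetric]
      by (intro Bochner_Integration.integral_cong refl) (simp add: exp_cnj mult_ac)
    finally show ?thesis by (simp add: fock_inner_eq[OF l])
  qed
  show ?thesis
    unfolding fock_adjoint_def fock_space_eq_fock_set[OF l] K_def[symmetric]
  proof (rule the_equality)
    show "K \<in> fock_set \<bar>l\<bar> \<and> (\<forall>G\<in>fock_set \<bar>l\<bar>. fock_inner l (bargmann_rep l z t G) H = fock_inner l G K)"
      using K adj by blast
    fix K' assume K': "K' \<in> fock_set \<bar>l\<bar> \<and> (\<forall>G\<in>fock_set \<bar>l\<bar>. fock_inner l (bargmann_rep l z t G) H = fock_inner l G K')"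
    show "K' = K"
    proof
      fix x :: "complex ^ 'n"
      have x: "fock_kernel \<bar>l\<bar> x \<in> fock_set \<bar>l\<bar>" by (rule fock_kernel_fock_set[OF m])
      have "finner \<bar>l\<bar> (fock_kernel \<bar>l\<bar> x) K' = finner \<bar>l\<bar> (fock_kernel \<bar>l\<bar> x) K"
        using K' adj[OF x] x K by (metis fock_inner_eq[OF l] fock_set_measurable)
      then show "K' x = K x"
        using fock_reproducing[OF m, of K' x] fock_reproducing[OF m K, of x] K' finner_cnj by metis
    qed
  qed
qed

lemma trace_formula:
  assumes neg: "l < 0"
  shows "fock_trace l (T \<circ> fock_adjoint l (bargmann_rep l z t))
    = exp (of_real (l / 4 * (norm z)\<^sup>2) - \<i> * of_real (l * t)) * fock_series \<bar>l\<bar> (\<lambda>\<alpha>. c (fock_basis \<bar>l\<bar> \<alpha>)) z"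
proof -
  define U where "U H = (\<lambda>w. exp (- (\<i> * of_real (l * t))) * weyl \<bar>l\<bar> (- vcnj z) H w)" for H :: "complex ^ 'n \<Rightarrow> complex"
  have U: "U H \<in> fock_set \<bar>l\<bar>" if "H \<in> fock_set \<bar>l\<bar>" for H
    unfolding U_def by (intro fock_set_cmult weyl_fock_set m that)
  have clin: "\<And>G H a b. G \<in> fock_set \<bar>l\<bar> \<Longrightarrow> H \<in> fock_set \<bar>l\<bar> \<Longrightarrow> c (\<lambda>x. a * G x + b * H x) = a * c G + b * c H"
    using bounded_functional by (simp add: bounded_functional_def)
  have cscale: "c (\<lambda>x. a * G x) = a * c G" if "G \<in> fock_set \<bar>l\<bar>" for a G
    using clin[OF that that, of a 0] by simp
  have nU: "nsq (U H) = nsq H" if H: "H \<in> fock_set \<bar>l\<bar>" for H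
  proof -
    have [measurable]: "H \<in> borel_measurable borel" using H by (rule fock_set_measurable)
    have "finner \<bar>l\<bar> (U H) (U H) = finner \<bar>l\<bar> (weyl \<bar>l\<bar> (- vcnj z) H) (weyl \<bar>l\<bar> (- vcnj z) H)"
      unfolding finner_def
    proof (intro Bochner_Integration.integral_cong refl)
      fix w
      let ?k = "exp (- (\<i> * complex_of_real (l * t)))"
      have "?k * cnj ?k = 1" by (simp add: exp_cnj flip: exp_add)
      moreover have "U H w * cnj (U H w) = (?k * cnj ?k) * (weyl \<bar>l\<bar> (- vcnj z) H w * cnj (weyl \<bar>l\<bar> (- vcnj z) H w))"
        by (simp only: U_def complex_cnj_mult mult_ac)
      ultimately show "U H w * cnj (U H w) = weyl \<bar>l\<bar> (- vcnj z) H w * cnj (weyl \<bar>l\<bar> (- vcnj z) H w)"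
        by (simp only: mult_1)
    qed
    also have "\<dots> = finner \<bar>l\<bar> H H"
      by (subst weyl_adjoint[OF m]) (simp_all add: weyl_weyl[of _ "- (- vcnj z)", simplified] weyl_weyl)
    finally show ?thesis by (simp add: nsq_def)
  qed
  have "bounded_functional (\<lambda>H. c (U H))"
    unfolding bounded_functional_def
  proof (intro conjI ballI allI)
    fix G H :: "complex ^ 'n \<Rightarrow> complex" and a b :: complex assume GH: "G \<in> fock_set \<bar>l\<bar>" "H \<in> fock_set \<bar>l\<bar>"
    have "U (\<lambda>x. a * G x + b * H x) = (\<lambda>x. a * U G x + b * U H x)"
      by (simp add: U_def weyl_def fun_eq_iff algebra_simps)
    then show "c (U (\<lambda>x. a * G x + b * H x)) = a * c (U G) + b * c (U H)" by (simp add: clin[OF U[OF GH(1)] U[OF GH(2)]])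
  next
    obtain C where "\<forall>G\<in>fock_set \<bar>l\<bar>. cmod (c G) \<le> C * sqrt (nsq G)" using bounded_functional by (auto simp: bounded_functional_def)
    then show "\<exists>C. \<forall>G\<in>fock_set \<bar>l\<bar>. cmod (c (U G)) \<le> C * sqrt (nsq G)" using U nU by (intro exI[of _ C]) fastforce
  qed
  note cU = this
  define B where "B = (SOME B. fock_onb l (B :: (complex ^ 'n \<Rightarrow> complex) set))"
  have B: "onb B" using fock_onb_some[OF l] by (simp add: B_def fock_onb_iff[OF l])
  then have BV: "B \<subseteq> fock_set \<bar>l\<bar>" by (auto simp: onb_def orthonormal_def)
  have one: "(\<lambda>_. 1) \<in> fock_set \<bar>l\<bar>" by (rule one_fock_set[OF m])
  have "fock_inner l ((T \<circ> fock_adjoint l (bargmann_rep l z t)) e) e = finner \<bar>l\<bar> (\<lambda>_. 1) e * c (U e)" if e: "e \<in> B" for e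
  proof -
    have eV: "e \<in> fock_set \<bar>l\<bar>" using e BV by blast
    have "fock_adjoint l (bargmann_rep l z t) e = U e" unfolding U_def by (rule bargmann_adjoint[OF neg eV])
    then have "(T \<circ> fock_adjoint l (bargmann_rep l z t)) e = (\<lambda>_. c (U e))"
      by (simp only: o_apply T[OF U[OF eV]])
    then show ?thesis by (simp add: fock_inner_eq[OF l _ fock_set_measurable[OF eV]] finner_def)
  qed
  then have "fock_trace l (T \<circ> fock_adjoint l (bargmann_rep l z t)) = (\<Sum>\<^sub>\<infinity>e\<in>B. finner \<bar>l\<bar> (\<lambda>_. 1) e * c (U e))"
    unfolding fock_trace_def B_def[symmetric] by (intro infsum_cong) auto
  also have "\<dots> = c (U (\<lambda>_. 1))" by (rule infsumI[OF onb_expansion[OF B cU one]])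
  also have "U (\<lambda>_. 1) = (\<lambda>w. exp (of_real (l / 4 * (norm z)\<^sup>2) - \<i> * of_real (l * t)) * fock_kernel \<bar>l\<bar> (vcnj z) w)"
  proof
    fix w
    have nv: "norm (vcnj z) = norm z" by (simp add: norm_vec_def vcnj_def)
    have "weyl \<bar>l\<bar> (- vcnj z) (\<lambda>_. 1) w = exp (of_real (l / 4 * (norm z)\<^sup>2)) * fock_kernel \<bar>l\<bar> (vcnj z) w"
      unfolding fock_kernel_weyl using neg by (simp add: nv mult.assoc[symmetric] flip: exp_add)
    moreover have "exp (of_real (l / 4 * (norm z)\<^sup>2) - \<i> * of_real (l * t))
        = exp (- (\<i> * of_real (l * t))) * exp (complex_of_real (l / 4 * (norm z)\<^sup>2))"
      by (simp only: mult_exp_exp diff_conv_add_uminus add.commute)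
    ultimately show "U (\<lambda>_. 1) w = exp (of_real (l / 4 * (norm z)\<^sup>2) - \<i> * of_real (l * t)) * fock_kernel \<bar>l\<bar> (vcnj z) w"
      by (simp only: U_def mult.assoc)
  qed
  finally show ?thesis by (simp only: cscale[OF fock_kernel_fock_set[OF m]] functional_kernel)
qed

end

text \<open>Conversely, every square-summable coefficient family defines such an operator.\<close>

definition series_operator :: "real \<Rightarrow> (('n \<Rightarrow> nat) \<Rightarrow> complex) \<Rightarrow> (complex ^ 'n \<Rightarrow> complex) \<Rightarrow> (complex ^ 'n \<Rightarrow> complex)" where
  "series_operator l a G = (\<lambda>_. \<integral>\<alpha>. finner \<bar>l\<bar> G (fock_basis \<bar>l\<bar> \<alpha>) * a \<alpha> \<partial>count_space UNIV)"

lemma series_operator_basis: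
  assumes "l \<noteq> 0"
  shows "series_operator l a (fock_basis \<bar>l\<bar> \<beta>) = (\<lambda>_. a \<beta>)"
proof -
  have "(\<integral>\<alpha>. finner \<bar>l\<bar> (fock_basis \<bar>l\<bar> \<beta>) (fock_basis \<bar>l\<bar> \<alpha>) * a \<alpha> \<partial>count_space UNIV)
      = infsetsum (\<lambda>\<alpha>. a \<alpha>) {\<beta>}"
    using assms unfolding infsetsum_altdef set_lebesgue_integral_def
    by (intro Bochner_Integration.integral_cong) (auto simp: fock_basis_inner)
  then show ?thesis by (simp add: series_operator_def)
qed

lemma series_operator_hilbert_schmidt:
  fixes a :: "('n::finite \<Rightarrow> nat) \<Rightarrow> complex"
  assumes l: "l \<noteq> 0" and a: "a \<in> sq_integrable (count_space UNIV)"
  shows "fock_hilbert_schmidt l (series_operator l a)"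
proof -
  have m: "\<bar>l\<bar> > 0" using l by simp
  interpret pre_hilbert "fock_set \<bar>l\<bar> :: (complex ^ 'n \<Rightarrow> complex) set" "finner \<bar>l\<bar>" by (rule fock_pre_hilbert[OF m])
  define g where "g G \<alpha> = finner \<bar>l\<bar> G (fock_basis \<bar>l\<bar> \<alpha>)" for G :: "complex ^ 'n \<Rightarrow> complex" and \<alpha>
  have g: "g G \<in> sq_integrable (count_space UNIV)" "sq_norm (count_space UNIV) (g G) = nsq G" if "G \<in> fock_set \<bar>l\<bar>" for G
    using fock_series_unitary(2)[OF m a that] fock_series_unitary(1)[OF m, of "g G"]
    by (auto simp: g_def[abs_def] fock_nsq[OF m])
  have const: "(\<lambda>_. k) \<in> fock_set \<bar>l\<bar>" for k :: complex
    using fock_set_cmult[OF one_fock_set[OF m], of k] by simp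
  have "fock_bounded_operator l (series_operator l a)"
    unfolding fock_bounded_operator_def fock_space_eq_fock_set[OF l]
  proof (intro conjI ballI allI)
    show "series_operator l a ` fock_set \<bar>l\<bar> \<subseteq> fock_set \<bar>l\<bar>" by (auto simp: series_operator_def const)
    fix G H :: "complex ^ 'n \<Rightarrow> complex" and x y :: complex assume GH: "G \<in> fock_set \<bar>l\<bar>" "H \<in> fock_set \<bar>l\<bar>"
    have "g (\<lambda>w. x * G w + y * H w) \<alpha> = x * g G \<alpha> + y * g H \<alpha>" for \<alpha>
      unfolding g_def by (rule ip_lincomb[OF GH fock_basis_fock_set[OF m]])
    then show "series_operator l a (\<lambda>w. x * G w + y * H w) = (\<lambda>w. x * series_operator l a G w + y * series_operator l a H w)"
      using sq_integrable_product(1)[OF g(1)[OF GH(1)] a] sq_integrable_product(1)[OF g(1)[OF GH(2)] a]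
      unfolding series_operator_def g_def[symmetric] by (simp add: distrib_right mult.assoc)
  next
    show "\<exists>C. \<forall>G\<in>fock_set \<bar>l\<bar>. fock_norm l (series_operator l a G) \<le> C * fock_norm l G"
    proof (intro exI ballI)
      fix G :: "complex ^ 'n \<Rightarrow> complex" assume G: "G \<in> fock_set \<bar>l\<bar>"
      have "(cmod (\<integral>\<alpha>. g G \<alpha> * a \<alpha> \<partial>count_space UNIV))\<^sup>2 \<le> nsq G * sq_norm (count_space UNIV) a"
        using Cauchy_Schwarz_integral[OF g(1)[OF G] a] g(2)[OF G] by simp
      then have "cmod (\<integral>\<alpha>. g G \<alpha> * a \<alpha> \<partial>count_space UNIV) \<le> sqrt (sq_norm (count_space UNIV) a) * sqrt (nsq G)"
        by (simp add: real_le_rsqrt mult.commute flip: real_sqrt_mult)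
      then show "fock_norm l (series_operator l a G) \<le> sqrt (sq_norm (count_space UNIV) a) * fock_norm l G"
        unfolding series_operator_def g_def[symmetric] fock_norm_const[OF l]
        by (simp add: fock_norm_eq[OF l fock_set_measurable[OF G]] fock_nsq[OF m])
    qed
  qed
  moreover have "(\<lambda>e. (fock_norm l (series_operator l a e))\<^sup>2) summable_on range (fock_basis \<bar>l\<bar> :: ('n \<Rightarrow> nat) \<Rightarrow> _)"
    using a by (simp add: summable_on_reindex[OF inj_fock_basis[OF m]] o_def series_operator_basis[OF l]
        fock_norm_const[OF l] sq_integrable_count_iff)
  ultimately show ?thesis using fock_onb_basis[OF l] by (auto simp: fock_hilbert_schmidt_def)
qed

section \<open>Change of variables by an injective holomorphic map\<close>

definition c2v :: "complex \<Rightarrow> real ^ 2" where "c2v z = vector [Re z, Im z]"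

definition v2c :: "real ^ 2 \<Rightarrow> complex" where "v2c x = Complex (x $ 1) (x $ 2)"

lemma c2v_v2c[simp]: "c2v (v2c x) = x" and v2c_c2v[simp]: "v2c (c2v z) = z"
  by (simp_all add: c2v_def v2c_def vec_eq_iff forall_2)

lemma bounded_linear_c2v: "bounded_linear c2v" and bounded_linear_v2c: "bounded_linear v2c"
  unfolding linear_conv_bounded_linear[symmetric]
  by (rule linearI; simp add: c2v_def v2c_def vec_eq_iff forall_2 complex_eq_iff)+

lemma c2v_v2c_measurable[measurable]: "c2v \<in> borel_measurable borel" "v2c \<in> borel_measurable borel"
  by (intro borel_measurable_continuous_onI linear_continuous_on bounded_linear_c2v bounded_linear_v2c)+

lemma Basis_real2: "(Basis :: (real ^ 2) set) = {axis 1 1, axis 2 1}"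
  by (auto simp: Basis_vec_def UNIV_2)

lemma lborel_distr_v2c: "distr lborel borel v2c = lborel"
proof (rule lborel_eqI[symmetric])
  fix l u :: complex assume le: "\<And>b. b \<in> Basis \<Longrightarrow> l \<bullet> b \<le> u \<bullet> b"
  have ne: "(axis 1 1 :: real ^ 2) \<noteq> axis 2 1" by (simp add: axis_eq_axis)
  have "v2c -` box l u = box (c2v l) (c2v u)"
    by (auto simp: mem_box Basis_real2 Basis_complex_def c2v_def v2c_def inner_axis)
  then have "emeasure (distr lborel borel v2c) (box l u) = emeasure lborel (box (c2v l) (c2v u))"
    by (simp add: emeasure_distr)
  also have "\<dots> = (\<Prod>b\<in>Basis. (c2v u - c2v l) \<bullet> b)"
    by (rule emeasure_lborel_box)
       (use le[of 1] le[of \<i>] in \<open>auto simp: Basis_real2 Basis_complex_def c2v_def inner_axis\<close>)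
  also have "(\<Prod>b\<in>Basis. (c2v u - c2v l) \<bullet> b) = (\<Prod>b\<in>Basis. (u - l) \<bullet> b)"
    using ne by (simp add: Basis_real2 Basis_complex_def c2v_def inner_axis)
  finally show "emeasure (distr lborel borel v2c) (box l u) = ennreal (\<Prod>b\<in>Basis. (u - l) \<bullet> b)" .
qed simp

lemma
  fixes k :: "complex \<Rightarrow> complex"
  assumes [measurable]: "k \<in> borel_measurable borel"
  shows integrable_c2v: "integrable lebesgue (\<lambda>x. c2v (k (v2c x))) \<longleftrightarrow> integrable lborel k"
    and integral_c2v: "integrable lborel k \<Longrightarrow> integral\<^sup>L lebesgue (\<lambda>x. c2v (k (v2c x))) = c2v (integral\<^sup>L lborel k)"
proof -
  have m: "(\<lambda>x. c2v (k (v2c x))) \<in> borel_measurable lborel" by measurable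
  have a: "integrable lborel k \<longleftrightarrow> integrable lborel (\<lambda>x. k (v2c x))"
    unfolding lborel_distr_v2c[symmetric] by (rule integrable_distr_eq) measurable
  have "integrable lborel (\<lambda>x. c2v (k (v2c x))) \<longleftrightarrow> integrable lborel (\<lambda>x. k (v2c x))"
  proof
    assume "integrable lborel (\<lambda>x. c2v (k (v2c x)))"
    from integrable_bounded_linear[OF bounded_linear_v2c this]
    show "integrable lborel (\<lambda>x. k (v2c x))" by (simp only: v2c_c2v)
  qed (rule integrable_bounded_linear[OF bounded_linear_c2v])
  then show "integrable lebesgue (\<lambda>x. c2v (k (v2c x))) \<longleftrightarrow> integrable lborel k"
    unfolding a integrable_completion[OF m] .
  assume int: "integrable lborel k"
  have "integral\<^sup>L lebesgue (\<lambda>x. c2v (k (v2c x))) = integral\<^sup>L lborel (\<lambda>x. c2v (k (v2c x)))"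
    by (rule integral_completion[OF m])
  also have "\<dots> = c2v (integral\<^sup>L lborel (\<lambda>x. k (v2c x)))"
    using int a by (intro integral_bounded_linear[OF bounded_linear_c2v]) simp
  also have "integral\<^sup>L lborel (\<lambda>x. k (v2c x)) = integral\<^sup>L lborel k"
  proof -
    have "integral\<^sup>L (distr lborel borel v2c) k = integral\<^sup>L lborel (\<lambda>x. k (v2c x))"
      by (rule integral_distr) measurable
    then show ?thesis by (simp only: lborel_distr_v2c)
  qed
  finally show "integral\<^sup>L lebesgue (\<lambda>x. c2v (k (v2c x))) = c2v (integral\<^sup>L lborel k)" .
qed

lemma c2v_scaleR: "c2v (r *\<^sub>R z) = r *\<^sub>R c2v z" and c2v_zero: "c2v 0 = 0"
  by (simp_all add: c2v_def vec_eq_iff forall_2)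

lemma c2v_inj: "c2v a = c2v b \<longleftrightarrow> a = b"
  by (metis v2c_c2v)

text \<open>
  Multiplication by a complex number has determinant the square of its modulus, so the real
  change of variables formula in the plane gives the complex one.
\<close>

lemma holomorphic_change_of_variables:
  fixes f f' h :: "complex \<Rightarrow> complex"
  assumes S: "open S" and f: "\<And>x. x \<in> S \<Longrightarrow> (f has_field_derivative f' x) (at x)" and inj: "inj_on f S"
    and m1: "(\<lambda>x. indicator S x *\<^sub>R ((cmod (f' x))\<^sup>2 *\<^sub>R h (f x))) \<in> borel_measurable borel"
    and m2: "(\<lambda>y. indicator (f ` S) y *\<^sub>R h y) \<in> borel_measurable borel"
    and int: "set_integrable lborel S (\<lambda>x. (cmod (f' x))\<^sup>2 *\<^sub>R h (f x))"
  shows "set_integrable lborel (f ` S) h"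
    and "(LINT y:f ` S|lborel. h y) = (LINT x:S|lborel. (cmod (f' x))\<^sup>2 *\<^sub>R h (f x))"
proof -
  note [measurable] = m1 m2
  define S' where "S' = v2c -` S"
  define g where "g x = c2v (f (v2c x))" for x
  define g' where "g' x = (\<lambda>v. c2v (f' (v2c x) * v2c v))" for x
  define F where "F x = c2v (h (v2c x))" for x
  have openS': "open S'"
    unfolding S'_def by (intro open_vimage S linear_continuous_on bounded_linear_v2c)
  have der: "(g has_derivative g' x) (at x within S')" if "x \<in> S'" for x
  proof -
    have "(f has_derivative (*) (f' (v2c x))) (at (v2c x))"
      using f[of "v2c x"] that by (simp add: S'_def has_field_derivative_def)
    from has_derivative_compose[OF bounded_linear_imp_has_derivative[OF bounded_linear_v2c] this]
    have "((\<lambda>x. f (v2c x)) has_derivative (\<lambda>v. f' (v2c x) * v2c v)) (at x within S')" .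
    from bounded_linear.has_derivative[OF bounded_linear_c2v this] show ?thesis
      by (simp add: g_def[abs_def] g'_def)
  qed
  have det: "\<bar>det (matrix (g' x))\<bar> = (cmod (f' (v2c x)))\<^sup>2" for x
  proof -
    have "det (matrix (g' x)) = (Re (f' (v2c x)))\<^sup>2 + (Im (f' (v2c x)))\<^sup>2"
      by (simp add: det_2 matrix_def g'_def c2v_def v2c_def axis_def power2_eq_square)
    then show ?thesis by (simp add: cmod_power2)
  qed
  have inj': "inj_on g S'"
  proof (rule inj_onI)
    fix x y assume "x \<in> S'" "y \<in> S'" "g x = g y"
    then have "v2c x = v2c y" using inj by (auto simp: g_def S'_def c2v_inj dest: inj_onD)
    then show "x = y" by (metis c2v_v2c)
  qed
  have image: "g ` S' = v2c -` (f ` S)"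
  proof -
    have "v2c ` S' = S" unfolding S'_def by (rule surj_image_vimage_eq) (metis v2c_c2v surjI)
    then have "g ` S' = c2v ` (f ` S)" by (simp add: g_def image_comp[symmetric] o_def image_image flip: \<open>v2c ` S' = S\<close>)
    also have "\<dots> = v2c -` (f ` S)" by (auto simp: image_iff) (metis c2v_v2c)
    finally show ?thesis .
  qed
  let ?k1 = "\<lambda>x. indicator S x *\<^sub>R ((cmod (f' x))\<^sup>2 *\<^sub>R h (f x))"
  let ?k2 = "\<lambda>y. indicator (f ` S) y *\<^sub>R h y"
  have int1: "integrable lborel ?k1" using int by (simp add: set_integrable_def)
  have eq1: "indicator S' x *\<^sub>R (\<bar>det (matrix (g' x))\<bar> *\<^sub>R F (g x)) = c2v (?k1 (v2c x))" for x
    by (simp add: det F_def g_def S'_def indicator_def c2v_scaleR c2v_zero)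
  have eq2: "indicator (g ` S') x *\<^sub>R F x = c2v (?k2 (v2c x))" for x
    by (simp add: F_def image indicator_def c2v_zero)
  have abs1: "(\<lambda>x. \<bar>det (matrix (g' x))\<bar> *\<^sub>R F (g x)) absolutely_integrable_on S'"
    unfolding set_integrable_def eq1 integrable_c2v[OF m1] by (rule int1)
  have "integral S' (\<lambda>x. \<bar>det (matrix (g' x))\<bar> *\<^sub>R F (g x)) = c2v (integral\<^sup>L lborel ?k1)"
    unfolding set_lebesgue_integral_eq_integral(2)[OF abs1, symmetric] set_lebesgue_integral_def eq1
    by (rule integral_c2v[OF m1 int1])
  with has_absolute_integral_change_of_variables[OF _ der inj', of F "c2v (integral\<^sup>L lborel ?k1)"] abs1 openS'
  have abs2: "F absolutely_integrable_on (g ` S')" and I2: "integral (g ` S') F = c2v (integral\<^sup>L lborel ?k1)"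
    by auto
  have int2: "integrable lborel ?k2"
    using abs2 unfolding set_integrable_def eq2 integrable_c2v[OF m2] .
  then show "set_integrable lborel (f ` S) h" by (simp add: set_integrable_def)
  have "c2v (integral\<^sup>L lborel ?k2) = c2v (integral\<^sup>L lborel ?k1)"
    unfolding integral_c2v[OF m2 int2, symmetric] I2[symmetric]
      set_lebesgue_integral_eq_integral(2)[OF abs2, symmetric] set_lebesgue_integral_def eq2 ..
  then show "(LINT y:f ` S|lborel. h y) = (LINT x:S|lborel. (cmod (f' x))\<^sup>2 *\<^sub>R h (f x))"
    by (simp add: set_lebesgue_integral_def c2v_inj)
qed

section \<open>A mean value formula on the upper half-plane\<close>

definition upper :: "complex set" where "upper = {w. Im w > 0}"

lemma open_upper: "open upper"
  unfolding upper_def by (rule open_halfspace_Im_gt)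

definition cayley :: "real \<Rightarrow> complex \<Rightarrow> complex" where
  "cayley y0 w = (w - \<i> * of_real y0) / (w + \<i> * of_real y0)"

definition cayley_inv :: "real \<Rightarrow> complex \<Rightarrow> complex" where
  "cayley_inv y0 u = \<i> * of_real y0 * (1 + u) / (1 - u)"

lemma upper_add_nonzero: "w \<in> upper \<Longrightarrow> y0 > 0 \<Longrightarrow> w + \<i> * of_real y0 \<noteq> 0"
  by (auto simp: upper_def complex_eq_iff)

lemma one_diff_add_divide:
  assumes "a \<noteq> (0 :: 'a :: field)"
  shows "1 - b / a = (a - b) / a" "1 + b / a = (a + b) / a"
  using assms by (simp_all add: diff_divide_distrib add_divide_distrib)

lemma cayley_norm:
  assumes "w \<in> upper" "y0 > 0"
  shows "1 - (cmod (cayley y0 w))\<^sup>2 = 4 * y0 * Im w / (cmod (w + \<i> * of_real y0))\<^sup>2"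
proof -
  have "(cmod (w + \<i> * of_real y0))\<^sup>2 \<noteq> 0" using upper_add_nonzero[OF assms] by simp
  note 1 = one_diff_add_divide(1)[OF this, of "(cmod (w - \<i> * of_real y0))\<^sup>2"]
  have 2: "(cmod (w + \<i> * of_real y0))\<^sup>2 - (cmod (w - \<i> * of_real y0))\<^sup>2 = 4 * y0 * Im w"
    unfolding cmod_power2 by (simp add: power2_eq_square algebra_simps)
  show ?thesis unfolding cayley_def norm_divide power_divide 1 2 ..
qed

lemma cayley_inv_cayley:
  assumes "w \<in> upper" "y0 > 0" shows "cayley_inv y0 (cayley y0 w) = w"
proof -
  let ?d = "w + \<i> * of_real y0"
  have d: "?d \<noteq> 0" by (rule upper_add_nonzero[OF assms])
  have "1 + cayley y0 w = (?d + (w - \<i> * of_real y0)) / ?d" "1 - cayley y0 w = (?d - (w - \<i> * of_real y0)) / ?d"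
    unfolding cayley_def by (rule one_diff_add_divide[OF d])+
  then have "1 + cayley y0 w = 2 * w / ?d" "1 - cayley y0 w = 2 * \<i> * of_real y0 / ?d"
    by simp_all
  then show ?thesis using d assms(2) by (simp add: cayley_inv_def)
qed

lemma cayley_cayley_inv:
  assumes "u \<noteq> 1" "y0 > 0" shows "cayley y0 (cayley_inv y0 u) = u"
proof -
  have d: "1 - u \<noteq> 0" using assms by simp
  have "cayley_inv y0 u - \<i> * of_real y0 = (\<i> * of_real y0 * (1 + u) - \<i> * of_real y0 * (1 - u)) / (1 - u)"
    "cayley_inv y0 u + \<i> * of_real y0 = (\<i> * of_real y0 * (1 + u) + \<i> * of_real y0 * (1 - u)) / (1 - u)"
    using d by (simp_all add: cayley_inv_def add_divide_distrib diff_divide_distrib)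
  then have "cayley_inv y0 u - \<i> * of_real y0 = 2 * \<i> * of_real y0 * u / (1 - u)"
    "cayley_inv y0 u + \<i> * of_real y0 = 2 * \<i> * of_real y0 / (1 - u)"
    by (simp_all add: algebra_simps)
  then show ?thesis using d assms(2) by (simp add: cayley_def)
qed

lemma cayley_inv_upper:
  assumes "u \<in> ball 0 1" "y0 > 0" shows "cayley_inv y0 u \<in> upper"
proof -
  have u: "cmod u < 1" "1 - u \<noteq> 0" using assms(1) by auto
  have "cayley_inv y0 u = \<i> * (of_real y0 * ((1 + u) / (1 - u)))" by (simp add: cayley_inv_def)
  moreover have "Im (\<i> * (of_real y0 * X)) = y0 * Re X" for X by simp
  ultimately have "Im (cayley_inv y0 u) = y0 * Re ((1 + u) / (1 - u))" by (simp only:)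
  also have "Re ((1 + u) / (1 - u)) = (1 - (cmod u)\<^sup>2) / (cmod (1 - u))\<^sup>2"
    unfolding Re_divide cmod_power2 by (simp add: power2_eq_square algebra_simps)
  finally show ?thesis using u assms(2) by (simp add: upper_def abs_square_less_1)
qed

lemma cayley_image: "y0 > 0 \<Longrightarrow> cayley y0 ` upper = ball 0 1"
proof (intro equalityI subsetI)
  fix u assume y0: "y0 > 0" and "u \<in> cayley y0 ` upper"
  then obtain w where w: "w \<in> upper" "u = cayley y0 w" by blast
  have "4 * y0 * Im w / (cmod (w + \<i> * of_real y0))\<^sup>2 > 0"
    using w y0 upper_add_nonzero[OF w(1) y0] by (intro divide_pos_pos) (auto simp: upper_def)
  then have "(cmod u)\<^sup>2 < 1" using cayley_norm[OF w(1) y0] w(2) by simp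
  then show "u \<in> ball 0 1" by (simp add: abs_square_less_1)
next
  fix u assume y0: "y0 > 0" and u: "u \<in> ball (0::complex) 1"
  then have "u \<noteq> 1" by auto
  then show "u \<in> cayley y0 ` upper"
    using cayley_cayley_inv[OF _ y0] cayley_inv_upper[OF u y0] by (metis imageI)
qed

lemma integral_disc_power:
  assumes p: "p > (-1::real)"
  shows "integrable lborel (\<lambda>u::complex. indicator (ball 0 1) u * (1 - (cmod u)\<^sup>2) powr p)"
    and "(\<integral>u. indicator (ball 0 1) u * (1 - (cmod u)\<^sup>2) powr p \<partial>(lborel :: complex measure)) = pi / (p + 1)"
proof -
  have "(\<integral>\<^sup>+u. ennreal (indicator (ball 0 1) u * (1 - (cmod u)\<^sup>2) powr p) \<partial>lborel)
      = (\<integral>\<^sup>+u. ennreal (4 powr p) * ennreal (indicator {z. (norm z)\<^sup>2 / 4 < 1/4} u * (1/4 - (norm u)\<^sup>2 / 4) powr p) \<partial>(lborel :: complex measure))"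
  proof (intro nn_integral_cong)
    fix u :: complex
    have "indicator (ball 0 1) u * (1 - (cmod u)\<^sup>2) powr p
      = 4 powr p * (indicator {z. (norm z)\<^sup>2 / 4 < 1/4} u * (1/4 - (norm u)\<^sup>2 / 4) powr p)"
    proof (cases "cmod u < 1")
      case True
      then have lt: "(cmod u)\<^sup>2 < 1" by (simp add: abs_square_less_1)
      have "(1 - (cmod u)\<^sup>2) powr p = (4 * (1/4 - (norm u)\<^sup>2 / 4)) powr p" by (simp add: algebra_simps)
      also have "\<dots> = 4 powr p * (1/4 - (norm u)\<^sup>2 / 4) powr p" using lt by (subst powr_mult) auto
      finally show ?thesis using True lt by simp
    next
      case False
      then have "\<not> (cmod u)\<^sup>2 < 1" by (simp add: abs_square_less_1)
      then show ?thesis using False by simp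
    qed
    then show "ennreal (indicator (ball 0 1) u * (1 - (cmod u)\<^sup>2) powr p)
      = ennreal (4 powr p) * ennreal (indicator {z. (norm z)\<^sup>2 / 4 < 1/4} u * (1/4 - (norm u)\<^sup>2 / 4) powr p)"
      by (simp flip: ennreal_mult)
  qed
  also have "\<dots> = ennreal (4 powr p) * ennreal ((4 * pi) ^ 1 * Gamma (p + 1) / Gamma (real 1 + p + 1) * (1/4) powr (real 1 + p))"
    using nn_integral_truncated_power[OF p, of "1/4" 1, where 'a = complex]
    by (subst nn_integral_cmult) (auto simp: DIM_complex)
  also have "\<dots> = ennreal (4 powr p * (4 * pi * Gamma (p + 1) / Gamma (1 + p + 1) * (1/4) powr (1 + p)))"
    by (subst ennreal_mult'[symmetric]) (simp_all add: mult.assoc)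
  also have "4 powr p * (4 * pi * Gamma (p + 1) / Gamma (1 + p + 1) * (1/4) powr (1 + p)) = pi / (p + 1)"
  proof -
    have G: "Gamma (1 + p + 1) = (p + 1) * Gamma (p + 1)" using Gamma_plus1[of "p + 1"] p by (simp add: add_ac nonpos_Ints_def)
    have "Gamma (p + 1) > 0" using p by (intro Gamma_real_pos) simp
    then have "Gamma (p + 1) \<noteq> 0" by linarith
    moreover have "(1/4::real) powr (1 + p) = 1 / (4 * 4 powr p)" by (simp add: powr_divide powr_add)
    ultimately show ?thesis unfolding G using p by simp
  qed
  finally have nn: "(\<integral>\<^sup>+u. ennreal (indicator (ball 0 1) u * (1 - (cmod u)\<^sup>2) powr p) \<partial>(lborel :: complex measure)) = ennreal (pi / (p + 1))" .
  have [measurable]: "ball (0::complex) 1 \<in> sets borel" by simp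
  have meas: "(\<lambda>u::complex. indicator (ball 0 1) u * (1 - (cmod u)\<^sup>2) powr p) \<in> borel_measurable borel"
    by measurable
  then show int: "integrable lborel (\<lambda>u::complex. indicator (ball 0 1) u * (1 - (cmod u)\<^sup>2) powr p)"
    by (intro integrableI_nonneg) (use nn in auto)
  show "(\<integral>u. indicator (ball 0 1) u * (1 - (cmod u)\<^sup>2) powr p \<partial>(lborel :: complex measure)) = pi / (p + 1)"
    using nn p meas by (subst integral_eq_nn_integral) auto
qed

text \<open>
  The weight is a power of the hyperbolic distance to \<open>\<i> y\<^sub>0\<close> times the density that the Cayley
  transform turns into Lebesgue measure on the disc.  There the integral is an average over
  rotations about the centre.
\<close>

lemma upper_mean_value:
  assumes g: "g holomorphic_on upper" and y0: "y0 > 0" and p: "p > -1"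
    and int: "set_integrable lborel upper (\<lambda>w. ((Im w / (cmod (w + \<i> * of_real y0))\<^sup>2) powr p / cmod (w + \<i> * of_real y0) ^ 4) *\<^sub>R g w)"
  shows "(LINT w:upper|lborel. ((Im w / (cmod (w + \<i> * of_real y0))\<^sup>2) powr p / cmod (w + \<i> * of_real y0) ^ 4) *\<^sub>R g w)
    = (pi / (p + 1) / ((4 * y0) powr p * (4 * y0\<^sup>2))) *\<^sub>R g (\<i> * of_real y0)"
proof -
  define c where "c = 1 / ((4 * y0) powr p * (4 * y0\<^sup>2))"
  define G where "G u = indicator (ball 0 1) u *\<^sub>R g (cayley_inv y0 u)" for u
  define W where "W u = indicator (ball 0 1) u * (1 - (cmod u)\<^sup>2) powr p" for u :: complex
  define h where "h u = c *\<^sub>R (W u *\<^sub>R G u)" for u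
  define C' where "C' w = 2 * \<i> * of_real y0 / (w + \<i> * of_real y0)\<^sup>2" for w
  have C': "(cayley y0 has_field_derivative C' w) (at w)" if "w \<in> upper" for w
    unfolding cayley_def[abs_def] C'_def using upper_add_nonzero[OF that y0]
    by (auto intro!: derivative_eq_intros simp: power2_eq_square field_simps)
  have inj: "inj_on (cayley y0) upper" by (metis cayley_inv_cayley[OF _ y0] inj_on_inverseI)
  have holinv: "(\<lambda>u. g (cayley_inv y0 u)) holomorphic_on ball 0 1"
  proof -
    have "cayley_inv y0 holomorphic_on ball 0 1"
      unfolding cayley_inv_def[abs_def] by (intro holomorphic_intros) auto
    moreover have "cayley_inv y0 ` ball 0 1 \<subseteq> upper" using cayley_inv_upper[OF _ y0] by blast
    ultimately show ?thesis using holomorphic_on_compose_gen[OF _ g] by (simp add: o_def)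
  qed
  have Gm[measurable]: "G \<in> borel_measurable borel"
    unfolding G_def by (rule borel_measurable_continuous_on_indicator) (auto intro: holomorphic_on_imp_continuous_on holinv)
  have [measurable]: "ball (0::complex) 1 \<in> sets borel" by simp
  have Wm[measurable]: "W \<in> borel_measurable borel" unfolding W_def by measurable
  have hm: "h \<in> borel_measurable borel" unfolding h_def by measurable
  have key: "(cmod (C' w))\<^sup>2 *\<^sub>R h (cayley y0 w)
      = ((Im w / (cmod (w + \<i> * of_real y0))\<^sup>2) powr p / cmod (w + \<i> * of_real y0) ^ 4) *\<^sub>R g w" if w: "w \<in> upper" for w
  proof -
    let ?d = "cmod (w + \<i> * of_real y0)"
    have d: "?d > 0" using upper_add_nonzero[OF w y0] by simp
    have in_ball: "cayley y0 w \<in> ball 0 1" using cayley_image[OF y0] w by blast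
    have "(1 - (cmod (cayley y0 w))\<^sup>2) powr p = (4 * y0) powr p * (Im w / ?d\<^sup>2) powr p"
      unfolding cayley_norm[OF w y0] using y0 w d by (subst powr_mult[symmetric]) (auto simp: upper_def)
    moreover have "(cmod (C' w))\<^sup>2 = 4 * y0\<^sup>2 / ?d ^ 4"
      using y0 by (simp add: C'_def norm_divide norm_mult norm_power power_divide power_mult_distrib flip: power_mult)
    ultimately have "(cmod (C' w))\<^sup>2 * (c * W (cayley y0 w)) = (Im w / ?d\<^sup>2) powr p / ?d ^ 4"
      using y0 in_ball by (simp add: c_def W_def)
    moreover have "G (cayley y0 w) = g w" using in_ball by (simp add: G_def cayley_inv_cayley[OF w y0])
    ultimately show ?thesis by (simp add: h_def)
  qed
  have int': "set_integrable lborel upper (\<lambda>w. (cmod (C' w))\<^sup>2 *\<^sub>R h (cayley y0 w))"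
    using int by (subst set_integrable_cong[OF refl refl key]) auto
  have m1: "(\<lambda>w. indicator upper w *\<^sub>R ((cmod (C' w))\<^sup>2 *\<^sub>R h (cayley y0 w))) \<in> borel_measurable borel"
    using int' by (simp add: set_integrable_def borel_measurable_integrable)
  have m2: "(\<lambda>u. indicator (cayley y0 ` upper) u *\<^sub>R h u) \<in> borel_measurable borel"
    unfolding cayley_image[OF y0] using hm by measurable
  note cv = holomorphic_change_of_variables[OF open_upper C' inj m1 m2 int', unfolded cayley_image[OF y0]]
  have hind: "indicator (ball 0 1) u *\<^sub>R h u = h u" for u by (simp add: h_def W_def indicator_def)
  have inth: "integrable lborel h" using cv(1) by (simp add: set_integrable_def hind)
  have c0: "c > 0" using y0 by (simp add: c_def)
  have i1: "integrable lborel (\<lambda>u. W u *\<^sub>R G u)"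
  proof -
    have "integrable lborel (\<lambda>u. (1 / c) *\<^sub>R h u)" using inth by simp
    then show ?thesis using c0 by (simp add: h_def)
  qed
  have i2: "integrable lborel W" unfolding W_def by (rule integral_disc_power(1)[OF p])
  have i3: "(LINT t:{0..1}|lborel. G (cplx.rot t * u)) = g (\<i> * of_real y0)" if "W u \<noteq> 0" for u
  proof -
    have u: "u \<in> ball 0 1" using that by (auto simp: W_def indicator_def split: if_splits)
    have "cplx.hol_on (ball 0 1) (\<lambda>u. g (cayley_inv y0 u))"
      unfolding cplx.hol_on_def
    proof
      fix x assume "x \<in> ball (0::complex) 1"
      then obtain D where "((\<lambda>u. g (cayley_inv y0 u)) has_field_derivative D) (at x)"
        using holinv by (metis holomorphic_derivI open_ball)
      then show "\<exists>D. ((\<lambda>u. g (cayley_inv y0 u)) has_derivative D) (at x) \<and> (\<forall>c v. D (c * v) = c * D v)"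
        by (auto simp: has_field_derivative_def intro!: exI[of _ "(*) D"])
    qed
    from cplx.hol_on_cong[OF this] have "cplx.hol_on (ball 0 1) G" by (simp add: G_def)
    moreover have "\<zeta> * u \<in> ball 0 1" if "cmod \<zeta> \<le> 1" for \<zeta>
    proof -
      have "cmod \<zeta> * cmod u \<le> 1 * cmod u" using that by (intro mult_right_mono) auto
      then show ?thesis using u by (simp add: norm_mult)
    qed
    ultimately have "(LINT t:{0..1}|lborel. G (cplx.rot t * u)) = G 0"
      by (intro cplx.circle_mean) auto
    then show ?thesis by (simp add: G_def cayley_inv_def)
  qed
  have "W (c * v) = W v" if "cmod c = 1" for c v using that by (simp add: W_def norm_mult indicator_def)
  then have mean: "(\<integral>u. W u *\<^sub>R G u \<partial>lborel) = (\<integral>u. W u \<partial>lborel) *\<^sub>R g (\<i> * of_real y0)"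
    by (rule cplx.rotation_mean[OF Gm Wm _ i1 i2 i3])
  have "(LINT w:upper|lborel. ((Im w / (cmod (w + \<i> * of_real y0))\<^sup>2) powr p / cmod (w + \<i> * of_real y0) ^ 4) *\<^sub>R g w)
      = (LINT w:upper|lborel. (cmod (C' w))\<^sup>2 *\<^sub>R h (cayley y0 w))"
    by (rule set_lebesgue_integral_cong) (use key in \<open>auto simp: open_upper\<close>)
  also have "\<dots> = (\<integral>u. h u \<partial>lborel)"
    using cv(2) unfolding set_lebesgue_integral_def hind by (rule sym)
  also have "\<dots> = c *\<^sub>R ((\<integral>u. W u \<partial>lborel) *\<^sub>R g (\<i> * of_real y0))"
    unfolding h_def by (simp only: integral_scaleR_right mean)
  also have "(\<integral>u. W u \<partial>lborel) = pi / (p + 1)" unfolding W_def by (rule integral_disc_power(2)[OF p])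
  finally show ?thesis by (simp add: c_def)
qed

lemma upper_weight_integrable:
  assumes y0: "y0 > 0" and p: "p > -1"
  shows "set_integrable lborel upper (\<lambda>w. complex_of_real ((Im w / (cmod (w + \<i> * of_real y0))\<^sup>2) powr p / cmod (w + \<i> * of_real y0) ^ 4))"
proof -
  define h where "h w = complex_of_real ((Im w / (cmod (w + \<i> * of_real y0))\<^sup>2) powr p / cmod (w + \<i> * of_real y0) ^ 4)" for w
  define C' where "C' u = 2 * \<i> * of_real y0 / (1 - u)\<^sup>2" for u
  have image: "cayley_inv y0 ` ball 0 1 = upper"
  proof (intro equalityI subsetI)
    fix w assume w: "w \<in> upper"
    then have "cayley y0 w \<in> ball 0 1" using cayley_image[OF y0] by blast
    then show "w \<in> cayley_inv y0 ` ball 0 1" using cayley_inv_cayley[OF w y0] by (metis imageI)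
  qed (use cayley_inv_upper[OF _ y0] in blast)
  have ne: "u \<noteq> 1" if "u \<in> ball (0::complex) 1" for u using that by auto
  have C': "(cayley_inv y0 has_field_derivative C' u) (at u)" if "u \<in> ball 0 1" for u
    unfolding cayley_inv_def[abs_def] C'_def using ne[OF that]
    by (auto intro!: derivative_eq_intros simp: power2_eq_square field_simps)
  have inj: "inj_on (cayley_inv y0) (ball 0 1)"
    using cayley_cayley_inv[OF ne y0] by (metis inj_on_inverseI)
  have hm[measurable]: "h \<in> borel_measurable borel" unfolding h_def by measurable
  have [measurable]: "ball (0::complex) 1 \<in> sets borel" "upper \<in> sets borel" using open_upper by auto
  have [measurable]: "cayley_inv y0 \<in> borel_measurable borel" unfolding cayley_inv_def by measurable
  have [measurable]: "C' \<in> borel_measurable borel" unfolding C'_def by measurable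
  have key: "(cmod (C' u))\<^sup>2 *\<^sub>R h (cayley_inv y0 u)
      = of_real (1 / ((4 * y0) powr p * (4 * y0\<^sup>2)) * (1 - (cmod u)\<^sup>2) powr p)" if u: "u \<in> ball 0 1" for u
  proof -
    let ?w = "cayley_inv y0 u"
    have w: "?w \<in> upper" by (rule cayley_inv_upper[OF u y0])
    have u1: "u \<noteq> 1" "cmod (1 - u) > 0" using ne[OF u] by auto
    have lt: "(cmod u)\<^sup>2 < 1" using u by (simp add: abs_square_less_1)
    have d: "?w + \<i> * of_real y0 = 2 * \<i> * of_real y0 / (1 - u)"
      using u1 by (simp add: cayley_inv_def field_simps)
    have d4: "cmod (?w + \<i> * of_real y0) ^ 4 = (4 * y0\<^sup>2) * (4 * y0\<^sup>2) / cmod (1 - u) ^ 4"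
      unfolding d using y0 by (simp add: norm_divide norm_mult power_divide power_mult_distrib flip: power_add)
    have c2: "(cmod (C' u))\<^sup>2 = 4 * y0\<^sup>2 / cmod (1 - u) ^ 4"
      using y0 by (simp add: C'_def norm_divide norm_mult norm_power power_divide power_mult_distrib flip: power_mult)
    have "1 - (cmod u)\<^sup>2 = 4 * y0 * (Im ?w / (cmod (?w + \<i> * of_real y0))\<^sup>2)"
      using cayley_norm[OF w y0] cayley_cayley_inv[OF u1(1) y0] by simp
    then have "Im ?w / (cmod (?w + \<i> * of_real y0))\<^sup>2 = (1 - (cmod u)\<^sup>2) / (4 * y0)"
      using y0 by (simp add: field_simps)
    then have e: "(Im ?w / (cmod (?w + \<i> * of_real y0))\<^sup>2) powr p = (1 - (cmod u)\<^sup>2) powr p / (4 * y0) powr p"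
      using lt y0 by (simp add: powr_divide)
    have "(cmod (C' u))\<^sup>2 * ((Im ?w / (cmod (?w + \<i> * of_real y0))\<^sup>2) powr p / cmod (?w + \<i> * of_real y0) ^ 4)
        = 1 / ((4 * y0) powr p * (4 * y0\<^sup>2)) * (1 - (cmod u)\<^sup>2) powr p"
    proof -
      have gen: "(B / A) * ((P / Q) / (B * B / A)) = 1 / (Q * B) * P" if "A \<noteq> 0" "B \<noteq> 0" for A B P Q :: real
        using that by (simp add: field_simps)
      show ?thesis
        unfolding d4 c2 e by (rule gen) (use y0 u1 in simp_all)
    qed
    then show ?thesis unfolding h_def scaleR_conv_of_real of_real_mult[symmetric] by simp
  qed
  have "integrable lborel (\<lambda>u::complex. complex_of_real (1 / ((4 * y0) powr p * (4 * y0\<^sup>2)) * (indicator (ball 0 1) u * (1 - (cmod u)\<^sup>2) powr p)))"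
    unfolding complex_of_real_integrable_eq using integral_disc_power(1)[OF p] by (intro integrable_mult_right)
  moreover have "indicator (ball 0 1) u *\<^sub>R ((cmod (C' u))\<^sup>2 *\<^sub>R h (cayley_inv y0 u))
      = complex_of_real (1 / ((4 * y0) powr p * (4 * y0\<^sup>2)) * (indicator (ball 0 1) u * (1 - (cmod u)\<^sup>2) powr p))" for u
    using key[of u] by (cases "u \<in> ball 0 1") (simp_all del: mem_ball)
  ultimately have int: "set_integrable lborel (ball 0 1) (\<lambda>u. (cmod (C' u))\<^sup>2 *\<^sub>R h (cayley_inv y0 u))"
    unfolding set_integrable_def by simp
  have "set_integrable lborel (cayley_inv y0 ` ball 0 1) h"
    by (rule holomorphic_change_of_variables(1)[OF open_ball C' inj _ _ int]) (unfold image, measurable)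
  then show ?thesis unfolding image h_def .
qed

section \<open>A complex Laplace transform\<close>

text \<open>The integral is known for real \<open>p\<close>, and both sides are holomorphic in \<open>p\<close>.\<close>

lemma
  assumes s: "s > 0" and x: "x > 0"
  shows Gamma_Laplace_integrable: "integrable lborel (\<lambda>l::real. indicator {..<0} l * (\<bar>l\<bar> powr (s - 1) * exp (l * x)))"
    and Gamma_Laplace_real: "(\<integral>l. indicator {..<0} l * (\<bar>l\<bar> powr (s - 1) * exp (l * x)) \<partial>lborel) = Gamma s / x powr s"
proof -
  let ?f = "\<lambda>l::real. indicator {..<0} l * (\<bar>l\<bar> powr (s - 1) * exp (l * x))"
  have "(\<integral>\<^sup>+l. ennreal (?f l) \<partial>lborel) = (\<integral>\<^sup>+l. ennreal (?f (- l)) \<partial>lborel)"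
    by (rule nn_integral_lborel_isometry[symmetric]) (auto simp: linear_uminus)
  also have "\<dots> = (\<integral>\<^sup>+t. ennreal (indicator {0<..} t * (t powr (s - 1) * exp (- x * t))) \<partial>lborel)"
    by (intro nn_integral_cong) (auto simp: indicator_def mult.commute)
  also have "\<dots> = ennreal (Gamma s / x powr s)" using nn_integral_Gamma[of "s - 1" x] s x by simp
  finally have nn: "(\<integral>\<^sup>+l. ennreal (?f l) \<partial>lborel) = ennreal (Gamma s / x powr s)" .
  have m: "?f \<in> borel_measurable borel" by measurable
  then show "integrable lborel ?f" by (intro integrableI_nonneg) (use nn in auto)
  show "(\<integral>l. ?f l \<partial>lborel) = Gamma s / x powr s"
    using m nn s Gamma_real_pos[OF s] by (subst integral_eq_nn_integral) (auto simp: less_imp_le)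
qed

definition half_plane :: "complex set" where "half_plane = {p. Re p > 0}"

lemma
  assumes s: "s > 0" and p: "p \<in> half_plane"
  shows Gamma_Laplace_complex_integrable:
      "integrable lborel (\<lambda>l::real. indicator {..<0} l *\<^sub>R (\<bar>l\<bar> powr (s - 1) *\<^sub>R exp (of_real l * p)))" (is ?int)
    and Gamma_Laplace_complex:
      "(\<integral>l. indicator {..<0} l *\<^sub>R (\<bar>l\<bar> powr (s - 1) *\<^sub>R exp (of_real l * p)) \<partial>lborel)
        = of_real (Gamma s) * exp (- of_real s * Ln p)"
proof -
  define f where "f p l = indicator {..<0} l *\<^sub>R (\<bar>l\<bar> powr (s - 1) *\<^sub>R exp (of_real l * p))" for p :: complex and l :: real
  define I where "I p = (\<integral>l. f p l \<partial>lborel)" for p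
  have op: "open half_plane" unfolding half_plane_def by (rule open_halfspace_Re_gt)
  have conn: "connected half_plane" unfolding half_plane_def by (intro convex_connected convex_halfspace_Re_gt)
  have fm[measurable]: "f p \<in> borel_measurable borel" for p unfolding f_def by measurable
  have nf: "cmod (f p l) = indicator {..<0} l * (\<bar>l\<bar> powr (s - 1) * exp (l * Re p))" for p l
    by (simp add: f_def)
  have int: "integrable lborel (f p)" if "p \<in> half_plane" for p
    by (rule Bochner_Integration.integrable_bound[OF Gamma_Laplace_integrable[OF s, of "Re p"]])
       (use that in \<open>auto simp: nf half_plane_def\<close>)
  show ?int using int[OF p] by (simp add: f_def[abs_def])
  have hol: "I holomorphic_on half_plane"
    unfolding holomorphic_on_def
  proof
    fix q assume q: "q \<in> half_plane"
    define r where "r = Re q / 2"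
    have r: "r > 0" using q by (simp add: r_def half_plane_def)
    have "\<exists>D. ((\<lambda>p. \<integral>l. f p l \<partial>lborel) has_derivative D) (at q) \<and> (\<forall>c v. D (c * v) = c * D v)"
    proof (rule cplx.hol_integral[OF r, where B = "\<lambda>l. indicator {..<0} l * (\<bar>l\<bar> powr (s - 1) * exp (l * r))"])
      show "cplx.hol_on (ball q r) (\<lambda>p. f p l)" for l
      proof -
        have "cplx.hol_on (ball q r) (\<lambda>p. p)" by (rule cplx.hol_on_linear[OF bounded_linear_ident]) simp
        from cplx.hol_on_exp[OF cplx.hol_on_mult[OF cplx.hol_on_const this]]
        show ?thesis unfolding f_def scaleR_conv_of_real by (intro cplx.hol_on_mult[OF cplx.hol_on_const])
      qed
      show "integrable lborel (\<lambda>l::real. indicator {..<0} l * (\<bar>l\<bar> powr (s - 1) * exp (l * r)))"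
        by (rule Gamma_Laplace_integrable[OF s r])
      fix p l assume "p \<in> ball q r"
      then have "cmod (q - p) < r" by (simp add: dist_norm)
      then have "Re p \<ge> r" using abs_Re_le_cmod[of "q - p"] by (simp add: r_def)
      then show "cmod (f p l) \<le> indicator {..<0} l * (\<bar>l\<bar> powr (s - 1) * exp (l * r))"
        unfolding nf by (auto simp: indicator_def intro!: mult_left_mono)
    qed measurable
    then obtain D where D: "(I has_derivative D) (at q)" "\<forall>c v. D (c * v) = c * D v" by (auto simp: I_def[abs_def])
    have "D = (*) (D 1)"
    proof
      fix v
      have "D (v * 1) = v * D 1" using D(2) by blast
      then show "D v = D 1 * v" by (simp only: mult_1_right mult.commute[of "D 1"])
    qed
    then have "(I has_field_derivative D 1) (at q)" using D(1) by (simp add: has_field_derivative_def)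
    then show "I field_differentiable at q within half_plane"
      using field_differentiable_at_within field_differentiable_def by blast
  qed
  have nonpos: "q \<notin> \<real>\<^sub>\<le>\<^sub>0" if "q \<in> half_plane" for q
    using that by (auto simp: half_plane_def complex_nonpos_Reals_iff)
  have hol2: "(\<lambda>p. of_real (Gamma s) * exp (- of_real s * Ln p)) holomorphic_on half_plane"
    by (intro holomorphic_intros) (use nonpos in auto)
  have real: "I (of_real x) - of_real (Gamma s) * exp (- of_real s * Ln (of_real x)) = 0" if x: "x > 0" for x :: real
  proof -
    have "I (of_real x) = (\<integral>l. complex_of_real (indicator {..<0} l * (\<bar>l\<bar> powr (s - 1) * exp (l * x))) \<partial>lborel)"
      unfolding I_def f_def
    proof (rule Bochner_Integration.integral_cong[OF refl])
      fix l :: real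
      have "exp (of_real l * of_real x) = complex_of_real (exp (l * x))" by (metis exp_of_real of_real_mult)
      then show "indicator {..<0} l *\<^sub>R (\<bar>l\<bar> powr (s - 1) *\<^sub>R exp (of_real l * of_real x))
          = complex_of_real (indicator {..<0} l * (\<bar>l\<bar> powr (s - 1) * exp (l * x)))"
        by (simp only: scaleR_conv_of_real of_real_mult)
    qed
    also have "\<dots> = of_real (Gamma s / x powr s)"
      by (simp only: integral_complex_of_real Gamma_Laplace_real[OF s x])
    also have "Gamma s / x powr s = Gamma s * exp (- s * ln x)"
      using x by (simp add: powr_def exp_minus divide_inverse)
    also have "complex_of_real (Gamma s * exp (- s * ln x)) = of_real (Gamma s) * exp (- of_real s * Ln (of_real x))"
    proof -
      have "exp (- of_real s * Ln (of_real x)) = exp (complex_of_real (- s * ln x))"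
        using x by (simp add: Ln_of_real)
      also have "\<dots> = of_real (exp (- s * ln x))" by (rule exp_of_real)
      finally show ?thesis by simp
    qed
    finally show ?thesis by simp
  qed
  have "I p - of_real (Gamma s) * exp (- of_real s * Ln p) = 0"
  proof (rule analytic_continuation[where f = "\<lambda>p. I p - of_real (Gamma s) * exp (- of_real s * Ln p)"
        and w = p and S = half_plane and U = "complex_of_real ` {0<..}" and \<xi> = 1])
    show "(\<lambda>p. I p - of_real (Gamma s) * exp (- of_real s * Ln p)) holomorphic_on half_plane"
      by (intro holomorphic_on_diff hol hol2)
    show "1 islimpt complex_of_real ` {0<..}"
      unfolding islimpt_approachable
    proof (intro allI impI)
      fix e :: real assume "e > 0"
      moreover have "complex_of_real (1 + e / 2) \<in> complex_of_real ` {0<..}" using \<open>e > 0\<close> by (intro imageI) simp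
      ultimately show "\<exists>x'\<in>complex_of_real ` {0<..}. x' \<noteq> 1 \<and> dist x' 1 < e"
        by (intro bexI[of _ "complex_of_real (1 + e / 2)"]) (simp_all add: dist_norm)
    qed
    show "complex_of_real ` {0<..} \<subseteq> half_plane" by (auto simp: half_plane_def)
    show "I z - of_real (Gamma s) * exp (- of_real s * Ln z) = 0" if "z \<in> complex_of_real ` {0<..}" for z
      using that real by blast
    show "1 \<in> half_plane" by (simp add: half_plane_def)
  qed (rule op conn p)+
  then show "(\<integral>l. indicator {..<0} l *\<^sub>R (\<bar>l\<bar> powr (s - 1) *\<^sub>R exp (of_real l * p)) \<partial>lborel)
        = of_real (Gamma s) * exp (- of_real s * Ln p)" by (simp add: I_def f_def)
qed

section \<open>The two measure spaces and the Bergman kernel\<close>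

lemma open_siegel: "open siegel_space"
  unfolding siegel_space_def by (intro open_Collect_less continuous_intros) auto

lemma siegel_rho_pos: "\<zeta> \<in> siegel_space \<Longrightarrow> siegel_rho \<zeta> > 0"
  by (simp add: siegel_space_def siegel_rho_def)

lemma siegel_measurable[measurable]: "siegel_space \<in> sets borel"
  by (rule borel_open[OF open_siegel])

lemma siegel_rho_measurable[measurable]: "siegel_rho \<in> borel_measurable borel"
  unfolding siegel_rho_def by (intro borel_measurable_continuous_onI continuous_intros) auto

definition siegel_measure :: "real \<Rightarrow> ((complex ^ 'n) \<times> complex) measure" where
  "siegel_measure \<nu> = density (restrict_space lborel siegel_space) (\<lambda>\<zeta>. ennreal (siegel_rho \<zeta> powr \<nu>))"

lemma space_siegel_measure[simp]: "space (siegel_measure \<nu>) = siegel_space"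
  by (simp add: siegel_measure_def space_restrict_space)

lemma siegel_measureI: "f \<in> borel_measurable borel \<Longrightarrow> f \<in> borel_measurable (siegel_measure \<nu>)"
  by (simp add: siegel_measure_def measurable_restrict_space1)

lemma siegel_measure_iff:
  fixes f :: "_ \<Rightarrow> 'b::{banach, second_countable_topology}"
  shows "f \<in> borel_measurable (siegel_measure \<nu>) \<longleftrightarrow> (\<lambda>\<zeta>. indicator siegel_space \<zeta> *\<^sub>R f \<zeta>) \<in> borel_measurable borel"
  by (simp add: siegel_measure_def borel_measurable_restrict_space_iff)

lemma
  fixes f :: "(complex ^ 'n) \<times> complex \<Rightarrow> 'b::{banach, second_countable_topology}"
  assumes f: "f \<in> borel_measurable (siegel_measure \<nu>)"
  shows integrable_siegel_measure: "integrable (siegel_measure \<nu>) f \<longleftrightarrow> set_integrable lborel siegel_space (\<lambda>\<zeta>. siegel_rho \<zeta> powr \<nu> *\<^sub>R f \<zeta>)"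
    and integral_siegel_measure: "(\<integral>\<zeta>. f \<zeta> \<partial>siegel_measure \<nu>) = (LINT \<zeta>:siegel_space|lborel. siegel_rho \<zeta> powr \<nu> *\<^sub>R f \<zeta>)"
proof -
  have [measurable]: "f \<in> borel_measurable (restrict_space lborel siegel_space)"
    using f by (simp add: siegel_measure_def)
  have [measurable]: "(\<lambda>\<zeta>. siegel_rho \<zeta> powr \<nu>) \<in> borel_measurable (restrict_space lborel (siegel_space :: ((complex ^ 'n) \<times> complex) set))"
    by (rule measurable_restrict_space1) measurable
  show "integrable (siegel_measure \<nu>) f \<longleftrightarrow> set_integrable lborel siegel_space (\<lambda>\<zeta>. siegel_rho \<zeta> powr \<nu> *\<^sub>R f \<zeta>)"
    unfolding siegel_measure_def set_integrable_def
    by (subst integrable_density) (simp_all add: integrable_restrict_space)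
  show "(\<integral>\<zeta>. f \<zeta> \<partial>siegel_measure \<nu>) = (LINT \<zeta>:siegel_space|lborel. siegel_rho \<zeta> powr \<nu> *\<^sub>R f \<zeta>)"
    unfolding siegel_measure_def set_lebesgue_integral_def
    by (subst integral_density) (simp_all add: integral_restrict_space)
qed

lemma sigma_finite_siegel_measure: "sigma_finite_measure (siegel_measure \<nu> :: ((complex ^ 'n) \<times> complex) measure)"
proof -
  interpret R: sigma_finite_measure "restrict_space lborel (siegel_space :: ((complex ^ 'n) \<times> complex) set)"
    by (rule sigma_finite_measure_restrict_space) (auto intro: sigma_finite_lborel)
  have "(\<lambda>\<zeta>. ennreal (siegel_rho \<zeta> powr \<nu>)) \<in> borel_measurable (restrict_space lborel (siegel_space :: ((complex ^ 'n) \<times> complex) set))"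
    by (rule measurable_restrict_space1) measurable
  from R.sigma_finite_iff_density_finite[OF this] show ?thesis by (simp add: siegel_measure_def)
qed

definition spectral_weight :: "real \<Rightarrow> nat \<Rightarrow> real \<Rightarrow> real" where
  "spectral_weight \<nu> n l = indicator {..<0} l * (Gamma (\<nu> + 1) / 2 powr (\<nu> + 1) / (2 * pi) ^ (n + 1) * \<bar>l\<bar> powr (real n - (\<nu> + 1)))"

lemma spectral_weight_measurable[measurable]: "spectral_weight \<nu> n \<in> borel_measurable borel"
  unfolding spectral_weight_def by measurable

lemma spectral_weight_nonneg: "\<nu> > -1 \<Longrightarrow> 0 \<le> spectral_weight \<nu> n l"
  using Gamma_real_pos[of "\<nu> + 1"] by (simp add: spectral_weight_def less_imp_le)

definition frequency_measure :: "real \<Rightarrow> nat \<Rightarrow> real measure" where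
  "frequency_measure \<nu> n = density lborel (\<lambda>l. ennreal (spectral_weight \<nu> n l))"

definition spectral_measure :: "real \<Rightarrow> (('n::finite \<Rightarrow> nat) \<times> real) measure" where
  "spectral_measure \<nu> = count_space UNIV \<Otimes>\<^sub>M frequency_measure \<nu> CARD('n)"

lemma sets_frequency_measure[simp, measurable_cong]: "sets (frequency_measure \<nu> n) = sets borel"
  by (simp add: frequency_measure_def)

lemma space_frequency_measure[simp]: "space (frequency_measure \<nu> n) = UNIV"
  by (simp add: frequency_measure_def)

lemma space_spectral_measure[simp]: "space (spectral_measure \<nu>) = UNIV"
  by (simp add: spectral_measure_def space_pair_measure)

lemma sigma_finite_frequency_measure: "sigma_finite_measure (frequency_measure \<nu> n)"
  unfolding frequency_measure_def
  by (subst sigma_finite_measure.sigma_finite_iff_density_finite[OF sigma_finite_lborel]) auto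

lemma pair_sigma_finite_spectral:
  "pair_sigma_finite (count_space (UNIV :: ('n::finite \<Rightarrow> nat) set)) (frequency_measure \<nu> k)"
  by (intro pair_sigma_finite.intro sigma_finite_measure_count_space_countable sigma_finite_frequency_measure) simp

lemma sigma_finite_spectral_measure: "sigma_finite_measure (spectral_measure \<nu> :: (('n::finite \<Rightarrow> nat) \<times> real) measure)"
proof -
  interpret pair_sigma_finite "count_space (UNIV :: ('n \<Rightarrow> nat) set)" "frequency_measure \<nu> CARD('n)"
    by (rule pair_sigma_finite_spectral)
  show ?thesis unfolding spectral_measure_def ..
qed

lemma spectral_measurableI:
  fixes f :: "('n::finite \<Rightarrow> nat) \<times> real \<Rightarrow> 'b::topological_space"
  assumes "\<And>\<alpha>. (\<lambda>l. f (\<alpha>, l)) \<in> borel_measurable borel"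
  shows "f \<in> borel_measurable (spectral_measure \<nu>)"
  unfolding spectral_measure_def by (rule measurable_pair_measure_countable1) (use assms in \<open>auto cong: measurable_cong_sets\<close>)

lemma spectral_measurableD:
  fixes f :: "('n::finite \<Rightarrow> nat) \<times> real \<Rightarrow> 'b::topological_space"
  assumes "f \<in> borel_measurable (spectral_measure \<nu>)"
  shows "(\<lambda>l. f (\<alpha>, l)) \<in> borel_measurable borel"
  using measurable_Pair2[OF assms[unfolded spectral_measure_def], of \<alpha>] by (simp cong: measurable_cong_sets)

lemma fock_basis_frequency_measurable[measurable]: "(\<lambda>l. fock_basis \<bar>l\<bar> \<alpha> z) \<in> borel_measurable borel"
  unfolding fock_basis_def by measurable

definition siegel_feature :: "real \<Rightarrow> (complex ^ 'n) \<times> complex \<Rightarrow> ('n \<Rightarrow> nat) \<times> real \<Rightarrow> complex" where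
  "siegel_feature \<nu> \<zeta> y = of_real (2 powr (\<nu> + 1) / Gamma (\<nu> + 1) * \<bar>snd y\<bar> powr (\<nu> + 1)) *
     cnj (exp (- \<i> * of_real (snd y) * snd \<zeta>) * fock_basis \<bar>snd y\<bar> (fst y) (fst \<zeta>))"

lemma monomial_measurable[measurable]: "monomial \<alpha> \<in> borel_measurable borel"
  by (rule entire_measurable) (simp add: entire_iff_hol_on entire_monomial)

lemma siegel_feature_measurable:
  "(\<lambda>(\<zeta>, y). siegel_feature \<nu> \<zeta> y) \<in> borel_measurable (siegel_measure \<nu> \<Otimes>\<^sub>M (spectral_measure \<nu> :: (('n::finite \<Rightarrow> nat) \<times> real) measure))"
proof -
  let ?P = "siegel_measure \<nu> \<Otimes>\<^sub>M (spectral_measure \<nu> :: (('n \<Rightarrow> nat) \<times> real) measure)"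
  have z: "(\<lambda>x. fst (fst x)) \<in> borel_measurable ?P"
    by (rule measurable_compose[OF measurable_fst siegel_measureI]) (intro borel_measurable_continuous_onI continuous_intros)
  have w: "(\<lambda>x. snd (fst x)) \<in> borel_measurable ?P"
    by (rule measurable_compose[OF measurable_fst siegel_measureI]) (intro borel_measurable_continuous_onI continuous_intros)
  have l: "(\<lambda>x. snd (snd x)) \<in> borel_measurable ?P"
    unfolding spectral_measure_def by measurable
  have a: "(\<lambda>x. fst (snd x)) \<in> measurable ?P (count_space UNIV)"
    unfolding spectral_measure_def by measurable
  note [measurable] = w l measurable_compose[OF z monomial_measurable]
  have "(\<lambda>x. siegel_feature \<nu> (fst x) (\<alpha>, snd (snd x))) \<in> borel_measurable ?P" for \<alpha>
    unfolding siegel_feature_def fock_basis_def fst_conv snd_conv by measurable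
  from measurable_compose_countable[where f = "\<lambda>\<alpha> x. siegel_feature \<nu> (fst x) (\<alpha>, snd (snd x))", OF this a] show ?thesis by (simp add: split_beta')
qed

definition siegel_pairing :: "(complex ^ 'n) \<times> complex \<Rightarrow> (complex ^ 'n) \<times> complex \<Rightarrow> complex" where
  "siegel_pairing \<zeta> \<eta> = - \<i> * (snd \<zeta> - cnj (snd \<eta>)) - cdot (fst \<zeta>) (vcnj (fst \<eta>)) / 2"

lemma Re_siegel_pairing:
  "Re (siegel_pairing \<zeta> \<eta>) = siegel_rho \<zeta> + siegel_rho \<eta> + (norm (fst \<zeta> - fst \<eta>))\<^sup>2 / 4"
proof -
  have "(norm (fst \<zeta> - fst \<eta>))\<^sup>2 = (norm (fst \<zeta>))\<^sup>2 - 2 * (fst \<zeta> \<bullet> fst \<eta>) + (norm (fst \<eta>))\<^sup>2"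
    using norm_add_sq[of "fst \<zeta>" "- fst \<eta>"] by simp
  then show ?thesis by (simp add: siegel_pairing_def siegel_rho_def Re_cdot field_simps)
qed

lemma siegel_pairing_half_plane: "\<zeta> \<in> siegel_space \<Longrightarrow> \<eta> \<in> siegel_space \<Longrightarrow> siegel_pairing \<zeta> \<eta> \<in> half_plane"
  unfolding half_plane_def mem_Collect_eq Re_siegel_pairing
  using siegel_rho_pos[of \<zeta>] siegel_rho_pos[of \<eta>] by (simp add: add_pos_nonneg)

lemma siegel_pairing_self: "siegel_pairing \<zeta> \<zeta> = of_real (2 * siegel_rho \<zeta>)"
  by (simp add: complex_eq_iff Re_siegel_pairing) (simp add: siegel_pairing_def cdot_self)

definition kernel_exponent :: "real \<Rightarrow> nat \<Rightarrow> real" where "kernel_exponent \<nu> n = real n + \<nu> + 2"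

definition kernel_const :: "real \<Rightarrow> nat \<Rightarrow> real" where
  "kernel_const \<nu> n = 2 powr (\<nu> + 1) / Gamma (\<nu> + 1) / (2 * pi) ^ (n + 1)"

lemma kernel_const_pos: "\<nu> > -1 \<Longrightarrow> kernel_const \<nu> n > 0"
  using Gamma_real_pos[of "\<nu> + 1"] by (simp add: kernel_const_def)

lemma feature_product:
  fixes \<zeta> \<eta> :: "(complex ^ 'n) \<times> complex"
  assumes \<nu>: "\<nu> > -1" and l: "l < 0"
  shows "integrable (count_space UNIV) (\<lambda>\<alpha>. siegel_feature \<nu> \<eta> (\<alpha>, l) * cnj (siegel_feature \<nu> \<zeta> (\<alpha>, l)))"
    and "spectral_weight \<nu> CARD('n) l *\<^sub>R (\<integral>\<alpha>. siegel_feature \<nu> \<eta> (\<alpha>, l) * cnj (siegel_feature \<nu> \<zeta> (\<alpha>, l)) \<partial>count_space UNIV)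
      = kernel_const \<nu> CARD('n) *\<^sub>R (\<bar>l\<bar> powr (kernel_exponent \<nu> CARD('n) - 1) *\<^sub>R exp (of_real l * siegel_pairing \<zeta> \<eta>))"
proof -
  define b where "b = 2 powr (\<nu> + 1) / Gamma (\<nu> + 1) * \<bar>l\<bar> powr (\<nu> + 1)"
  define E where "E = exp (- \<i> * of_real l * snd \<zeta>) * cnj (exp (- \<i> * of_real l * snd \<eta>))"
  have eq: "siegel_feature \<nu> \<eta> (\<alpha>, l) * cnj (siegel_feature \<nu> \<zeta> (\<alpha>, l))
      = (of_real (b * b) * E) * (fock_basis \<bar>l\<bar> \<alpha> (fst \<zeta>) * cnj (fock_basis \<bar>l\<bar> \<alpha> (fst \<eta>)))" for \<alpha>
    unfolding siegel_feature_def b_def E_def fst_conv snd_conv by (simp only: complex_cnj_mult complex_cnj_cnj complex_cnj_complex_of_real of_real_mult) (simp only: mult_ac)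
  have m: "\<bar>l\<bar> > 0" using l by simp
  show "integrable (count_space UNIV) (\<lambda>\<alpha>. siegel_feature \<nu> \<eta> (\<alpha>, l) * cnj (siegel_feature \<nu> \<zeta> (\<alpha>, l)))"
    unfolding eq by (intro integrable_mult_right fock_basis_summable m)
  have sum: "(\<integral>\<alpha>. siegel_feature \<nu> \<eta> (\<alpha>, l) * cnj (siegel_feature \<nu> \<zeta> (\<alpha>, l)) \<partial>count_space UNIV)
      = (of_real (b * b) * E) * fock_kernel \<bar>l\<bar> (fst \<eta>) (fst \<zeta>)"
    unfolding eq integral_mult_right_zero fock_basis_sum[OF m] ..
  have E: "E * fock_kernel \<bar>l\<bar> (fst \<eta>) (fst \<zeta>) = exp (of_real l * siegel_pairing \<zeta> \<eta>)"
    unfolding E_def fock_kernel_def exp_cnj mult_exp_exp siegel_pairing_def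
    by (rule arg_cong[of _ _ exp]) (use l in \<open>simp add: algebra_simps\<close>)
  have W: "spectral_weight \<nu> CARD('n) l * (b * b) = kernel_const \<nu> CARD('n) * \<bar>l\<bar> powr (kernel_exponent \<nu> CARD('n) - 1)"
  proof -
    have G: "Gamma (\<nu> + 1) \<noteq> 0" using Gamma_real_pos[of "\<nu> + 1"] \<nu> by linarith
    have "\<bar>l\<bar> powr (real CARD('n) - (\<nu> + 1)) * (\<bar>l\<bar> powr (\<nu> + 1) * \<bar>l\<bar> powr (\<nu> + 1)) = \<bar>l\<bar> powr (kernel_exponent \<nu> CARD('n) - 1)"
      by (simp add: kernel_exponent_def add_ac flip: powr_add)
    moreover have "spectral_weight \<nu> CARD('n) l * (b * b) = kernel_const \<nu> CARD('n) * (\<bar>l\<bar> powr (real CARD('n) - (\<nu> + 1)) * (\<bar>l\<bar> powr (\<nu> + 1) * \<bar>l\<bar> powr (\<nu> + 1)))"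
    proof -
      have gen: "(g / p / q * u) * ((p / g * v) * (p / g * v)) = p / g / q * (u * (v * v))"
        if "g \<noteq> 0" "p \<noteq> 0" for g p q u v :: real
        using that by (simp add: field_simps)
      have "spectral_weight \<nu> CARD('n) l = Gamma (\<nu> + 1) / 2 powr (\<nu> + 1) / (2 * pi) ^ (CARD('n) + 1) * \<bar>l\<bar> powr (real CARD('n) - (\<nu> + 1))"
        using l by (simp add: spectral_weight_def)
      then show ?thesis unfolding kernel_const_def b_def by (simp only:) (rule gen, use G in simp_all)
    qed
    ultimately show ?thesis by simp
  qed
  show "spectral_weight \<nu> CARD('n) l *\<^sub>R (\<integral>\<alpha>. siegel_feature \<nu> \<eta> (\<alpha>, l) * cnj (siegel_feature \<nu> \<zeta> (\<alpha>, l)) \<partial>count_space UNIV)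
      = kernel_const \<nu> CARD('n) *\<^sub>R (\<bar>l\<bar> powr (kernel_exponent \<nu> CARD('n) - 1) *\<^sub>R exp (of_real l * siegel_pairing \<zeta> \<eta>))"
  proof -
    have "complex_of_real w * (of_real v * X) = of_real (w * v) * X" for w v X
      by (simp only: of_real_mult mult.assoc)
    then show ?thesis
      unfolding sum mult.assoc[of "of_real (b * b)"] E scaleR_conv_of_real by (simp only: W)
  qed
qed


lemma nn_integral_spectral:
  fixes f :: "('n::finite \<Rightarrow> nat) \<times> real \<Rightarrow> ennreal"
  assumes \<nu>: "\<nu> > -1" and f: "f \<in> borel_measurable (spectral_measure \<nu>)"
  shows "(\<integral>\<^sup>+y. f y \<partial>spectral_measure \<nu>)
    = (\<integral>\<^sup>+l. ennreal (spectral_weight \<nu> CARD('n) l) * (\<integral>\<^sup>+\<alpha>. f (\<alpha>, l) \<partial>count_space UNIV) \<partial>lborel)"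
proof -
  interpret P: pair_sigma_finite "count_space (UNIV :: ('n \<Rightarrow> nat) set)" "frequency_measure \<nu> CARD('n)"
    by (rule pair_sigma_finite_spectral)
  interpret Q: pair_sigma_finite "frequency_measure \<nu> CARD('n)" "count_space (UNIV :: ('n \<Rightarrow> nat) set)" ..
  have f': "f \<in> borel_measurable (count_space UNIV \<Otimes>\<^sub>M frequency_measure \<nu> CARD('n))"
    using f by (simp add: spectral_measure_def)
  have inner: "(\<lambda>l. \<integral>\<^sup>+\<alpha>. f (\<alpha>, l) \<partial>count_space UNIV) \<in> borel_measurable (frequency_measure \<nu> CARD('n))"
    using measurable_compose[OF measurable_pair_swap' f'] by (intro P.M1.borel_measurable_nn_integral) (simp add: split_beta')
  have "(\<integral>\<^sup>+y. f y \<partial>spectral_measure \<nu>) = (\<integral>\<^sup>+l. (\<integral>\<^sup>+\<alpha>. f (\<alpha>, l) \<partial>count_space UNIV) \<partial>frequency_measure \<nu> CARD('n))"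
    unfolding spectral_measure_def using P.nn_integral_snd[OF f'] by simp
  also have "\<dots> = (\<integral>\<^sup>+l. ennreal (spectral_weight \<nu> CARD('n) l) * (\<integral>\<^sup>+\<alpha>. f (\<alpha>, l) \<partial>count_space UNIV) \<partial>lborel)"
    unfolding frequency_measure_def
    by (rule nn_integral_density) (use inner in \<open>auto simp: spectral_weight_nonneg[OF \<nu>] cong: measurable_cong_sets\<close>)
  finally show ?thesis .
qed

lemma integral_spectral:
  fixes f :: "('n::finite \<Rightarrow> nat) \<times> real \<Rightarrow> complex"
  assumes \<nu>: "\<nu> > -1" and f: "integrable (spectral_measure \<nu>) f"
  shows "(\<integral>y. f y \<partial>spectral_measure \<nu>)
    = (\<integral>l. spectral_weight \<nu> CARD('n) l *\<^sub>R (\<integral>\<alpha>. f (\<alpha>, l) \<partial>count_space UNIV) \<partial>lborel)"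
    and "integrable lborel (\<lambda>l. spectral_weight \<nu> CARD('n) l *\<^sub>R (\<integral>\<alpha>. f (\<alpha>, l) \<partial>count_space UNIV))"
proof -
  interpret P: pair_sigma_finite "count_space (UNIV :: ('n \<Rightarrow> nat) set)" "frequency_measure \<nu> CARD('n)"
    by (rule pair_sigma_finite_spectral)
  have f': "integrable (count_space UNIV \<Otimes>\<^sub>M frequency_measure \<nu> CARD('n)) (case_prod (\<lambda>\<alpha> l. f (\<alpha>, l)))"
    using f by (simp add: spectral_measure_def)
  have int: "integrable (frequency_measure \<nu> CARD('n)) (\<lambda>l. \<integral>\<alpha>. f (\<alpha>, l) \<partial>count_space UNIV)"
    by (rule P.integrable_snd[OF f'])
  then have m: "(\<lambda>l. \<integral>\<alpha>. f (\<alpha>, l) \<partial>count_space UNIV) \<in> borel_measurable lborel"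
    by (auto dest: borel_measurable_integrable cong: measurable_cong_sets)
  have "(\<integral>y. f y \<partial>spectral_measure \<nu>) = (\<integral>l. (\<integral>\<alpha>. f (\<alpha>, l) \<partial>count_space UNIV) \<partial>frequency_measure \<nu> CARD('n))"
    unfolding spectral_measure_def using P.integral_snd[OF f'] by simp
  also have "\<dots> = (\<integral>l. spectral_weight \<nu> CARD('n) l *\<^sub>R (\<integral>\<alpha>. f (\<alpha>, l) \<partial>count_space UNIV) \<partial>lborel)"
    unfolding frequency_measure_def by (rule integral_density) (use m in \<open>auto simp: spectral_weight_nonneg[OF \<nu>]\<close>)
  finally show "(\<integral>y. f y \<partial>spectral_measure \<nu>)
    = (\<integral>l. spectral_weight \<nu> CARD('n) l *\<^sub>R (\<integral>\<alpha>. f (\<alpha>, l) \<partial>count_space UNIV) \<partial>lborel)" .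
  show "integrable lborel (\<lambda>l. spectral_weight \<nu> CARD('n) l *\<^sub>R (\<integral>\<alpha>. f (\<alpha>, l) \<partial>count_space UNIV))"
    using int unfolding frequency_measure_def
    by (subst (asm) integrable_density) (use m in \<open>auto simp: spectral_weight_nonneg[OF \<nu>]\<close>)
qed

lemma spectral_weight_zero: "\<not> l < 0 \<Longrightarrow> spectral_weight \<nu> n l = 0"
  by (simp add: spectral_weight_def)

lemma kernel_exponent_pos: "\<nu> > -1 \<Longrightarrow> kernel_exponent \<nu> n > 0"
  by (simp add: kernel_exponent_def)

lemma feature_measurable1: "siegel_feature \<nu> \<zeta> \<in> borel_measurable (spectral_measure \<mu>)"
  by (rule spectral_measurableI) (unfold siegel_feature_def fst_conv snd_conv, measurable)

lemma feature_sq_integrable: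
  fixes \<zeta> :: "(complex ^ 'n) \<times> complex"
  assumes \<nu>: "\<nu> > -1" and \<zeta>: "\<zeta> \<in> siegel_space"
  shows "siegel_feature \<nu> \<zeta> \<in> sq_integrable (spectral_measure \<nu>)"
proof -
  let ?n = "CARD('n)" and ?\<kappa> = "siegel_feature \<nu> \<zeta>"
  let ?s = "kernel_exponent \<nu> ?n" and ?r = "2 * siegel_rho \<zeta>"
  let ?g = "\<lambda>l. kernel_const \<nu> ?n * (indicator {..<0} l * (\<bar>l\<bar> powr (?s - 1) * exp (l * ?r)))"
  have [measurable]: "?\<kappa> \<in> borel_measurable (spectral_measure \<nu>)" by (rule feature_measurable1)
  have "(\<integral>\<^sup>+y. ennreal ((cmod (?\<kappa> y))\<^sup>2) \<partial>spectral_measure \<nu>) = (\<integral>\<^sup>+l. ennreal (?g l) \<partial>lborel)"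
  proof (subst nn_integral_spectral[OF \<nu>])
    show "(\<lambda>y. ennreal ((cmod (?\<kappa> y))\<^sup>2)) \<in> borel_measurable (spectral_measure \<nu>)" by measurable
    show "(\<integral>\<^sup>+l. ennreal (spectral_weight \<nu> ?n l) * (\<integral>\<^sup>+\<alpha>. ennreal ((cmod (?\<kappa> (\<alpha>, l)))\<^sup>2) \<partial>count_space UNIV) \<partial>lborel)
        = (\<integral>\<^sup>+l. ennreal (?g l) \<partial>lborel)"
    proof (rule nn_integral_cong)
      fix l :: real
      show "ennreal (spectral_weight \<nu> ?n l) * (\<integral>\<^sup>+\<alpha>. ennreal ((cmod (?\<kappa> (\<alpha>, l)))\<^sup>2) \<partial>count_space UNIV) = ennreal (?g l)"
      proof (cases "l < 0")
        case True
        have "integrable (count_space UNIV) (\<lambda>\<alpha>. complex_of_real ((cmod (?\<kappa> (\<alpha>, l)))\<^sup>2))"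
          using feature_product(1)[OF \<nu> True, of \<zeta> \<zeta>] by (simp only: complex_mult_cnj_cmod)
        then have i: "integrable (count_space UNIV) (\<lambda>\<alpha>. (cmod (?\<kappa> (\<alpha>, l)))\<^sup>2)"
          by (simp only: complex_of_real_integrable_eq)
        have "complex_of_real (spectral_weight \<nu> ?n l * (\<integral>\<alpha>. (cmod (?\<kappa> (\<alpha>, l)))\<^sup>2 \<partial>count_space UNIV)) = of_real (?g l)"
        proof -
          have "exp (of_real l * siegel_pairing \<zeta> \<zeta>) = complex_of_real (exp (l * ?r))"
            unfolding siegel_pairing_self of_real_mult[symmetric] by (rule exp_of_real)
          then show ?thesis
            using feature_product(2)[OF \<nu> True, of \<zeta> \<zeta>] True
            unfolding complex_mult_cnj_cmod integral_complex_of_real scaleR_conv_of_real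
            by (simp only: of_real_mult[symmetric]) simp
        qed
        then have "spectral_weight \<nu> ?n l * (\<integral>\<alpha>. (cmod (?\<kappa> (\<alpha>, l)))\<^sup>2 \<partial>count_space UNIV) = ?g l"
          by (simp only: of_real_eq_iff)
        then show ?thesis
          using i by (subst nn_integral_eq_integral) (auto simp: spectral_weight_nonneg[OF \<nu>] simp flip: ennreal_mult)
      qed (simp add: spectral_weight_zero)
    qed
  qed
  also have "\<dots> < \<infinity>"
  proof -
    have "integrable lborel ?g"
      by (intro integrable_mult_right Gamma_Laplace_integrable kernel_exponent_pos \<nu>) (use siegel_rho_pos[OF \<zeta>] in simp)
    then have "(\<integral>\<^sup>+l. ennreal (norm (?g l)) \<partial>lborel) < \<infinity>" unfolding integrable_iff_bounded by blast
    moreover have "norm (?g l) = ?g l" for l using kernel_const_pos[OF \<nu>, of ?n] by (simp add: less_imp_le)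
    ultimately show ?thesis by (simp only:)
  qed
  finally have "integrable (spectral_measure \<nu>) (\<lambda>y. (cmod (?\<kappa> y))\<^sup>2)"
    by (intro integrableI_bounded) (simp_all)
  then show ?thesis by (simp add: sq_integrable_def)
qed

lemma siegel_feature_map:
  "\<nu> > -1 \<Longrightarrow> feature_map (siegel_measure \<nu> :: ((complex ^ 'n) \<times> complex) measure) (spectral_measure \<nu>) (siegel_feature \<nu>)"
  by (intro feature_map.intro pair_sigma_finite.intro sigma_finite_siegel_measure sigma_finite_spectral_measure
      feature_map_axioms.intro siegel_feature_measurable feature_sq_integrable) auto

definition bergman_kernel :: "real \<Rightarrow> (complex ^ 'n) \<times> complex \<Rightarrow> (complex ^ 'n) \<times> complex \<Rightarrow> complex" where
  "bergman_kernel \<nu> \<zeta> \<eta> = of_real (kernel_const \<nu> CARD('n) * Gamma (kernel_exponent \<nu> CARD('n))) *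
     exp (- of_real (kernel_exponent \<nu> CARD('n)) * Ln (siegel_pairing \<zeta> \<eta>))"

lemma feature_inner:
  fixes \<zeta> \<eta> :: "(complex ^ 'n) \<times> complex"
  assumes \<nu>: "\<nu> > -1" and \<zeta>: "\<zeta> \<in> siegel_space" "\<eta> \<in> siegel_space"
  shows "(\<integral>y. siegel_feature \<nu> \<eta> y * cnj (siegel_feature \<nu> \<zeta> y) \<partial>spectral_measure \<nu>) = bergman_kernel \<nu> \<zeta> \<eta>"
proof -
  let ?n = "CARD('n)"
  let ?s = "kernel_exponent \<nu> ?n"
  have "(\<integral>y. siegel_feature \<nu> \<eta> y * cnj (siegel_feature \<nu> \<zeta> y) \<partial>spectral_measure \<nu>)
      = (\<integral>l. spectral_weight \<nu> ?n l *\<^sub>R (\<integral>\<alpha>. siegel_feature \<nu> \<eta> (\<alpha>, l) * cnj (siegel_feature \<nu> \<zeta> (\<alpha>, l)) \<partial>count_space UNIV) \<partial>lborel)"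
    by (intro integral_spectral(1) \<nu> sq_integrable_product sq_integrable_cnj feature_sq_integrable \<zeta>)
  also have "\<dots> = (\<integral>l. kernel_const \<nu> ?n *\<^sub>R (indicator {..<0} l *\<^sub>R (\<bar>l\<bar> powr (?s - 1) *\<^sub>R exp (of_real l * siegel_pairing \<zeta> \<eta>))) \<partial>lborel)"
  proof (rule Bochner_Integration.integral_cong[OF refl])
    fix l :: real
    show "spectral_weight \<nu> ?n l *\<^sub>R (\<integral>\<alpha>. siegel_feature \<nu> \<eta> (\<alpha>, l) * cnj (siegel_feature \<nu> \<zeta> (\<alpha>, l)) \<partial>count_space UNIV)
        = kernel_const \<nu> ?n *\<^sub>R (indicator {..<0} l *\<^sub>R (\<bar>l\<bar> powr (?s - 1) *\<^sub>R exp (of_real l * siegel_pairing \<zeta> \<eta>)))"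
      by (cases "l < 0") (simp_all add: feature_product(2)[OF \<nu>] spectral_weight_zero)
  qed
  also have "\<dots> = bergman_kernel \<nu> \<zeta> \<eta>"
    unfolding integral_scaleR_right Gamma_Laplace_complex[OF kernel_exponent_pos[OF \<nu>] siegel_pairing_half_plane[OF \<zeta>]]
    by (simp add: bergman_kernel_def scaleR_conv_of_real mult.assoc)
  finally show ?thesis .
qed


section \<open>The reproducing formula of the Bergman space\<close>

text \<open>
  Heisenberg translations are affine, preserve Lebesgue measure and the defining function, and move
  a point of the fibre over \<open>0\<close> to any given point.
\<close>

definition heis :: "(complex ^ 'n) \<times> complex \<Rightarrow> (complex ^ 'n) \<times> complex \<Rightarrow> (complex ^ 'n) \<times> complex" where
  "heis \<zeta> \<eta> = (fst \<eta> + fst \<zeta>,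
     snd \<eta> + (of_real (Re (snd \<zeta>)) + \<i> * of_real ((norm (fst \<zeta>))\<^sup>2 / 4)) + \<i> / 2 * cdot (fst \<eta>) (vcnj (fst \<zeta>)))"

lemma siegel_rho_heis: "siegel_rho (heis \<zeta> \<eta>) = siegel_rho \<eta>"
  by (simp add: siegel_rho_def heis_def norm_add_sq Re_cdot field_simps)

lemma heis_siegel:
  fixes \<zeta> \<eta> :: "(complex ^ 'n) \<times> complex"
  shows "heis \<zeta> \<eta> \<in> siegel_space \<longleftrightarrow> \<eta> \<in> siegel_space"
proof -
  have "\<xi> \<in> siegel_space \<longleftrightarrow> siegel_rho \<xi> > 0" for \<xi> :: "(complex ^ 'n) \<times> complex"
    by (simp add: siegel_space_def siegel_rho_def)
  then show ?thesis by (simp add: siegel_rho_heis)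
qed

lemma siegel_pairing_heis: "siegel_pairing (heis \<zeta> \<xi>) (heis \<zeta> \<eta>) = siegel_pairing \<xi> \<eta>"
proof -
  define z a b where "z = fst \<zeta>" and "a = fst \<xi>" and "b = fst \<eta>"
  have e: "cdot (a + z) (vcnj (b + z)) = cdot a (vcnj b) + cdot a (vcnj z) + cdot z (vcnj b) + of_real ((norm z)\<^sup>2)"
    unfolding cdot_self[symmetric] by (simp add: cdot_def vcnj_def algebra_simps sum.distrib)
  have c: "cnj (cdot b (vcnj z)) = cdot z (vcnj b)" by (rule cnj_cdot)
  have cc: "cnj (\<i> / 2 * cdot b (vcnj z)) = - \<i> / 2 * cdot z (vcnj b)" by (simp add: c)
  show ?thesis
    unfolding siegel_pairing_def heis_def fst_conv snd_conv z_def[symmetric] a_def[symmetric] b_def[symmetric] e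
      complex_cnj_add cc
    by (simp add: algebra_simps)
qed

lemma heis_origin: "heis \<zeta> (0, \<i> * of_real (siegel_rho \<zeta>)) = \<zeta>"
  by (simp add: heis_def siegel_rho_def prod_eq_iff cdot_simps complex_eq_iff)

lemma continuous_on_heis: "continuous_on UNIV (heis \<zeta>)"
proof -
  have "continuous_on UNIV (\<lambda>\<eta> :: (complex ^ 'a) \<times> complex. cdot (fst \<eta>) c)" for c :: "complex ^ 'a"
    by (rule continuous_on_compose2[OF linear_continuous_on[OF bounded_linear_cdot, of UNIV c] continuous_on_fst[OF continuous_on_id]]) simp
  then show ?thesis unfolding heis_def by (intro continuous_intros)
qed

lemma heis_measurable[measurable]: "heis \<zeta> \<in> borel_measurable borel"
  by (rule borel_measurable_continuous_onI[OF continuous_on_heis])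

lemma lborel_distr_heis:
  fixes \<zeta> :: "(complex ^ 'n) \<times> complex"
  shows "distr lborel borel (heis \<zeta>) = lborel"
proof (rule measure_eqI)
  fix B assume "B \<in> sets (distr lborel borel (heis \<zeta>))"
  then have [measurable]: "B \<in> sets borel" by simp
  define f where "f x = (indicator B x :: ennreal)" for x
  have fm[measurable]: "f \<in> borel_measurable borel" unfolding f_def by measurable
  have fm2: "(\<lambda>p. f (fst p, snd p)) \<in> borel_measurable (lborel \<Otimes>\<^sub>M lborel)" using fm by (simp add: lborel_prod)
  define c where "c z = of_real (Re (snd \<zeta>)) + \<i> * of_real ((norm (fst \<zeta>))\<^sup>2 / 4) + \<i> / 2 * cdot z (vcnj (fst \<zeta>))" for z
  have hz: "heis \<zeta> (z, w) = (z + fst \<zeta>, w + c z)" for z w by (simp add: heis_def c_def add.assoc)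
  have split: "(\<integral>\<^sup>+p. g p \<partial>lborel) = (\<integral>\<^sup>+z. \<integral>\<^sup>+w. g (z, w) \<partial>lborel \<partial>lborel)"
    if "g \<in> borel_measurable borel" for g :: "(complex ^ 'n) \<times> complex \<Rightarrow> ennreal"
    using lborel.nn_integral_fst[of g lborel] that by (simp add: lborel_prod)
  have sec: "(\<lambda>w. f (z, w)) \<in> borel_measurable borel" for z by measurable
  have secz: "(\<lambda>z. \<integral>\<^sup>+w. f (z, w) \<partial>lborel) \<in> borel_measurable borel"
    using lborel.borel_measurable_nn_integral_fst[of f lborel] fm by (simp add: lborel_prod)
  have "emeasure (distr lborel borel (heis \<zeta>)) B = (\<integral>\<^sup>+p. f p \<partial>distr lborel borel (heis \<zeta>))"
    by (simp add: f_def)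
  also have "\<dots> = (\<integral>\<^sup>+p. f (heis \<zeta> p) \<partial>lborel)" by (rule nn_integral_distr) measurable
  also have "\<dots> = (\<integral>\<^sup>+z. \<integral>\<^sup>+w. f (z + fst \<zeta>, w + c z) \<partial>lborel \<partial>lborel)"
    by (subst split) (simp_all add: hz)
  also have "\<dots> = (\<integral>\<^sup>+z. \<integral>\<^sup>+w. f (z + fst \<zeta>, w) \<partial>lborel \<partial>lborel)"
    by (rule nn_integral_cong, rule nn_integral_lborel_translate[OF sec])
  also have "\<dots> = (\<integral>\<^sup>+z. \<integral>\<^sup>+w. f (z, w) \<partial>lborel \<partial>lborel)"
    by (rule nn_integral_lborel_translate[OF secz])
  also have "\<dots> = (\<integral>\<^sup>+p. f p \<partial>lborel)" by (rule split[OF fm, symmetric])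
  also have "\<dots> = emeasure lborel B" by (simp add: f_def)
  finally show "emeasure (distr lborel borel (heis \<zeta>)) B = emeasure lborel B" .
qed simp

lemma
  fixes f :: "(complex ^ 'n) \<times> complex \<Rightarrow> complex"
  assumes [measurable]: "f \<in> borel_measurable borel"
  shows integral_heis: "(\<integral>p. f (heis \<zeta> p) \<partial>lborel) = (\<integral>p. f p \<partial>lborel)"
    and integrable_heis: "integrable lborel (\<lambda>p. f (heis \<zeta> p)) \<longleftrightarrow> integrable lborel f"
proof -
  have "integral\<^sup>L (distr lborel borel (heis \<zeta>)) f = (\<integral>p. f (heis \<zeta> p) \<partial>lborel)"
    by (rule integral_distr) measurable
  then show "(\<integral>p. f (heis \<zeta> p) \<partial>lborel) = (\<integral>p. f p \<partial>lborel)" by (simp only: lborel_distr_heis)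
  have "integrable (distr lborel borel (heis \<zeta>)) f \<longleftrightarrow> integrable lborel (\<lambda>p. f (heis \<zeta> p))"
    by (rule integrable_distr_eq) measurable
  then show "integrable lborel (\<lambda>p. f (heis \<zeta> p)) \<longleftrightarrow> integrable lborel f" by (simp only: lborel_distr_heis)
qed

lemma siegel_holomorphic_heis:
  fixes \<zeta> :: "(complex ^ 'n) \<times> complex"
  assumes F: "pair.hol_on siegel_space F"
  shows "pair.hol_on siegel_space (\<lambda>\<eta>. F (heis \<zeta> \<eta>))"
  unfolding pair.hol_on_def
proof
  fix \<eta> :: "(complex ^ 'n) \<times> complex" assume "\<eta> \<in> siegel_space"
  then have "heis \<zeta> \<eta> \<in> siegel_space" by (simp add: heis_siegel)
  then obtain D where D: "(F has_derivative D) (at (heis \<zeta> \<eta>))" "\<forall>c v. D (pair_scale c v) = c * D v"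
    using F unfolding pair.hol_on_def by blast
  define L where "L v = (fst v, snd v + \<i> / 2 * cdot (fst v) (vcnj (fst \<zeta>)))" for v :: "(complex ^ 'n) \<times> complex"
  have "(heis \<zeta> has_derivative L) (at \<eta>)"
    unfolding heis_def[abs_def] L_def
    by (auto intro!: derivative_eq_intros bounded_linear.has_derivative[OF bounded_linear_cdot])
  from has_derivative_compose[OF this D(1)] have "((\<lambda>\<eta>. F (heis \<zeta> \<eta>)) has_derivative (\<lambda>v. D (L v))) (at \<eta>)" .
  moreover have "D (L (pair_scale c v)) = c * D (L v)" for c v
  proof -
    have "L (pair_scale c v) = pair_scale c (L v)" by (simp add: L_def pair_scale_def cdot_simps algebra_simps)
    then show ?thesis by (simp add: D(2))
  qed
  ultimately show "\<exists>D. ((\<lambda>\<eta>. F (heis \<zeta> \<eta>)) has_derivative D) (at \<eta>) \<and> (\<forall>c v. D (pair_scale c v) = c * D v)" by blast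
qed

definition fibre_weight :: "real \<Rightarrow> real \<Rightarrow> complex ^ 'n \<Rightarrow> real" where
  "fibre_weight \<nu> Y z = indicator {z. (norm z)\<^sup>2 / 4 < Y} z * (Y - (norm z)\<^sup>2 / 4) powr \<nu>"

definition fibre_const :: "real \<Rightarrow> nat \<Rightarrow> real" where
  "fibre_const \<nu> n = (4 * pi) ^ n * Gamma (\<nu> + 1) / Gamma (real n + \<nu> + 1)"

lemma fibre_weight_measurable[measurable]: "fibre_weight \<nu> Y \<in> borel_measurable borel"
  unfolding fibre_weight_def by measurable

lemma fibre_const_pos: "\<nu> > -1 \<Longrightarrow> fibre_const \<nu> n > 0"
  unfolding fibre_const_def by (intro divide_pos_pos mult_pos_pos Gamma_real_pos) auto

lemma nn_integral_fibre_weight: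
  assumes "\<nu> > -1" "Y > 0"
  shows "(\<integral>\<^sup>+z. ennreal (fibre_weight \<nu> Y z) \<partial>(lborel :: (complex ^ 'n) measure))
    = ennreal (fibre_const \<nu> CARD('n) * Y powr (real CARD('n) + \<nu>))"
  unfolding fibre_weight_def fibre_const_def by (rule nn_integral_truncated_power[OF assms DIM_complex_vec])

lemma
  assumes \<nu>: "\<nu> > -1" and Y: "Y > 0"
  shows fibre_weight_integrable: "integrable lborel (fibre_weight \<nu> Y :: complex ^ 'n \<Rightarrow> real)"
    and fibre_weight_integral: "(\<integral>z. fibre_weight \<nu> Y z \<partial>(lborel :: (complex ^ 'n) measure))
      = fibre_const \<nu> CARD('n) * Y powr (real CARD('n) + \<nu>)"
proof -
  have nn: "0 \<le> fibre_weight \<nu> Y z" for z :: "complex ^ 'n" by (simp add: fibre_weight_def)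
  show "integrable lborel (fibre_weight \<nu> Y :: complex ^ 'n \<Rightarrow> real)"
    by (rule integrableI_nonneg) (use nn nn_integral_fibre_weight[OF \<nu> Y, where 'n = 'n] in auto)
  show "(\<integral>z. fibre_weight \<nu> Y z \<partial>(lborel :: (complex ^ 'n) measure)) = fibre_const \<nu> CARD('n) * Y powr (real CARD('n) + \<nu>)"
    using nn nn_integral_fibre_weight[OF \<nu> Y, where 'n = 'n] fibre_const_pos[OF \<nu>, of "CARD('n)"]
    by (subst integral_eq_nn_integral) (auto simp: less_imp_le)
qed

text \<open>The weight on a fibre over a point of the upper half-plane is radial in \<open>z\<close>.\<close>

lemma fibre_mean:
  fixes G :: "complex ^ 'n \<Rightarrow> complex"
  assumes \<nu>: "\<nu> > -1" and Y: "Y > 0" and G: "vec.hol_on {z. (norm z)\<^sup>2 / 4 < Y} G"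
    and int: "integrable lborel (\<lambda>z. fibre_weight \<nu> Y z *\<^sub>R G z)"
  shows "(\<integral>z. fibre_weight \<nu> Y z *\<^sub>R G z \<partial>lborel) = (fibre_const \<nu> CARD('n) * Y powr (real CARD('n) + \<nu>)) *\<^sub>R G 0"
proof -
  define S where "S = {z :: complex ^ 'n. (norm z)\<^sup>2 / 4 < Y}"
  define f where "f z = indicator S z *\<^sub>R G z" for z
  have S: "open S" unfolding S_def by (intro open_Collect_less continuous_intros) auto
  have fG: "fibre_weight \<nu> Y z *\<^sub>R f z = fibre_weight \<nu> Y z *\<^sub>R G z" for z
    by (simp add: f_def fibre_weight_def S_def indicator_def)
  have fm: "f \<in> borel_measurable borel"
    unfolding f_def using G S by (intro borel_measurable_continuous_on_indicator vec.hol_on_continuous) (auto simp: S_def)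
  have fh: "vec.hol_on S f"
    by (rule vec.hol_on_cong[OF G[folded S_def] S]) (simp add: f_def)
  have "(\<integral>z. fibre_weight \<nu> Y z *\<^sub>R f z \<partial>lborel) = (\<integral>z. fibre_weight \<nu> Y z \<partial>(lborel :: (complex ^ 'n) measure)) *\<^sub>R f 0"
  proof (rule vec.rotation_mean[OF fm fibre_weight_measurable])
    show "fibre_weight \<nu> Y (c *s v) = fibre_weight \<nu> Y v" if "cmod c = 1" for c and v :: "complex ^ 'n"
      using that by (simp add: fibre_weight_def norm_vector_scalar_mult indicator_def)
    show "integrable lborel (\<lambda>z. fibre_weight \<nu> Y z *\<^sub>R f z)" using int by (simp only: fG)
    show "integrable lborel (fibre_weight \<nu> Y :: complex ^ 'n \<Rightarrow> real)" by (rule fibre_weight_integrable[OF \<nu> Y])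
    show "(LINT t:{0..1}|lborel. f (vec.rot t *s z)) = f 0" if "fibre_weight \<nu> Y z \<noteq> 0" for z
    proof (rule vec.circle_mean[OF fh S])
      have "z \<in> S" using that by (auto simp: fibre_weight_def S_def indicator_def split: if_splits)
      fix \<zeta> :: complex assume "cmod \<zeta> \<le> 1"
      then have "cmod \<zeta> * norm z \<le> 1 * norm z" by (intro mult_right_mono) auto
      then have sq: "(norm (\<zeta> *s z))\<^sup>2 \<le> (norm z)\<^sup>2" by (intro power_mono) (simp_all add: norm_vector_scalar_mult)
      show "\<zeta> *s z \<in> S" using \<open>z \<in> S\<close> sq unfolding S_def mem_Collect_eq by linarith
    qed
  qed
  then show ?thesis unfolding fG fibre_weight_integral[OF \<nu> Y] using Y by (simp add: f_def S_def)
qed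

lemma siegel_fibre: "(z, w) \<in> siegel_space \<longleftrightarrow> (norm z)\<^sup>2 / 4 < Im w"
  by (simp add: siegel_space_def)

lemma siegel_fibre_weight:
  "indicator siegel_space (z, w) * siegel_rho (z, w) powr \<nu> = fibre_weight \<nu> (Im w) z"
  by (simp add: fibre_weight_def siegel_rho_def siegel_fibre indicator_def)

lemma fibre_weight_lower: "Im w \<le> 0 \<Longrightarrow> fibre_weight \<nu> (Im w) z = 0"
proof -
  assume "Im w \<le> 0"
  then have "\<not> (norm z)\<^sup>2 / 4 < Im w" using zero_le_power2[of "norm z"] by linarith
  then show ?thesis by (simp add: fibre_weight_def)
qed

lemma half_plane_weight:
  fixes y q p :: real
  assumes "y > 0" "q > 0"
  shows "(y / q\<^sup>2) powr p / q ^ 4 = y powr p * exp (- (2 * (p + 2)) * ln q)"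
proof -
  have "q\<^sup>2 powr p = exp (2 * p * ln q)" using assms by (simp add: powr_def ln_realpow mult_ac)
  then have "(y / q\<^sup>2) powr p = y powr p / exp (2 * p * ln q)"
    using assms by (simp add: powr_divide)
  moreover have "q ^ 4 = exp (4 * ln q)"
    using assms by (metis exp_ln exp_of_nat_mult of_nat_numeral)
  ultimately show ?thesis
    by (simp add: divide_inverse exp_minus[symmetric] mult.assoc algebra_simps flip: exp_add)
qed

definition bergman_const :: "real \<Rightarrow> nat \<Rightarrow> real" where
  "bergman_const \<nu> n = kernel_const \<nu> n * Gamma (kernel_exponent \<nu> n)"

lemma bergman_const_pos: "\<nu> > -1 \<Longrightarrow> bergman_const \<nu> n > 0"
  unfolding bergman_const_def by (intro mult_pos_pos kernel_const_pos Gamma_real_pos kernel_exponent_pos)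

lemma half_plane_nonpos: "q \<in> half_plane \<Longrightarrow> q \<notin> \<real>\<^sub>\<le>\<^sub>0"
  by (auto simp: half_plane_def complex_nonpos_Reals_iff)

lemma cmod_bergman_kernel:
  fixes \<zeta> \<eta> :: "(complex ^ 'n) \<times> complex"
  assumes "\<nu> > -1" "\<zeta> \<in> siegel_space" "\<eta> \<in> siegel_space"
  shows "cmod (bergman_kernel \<nu> \<zeta> \<eta>) = bergman_const \<nu> CARD('n) * exp (- kernel_exponent \<nu> CARD('n) * ln (cmod (siegel_pairing \<zeta> \<eta>)))"
proof -
  have "siegel_pairing \<zeta> \<eta> \<noteq> 0" using siegel_pairing_half_plane[OF assms(2,3)] by (auto simp: half_plane_def)
  then show ?thesis using bergman_const_pos[OF assms(1), of "CARD('n)"]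
    unfolding bergman_kernel_def bergman_const_def[symmetric] norm_mult norm_of_real by simp
qed

lemma cnj_siegel_pairing: "cnj (siegel_pairing \<zeta> \<eta>) = siegel_pairing \<eta> \<zeta>"
  by (simp add: siegel_pairing_def cnj_cdot algebra_simps)

lemma cnj_bergman_kernel:
  "\<zeta> \<in> siegel_space \<Longrightarrow> \<eta> \<in> siegel_space \<Longrightarrow> cnj (bergman_kernel \<nu> \<zeta> \<eta>) = bergman_kernel \<nu> \<eta> \<zeta>"
  using half_plane_nonpos[OF siegel_pairing_half_plane[of \<zeta> \<eta>]]
  by (simp add: bergman_kernel_def exp_cnj cnj_Ln cnj_siegel_pairing)

lemma bergman_kernel_holomorphic:
  fixes \<zeta> :: "(complex ^ 'n) \<times> complex"
  assumes \<zeta>: "\<zeta> \<in> siegel_space"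
  shows "pair.hol_on siegel_space (\<lambda>\<eta>. bergman_kernel \<nu> \<eta> \<zeta>)"
proof -
  define L where "L \<eta> = - \<i> * snd \<eta> - cdot (fst \<eta>) (vcnj (fst \<zeta>)) / 2" for \<eta> :: "(complex ^ 'n) \<times> complex"
  have "bounded_linear L" unfolding L_def[abs_def]
    by (intro bounded_linear_sub bounded_linear_divide[THEN bounded_linear_compose] bounded_linear_compose[OF bounded_linear_mult_right bounded_linear_snd]
        bounded_linear_compose[OF bounded_linear_cdot bounded_linear_fst])
  then have L: "pair.hol_on siegel_space L"
    by (rule pair.hol_on_linear) (simp add: L_def pair_scale_def cdot_simps algebra_simps)
  have "siegel_pairing \<eta> \<zeta> = L \<eta> + \<i> * cnj (snd \<zeta>)" for \<eta> by (simp add: siegel_pairing_def L_def algebra_simps)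
  then have p: "pair.hol_on siegel_space (\<lambda>\<eta>. siegel_pairing \<eta> \<zeta>)"
    using pair.hol_on_add[OF L pair.hol_on_const] by simp
  have "pair.hol_on siegel_space (\<lambda>\<eta>. Ln (siegel_pairing \<eta> \<zeta>))"
    by (rule pair.hol_on_compose[OF p, of Ln "\<lambda>\<eta>. inverse (siegel_pairing \<eta> \<zeta>)"])
       (use half_plane_nonpos[OF siegel_pairing_half_plane[OF _ \<zeta>]] in \<open>auto intro!: has_field_derivative_Ln\<close>)
  then show ?thesis unfolding bergman_kernel_def
    by (intro pair.hol_on_mult[OF pair.hol_on_const pair.hol_on_exp[OF pair.hol_on_mult[OF pair.hol_on_const]]])
qed

lemma hol_on_siegel_measurable: "pair.hol_on siegel_space F \<Longrightarrow> F \<in> borel_measurable (siegel_measure \<nu>)"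
  unfolding siegel_measure_iff by (intro borel_measurable_continuous_on_indicator pair.hol_on_continuous) auto

lemma bergman_kernel_measurable:
  assumes "\<zeta> \<in> siegel_space" shows "bergman_kernel \<nu> \<zeta> \<in> borel_measurable (siegel_measure \<nu>)"
proof -
  have "(\<lambda>\<eta>. cnj (bergman_kernel \<nu> \<eta> \<zeta>)) \<in> borel_measurable (siegel_measure \<nu>)"
    by (intro borel_measurable_cnj hol_on_siegel_measurable bergman_kernel_holomorphic assms)
  then show ?thesis
    by (subst measurable_cong[of _ _ "\<lambda>\<eta>. cnj (bergman_kernel \<nu> \<eta> \<zeta>)"]) (simp_all add: cnj_bergman_kernel assms)
qed

lemma bergman_kernel_heis: "bergman_kernel \<nu> (heis \<zeta> \<xi>) (heis \<zeta> \<eta>) = bergman_kernel \<nu> \<xi> \<eta>"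
  by (simp add: bergman_kernel_def siegel_pairing_heis)

lemma siegel_pairing_origin: "siegel_pairing (0, \<i> * of_real h) (z, w) = of_real h + \<i> * cnj w"
  by (simp add: siegel_pairing_def cdot_simps algebra_simps)

lemma cmod_pairing_origin: "cmod (of_real h + \<i> * cnj w) = cmod (w + \<i> * of_real h)"
proof -
  have "cnj (of_real h + \<i> * cnj w) = - \<i> * (w + \<i> * of_real h)" by (simp add: algebra_simps)
  then have "cmod (cnj (of_real h + \<i> * cnj w)) = cmod (w + \<i> * of_real h)" by (simp only: norm_mult) simp
  then show ?thesis by (simp only: complex_mod_cnj)
qed

lemma bergman_kernel_sq_integrable:
  fixes \<zeta> :: "(complex ^ 'n) \<times> complex"
  assumes \<nu>: "\<nu> > -1" and \<zeta>: "\<zeta> \<in> siegel_space"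
  shows "bergman_kernel \<nu> \<zeta> \<in> sq_integrable (siegel_measure \<nu>)"
proof -
  let ?n = "CARD('n)"
  define h where "h = siegel_rho \<zeta>"
  define b0 where "b0 = ((0 :: complex ^ 'n), \<i> * complex_of_real h)"
  have h: "h > 0" using siegel_rho_pos[OF \<zeta>] by (simp add: h_def)
  have b0: "b0 \<in> siegel_space" "heis \<zeta> b0 = \<zeta>" using h by (simp_all add: b0_def siegel_space_def heis_origin h_def)
  let ?p = "real ?n + \<nu>"
  define C where "C = (bergman_const \<nu> ?n)\<^sup>2 * fibre_const \<nu> ?n"
  have p: "?p > -1" using \<nu> by simp
  define v where "v \<xi> \<eta> = ennreal (indicator siegel_space \<eta> * (siegel_rho \<eta> powr \<nu> * (cmod (bergman_kernel \<nu> \<xi> \<eta>))\<^sup>2))" for \<xi> \<eta> :: "(complex ^ 'n) \<times> complex"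
  have vm: "v \<xi> \<in> borel_measurable borel" if "\<xi> \<in> siegel_space" for \<xi>
  proof -
    have "(\<lambda>\<eta>. (cmod (bergman_kernel \<nu> \<xi> \<eta>))\<^sup>2) \<in> borel_measurable (siegel_measure \<nu>)"
      using bergman_kernel_measurable[OF that] by measurable
    then have "(\<lambda>\<eta>. siegel_rho \<eta> powr \<nu> * (indicator siegel_space \<eta> *\<^sub>R (cmod (bergman_kernel \<nu> \<xi> \<eta>))\<^sup>2)) \<in> borel_measurable borel"
      unfolding siegel_measure_iff by measurable
    then show ?thesis unfolding v_def by (simp add: mult_ac)
  qed
  have "(\<integral>\<^sup>+\<eta>. v \<zeta> \<eta> \<partial>lborel) = (\<integral>\<^sup>+\<eta>. v \<zeta> \<eta> \<partial>distr lborel borel (heis \<zeta>))" by (simp only: lborel_distr_heis)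
  also have "\<dots> = (\<integral>\<^sup>+\<eta>. v \<zeta> (heis \<zeta> \<eta>) \<partial>lborel)" by (rule nn_integral_distr) (use vm[OF \<zeta>] in measurable)
  also have "\<dots> = (\<integral>\<^sup>+\<eta>. v b0 \<eta> \<partial>lborel)"
  proof (rule nn_integral_cong)
    fix \<eta>
    have "bergman_kernel \<nu> \<zeta> (heis \<zeta> \<eta>) = bergman_kernel \<nu> b0 \<eta>" using bergman_kernel_heis[of \<nu> \<zeta> b0 \<eta>] by (simp add: b0)
    then show "v \<zeta> (heis \<zeta> \<eta>) = v b0 \<eta>" by (simp add: v_def heis_siegel siegel_rho_heis indicator_def)
  qed
  also have "\<dots> = (\<integral>\<^sup>+w. \<integral>\<^sup>+z. v b0 (z, w) \<partial>lborel \<partial>lborel)"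
    using lborel_pair.nn_integral_snd[of "v b0"] vm[OF b0(1)] by (simp add: lborel_prod)
  also have "\<dots> = (\<integral>\<^sup>+w. ennreal (C * (indicator upper w * ((Im w / (cmod (w + \<i> * of_real h))\<^sup>2) powr ?p / cmod (w + \<i> * of_real h) ^ 4))) \<partial>lborel)"
  proof (rule nn_integral_cong)
    fix w :: complex
    define q where "q = cmod (w + \<i> * of_real h)"
    show "(\<integral>\<^sup>+z. v b0 (z, w) \<partial>lborel) = ennreal (C * (indicator upper w * ((Im w / q\<^sup>2) powr ?p / q ^ 4)))"
    proof (cases "Im w > 0")
      case True
      have "w \<in> upper" using True by (simp add: upper_def)
      from upper_add_nonzero[OF this h] have q: "q > 0" by (simp add: q_def)
      define k where "k = (bergman_const \<nu> ?n)\<^sup>2 * exp (- (2 * (?p + 2)) * ln q)"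
      have "v b0 (z, w) = ennreal k * ennreal (fibre_weight \<nu> (Im w) z)" for z
      proof (cases "(z, w) \<in> siegel_space")
        case True
        have "cmod (bergman_kernel \<nu> b0 (z, w)) = bergman_const \<nu> ?n * exp (- kernel_exponent \<nu> ?n * ln q)"
          using cmod_bergman_kernel[OF \<nu> b0(1) True] by (simp only: b0_def siegel_pairing_origin cmod_pairing_origin q_def)
        then have "(cmod (bergman_kernel \<nu> b0 (z, w)))\<^sup>2 = k"
          by (simp add: k_def kernel_exponent_def power_mult_distrib algebra_simps flip: exp_double)
        then show ?thesis unfolding v_def siegel_fibre_weight[symmetric]
          by (simp add: k_def mult_ac True flip: ennreal_mult)
      qed (simp add: v_def fibre_weight_def siegel_fibre)
      then have "(\<integral>\<^sup>+z. v b0 (z, w) \<partial>lborel) = ennreal k * ennreal (fibre_const \<nu> ?n * Im w powr ?p)"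
        using nn_integral_fibre_weight[OF \<nu> True, where 'n = 'n] by (simp add: nn_integral_cmult)
      also have "\<dots> = ennreal (k * (fibre_const \<nu> ?n * Im w powr ?p))"
        by (rule ennreal_mult'[symmetric]) (simp add: k_def)
      also have "k * (fibre_const \<nu> ?n * Im w powr ?p) = C * ((Im w / q\<^sup>2) powr ?p / q ^ 4)"
        unfolding half_plane_weight[OF True q] k_def C_def by (simp only: mult_ac)
      finally show ?thesis using \<open>w \<in> upper\<close> by simp
    next
      case False
      have "v b0 (z, w) = 0" for z
      proof -
        have "(z, w) \<notin> siegel_space" unfolding siegel_fibre using False zero_le_power2[of "norm z"] by linarith
        then show ?thesis by (simp add: v_def)
      qed
      then show ?thesis using False by (simp add: upper_def)
    qed
  qed
  also have "\<dots> < \<infinity>"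
  proof -
    have "integrable lborel (\<lambda>w. complex_of_real (C * (indicator upper w * ((Im w / (cmod (w + \<i> * of_real h))\<^sup>2) powr ?p / cmod (w + \<i> * of_real h) ^ 4))))"
      using integrable_mult_right[OF upper_weight_integrable[OF h p, unfolded set_integrable_def], of "complex_of_real C"]
      by (simp add: scaleR_conv_of_real)
    then have "integrable lborel (\<lambda>w. C * (indicator upper w * ((Im w / (cmod (w + \<i> * of_real h))\<^sup>2) powr ?p / cmod (w + \<i> * of_real h) ^ 4)))"
      by (simp only: complex_of_real_integrable_eq)
    moreover have "C \<ge> 0" using fibre_const_pos[OF \<nu>, of ?n] by (simp add: C_def)
    ultimately show ?thesis by (subst nn_integral_eq_integral) auto
  qed
  finally have fin: "(\<integral>\<^sup>+\<eta>. v \<zeta> \<eta> \<partial>lborel) < \<infinity>" .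
  have [measurable]: "bergman_kernel \<nu> \<zeta> \<in> borel_measurable (siegel_measure \<nu>)" by (rule bergman_kernel_measurable[OF \<zeta>])
  have "set_integrable lborel siegel_space (\<lambda>\<eta>. siegel_rho \<eta> powr \<nu> *\<^sub>R (cmod (bergman_kernel \<nu> \<zeta> \<eta>))\<^sup>2)"
    unfolding set_integrable_def
  proof (rule integrableI_nonneg)
    have "(\<lambda>\<eta>. (cmod (bergman_kernel \<nu> \<zeta> \<eta>))\<^sup>2) \<in> borel_measurable (siegel_measure \<nu>)" by measurable
    then have "(\<lambda>\<eta>. siegel_rho \<eta> powr \<nu> * (indicator siegel_space \<eta> *\<^sub>R (cmod (bergman_kernel \<nu> \<zeta> \<eta>))\<^sup>2)) \<in> borel_measurable borel"
      unfolding siegel_measure_iff by measurable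
    then show "(\<lambda>\<eta>. indicator siegel_space \<eta> *\<^sub>R siegel_rho \<eta> powr \<nu> *\<^sub>R (cmod (bergman_kernel \<nu> \<zeta> \<eta>))\<^sup>2) \<in> borel_measurable lborel"
      by (simp add: mult_ac)
    show "(\<integral>\<^sup>+\<eta>. ennreal (indicator siegel_space \<eta> *\<^sub>R siegel_rho \<eta> powr \<nu> *\<^sub>R (cmod (bergman_kernel \<nu> \<zeta> \<eta>))\<^sup>2) \<partial>lborel) < \<infinity>"
      using fin by (simp add: v_def)
  qed auto
  then have "integrable (siegel_measure \<nu>) (\<lambda>\<eta>. (cmod (bergman_kernel \<nu> \<zeta> \<eta>))\<^sup>2)"
    by (subst integrable_siegel_measure) measurable
  then show ?thesis by (simp add: sq_integrable_def)
qed

lemma fibre_holomorphic: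
  fixes F :: "(complex ^ 'n) \<times> complex \<Rightarrow> complex"
  assumes "pair.hol_on siegel_space F"
  shows "vec.hol_on {z. (norm z)\<^sup>2 / 4 < Im w} (\<lambda>z. F (z, w))"
  unfolding vec.hol_on_def
proof
  fix z :: "complex ^ 'n" assume "z \<in> {z. (norm z)\<^sup>2 / 4 < Im w}"
  then have "(z, w) \<in> siegel_space" by (simp add: siegel_fibre)
  then obtain D where D: "(F has_derivative D) (at (z, w))" "\<forall>c v. D (pair_scale c v) = c * D v"
    using assms unfolding pair.hol_on_def by blast
  have "((\<lambda>z. (z, w)) has_derivative (\<lambda>v. (v, 0))) (at z)" by (auto intro!: derivative_eq_intros)
  from has_derivative_compose[OF this D(1)] have "((\<lambda>z. F (z, w)) has_derivative (\<lambda>v. D (v, 0))) (at z)" .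
  moreover have "D (c *s v, 0) = c * D (v, 0)" for c v
    using D(2)[rule_format, of c "(v, 0)"] by (simp add: pair_scale_def)
  ultimately show "\<exists>D. ((\<lambda>z. F (z, w)) has_derivative D) (at z) \<and> (\<forall>c v. D (c *s v) = c * D v)" by blast
qed

text \<open>
  The Gamma factors of the kernel, of the fibre volume and of the half-plane integral cancel.
\<close>

lemma reproducing_constant:
  assumes \<nu>: "\<nu> > -1" and h: "h > 0"
  shows "bergman_const \<nu> n * fibre_const \<nu> n * (pi / (real n + \<nu> + 1) / ((4 * h) powr (real n + \<nu>) * (4 * h\<^sup>2)))
      * exp (kernel_exponent \<nu> n * ln (2 * h)) = 1"
proof -
  define p where "p = real n + \<nu>"
  have p: "p > -1" using \<nu> by (simp add: p_def)
  define G1 G2 A where "G1 = Gamma (\<nu> + 1)" and "G2 = Gamma (p + 1)" and "A = h powr p"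
  have pos: "G1 > 0" "G2 > 0" "A > 0" using \<nu> p h by (auto simp: G1_def G2_def A_def intro!: Gamma_real_pos)
  have s: "kernel_exponent \<nu> n = p + 2" by (simp add: kernel_exponent_def p_def)
  have Gs: "Gamma (p + 2) = (p + 1) * G2"
  proof -
    have "p + 1 \<notin> \<int>\<^sub>\<le>\<^sub>0" using p by (auto elim!: nonpos_Ints_cases)
    from Gamma_plus1[OF this] show ?thesis unfolding G2_def by (simp only: add.assoc one_add_one)
  qed
  have e1: "exp ((p + 2) * ln (2 * h)) = 2 powr p * A * (4 * h\<^sup>2)"
  proof -
    have "exp ((p + 2) * ln (2 * h)) = (2 * h) powr (p + 2)" using h by (simp add: powr_def)
    also have "\<dots> = (2 * h) powr p * (2 * h)\<^sup>2" using h by (simp add: powr_add powr_numeral)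
    also have "(2 * h) powr p = 2 powr p * A" unfolding A_def by (rule powr_mult)
    also have "(2 * h)\<^sup>2 = 4 * h\<^sup>2" by (simp add: power_mult_distrib)
    finally show ?thesis .
  qed
  have e2: "(4 * h) powr p = 2 powr p * 2 powr p * A"
  proof -
    have "(4 * h) powr p = 4 powr p * A" unfolding A_def by (rule powr_mult)
    moreover have "(2 * 2 :: real) powr p = 2 powr p * 2 powr p" by (rule powr_mult)
    moreover have "(2 * 2 :: real) = 4" by simp
    ultimately show ?thesis by (simp only:)
  qed
  have "bergman_const \<nu> n * fibre_const \<nu> n = (2 powr (\<nu> + 1) * (4 * pi) ^ n) * (p + 1) / (2 * pi) ^ (n + 1)"
  proof -
    have gen: "k / g1 / q * (b * g2) * (f * g1 / g2) = (k * f) * b / q"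
      if "g1 \<noteq> 0" "g2 \<noteq> 0" for k q b f g1 g2 :: real
      using that by (simp add: field_simps)
    show ?thesis
      unfolding bergman_const_def kernel_const_def fibre_const_def s Gs p_def[symmetric] G1_def[symmetric] G2_def[symmetric]
      by (rule gen) (use pos in auto)
  qed
  also have "(4 * pi) ^ n = 2 ^ n * (2 * pi) ^ n"
  proof -
    have "(4 * pi) ^ n = (2 * (2 * pi)) ^ n" by simp
    also have "\<dots> = 2 ^ n * (2 * pi) ^ n" by (rule power_mult_distrib)
    finally show ?thesis .
  qed
  also have "2 powr (\<nu> + 1) * (2 ^ n * (2 * pi) ^ n) = 2 * 2 powr p * (2 * pi) ^ n"
  proof -
    have "2 powr p = 2 ^ n * 2 powr \<nu>" unfolding p_def powr_add by (simp add: powr_realpow)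
    moreover have "(2::real) powr (\<nu> + 1) = 2 * 2 powr \<nu>" unfolding powr_add by simp
    ultimately show ?thesis by (simp only: mult_ac)
  qed
  also have "2 * 2 powr p * (2 * pi) ^ n * (p + 1) / (2 * pi) ^ (n + 1) = 2 powr p * (p + 1) / pi"
  proof -
    have gen: "2 * a * q * b / (q * (2 * c)) = a * b / c" if "q \<noteq> 0" for a b c q :: real
      using that by simp
    show ?thesis unfolding power_add power_one_right by (rule gen) simp
  qed
  finally have c: "bergman_const \<nu> n * fibre_const \<nu> n = 2 powr p * (p + 1) / pi" .
  have "(2 powr p * (p + 1) / pi) * (pi / (p + 1) / ((2 powr p * 2 powr p * A) * (4 * h\<^sup>2))) * (2 powr p * A * (4 * h\<^sup>2)) = 1"
  proof -
    have gen: "(a * b / \<pi>) * (\<pi> / b / ((a * a * A) * d)) * (a * A * d) = 1"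
      if "a \<noteq> 0" "b \<noteq> 0" "\<pi> \<noteq> 0" "d \<noteq> 0" "A \<noteq> 0" for a b \<pi> d :: real
      using that by (simp add: field_simps)
    show ?thesis by (rule gen) (use p h pos in auto)
  qed
  then show ?thesis unfolding c s e1 p_def[symmetric] e2 .
qed

text \<open>
  A Heisenberg translation moves \<open>\<zeta>\<close> to \<open>(0, \<i> h)\<close>.  There the kernel depends on the last coordinate
  only, so the integral over each fibre is a multiple of the value of \<open>F\<close> at the centre of the fibre
  (\<open>fibre_mean\<close>).  The remaining weight on the upper half-plane is invariant under the rotations
  about \<open>\<i> h\<close> once half of the kernel is moved into the holomorphic factor: the kernel is
  \<open>cnj Q\<^sup>-\<^sup>s = \<bar>Q\<bar>\<^sup>-\<^sup>2\<^sup>s Q\<^sup>s\<close>, and \<open>upper_mean_value\<close> applies to \<open>F Q\<^sup>s\<close>.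
\<close>

theorem bergman_reproducing:
  fixes F :: "(complex ^ 'n) \<times> complex \<Rightarrow> complex"
  assumes \<nu>: "\<nu> > -1" and hol: "pair.hol_on siegel_space F" and F2: "F \<in> sq_integrable (siegel_measure \<nu>)"
    and \<zeta>: "\<zeta> \<in> siegel_space"
  shows "(\<integral>\<eta>. F \<eta> * bergman_kernel \<nu> \<zeta> \<eta> \<partial>siegel_measure \<nu>) = F \<zeta>"
proof -
  let ?n = "CARD('n)"
  let ?p = "real ?n + \<nu>"
  let ?s = "kernel_exponent \<nu> ?n"
  define h where "h = siegel_rho \<zeta>"
  define b0 where "b0 = ((0 :: complex ^ 'n), \<i> * complex_of_real h)"
  have h: "h > 0" using siegel_rho_pos[OF \<zeta>] by (simp add: h_def)
  have b0: "b0 \<in> siegel_space" "heis \<zeta> b0 = \<zeta>" using h by (simp_all add: b0_def siegel_space_def heis_origin h_def)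
  have p: "?p > -1" using \<nu> by simp
  define F' where "F' \<eta> = F (heis \<zeta> \<eta>)" for \<eta>
  have hol': "pair.hol_on siegel_space F'" unfolding F'_def by (rule siegel_holomorphic_heis[OF hol])
  note K2 = bergman_kernel_sq_integrable[OF \<nu> \<zeta>]
  note FK = sq_integrable_product(1)[OF F2 K2]
  define g where "g \<eta> = indicator siegel_space \<eta> *\<^sub>R (siegel_rho \<eta> powr \<nu> *\<^sub>R (F \<eta> * bergman_kernel \<nu> \<zeta> \<eta>))" for \<eta>
  have int_g: "integrable lborel g"
    using FK unfolding g_def set_integrable_def[symmetric]
    by (subst (asm) integrable_siegel_measure[OF borel_measurable_integrable[OF FK]])
  have I: "(\<integral>\<eta>. F \<eta> * bergman_kernel \<nu> \<zeta> \<eta> \<partial>siegel_measure \<nu>) = (\<integral>\<eta>. g \<eta> \<partial>lborel)"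
    unfolding integral_siegel_measure[OF borel_measurable_integrable[OF FK]] g_def set_lebesgue_integral_def ..
  have gm: "g \<in> borel_measurable borel" using int_g by (auto dest: borel_measurable_integrable)
  define k where "k w = complex_of_real (bergman_const \<nu> ?n) * exp (- of_real ?s * Ln (of_real h + \<i> * cnj w))" for w
  have k0: "k w \<noteq> 0" for w using bergman_const_pos[OF \<nu>, of ?n] by (simp add: k_def)
  have gh: "g (heis \<zeta> (z, w)) = k w * (fibre_weight \<nu> (Im w) z *\<^sub>R F' (z, w))" for z w
  proof -
    have "bergman_kernel \<nu> \<zeta> (heis \<zeta> (z, w)) = bergman_kernel \<nu> b0 (z, w)"
      using bergman_kernel_heis[of \<nu> \<zeta> b0 "(z, w)"] by (simp add: b0)
    also have "\<dots> = k w" by (simp add: bergman_kernel_def b0_def siegel_pairing_origin k_def bergman_const_def)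
    finally have K: "bergman_kernel \<nu> \<zeta> (heis \<zeta> (z, w)) = k w" .
    have "g (heis \<zeta> (z, w)) = (indicator siegel_space (z, w) * siegel_rho (z, w) powr \<nu>) *\<^sub>R (F' (z, w) * k w)"
      unfolding g_def K F'_def siegel_rho_heis scaleR_scaleR by (simp add: indicator_def heis_siegel)
    then show ?thesis unfolding siegel_fibre_weight by (simp add: mult.commute)
  qed
  have int: "integrable (lborel \<Otimes>\<^sub>M lborel) (case_prod (\<lambda>z w. g (heis \<zeta> (z, w))))"
    using int_g integrable_heis[OF gm, of \<zeta>] by (simp add: lborel_prod split_beta')
  define G where "G w = F' (0, w) * exp (of_real ?s * Ln (of_real h - \<i> * w))" for w
  define C where "C = bergman_const \<nu> ?n * fibre_const \<nu> ?n"
  define r where "r w = indicator upper w *\<^sub>R (((Im w / (cmod (w + \<i> * of_real h))\<^sup>2) powr ?p / cmod (w + \<i> * of_real h) ^ 4) *\<^sub>R G w)" for w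
  have holG: "G holomorphic_on upper"
  proof -
    have "(\<lambda>w. F' ((0, 0) + pair_scale w (0, 1))) holomorphic_on {w. (0, 0) + pair_scale w (0, 1) \<in> (siegel_space :: ((complex ^ 'n) \<times> complex) set)}"
      by (rule pair.slice_holomorphic[OF hol'])
    then have "(\<lambda>w. F' (0, w)) holomorphic_on upper"
      by (simp add: pair_scale_def upper_def siegel_fibre)
    moreover have "of_real h - \<i> * w \<notin> \<real>\<^sub>\<le>\<^sub>0" if "w \<in> upper" for w
      using that h by (intro half_plane_nonpos) (simp add: half_plane_def upper_def)
    ultimately show ?thesis unfolding G_def by (intro holomorphic_intros) auto
  qed
  have inner: "(\<integral>z. g (heis \<zeta> (z, w)) \<partial>lborel) = C *\<^sub>R r w" if w: "integrable lborel (\<lambda>z. g (heis \<zeta> (z, w)))" for w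
  proof (cases "Im w > 0")
    case True
    then have wu: "w \<in> upper" by (simp add: upper_def)
    define q where "q = cmod (w + \<i> * of_real h)"
    define Q where "Q = of_real h - \<i> * w"
    have q: "q > 0" using upper_add_nonzero[OF wu h] by (simp add: q_def)
    have Qh: "Q \<in> half_plane" using True h by (simp add: Q_def half_plane_def)
    have cQ: "cnj Q = of_real h + \<i> * cnj w" by (simp add: Q_def)
    have nQ: "cmod Q = q" using cmod_pairing_origin[of h w] unfolding q_def cQ[symmetric] by simp
    have Q0: "Q \<noteq> 0" using nQ q by auto
    have kw: "k w = of_real (bergman_const \<nu> ?n * exp (- (2 * (?p + 2)) * ln q)) * exp (of_real ?s * Ln Q)"
    proof -
      have "exp (- of_real ?s * Ln (cnj Q)) = cnj (exp (- of_real ?s * Ln Q))"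
        using half_plane_nonpos[OF Qh] by (simp add: cnj_Ln exp_cnj)
      also have "\<dots> = (cnj (exp (- of_real ?s * Ln Q)) * exp (- of_real ?s * Ln Q)) * exp (of_real ?s * Ln Q)"
        by (simp add: mult.assoc flip: exp_add)
      also have "cnj (exp (- of_real ?s * Ln Q)) * exp (- of_real ?s * Ln Q) = of_real ((exp (- ?s * ln q))\<^sup>2)"
        using complex_mult_cnj_cmod[of "exp (- of_real ?s * Ln Q)"] Q0 nQ by (simp add: mult.commute)
      also have "(exp (- ?s * ln q))\<^sup>2 = exp (- (2 * (?p + 2)) * ln q)"
        by (simp add: kernel_exponent_def algebra_simps flip: exp_double)
      finally show ?thesis unfolding k_def cQ[symmetric] by simp
    qed
    have "integrable lborel (\<lambda>z. (1 / k w) * g (heis \<zeta> (z, w)))" using w by simp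
    then have "integrable lborel (\<lambda>z. fibre_weight \<nu> (Im w) z *\<^sub>R F' (z, w))" unfolding gh using k0[of w] by simp
    from fibre_mean[OF \<nu> True fibre_holomorphic[OF hol'] this]
    have "(\<integral>z. g (heis \<zeta> (z, w)) \<partial>lborel) = k w * ((fibre_const \<nu> ?n * Im w powr ?p) *\<^sub>R F' (0, w))"
      unfolding gh integral_mult_right_zero by (simp only:)
    also have "\<dots> = C *\<^sub>R (((Im w / q\<^sup>2) powr ?p / q ^ 4) *\<^sub>R G w)"
      unfolding half_plane_weight[OF True q] kw G_def C_def Q_def[symmetric] scaleR_conv_of_real
      by (simp only: of_real_mult mult_ac)
    finally show ?thesis using wu by (simp add: r_def q_def)
  next
    case False
    then show ?thesis by (simp add: gh fibre_weight_lower r_def upper_def)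
  qed
  have rm: "r \<in> borel_measurable borel"
  proof -
    have "(\<lambda>w. indicator upper w *\<^sub>R G w) \<in> borel_measurable borel"
      using open_upper by (intro borel_measurable_continuous_on_indicator holomorphic_on_imp_continuous_on holG) auto
    then have "(\<lambda>w. ((Im w / (cmod (w + \<i> * of_real h))\<^sup>2) powr ?p / cmod (w + \<i> * of_real h) ^ 4) *\<^sub>R (indicator upper w *\<^sub>R G w)) \<in> borel_measurable borel"
      by measurable
    then show ?thesis unfolding r_def by (simp add: mult.commute)
  qed
  have ae: "AE w in lborel. (\<integral>z. g (heis \<zeta> (z, w)) \<partial>lborel) = C *\<^sub>R r w"
    using lborel_pair.AE_integrable_snd[OF int] by eventually_elim (rule inner)
  have int2: "integrable lborel (\<lambda>w. \<integral>z. g (heis \<zeta> (z, w)) \<partial>lborel)"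
    by (rule lborel_pair.integrable_snd[OF int])
  have C0: "C > 0" unfolding C_def by (intro mult_pos_pos bergman_const_pos fibre_const_pos \<nu>)
  have "integrable lborel (\<lambda>w. C *\<^sub>R r w)"
    using int2 rm by (subst integrable_cong_AE[OF _ _ ae, symmetric]) (auto dest: borel_measurable_integrable)
  from integrable_scaleR_right[OF this, of "1 / C"]
  have "integrable lborel (\<lambda>w. (1 / C) *\<^sub>R (C *\<^sub>R r w))" .
  moreover have "(\<lambda>w. (1 / C) *\<^sub>R (C *\<^sub>R r w)) = r" using C0 by (intro ext) simp
  ultimately have int_r: "integrable lborel r" by (simp only:)
  have "(\<integral>\<eta>. g \<eta> \<partial>lborel) = (\<integral>\<eta>. g (heis \<zeta> \<eta>) \<partial>lborel)" by (rule integral_heis[OF gm, symmetric])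
  also have "\<dots> = (\<integral>w. (\<integral>z. g (heis \<zeta> (z, w)) \<partial>lborel) \<partial>lborel)"
    using lborel_pair.integral_snd[OF int] by (simp add: lborel_prod split_beta')
  also have "\<dots> = (\<integral>w. C *\<^sub>R r w \<partial>lborel)"
    using int2 rm by (intro integral_cong_AE ae) (auto dest: borel_measurable_integrable)
  also have "\<dots> = C *\<^sub>R (\<integral>w. r w \<partial>lborel)" by simp
  also have "(\<integral>w. r w \<partial>lborel) = (pi / (?p + 1) / ((4 * h) powr ?p * (4 * h\<^sup>2))) *\<^sub>R G (\<i> * of_real h)"
    using upper_mean_value[OF holG h p] int_r unfolding set_integrable_def set_lebesgue_integral_def r_def by blast
  also have "G (\<i> * of_real h) = of_real (exp (?s * ln (2 * h))) * F \<zeta>"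
  proof -
    have "F' (0, \<i> * of_real h) = F \<zeta>" using b0(2) by (simp add: F'_def b0_def)
    moreover have "of_real h - \<i> * (\<i> * of_real h) = complex_of_real (2 * h)" by simp
    moreover have "exp (of_real ?s * Ln (complex_of_real (2 * h))) = complex_of_real (exp (?s * ln (2 * h)))"
    proof -
      have "Ln (complex_of_real (2 * h)) = of_real (ln (2 * h))" using h by (intro Ln_of_real) simp
      then show ?thesis by (simp only: of_real_mult[symmetric] exp_of_real)
    qed
    ultimately show ?thesis unfolding G_def by (simp only: mult.commute)
  qed
  also have "C *\<^sub>R ((pi / (?p + 1) / ((4 * h) powr ?p * (4 * h\<^sup>2))) *\<^sub>R (of_real (exp (?s * ln (2 * h))) * F \<zeta>)) = F \<zeta>"
  proof -
    have "C *\<^sub>R (d *\<^sub>R (of_real e * x)) = of_real (C * d * e) * x" for d e and x :: complex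
      by (simp add: scaleR_conv_of_real)
    then show ?thesis unfolding C_def by (simp only: reproducing_constant[OF \<nu> h] of_real_1 mult_1)
  qed
  finally show ?thesis unfolding I .
qed

section \<open>Synthesis on the Siegel half-space\<close>

definition siegel_synthesis :: "real \<Rightarrow> (('n \<Rightarrow> nat) \<times> real \<Rightarrow> complex) \<Rightarrow> (complex ^ 'n) \<times> complex \<Rightarrow> complex" where
  "siegel_synthesis \<nu> a \<zeta> = (\<integral>y. a y * cnj (siegel_feature \<nu> \<zeta> y) \<partial>spectral_measure \<nu>)"

lemma synthesis_eq:
  "\<nu> > -1 \<Longrightarrow> feature_map.synthesis (spectral_measure \<nu>) (siegel_feature \<nu>) = siegel_synthesis \<nu>"
  by (intro ext) (simp add: feature_map.synthesis_def[OF siegel_feature_map] siegel_synthesis_def)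

lemma siegel_ker:
  assumes "\<nu> > -1" "x \<in> siegel_space" "y \<in> siegel_space"
  shows "feature_map.ker (spectral_measure \<nu>) (siegel_feature \<nu>) x y = bergman_kernel \<nu> x y"
  unfolding feature_map.ker_def[OF siegel_feature_map[OF assms(1)]] by (rule feature_inner[OF assms])

lemma bergman_reproduced:
  fixes F :: "(complex ^ 'n) \<times> complex \<Rightarrow> complex"
  assumes \<nu>: "\<nu> > -1" and F: "pair.hol_on siegel_space F" "F \<in> sq_integrable (siegel_measure \<nu>)"
  shows "F \<in> feature_map.reproduced (siegel_measure \<nu>) (spectral_measure \<nu>) (siegel_feature \<nu>)"
proof -
  have "F x = (\<integral>y. F y * feature_map.ker (spectral_measure \<nu>) (siegel_feature \<nu>) x y \<partial>siegel_measure \<nu>)"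
    if x: "x \<in> siegel_space" for x
    unfolding bergman_reproducing[OF \<nu> F x, symmetric]
    by (intro Bochner_Integration.integral_cong refl) (simp add: siegel_ker[OF \<nu> x])
  then show ?thesis unfolding feature_map.reproduced_def[OF siegel_feature_map[OF \<nu>]] using F(2) by simp
qed

lemma siegel_reproducing_feature_map:
  assumes \<nu>: "\<nu> > -1"
  shows "reproducing_feature_map (siegel_measure \<nu> :: ((complex ^ 'n) \<times> complex) measure) (spectral_measure \<nu>) (siegel_feature \<nu>)"
proof -
  interpret feature_map "siegel_measure \<nu> :: ((complex ^ 'n) \<times> complex) measure" "spectral_measure \<nu>" "siegel_feature \<nu>"
    by (rule siegel_feature_map[OF \<nu>])
  show ?thesis
  proof unfold_locales
    fix x :: "(complex ^ 'n) \<times> complex" assume "x \<in> space (siegel_measure \<nu>)"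
    then have x: "x \<in> siegel_space" by simp
    have k: "ker y x = bergman_kernel \<nu> y x" if "y \<in> siegel_space" for y by (rule siegel_ker[OF \<nu> that x])
    have "pair.hol_on siegel_space (\<lambda>y. ker y x)"
      by (rule pair.hol_on_cong[OF bergman_kernel_holomorphic[OF x] open_siegel]) (simp add: k)
    moreover have "(\<lambda>y. ker y x) \<in> sq_integrable (siegel_measure \<nu>)"
      using sq_integrable_cnj[OF bergman_kernel_sq_integrable[OF \<nu> x]]
      by (subst sq_integrable_cong) (auto simp: k cnj_bergman_kernel[OF x])
    ultimately show "(\<lambda>y. ker y x) \<in> reproduced" by (rule bergman_reproduced[OF \<nu>])
  qed
qed

definition spectral_integrand :: "(('n \<Rightarrow> nat) \<times> real \<Rightarrow> complex) \<Rightarrow> (complex ^ 'n) \<times> complex \<Rightarrow> real \<Rightarrow> complex" where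
  "spectral_integrand a \<zeta> l = exp (- \<i> * of_real l * snd \<zeta>) * fock_series \<bar>l\<bar> (\<lambda>\<alpha>. a (\<alpha>, l)) (fst \<zeta>) * of_real (\<bar>l\<bar> ^ CARD('n))"

text \<open>
  The powers of \<open>\<bar>l\<bar>\<close> and the Gamma factors in the weight and in the features are balanced so that
  they cancel in the synthesis, except for the Plancherel density \<open>\<bar>l\<bar>\<^sup>n / (2\<pi>)\<^sup>n\<^sup>+\<^sup>1\<close>.
\<close>

lemma
  fixes \<zeta> :: "(complex ^ 'n) \<times> complex"
  assumes \<nu>: "\<nu> > -1" and a: "a \<in> sq_integrable (spectral_measure \<nu>)" and \<zeta>: "\<zeta> \<in> siegel_space"
  shows spectral_integrand_integrable: "integrable lborel (\<lambda>l. indicator {..<0} l *\<^sub>R spectral_integrand a \<zeta> l)"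
    and siegel_synthesis_eq: "siegel_synthesis \<nu> a \<zeta>
      = of_real (1 / (2 * pi) ^ (CARD('n) + 1)) * (\<integral>l. indicator {..<0} l *\<^sub>R spectral_integrand a \<zeta> l \<partial>lborel)"
proof -
  let ?n = "CARD('n)"
  let ?c = "1 / (2 * pi) ^ (?n + 1)"
  have int: "integrable (spectral_measure \<nu>) (\<lambda>y. a y * cnj (siegel_feature \<nu> \<zeta> y))"
    by (intro sq_integrable_product a sq_integrable_cnj feature_sq_integrable \<nu> \<zeta>)
  have eq: "spectral_weight \<nu> ?n l *\<^sub>R (\<integral>\<alpha>. a (\<alpha>, l) * cnj (siegel_feature \<nu> \<zeta> (\<alpha>, l)) \<partial>count_space UNIV)
      = ?c *\<^sub>R (indicator {..<0} l *\<^sub>R spectral_integrand a \<zeta> l)" for l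
  proof (cases "l < 0")
    case True
    define E where "E = exp (- \<i> * of_real l * snd \<zeta>)"
    define b where "b = 2 powr (\<nu> + 1) / Gamma (\<nu> + 1) * \<bar>l\<bar> powr (\<nu> + 1)"
    have "a (\<alpha>, l) * cnj (siegel_feature \<nu> \<zeta> (\<alpha>, l)) = (of_real b * E) * (a (\<alpha>, l) * fock_basis \<bar>l\<bar> \<alpha> (fst \<zeta>))" for \<alpha>
      unfolding siegel_feature_def b_def E_def fst_conv snd_conv complex_cnj_mult complex_cnj_cnj complex_cnj_complex_of_real
      by (simp only: mult_ac)
    then have "(\<integral>\<alpha>. a (\<alpha>, l) * cnj (siegel_feature \<nu> \<zeta> (\<alpha>, l)) \<partial>count_space UNIV)
        = (of_real b * E) * fock_series \<bar>l\<bar> (\<lambda>\<alpha>. a (\<alpha>, l)) (fst \<zeta>)"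
      by (simp only: fock_series_def integral_mult_right_zero)
    moreover have "spectral_weight \<nu> ?n l * b = ?c * \<bar>l\<bar> ^ ?n"
    proof -
      have G: "Gamma (\<nu> + 1) \<noteq> 0" using Gamma_real_pos[of "\<nu> + 1"] \<nu> by linarith
      have p: "\<bar>l\<bar> powr (real ?n - (\<nu> + 1)) * \<bar>l\<bar> powr (\<nu> + 1) = \<bar>l\<bar> ^ ?n"
        using True by (simp add: powr_realpow flip: powr_add)
      have gen: "(g / p / q * u) * (p / g * v) = 1 / q * (u * v)" if "g \<noteq> 0" "p \<noteq> 0" for g p q u v :: real
        using that by (simp add: field_simps)
      have "spectral_weight \<nu> ?n l = Gamma (\<nu> + 1) / 2 powr (\<nu> + 1) / (2 * pi) ^ (?n + 1) * \<bar>l\<bar> powr (real ?n - (\<nu> + 1))"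
        using True by (simp add: spectral_weight_def)
      then show ?thesis unfolding b_def p[symmetric] by (simp only:) (rule gen, use G in simp_all)
    qed
    moreover have "w *\<^sub>R ((of_real b * E) * X) = (w * b) *\<^sub>R (E * X)" for w X
      by (simp add: scaleR_conv_of_real)
    moreover have "(?c * r) *\<^sub>R (E * X) = ?c *\<^sub>R (E * X * of_real r)" for r X
      by (simp add: scaleR_conv_of_real)
    ultimately show ?thesis using True by (simp only: spectral_integrand_def E_def[symmetric]) (simp add: indicator_def)
  qed (simp add: spectral_weight_zero)
  have "integrable lborel (\<lambda>l. ?c *\<^sub>R (indicator {..<0} l *\<^sub>R spectral_integrand a \<zeta> l))"
    using integral_spectral(2)[OF \<nu> int] unfolding eq .
  from integrable_scaleR_right[OF this, of "1 / ?c"]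
  have "integrable lborel (\<lambda>l. (1 / ?c) *\<^sub>R (?c *\<^sub>R (indicator {..<0} l *\<^sub>R spectral_integrand a \<zeta> l)))" .
  moreover have "(1 / ?c) *\<^sub>R (?c *\<^sub>R x) = x" for x :: complex by (simp add: scaleR_scaleR del: power_Suc)
  ultimately show "integrable lborel (\<lambda>l. indicator {..<0} l *\<^sub>R spectral_integrand a \<zeta> l)" by (simp only:)
  show "siegel_synthesis \<nu> a \<zeta>
      = of_real ?c * (\<integral>l. indicator {..<0} l *\<^sub>R spectral_integrand a \<zeta> l \<partial>lborel)"
    unfolding siegel_synthesis_def integral_spectral(1)[OF \<nu> int] eq integral_scaleR_right
    by (rule scaleR_conv_of_real)
qed

lemma spectral_weight_pos: "\<nu> > -1 \<Longrightarrow> l < 0 \<Longrightarrow> spectral_weight \<nu> n l > 0"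
  using Gamma_real_pos[of "\<nu> + 1"] by (simp add: spectral_weight_def)

lemma sq_integrable_count_nn:
  "a \<in> sq_integrable (count_space UNIV) \<longleftrightarrow> (\<integral>\<^sup>+\<alpha>. ennreal ((cmod (a \<alpha>))\<^sup>2) \<partial>count_space UNIV) < \<infinity>"
  by (simp add: sq_integrable_def integrable_iff_bounded)

lemma nn_integral_count_sq:
  "a \<in> sq_integrable (count_space UNIV) \<Longrightarrow> (\<integral>\<^sup>+\<alpha>. ennreal ((cmod (a \<alpha>))\<^sup>2) \<partial>count_space UNIV) = ennreal (sq_norm (count_space UNIV) a)"
  unfolding sq_norm_def by (intro nn_integral_eq_integral) (auto simp: sq_integrable_def)

lemma spectral_section_nn_measurable:
  fixes a :: "('n::finite \<Rightarrow> nat) \<times> real \<Rightarrow> complex"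
  assumes [measurable]: "\<And>\<alpha>. (\<lambda>l. a (\<alpha>, l)) \<in> borel_measurable borel"
  shows "(\<lambda>l. \<integral>\<^sup>+\<alpha>. ennreal ((cmod (a (\<alpha>, l)))\<^sup>2) \<partial>count_space UNIV) \<in> borel_measurable borel"
proof -
  interpret sigma_finite_measure "count_space (UNIV :: ('n \<Rightarrow> nat) set)"
    by (rule sigma_finite_measure_count_space_countable) simp
  have "(\<lambda>x. ennreal ((cmod (a (\<alpha>, fst x)))\<^sup>2)) \<in> borel_measurable (borel \<Otimes>\<^sub>M count_space (UNIV :: ('n \<Rightarrow> nat) set))" for \<alpha>
    by measurable
  from measurable_compose_countable[where f = "\<lambda>\<alpha> x. ennreal ((cmod (a (\<alpha>, fst x)))\<^sup>2)", OF this measurable_snd]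
  show ?thesis by (intro borel_measurable_nn_integral) (simp add: split_beta')
qed

lemma spectral_sections:
  fixes a :: "('n::finite \<Rightarrow> nat) \<times> real \<Rightarrow> complex"
  assumes \<nu>: "\<nu> > -1" and a: "a \<in> sq_integrable (spectral_measure \<nu>)"
  shows "AE l in lborel. l < 0 \<longrightarrow> (\<lambda>\<alpha>. a (\<alpha>, l)) \<in> sq_integrable (count_space UNIV)"
proof -
  have [measurable]: "a \<in> borel_measurable (spectral_measure \<nu>)" by (rule sq_integrable_measurable[OF a])
  note m[measurable] = spectral_section_nn_measurable[OF spectral_measurableD[OF sq_integrable_measurable[OF a]]]
  have "(\<integral>\<^sup>+l. ennreal (spectral_weight \<nu> CARD('n) l) * (\<integral>\<^sup>+\<alpha>. ennreal ((cmod (a (\<alpha>, l)))\<^sup>2) \<partial>count_space UNIV) \<partial>lborel)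
      = (\<integral>\<^sup>+y. ennreal ((cmod (a y))\<^sup>2) \<partial>spectral_measure \<nu>)"
    by (rule nn_integral_spectral[OF \<nu>, symmetric]) measurable
  also have "\<dots> < \<infinity>" using a by (simp add: sq_integrable_def integrable_iff_bounded)
  finally have "AE l in lborel. ennreal (spectral_weight \<nu> CARD('n) l) * (\<integral>\<^sup>+\<alpha>. ennreal ((cmod (a (\<alpha>, l)))\<^sup>2) \<partial>count_space UNIV) \<noteq> \<infinity>"
    by (intro nn_integral_PInf_AE) auto
  then show ?thesis
  proof eventually_elim
    case (elim l)
    show ?case
    proof
      assume "l < 0"
      from spectral_weight_pos[OF \<nu> this, of "CARD('n)"] elim
      show "(\<lambda>\<alpha>. a (\<alpha>, l)) \<in> sq_integrable (count_space UNIV)"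
        unfolding sq_integrable_count_nn by (auto simp: ennreal_mult_eq_top_iff less_top)
    qed
  qed
qed

lemma
  fixes a :: "('n::finite \<Rightarrow> nat) \<times> real \<Rightarrow> complex"
  assumes \<nu>: "\<nu> > -1" and a: "a \<in> sq_integrable (spectral_measure \<nu>)"
  shows spectral_norm_integrable: "integrable lborel (\<lambda>l. spectral_weight \<nu> CARD('n) l * sq_norm (count_space UNIV) (\<lambda>\<alpha>. a (\<alpha>, l)))"
    and sq_norm_spectral: "sq_norm (spectral_measure \<nu>) a = (\<integral>l. spectral_weight \<nu> CARD('n) l * sq_norm (count_space UNIV) (\<lambda>\<alpha>. a (\<alpha>, l)) \<partial>lborel)"
proof -
  have int: "integrable (spectral_measure \<nu>) (\<lambda>y. complex_of_real ((cmod (a y))\<^sup>2))"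
    using sq_integrableD[OF a] by (simp only: complex_of_real_integrable_eq)
  have eq: "spectral_weight \<nu> CARD('n) l *\<^sub>R (\<integral>\<alpha>. complex_of_real ((cmod (a (\<alpha>, l)))\<^sup>2) \<partial>count_space UNIV)
     = complex_of_real (spectral_weight \<nu> CARD('n) l * sq_norm (count_space UNIV) (\<lambda>\<alpha>. a (\<alpha>, l)))" for l
    unfolding integral_complex_of_real sq_norm_def by (simp add: scaleR_conv_of_real)
  show "integrable lborel (\<lambda>l. spectral_weight \<nu> CARD('n) l * sq_norm (count_space UNIV) (\<lambda>\<alpha>. a (\<alpha>, l)))"
    using integral_spectral(2)[OF \<nu> int] unfolding eq by (simp only: complex_of_real_integrable_eq)
  show "sq_norm (spectral_measure \<nu>) a = (\<integral>l. spectral_weight \<nu> CARD('n) l * sq_norm (count_space UNIV) (\<lambda>\<alpha>. a (\<alpha>, l)) \<partial>lborel)"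
    using integral_spectral(1)[OF \<nu> int] unfolding eq
    unfolding integral_complex_of_real of_real_eq_iff sq_norm_def[of "spectral_measure \<nu>"] .
qed


section \<open>Injectivity of the synthesis\<close>

lemma real_fourier_unique:
  fixes b :: "real \<Rightarrow> real"
  assumes b: "integrable lborel b" and zero: "\<And>t. (\<integral>l. iexp (t * l) * complex_of_real (b l) \<partial>lborel) = 0"
  shows "AE l in lborel. b l = 0"
proof -
  define p where "p l = max 0 (b l)" for l
  define m where "m l = max 0 (- b l)" for l
  have [measurable]: "b \<in> borel_measurable borel" using b by (auto dest: borel_measurable_integrable)
  have pi: "integrable lborel p" "integrable lborel m"
    unfolding p_def m_def using b by (auto intro!: integrable_max)
  have pos: "p l \<ge> 0" "m l \<ge> 0" for l by (simp_all add: p_def m_def)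
  have b_eq: "b l = p l - m l" for l by (simp add: p_def m_def)
  have iexp_int: "integrable lborel (\<lambda>l. iexp (t * l) * complex_of_real (f l))" if f: "integrable lborel f" for f :: "real \<Rightarrow> real" and t
    by (rule Bochner_Integration.integrable_bound[OF f])
       (use f in \<open>auto simp: norm_mult dest: borel_measurable_integrable\<close>)
  have eq: "(\<integral>l. iexp (t * l) * complex_of_real (p l) \<partial>lborel) = (\<integral>l. iexp (t * l) * complex_of_real (m l) \<partial>lborel)" for t
    using zero[of t] Bochner_Integration.integral_diff[OF iexp_int[OF pi(1), of t] iexp_int[OF pi(2), of t]]
    by (simp add: b_eq right_diff_distrib)
  define c where "c = (\<integral>l. p l \<partial>lborel)"
  have "complex_of_real (\<integral>l. p l \<partial>lborel) = complex_of_real (\<integral>l. m l \<partial>lborel)"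
    using eq[of 0] by simp
  then have cm: "c = (\<integral>l. m l \<partial>lborel)" unfolding c_def of_real_eq_iff .
  show ?thesis
  proof (cases "c = 0")
    case True
    have "AE l in lborel. p l = 0" "AE l in lborel. m l = 0"
      using integral_nonneg_eq_0_iff_AE[OF pi(1)] integral_nonneg_eq_0_iff_AE[OF pi(2)] True cm pos by (auto simp: c_def)
    then show ?thesis by eventually_elim (simp add: b_eq)
  next
    case False
    have c: "c > 0" using False pos by (simp add: c_def order.strict_iff_order)
    define D where "D f = density lborel (\<lambda>l. ennreal (f l / c))" for f :: "real \<Rightarrow> real"
    have D: "real_distribution (D f)" "char (D f) t = of_real (1 / c) * (\<integral>l. iexp (t * l) * complex_of_real (f l) \<partial>lborel)"
      if f: "integrable lborel f" "\<And>l. f l \<ge> 0" "(\<integral>l. f l \<partial>lborel) = c" for f t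
    proof -
      have [measurable]: "f \<in> borel_measurable borel" using f(1) by (auto dest: borel_measurable_integrable)
      have "(\<integral>\<^sup>+l. ennreal (f l / c) \<partial>lborel) = ennreal (\<integral>l. f l / c \<partial>lborel)"
        using f c by (intro nn_integral_eq_integral) auto
      also have "\<dots> = 1" using f(3) c by simp
      finally have "emeasure (D f) (space (D f)) = 1" by (simp add: D_def emeasure_density)
      then show "real_distribution (D f)"
        by (intro real_distribution.intro prob_spaceI real_distribution_axioms.intro) (simp_all add: D_def)
      have "char (D f) t = (\<integral>l. (f l / c) *\<^sub>R iexp (t * l) \<partial>lborel)"
        unfolding char_def D_def using f(2) c by (intro integral_density) auto
      also have "\<dots> = (\<integral>l. of_real (1 / c) * (iexp (t * l) * complex_of_real (f l)) \<partial>lborel)"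
        by (intro Bochner_Integration.integral_cong refl) (simp add: scaleR_conv_of_real)
      finally show "char (D f) t = of_real (1 / c) * (\<integral>l. iexp (t * l) * complex_of_real (f l) \<partial>lborel)"
        by simp
    qed
    have "char (D p) = char (D m)"
      using D(2)[OF pi(1) pos(1) c_def[symmetric]] D(2)[OF pi(2) pos(2) cm[symmetric]] eq by (intro ext) simp
    then have "D p = D m"
      by (rule Levy_uniqueness[OF D(1)[OF pi(1) pos(1) c_def[symmetric]] D(1)[OF pi(2) pos(2) cm[symmetric]]])
    then have "AE l in lborel. ennreal (p l / c) = ennreal (m l / c)"
      unfolding D_def by (intro sigma_finite_measure.density_unique[OF sigma_finite_lborel]) (auto simp: p_def m_def)
    then show ?thesis
    proof eventually_elim
      case (elim l)
      then have "p l = m l" using pos[of l] c by (simp add: ennreal_inj)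
      then show ?case by (simp add: b_eq)
    qed
  qed
qed

lemma fourier_unique:
  fixes b :: "real \<Rightarrow> complex"
  assumes b: "integrable lborel b" and zero: "\<And>t. (\<integral>l. iexp (t * l) * b l \<partial>lborel) = 0"
  shows "AE l in lborel. b l = 0"
proof -
  have int: "integrable lborel (\<lambda>l. iexp (t * l) * f l)" if f: "integrable lborel f" for f :: "real \<Rightarrow> complex" and t
    by (rule Bochner_Integration.integrable_bound[OF f])
       (use f in \<open>auto simp: norm_mult dest: borel_measurable_integrable\<close>)
  have cb: "integrable lborel (\<lambda>l. cnj (b l))" using b by simp
  have zc: "(\<integral>l. iexp (t * l) * cnj (b l) \<partial>lborel) = 0" for t
  proof -
    have "(\<integral>l. iexp (t * l) * cnj (b l) \<partial>lborel) = (\<integral>l. cnj (iexp (- t * l) * b l) \<partial>lborel)"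
      by (intro Bochner_Integration.integral_cong refl) (simp add: exp_cnj)
    also have "\<dots> = cnj 0" unfolding zero[of "- t", symmetric] by (rule Bochner_Integration.integral_cnj)
    finally show ?thesis by simp
  qed
  have "AE l in lborel. Re (b l) = 0"
  proof (rule real_fourier_unique)
    fix t
    have "iexp (t * l) * complex_of_real (Re (b l)) = (1 / 2) * (iexp (t * l) * b l + iexp (t * l) * cnj (b l))" for l
      using complex_add_cnj[of "b l"] by (simp flip: distrib_left)
    then show "(\<integral>l. iexp (t * l) * complex_of_real (Re (b l)) \<partial>lborel) = 0"
      by (simp only: integral_mult_right_zero Bochner_Integration.integral_add[OF int[OF b] int[OF cb]] zero zc) simp
  qed (use b in simp)
  moreover have "AE l in lborel. Im (b l) = 0"
  proof (rule real_fourier_unique)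
    fix t
    have "complex_of_real (Im (b l)) = (- \<i> / 2) * (b l - cnj (b l))" for l by (simp add: complex_eq_iff)
    then have "iexp (t * l) * complex_of_real (Im (b l)) = (- \<i> / 2) * (iexp (t * l) * b l - iexp (t * l) * cnj (b l))" for l
      unfolding right_diff_distrib[symmetric] by (simp only: mult.left_commute)
    then show "(\<integral>l. iexp (t * l) * complex_of_real (Im (b l)) \<partial>lborel) = 0"
      by (simp only: integral_mult_right_zero Bochner_Integration.integral_diff[OF int[OF b] int[OF cb]] zero zc) simp
  qed (use b in simp)
  ultimately show ?thesis by eventually_elim (simp add: complex_eq_iff)
qed

lemma fock_series_measurable:
  fixes a :: "('n::finite \<Rightarrow> nat) \<times> real \<Rightarrow> complex"
  assumes [measurable]: "\<And>\<alpha>. (\<lambda>l. a (\<alpha>, l)) \<in> borel_measurable borel"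
  shows "(\<lambda>(z, l). fock_series \<bar>l\<bar> (\<lambda>\<alpha>. a (\<alpha>, l)) z) \<in> borel_measurable (lborel \<Otimes>\<^sub>M lborel)"
proof -
  interpret sigma_finite_measure "count_space (UNIV :: ('n \<Rightarrow> nat) set)"
    by (rule sigma_finite_measure_count_space_countable) simp
  let ?P = "(lborel \<Otimes>\<^sub>M lborel) :: ((complex ^ 'n) \<times> real) measure"
  have "(\<lambda>x. a (\<alpha>, snd (fst x)) * fock_basis \<bar>snd (fst x)\<bar> \<alpha> (fst (fst x))) \<in> borel_measurable (?P \<Otimes>\<^sub>M count_space (UNIV :: ('n \<Rightarrow> nat) set))" for \<alpha>
    unfolding fock_basis_def by measurable
  from measurable_compose_countable[where f = "\<lambda>\<alpha> x. a (\<alpha>, snd (fst x)) * fock_basis \<bar>snd (fst x)\<bar> \<alpha> (fst (fst x))", OF this measurable_snd]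
  show ?thesis unfolding fock_series_def split_beta' by (intro borel_measurable_lebesgue_integral) (simp add: split_beta')
qed

text \<open>
  On a horizontal line \<open>(z, t + \<i> y)\<close> the synthesis is a Fourier transform in \<open>t\<close>, so it vanishes only
  if almost every Fock series vanishes at \<open>z\<close>; varying \<open>z\<close>, the unitarity of the Fock expansion
  makes the coefficients vanish.
\<close>

lemma siegel_synthesis_injective:
  fixes a :: "('n::finite \<Rightarrow> nat) \<times> real \<Rightarrow> complex"
  assumes \<nu>: "\<nu> > -1" and a: "a \<in> sq_integrable (spectral_measure \<nu>)"
    and zero: "\<And>\<zeta>. \<zeta> \<in> siegel_space \<Longrightarrow> siegel_synthesis \<nu> a \<zeta> = 0"
  shows "AE y in spectral_measure \<nu>. a y = 0"
proof -
  define g where "g z l = fock_series \<bar>l\<bar> (\<lambda>\<alpha>. a (\<alpha>, l)) z" for z :: "complex ^ 'n" and l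
  have am[measurable]: "a \<in> borel_measurable (spectral_measure \<nu>)" by (rule sq_integrable_measurable[OF a])
  have gm[measurable]: "(\<lambda>(z, l). g z l) \<in> borel_measurable (lborel \<Otimes>\<^sub>M lborel)"
    unfolding g_def by (rule fock_series_measurable[OF spectral_measurableD[OF am]])
  have AE_l: "AE l in lborel. l < 0 \<longrightarrow> g z l = 0" for z
  proof -
    define y0 where "y0 = (norm z)\<^sup>2 / 4 + 1"
    define b where "b l = indicator {..<0} l *\<^sub>R spectral_integrand a (z, \<i> * of_real y0) l" for l
    have \<zeta>: "(z, of_real t + \<i> * of_real y0) \<in> siegel_space" for t by (simp add: siegel_fibre y0_def)
    have "integrable lborel b" unfolding b_def using spectral_integrand_integrable[OF \<nu> a \<zeta>[of 0]] by simp
    moreover have "(\<integral>l. iexp (t * l) * b l \<partial>lborel) = 0" for t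
    proof -
      have "iexp (t * l) * b l = indicator {..<0} l *\<^sub>R spectral_integrand a (z, of_real (- t) + \<i> * of_real y0) l" for l
      proof -
        have "iexp (t * l) * exp (- \<i> * of_real l * (\<i> * of_real y0)) = exp (- \<i> * of_real l * (of_real (- t) + \<i> * of_real y0))"
          by (simp add: algebra_simps flip: exp_add)
        then show ?thesis unfolding b_def spectral_integrand_def fst_conv snd_conv
          by (metis (no_types, lifting) mult.assoc mult_scaleR_right)
      qed
      then show ?thesis
        using siegel_synthesis_eq[OF \<nu> a \<zeta>[of "- t"]] zero[OF \<zeta>[of "- t"]] by (simp del: of_real_minus)
    qed
    ultimately have "AE l in lborel. b l = 0" by (rule fourier_unique)
    then show ?thesis
      by eventually_elim (auto simp: b_def spectral_integrand_def g_def)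
  qed
  have "AE l in lborel. AE z in (lborel :: (complex ^ 'n) measure). l < 0 \<longrightarrow> g z l = 0"
  proof (subst lborel_pair.AE_commute[symmetric])
    show "{x \<in> space (lborel \<Otimes>\<^sub>M lborel). snd x < 0 \<longrightarrow> g (fst x) (snd x) = 0} \<in> sets (lborel \<Otimes>\<^sub>M (lborel :: real measure))"
    proof -
      note [measurable] = gm[unfolded split_beta']
      have "Measurable.pred (lborel \<Otimes>\<^sub>M (lborel :: real measure)) (\<lambda>x. snd x < 0 \<longrightarrow> g (fst x) (snd x) = 0)" by measurable
      then show ?thesis by (simp only: pred_def)
    qed
  qed (use AE_l in simp)
  with spectral_sections[OF \<nu> a] have ae: "AE l in lborel. l < 0 \<longrightarrow> (\<forall>\<alpha>. a (\<alpha>, l) = 0)"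
  proof eventually_elim
    case (elim l)
    show ?case
    proof (intro impI allI)
      fix \<alpha> assume l: "l < 0"
      then have m: "\<bar>l\<bar> > 0" and s: "(\<lambda>\<alpha>. a (\<alpha>, l)) \<in> sq_integrable (count_space UNIV)" using elim(1) by auto
      have ae0: "AE z in fock_measure \<bar>l\<bar>. g z l = 0"
      proof -
        have "AE z in lborel. 0 < ennreal (gauss \<bar>l\<bar> z) \<longrightarrow> g z l = 0"
          using elim(2) by eventually_elim (use l in simp)
        then show ?thesis unfolding fock_measure_def by (subst AE_density) auto
      qed
      have "sq_norm (fock_measure \<bar>l\<bar>) (\<lambda>z. g z l) = 0"
      proof -
        have "AE z in fock_measure \<bar>l\<bar>. (cmod (g z l))\<^sup>2 = 0" using ae0 by eventually_elim simp
        then show ?thesis unfolding sq_norm_def by (rule integral_eq_zero_AE)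
      qed
      then have "sq_norm (count_space UNIV) (\<lambda>\<alpha>. a (\<alpha>, l)) = 0"
        using fock_series_unitary(1)[OF m s] by (simp add: g_def)
      then have "AE \<alpha> in count_space UNIV. (cmod (a (\<alpha>, l)))\<^sup>2 = 0"
        using sq_integrableD[OF s] unfolding sq_norm_def by (subst integral_nonneg_eq_0_iff_AE[symmetric]) auto
      then show "a (\<alpha>, l) = 0" by (simp add: AE_count_space)
    qed
  qed
  have "(\<integral>\<^sup>+y. ennreal ((cmod (a y))\<^sup>2) \<partial>spectral_measure \<nu>) = (\<integral>\<^sup>+l. 0 \<partial>(lborel :: real measure))"
  proof (subst nn_integral_spectral[OF \<nu>])
    show "(\<integral>\<^sup>+l. ennreal (spectral_weight \<nu> CARD('n) l) * (\<integral>\<^sup>+\<alpha>. ennreal ((cmod (a (\<alpha>, l)))\<^sup>2) \<partial>count_space UNIV) \<partial>lborel) = (\<integral>\<^sup>+l. 0 \<partial>(lborel :: real measure))"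
    proof (rule nn_integral_cong_AE)
      show "AE l in lborel. ennreal (spectral_weight \<nu> CARD('n) l) * (\<integral>\<^sup>+\<alpha>. ennreal ((cmod (a (\<alpha>, l)))\<^sup>2) \<partial>count_space UNIV) = 0"
        using ae
      proof eventually_elim
        case (elim l)
        then show ?case by (cases "l < 0") (simp_all add: spectral_weight_zero)
      qed
    qed
  qed measurable
  then have "AE y in spectral_measure \<nu>. ennreal ((cmod (a y))\<^sup>2) = 0"
    by (subst nn_integral_0_iff_AE[symmetric]) auto
  then show ?thesis by eventually_elim (simp add: ennreal_eq_0_iff)
qed

section \<open>The synthesis as a unitary operator onto the Bergman space\<close>

lemma cmod_fock_basis_mono:
  fixes x y :: "complex ^ 'n"
  assumes "\<And>j. cmod (x $ j) \<le> cmod (y $ j)" shows "cmod (fock_basis m \<alpha> x) \<le> cmod (fock_basis m \<alpha> y)"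
  unfolding fock_basis_def monomial_def norm_mult prod_norm[symmetric] norm_power
  by (intro mult_left_mono prod_mono conjI power_mono assms) auto

lemma AE_spectral_negative:
  assumes \<nu>: "\<nu> > -1" shows "AE y in (spectral_measure \<nu> :: (('n::finite \<Rightarrow> nat) \<times> real) measure). snd y < 0"
proof -
  define f where "f y = (indicator {0..} (snd y) :: ennreal)" for y :: "('n \<Rightarrow> nat) \<times> real"
  have [measurable]: "f \<in> borel_measurable (spectral_measure \<nu>)"
    by (rule spectral_measurableI) (simp add: f_def)
  have "(\<integral>\<^sup>+y. f y \<partial>spectral_measure \<nu>) = (\<integral>\<^sup>+l. 0 \<partial>(lborel :: real measure))"
  proof (subst nn_integral_spectral[OF \<nu>], measurable, rule nn_integral_cong)
    fix l :: real
    show "ennreal (spectral_weight \<nu> CARD('n) l) * (\<integral>\<^sup>+\<alpha>. f (\<alpha>, l) \<partial>count_space UNIV) = 0"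
      by (cases "l < 0") (simp_all add: spectral_weight_zero f_def)
  qed
  then have "AE y in spectral_measure \<nu>. f y = 0" by (subst nn_integral_0_iff_AE[symmetric]) auto
  then show ?thesis by eventually_elim (auto simp: f_def indicator_def split: if_splits)
qed

lemma norm_sq_vec: "(norm (x :: complex ^ 'n))\<^sup>2 = (\<Sum>j\<in>UNIV. (cmod (x $ j))\<^sup>2)"
  by (simp add: norm_vec_def L2_set_def sum_nonneg)

text \<open>
  Near a point the features are dominated by the feature at the corner of a polydisc: for \<open>l < 0\<close>
  both the exponential and the monomials are largest where \<open>Im\<close> of the last coordinate is smallest and
  the moduli of the others are largest.  Only the spectrum \<open>l < 0\<close> carries mass.
\<close>

lemma siegel_synthesis_holomorphic:
  fixes a :: "('n::finite \<Rightarrow> nat) \<times> real \<Rightarrow> complex"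
  assumes \<nu>: "\<nu> > -1" and a: "a \<in> sq_integrable (spectral_measure \<nu>)"
  shows "pair.hol_on siegel_space (siegel_synthesis \<nu> a)"
  unfolding pair.hol_on_def
proof
  fix \<zeta> :: "(complex ^ 'n) \<times> complex" assume \<zeta>: "\<zeta> \<in> siegel_space"
  have [measurable]: "a \<in> borel_measurable (spectral_measure \<nu>)" by (rule sq_integrable_measurable[OF a])
  have fm[measurable]: "siegel_feature \<nu> q \<in> borel_measurable (spectral_measure \<nu>)" for q :: "(complex ^ 'n) \<times> complex"
    by (rule feature_measurable1)
  have lm: "snd \<in> borel_measurable (spectral_measure \<nu> :: (('n \<Rightarrow> nat) \<times> real) measure)"
    by (rule spectral_measurableI) simp
  then have [measurable]: "Measurable.pred (spectral_measure \<nu> :: (('n \<Rightarrow> nat) \<times> real) measure) (\<lambda>y. snd y < 0)"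
    by measurable
  define corner where "corner r = ((\<chi> j. of_real (cmod (fst \<zeta> $ j) + r)) :: complex ^ 'n, \<i> * of_real (Im (snd \<zeta>) - r))" for r
  define \<phi> where "\<phi> r = (\<Sum>j\<in>UNIV. (cmod (fst \<zeta> $ j) + r)\<^sup>2) / 4 - (Im (snd \<zeta>) - r)" for r
  have corner: "corner r \<in> siegel_space \<longleftrightarrow> \<phi> r < 0" for r
  proof -
    have "(norm (fst (corner r)))\<^sup>2 = (\<Sum>j\<in>UNIV. (cmod (fst \<zeta> $ j) + r)\<^sup>2)"
      unfolding norm_sq_vec corner_def fst_conv vec_lambda_beta norm_of_real by simp
    then show ?thesis by (simp add: siegel_space_def \<phi>_def corner_def)
  qed
  have "open {r. \<phi> r < 0}" unfolding \<phi>_def by (intro open_Collect_less continuous_intros) auto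
  moreover have "\<phi> 0 < 0" using \<zeta> by (simp add: siegel_space_def \<phi>_def norm_sq_vec)
  ultimately obtain e where e: "e > 0" "ball 0 e \<subseteq> {r. \<phi> r < 0}" using open_contains_ball_eq by blast
  define r where "r = e / 2"
  have r: "r > 0" "corner r \<in> siegel_space" using e by (auto simp: r_def corner subset_eq)
  define f where "f q y = (if snd y < 0 then a y * cnj (siegel_feature \<nu> q y) else 0)" for q y
  have f_eq: "siegel_synthesis \<nu> a q = (\<integral>y. f q y \<partial>spectral_measure \<nu>)" for q
    unfolding siegel_synthesis_def
  proof (rule integral_cong_AE)
    show "AE y in spectral_measure \<nu>. a y * cnj (siegel_feature \<nu> q y) = f q y"
      using AE_spectral_negative[OF \<nu>] by eventually_elim (simp add: f_def)
  qed (unfold f_def, measurable)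
  have "\<exists>D. ((\<lambda>q. \<integral>y. f q y \<partial>spectral_measure \<nu>) has_derivative D) (at \<zeta>) \<and> (\<forall>c v. D (pair_scale c v) = c * D v)"
  proof (rule pair.hol_integral[OF r(1)])
    show "f q \<in> borel_measurable (spectral_measure \<nu>)" for q unfolding f_def by measurable
    show "integrable (spectral_measure \<nu>) (\<lambda>y. cmod (a y * cnj (siegel_feature \<nu> (corner r) y)))"
      by (intro integrable_norm sq_integrable_product a sq_integrable_cnj feature_sq_integrable \<nu> r)
    fix y :: "('n \<Rightarrow> nat) \<times> real"
    define m where "m = \<bar>snd y\<bar>"
    define b where "b = 2 powr (\<nu> + 1) / Gamma (\<nu> + 1) * m powr (\<nu> + 1)"
    have feat: "cnj (siegel_feature \<nu> q y) = of_real b * (exp ((- \<i> * of_real (snd y)) * snd q) * fock_basis m (fst y) (fst q))" for q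
      unfolding siegel_feature_def b_def m_def complex_cnj_mult complex_cnj_cnj complex_cnj_complex_of_real ..
    show "pair.hol_on (ball \<zeta> r) (\<lambda>q. f q y)"
    proof (cases "snd y < 0")
      case True
      have lin1: "pair.hol_on (ball \<zeta> r) (snd :: (complex ^ 'n) \<times> complex \<Rightarrow> complex)"
        by (rule pair.hol_on_linear) (simp_all add: bounded_linear_snd pair_scale_def)
      have lin2: "pair.hol_on (ball \<zeta> r) (\<lambda>q :: (complex ^ 'n) \<times> complex. fst q $ j)" for j
        by (rule pair.hol_on_linear)
           (simp_all add: pair_scale_def bounded_linear_compose[OF bounded_linear_vec_nth bounded_linear_fst])
      show ?thesis unfolding f_def if_P[OF True] feat fock_basis_def monomial_def
        by (intro pair.hol_on_mult pair.hol_on_const pair.hol_on_exp pair.hol_on_prod pair.hol_on_power lin1 lin2)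
    qed (simp add: f_def pair.hol_on_const)
    fix q assume q: "q \<in> ball \<zeta> r"
    show "cmod (f q y) \<le> cmod (a y * cnj (siegel_feature \<nu> (corner r) y))"
    proof (cases "snd y < 0")
      case True
      have d: "dist \<zeta> q < r" using q by simp
      have "\<bar>Im (snd \<zeta> - snd q)\<bar> \<le> dist (snd \<zeta>) (snd q)" unfolding dist_norm by (rule abs_Im_le_cmod)
      also have "\<dots> \<le> dist \<zeta> q" by (rule dist_snd_le)
      finally have "Im (snd \<zeta>) - r \<le> Im (snd q)" using d by simp
      then have ex: "cmod (exp ((- \<i> * of_real (snd y)) * snd q)) \<le> cmod (exp ((- \<i> * of_real (snd y)) * snd (corner r)))"
        unfolding norm_exp_eq_Re corner_def using True by (simp add: mult_left_mono_neg)
      have fb: "cmod (fock_basis m (fst y) (fst q)) \<le> cmod (fock_basis m (fst y) (fst (corner r)))"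
      proof (rule cmod_fock_basis_mono)
        fix j
        have "dist (fst \<zeta> $ j) (fst q $ j) \<le> dist (fst \<zeta>) (fst q)" by (rule dist_vec_nth_le)
        also have "\<dots> \<le> dist \<zeta> q" by (rule dist_fst_le)
        finally have "cmod (fst \<zeta> $ j - fst q $ j) \<le> r" using d by (simp add: dist_norm)
        then have "cmod (fst q $ j) \<le> cmod (fst \<zeta> $ j) + r"
          using norm_triangle_ineq4[of "fst \<zeta> $ j" "fst \<zeta> $ j - fst q $ j"] by simp
        moreover have "cmod (fst (corner r) $ j) = cmod (fst \<zeta> $ j) + r"
          unfolding corner_def fst_conv vec_lambda_beta norm_of_real using r(1) by simp
        ultimately show "cmod (fst q $ j) \<le> cmod (fst (corner r) $ j)" by simp
      qed
      show ?thesis unfolding f_def if_P[OF True] feat norm_mult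
        by (intro mult_left_mono mult_mono ex fb norm_ge_zero mult_nonneg_nonneg)
    qed (simp add: f_def)
  qed
  then show "\<exists>D. (siegel_synthesis \<nu> a has_derivative D) (at \<zeta>) \<and> (\<forall>c v. D (pair_scale c v) = c * D v)"
    unfolding f_eq[abs_def, symmetric] .
qed

lemma
  fixes F :: "(complex ^ 'n) \<times> complex \<Rightarrow> complex"
  shows bergman_space_iff: "F \<in> bergman_space \<nu> \<longleftrightarrow> pair.hol_on siegel_space F \<and> F \<in> sq_integrable (siegel_measure \<nu>)"
    and bergman_norm_eq: "pair.hol_on siegel_space F \<Longrightarrow> (bergman_norm \<nu> F)\<^sup>2 = sq_norm (siegel_measure \<nu>) F"
proof -
  have m: "F \<in> borel_measurable (siegel_measure \<nu>)" "(\<lambda>\<zeta>. (cmod (F \<zeta>))\<^sup>2) \<in> borel_measurable (siegel_measure \<nu>)"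
    if "pair.hol_on siegel_space F"
    using hol_on_siegel_measurable[OF that] by measurable
  have c: "siegel_rho \<zeta> powr \<nu> *\<^sub>R (cmod (F \<zeta>))\<^sup>2 = (norm (F \<zeta>))\<^sup>2 * siegel_rho \<zeta> powr \<nu>" for \<zeta> by simp
  show "F \<in> bergman_space \<nu> \<longleftrightarrow> pair.hol_on siegel_space F \<and> F \<in> sq_integrable (siegel_measure \<nu>)"
    using m integrable_siegel_measure[of "\<lambda>\<zeta>. (cmod (F \<zeta>))\<^sup>2" \<nu>, unfolded c]
    by (auto simp: bergman_space_def siegel_holomorphic_iff_hol_on sq_integrable_def)
  assume "pair.hol_on siegel_space F"
  note i = integral_siegel_measure[OF m(2)[OF this], unfolded c]
  have "(LINT \<zeta>:siegel_space|lborel. (norm (F \<zeta>))\<^sup>2 * siegel_rho \<zeta> powr \<nu>) \<ge> 0"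
    unfolding i[symmetric] by simp
  then show "(bergman_norm \<nu> F)\<^sup>2 = sq_norm (siegel_measure \<nu>) F"
    unfolding bergman_norm_def sq_norm_def i by (rule real_sqrt_pow2)
qed

theorem
  fixes a :: "('n::finite \<Rightarrow> nat) \<times> real \<Rightarrow> complex"
  assumes \<nu>: "\<nu> > -1"
  shows siegel_synthesis_bergman: "a \<in> sq_integrable (spectral_measure \<nu>) \<Longrightarrow> siegel_synthesis \<nu> a \<in> bergman_space \<nu>"
    and siegel_synthesis_isometry: "a \<in> sq_integrable (spectral_measure \<nu>) \<Longrightarrow>
      (bergman_norm \<nu> (siegel_synthesis \<nu> a))\<^sup>2 = sq_norm (spectral_measure \<nu>) a"
    and siegel_synthesis_surjective: "F \<in> bergman_space \<nu> \<Longrightarrow>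
      \<exists>a\<in>sq_integrable (spectral_measure \<nu> :: (('n \<Rightarrow> nat) \<times> real) measure). \<forall>\<zeta>\<in>siegel_space. F \<zeta> = siegel_synthesis \<nu> a \<zeta>"
proof -
  interpret reproducing_feature_map "siegel_measure \<nu> :: ((complex ^ 'n) \<times> complex) measure" "spectral_measure \<nu>" "siegel_feature \<nu>"
    by (rule siegel_reproducing_feature_map[OF \<nu>])
  note eq = synthesis_eq[OF \<nu>]
  have inj: "AE y in spectral_measure \<nu>. b y = 0" if "b \<in> sq_integrable (spectral_measure \<nu>)"
      "\<And>x. x \<in> space (siegel_measure \<nu>) \<Longrightarrow> synthesis b x = 0" for b :: "('n \<Rightarrow> nat) \<times> real \<Rightarrow> complex"
    using siegel_synthesis_injective[OF \<nu> that(1)] that(2) unfolding eq space_siegel_measure by blast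
  show "\<exists>a\<in>sq_integrable (spectral_measure \<nu> :: (('n \<Rightarrow> nat) \<times> real) measure). \<forall>\<zeta>\<in>siegel_space. F \<zeta> = siegel_synthesis \<nu> a \<zeta>"
    if "F \<in> bergman_space \<nu>"
  proof -
    have F: "F \<in> reproduced" using that unfolding bergman_space_iff by (intro bergman_reproduced[OF \<nu>]) blast+
    have "\<exists>a\<in>sq_integrable (spectral_measure \<nu>). \<forall>x\<in>space (siegel_measure \<nu>). F x = synthesis a x"
      by (rule synthesis_unitary(2)[OF _ F]) (rule inj)
    then show ?thesis unfolding eq space_siegel_measure .
  qed
  assume a: "a \<in> sq_integrable (spectral_measure \<nu>)"
  note hol = siegel_synthesis_holomorphic[OF \<nu> a]
  show "siegel_synthesis \<nu> a \<in> bergman_space \<nu>"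
    unfolding bergman_space_iff using hol synthesis_contraction(1)[OF a] unfolding eq by (rule conjI)
  show "(bergman_norm \<nu> (siegel_synthesis \<nu> a))\<^sup>2 = sq_norm (spectral_measure \<nu>) a"
  proof -
    have "sq_norm (siegel_measure \<nu>) (synthesis a) = sq_norm (spectral_measure \<nu>) a"
      by (rule synthesis_unitary(1)[OF _ a]) (rule inj)
    then show ?thesis unfolding eq bergman_norm_eq[OF hol] .
  qed
qed

section \<open>Operator fields with values in the constants\<close>

definition basis_scale :: "real \<Rightarrow> ('n::finite \<Rightarrow> nat) \<Rightarrow> real" where
  "basis_scale m \<alpha> = sqrt (\<Prod>j\<in>UNIV. (m / 2) ^ \<alpha> j / fact (\<alpha> j))"

lemma fock_basis_scale: "fock_basis m \<alpha> = (\<lambda>w. of_real (basis_scale m \<alpha>) * monomial \<alpha> w)"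
  by (intro ext) (simp add: fock_basis_def basis_scale_def)

lemma basis_scale_pos: "m > 0 \<Longrightarrow> basis_scale m \<alpha> > 0"
  unfolding basis_scale_def by (intro real_sqrt_gt_zero prod_pos) simp

lemma basis_scale_measurable[measurable]: "(\<lambda>l. basis_scale \<bar>l\<bar> \<alpha>) \<in> borel_measurable borel"
  unfolding basis_scale_def by measurable

lemma monomial_fock_set:
  assumes m: "m > 0" shows "monomial \<alpha> \<in> fock_set m"
proof -
  have "(\<lambda>w. of_real (1 / basis_scale m \<alpha>) * fock_basis m \<alpha> w) \<in> fock_set m"
    by (intro fock_set_cmult fock_basis_fock_set m)
  moreover have "(\<lambda>w. of_real (1 / basis_scale m \<alpha>) * fock_basis m \<alpha> w) = monomial \<alpha>"
    using basis_scale_pos[OF m, of \<alpha>] by (intro ext) (simp add: fock_basis_scale)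
  ultimately show ?thesis by simp
qed

lemma hilbert_schmidt_basis:
  assumes l: "l \<noteq> 0" and T: "fock_hilbert_schmidt l T"
  shows "T (fock_basis \<bar>l\<bar> \<alpha>) = (\<lambda>w. of_real (basis_scale \<bar>l\<bar> \<alpha>) * T (monomial \<alpha>) w)"
proof -
  have "monomial \<alpha> \<in> fock_space l" using l by (simp add: fock_space_eq_fock_set monomial_fock_set)
  moreover have "\<forall>G\<in>fock_space l. \<forall>H\<in>fock_space l. \<forall>a b. T (\<lambda>w. a * G w + b * H w) = (\<lambda>w. a * T G w + b * T H w)"
    using T unfolding fock_hilbert_schmidt_def fock_bounded_operator_def by blast
  ultimately have "T (\<lambda>w. of_real (basis_scale \<bar>l\<bar> \<alpha>) * monomial \<alpha> w + 0 * monomial \<alpha> w)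
      = (\<lambda>w. of_real (basis_scale \<bar>l\<bar> \<alpha>) * T (monomial \<alpha>) w + 0 * T (monomial \<alpha>) w)" by blast
  then show ?thesis by (simp add: fock_basis_scale)
qed

lemma fock_inner_const_monomial:
  fixes \<beta> :: "'n::finite \<Rightarrow> nat"
  assumes l: "l \<noteq> 0"
  shows "fock_inner l (\<lambda>_. c) (monomial \<beta>) = (if \<beta> = (\<lambda>_. 0) then c else 0)"
proof -
  have m: "\<bar>l\<bar> > 0" using l by simp
  let ?I = "\<integral>w. cnj (monomial \<beta> w) \<partial>fock_measure \<bar>l\<bar>"
  have one: "fock_basis \<bar>l\<bar> (\<lambda>_ :: 'n. 0) = (\<lambda>_. 1)"
    by (intro ext) (simp add: fock_basis_def monomial_def)
  have s: "basis_scale \<bar>l\<bar> \<beta> > 0" by (rule basis_scale_pos[OF m])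
  have "of_real (basis_scale \<bar>l\<bar> \<beta>) * ?I = finner \<bar>l\<bar> (fock_basis \<bar>l\<bar> (\<lambda>_. 0)) (fock_basis \<bar>l\<bar> \<beta>)"
    unfolding finner_def one by (simp add: fock_basis_scale)
  also have "\<dots> = (if \<beta> = (\<lambda>_. 0) then 1 else 0)" by (auto simp: fock_basis_inner[OF m])
  finally have I: "of_real (basis_scale \<bar>l\<bar> \<beta>) * ?I = (if \<beta> = (\<lambda>_. 0) then 1 else 0)" .
  have "?I = (if \<beta> = (\<lambda>_. 0) then 1 else 0)"
  proof (cases "\<beta> = (\<lambda>_. 0)")
    case True
    then have "basis_scale \<bar>l\<bar> \<beta> = 1" by (simp add: basis_scale_def)
    then show ?thesis using I by simp
  next
    case False
    then show ?thesis using I s by simp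
  qed
  moreover have "fock_inner l (\<lambda>_. c) (monomial \<beta>) = c * ?I"
    by (subst fock_inner_eq[OF l]) (simp_all add: finner_def)
  ultimately show ?thesis by simp
qed

lemma lebesgue_measurable_AE:
  fixes f g :: "real \<Rightarrow> 'b::topological_space"
  assumes g: "g \<in> borel_measurable lebesgue" and ae: "AE l in lebesgue. f l = g l"
  shows "f \<in> borel_measurable lebesgue"
proof (rule measurableI)
  fix A :: "'b set" assume A: "A \<in> sets borel"
  show "f -` A \<inter> space lebesgue \<in> sets lebesgue"
  proof (rule completion.in_sets_AE)
    show "AE l in lebesgue. l \<in> g -` A \<inter> space lebesgue \<longleftrightarrow> l \<in> f -` A \<inter> space lebesgue"
      using ae by eventually_elim simp
    show "g -` A \<inter> space lebesgue \<in> sets lebesgue" by (rule measurable_sets[OF g A])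
  qed simp
qed simp

lemma lebesgue_integral_AE:
  fixes f g :: "real \<Rightarrow> 'b::{banach, second_countable_topology}"
  assumes g: "integrable lborel g" and ae: "AE l in lborel. f l = g l"
  shows "integrable lebesgue f" "(\<integral>l. f l \<partial>lebesgue) = (\<integral>l. g l \<partial>lborel)"
proof -
  have gm: "g \<in> borel_measurable lborel" using g by (rule borel_measurable_integrable)
  have gl: "integrable lebesgue g" using g gm by (simp add: integrable_completion)
  have aec: "AE l in lebesgue. f l = g l" by (rule AE_completion[OF ae])
  have fm: "f \<in> borel_measurable lebesgue"
    by (rule lebesgue_measurable_AE[OF borel_measurable_integrable[OF gl] aec])
  show "integrable lebesgue f"
    using gl fm borel_measurable_integrable[OF gl] aec by (subst integrable_cong_AE)
  have "(\<integral>l. f l \<partial>lebesgue) = (\<integral>l. g l \<partial>lebesgue)"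
    by (rule integral_cong_AE[OF fm borel_measurable_integrable[OF gl] aec])
  then show "(\<integral>l. f l \<partial>lebesgue) = (\<integral>l. g l \<partial>lborel)" by (simp add: integral_completion[OF gm])
qed

lemma lebesgue_measurable_borel_version:
  fixes g :: "real \<Rightarrow> complex"
  assumes g: "g \<in> borel_measurable lebesgue"
  obtains g' where "g' \<in> borel_measurable borel" "AE l in lborel. g l = g' l"
proof -
  obtain u where u: "u \<in> borel_measurable lborel" "AE l in lborel. Re (g l) = u l"
    using completion_ex_borel_measurable_real[of "\<lambda>l. Re (g l)" lborel] g by auto
  obtain v where v: "v \<in> borel_measurable lborel" "AE l in lborel. Im (g l) = v l"
    using completion_ex_borel_measurable_real[of "\<lambda>l. Im (g l)" lborel] g by auto
  have [measurable]: "u \<in> borel_measurable borel" "v \<in> borel_measurable borel" using u(1) v(1) by simp_all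
  show ?thesis
  proof
    show "(\<lambda>l. Complex (u l) (v l)) \<in> borel_measurable borel" unfolding Complex_eq by measurable
    show "AE l in lborel. g l = Complex (u l) (v l)"
      using u(2) v(2) by eventually_elim (simp add: complex_eq_iff)
  qed
qed

text \<open>
  The values on the Fock basis determine a field of operators into the constants; the relation only
  sees the field up to null sets.
\<close>

definition has_coefficients ::
  "(real \<Rightarrow> (complex ^ 'n \<Rightarrow> complex) \<Rightarrow> (complex ^ 'n \<Rightarrow> complex)) \<Rightarrow> (('n \<Rightarrow> nat) \<times> real \<Rightarrow> complex) \<Rightarrow> bool" where
  "has_coefficients \<tau> a \<longleftrightarrow> (AE l in lborel. l < 0 \<longrightarrow>
     constant_valued l (\<tau> l) (\<lambda>G. \<tau> l G 0) \<and> (\<forall>\<alpha>. \<tau> l (fock_basis \<bar>l\<bar> \<alpha>) 0 = a (\<alpha>, l)))"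

text \<open>
  The Gaussian factor of the trace formula is what turns \<open>e\<^sup>h\<^sup>l\<close> into the modulus of the holomorphic
  exponential \<open>e\<^sup>-\<^sup>i\<^sup>l\<^sup>w\<close> in the last coordinate \<open>w\<close>.
\<close>

lemma inversion_integrand_eq:
  fixes \<zeta> :: "(complex ^ 'n) \<times> complex"
  assumes l: "l < 0" and c: "constant_valued l (\<tau> l) (\<lambda>G. \<tau> l G 0)" and a: "\<And>\<alpha>. \<tau> l (fock_basis \<bar>l\<bar> \<alpha>) 0 = a (\<alpha>, l)"
  shows "inversion_integrand \<tau> \<zeta> l = spectral_integrand a \<zeta> l"
proof -
  let ?z = "fst \<zeta>" and ?t = "Re (snd \<zeta>)" and ?h = "Im (snd \<zeta>) - (norm (fst \<zeta>))\<^sup>2 / 4"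
  have E: "of_real (exp (?h * l)) * exp (of_real (l / 4 * (norm ?z)\<^sup>2) - \<i> * of_real (l * ?t)) = exp (- \<i> * of_real l * snd \<zeta>)"
    unfolding exp_of_real[symmetric] mult_exp_exp
    by (rule arg_cong[of _ _ exp]) (simp add: complex_eq_iff field_simps)
  show ?thesis
    unfolding inversion_integrand_def siegel_coords_def spectral_integrand_def prod.case
      constant_valued.trace_formula[OF c l] a mult.assoc[symmetric] E ..
qed

lemma
  fixes a :: "('n::finite \<Rightarrow> nat) \<times> real \<Rightarrow> complex" and \<zeta> :: "(complex ^ 'n) \<times> complex"
  assumes \<nu>: "\<nu> > -1" and a: "a \<in> sq_integrable (spectral_measure \<nu>)" and \<tau>: "has_coefficients \<tau> a" and \<zeta>: "\<zeta> \<in> siegel_space"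
  shows inversion_integrand_integrable: "set_integrable lebesgue {..<0} (inversion_integrand \<tau> \<zeta>)"
    and inversion_integral_eq: "inversion_integral \<tau> \<zeta> = siegel_synthesis \<nu> a \<zeta>"
proof -
  have ae: "AE l in lborel. indicator {..<0} l *\<^sub>R inversion_integrand \<tau> \<zeta> l = indicator {..<0} l *\<^sub>R spectral_integrand a \<zeta> l"
    using \<tau> unfolding has_coefficients_def
  proof eventually_elim
    case (elim l)
    show ?case
    proof (cases "l < 0")
      case True
      with elim have "inversion_integrand \<tau> \<zeta> l = spectral_integrand a \<zeta> l" by (intro inversion_integrand_eq) auto
      then show ?thesis by simp
    qed simp
  qed
  note L = lebesgue_integral_AE[OF spectral_integrand_integrable[OF \<nu> a \<zeta>] ae]
  show "set_integrable lebesgue {..<0} (inversion_integrand \<tau> \<zeta>)"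
    unfolding set_integrable_def by (rule L(1))
  show "inversion_integral \<tau> \<zeta> = siegel_synthesis \<nu> a \<zeta>"
    unfolding inversion_integral_def set_lebesgue_integral_def L(2) siegel_synthesis_eq[OF \<nu> a \<zeta>] ..
qed

lemma spectral_weight_eq:
  "l < 0 \<Longrightarrow> spectral_weight \<nu> n l = Gamma (\<nu> + 1) / 2 powr (\<nu> + 1) * (1 / (2 * pi) ^ (n + 1)) * \<bar>l\<bar> powr (real n - (\<nu> + 1))"
  by (simp add: spectral_weight_def)

lemma
  fixes a :: "('n::finite \<Rightarrow> nat) \<times> real \<Rightarrow> complex"
  assumes \<nu>: "\<nu> > -1" and a: "a \<in> sq_integrable (spectral_measure \<nu>)" and \<tau>: "has_coefficients \<tau> a"
  shows hs_norm_integrable: "set_integrable lebesgue {..<0} (\<lambda>l. (fock_hs_norm l (\<tau> l))\<^sup>2 * \<bar>l\<bar> powr (real CARD('n) - (\<nu> + 1)))"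
    and op_field_norm_eq: "Gamma (\<nu> + 1) / 2 powr (\<nu> + 1) * (op_field_norm \<nu> \<tau>)\<^sup>2 = sq_norm (spectral_measure \<nu>) a"
proof -
  let ?n = "CARD('n)"
  define g where "g = Gamma (\<nu> + 1) / 2 powr (\<nu> + 1)"
  define q where "q = 1 / (2 * pi) ^ (?n + 1)"
  have gq: "g > 0" "q > 0" using Gamma_real_pos[of "\<nu> + 1"] \<nu> by (simp_all add: g_def q_def)
  define f where "f l = spectral_weight \<nu> ?n l * sq_norm (count_space UNIV) (\<lambda>\<alpha>. a (\<alpha>, l))" for l
  have f: "integrable lborel f" unfolding f_def by (rule spectral_norm_integrable[OF \<nu> a])
  have ae: "AE l in lborel. indicator {..<0} l *\<^sub>R ((fock_hs_norm l (\<tau> l))\<^sup>2 * \<bar>l\<bar> powr (real ?n - (\<nu> + 1))) = 1 / (g * q) * f l"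
    using \<tau> unfolding has_coefficients_def
  proof eventually_elim
    case (elim l)
    show ?case
    proof (cases "l < 0")
      case True
      with elim have c: "constant_valued l (\<tau> l) (\<lambda>G. \<tau> l G 0)" and "\<And>\<alpha>. \<tau> l (fock_basis \<bar>l\<bar> \<alpha>) 0 = a (\<alpha>, l)" by auto
      then have "(fock_hs_norm l (\<tau> l))\<^sup>2 = sq_norm (count_space UNIV) (\<lambda>\<alpha>. a (\<alpha>, l))"
        using constant_valued.hs_norm[OF c] by simp
      then show ?thesis using True gq
        unfolding f_def spectral_weight_eq[OF True] g_def[symmetric] q_def[symmetric] by simp
    qed (simp add: f_def spectral_weight_zero)
  qed
  note L = lebesgue_integral_AE[OF integrable_mult_right[OF f, of "1 / (g * q)"] ae]
  show "set_integrable lebesgue {..<0} (\<lambda>l. (fock_hs_norm l (\<tau> l))\<^sup>2 * \<bar>l\<bar> powr (real ?n - (\<nu> + 1)))"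
    unfolding set_integrable_def by (rule L(1))
  have f0: "(\<integral>l. f l \<partial>lborel) = sq_norm (spectral_measure \<nu>) a" unfolding f_def by (rule sq_norm_spectral[OF \<nu> a, symmetric])
  have I: "(LINT l:{..<0}|lebesgue. (fock_hs_norm l (\<tau> l))\<^sup>2 * \<bar>l\<bar> powr (real ?n - (\<nu> + 1))) = 1 / (g * q) * sq_norm (spectral_measure \<nu>) a"
    unfolding set_lebesgue_integral_def L(2) f0[symmetric] by (rule integral_mult_right_zero)
  have "(op_field_norm \<nu> \<tau>)\<^sup>2 = q * (1 / (g * q) * sq_norm (spectral_measure \<nu>) a)"
    unfolding op_field_norm_def I q_def[symmetric] using gq by (intro real_sqrt_pow2) simp
  then show "Gamma (\<nu> + 1) / 2 powr (\<nu> + 1) * (op_field_norm \<nu> \<tau>)\<^sup>2 = sq_norm (spectral_measure \<nu>) a"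
    unfolding g_def[symmetric] using gq by simp
qed

lemma constant_valued_series:
  fixes b :: "('n::finite \<Rightarrow> nat) \<Rightarrow> complex"
  assumes "l \<noteq> 0" "b \<in> sq_integrable (count_space UNIV)"
  shows "constant_valued l (series_operator l b) (\<lambda>G. series_operator l b G 0)"
  by (rule constant_valued.intro[OF assms(1) series_operator_hilbert_schmidt[OF assms]]) (simp add: series_operator_def)

text \<open>
  The sections of \<open>a\<close> are square-summable for almost every \<open>l < 0\<close> only, whereas a field must be
  Hilbert-Schmidt for every \<open>l\<close>; on the exceptional set and for \<open>l > 0\<close> the zero operator is used.
\<close>

lemma op_field_of_coefficients:
  fixes a :: "('n::finite \<Rightarrow> nat) \<times> real \<Rightarrow> complex"
  assumes \<nu>: "\<nu> > -1" and a: "a \<in> sq_integrable (spectral_measure \<nu>)"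
  obtains \<tau> where "\<tau> \<in> op_field_space \<nu>" "has_coefficients \<tau> a"
proof -
  note am[measurable] = spectral_measurableD[OF sq_integrable_measurable[OF a]]
  define S where "S l \<longleftrightarrow> l < 0 \<and> (\<lambda>\<alpha>. a (\<alpha>, l)) \<in> sq_integrable (count_space UNIV)" for l
  note [measurable] = spectral_section_nn_measurable[of a, OF am]
  have [measurable]: "Measurable.pred borel S" unfolding S_def[abs_def] sq_integrable_count_nn by measurable
  define b where "b l \<alpha> = (if S l then a (\<alpha>, l) else 0)" for l \<alpha>
  have bm[measurable]: "(\<lambda>l. b l \<alpha>) \<in> borel_measurable borel" for \<alpha> unfolding b_def by measurable
  have b: "b l \<in> sq_integrable (count_space UNIV)" for l
  proof (cases "S l")
    case True
    then have "b l = (\<lambda>\<alpha>. a (\<alpha>, l))" by (intro ext) (simp add: b_def)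
    with True show ?thesis by (simp add: S_def)
  next
    case False
    then have "b l = (\<lambda>_. 0)" by (intro ext) (simp add: b_def)
    then show ?thesis by simp
  qed
  define \<tau> where "\<tau> l = (series_operator l (b l) :: (complex ^ 'n \<Rightarrow> complex) \<Rightarrow> _)" for l
  have cv: "constant_valued l (\<tau> l) (\<lambda>G. \<tau> l G 0)" if "l \<noteq> 0" for l
    unfolding \<tau>_def by (rule constant_valued_series[OF that b])
  have hs: "fock_hilbert_schmidt l (\<tau> l)" if "l \<noteq> 0" for l by (rule constant_valued.hs[OF cv[OF that]])
  have const: "\<tau> l G = (\<lambda>_. \<tau> l G 0)" for l G by (simp add: \<tau>_def series_operator_def)
  have basis: "\<tau> l (fock_basis \<bar>l\<bar> \<alpha>) 0 = b l \<alpha>" if "l \<noteq> 0" for l \<alpha>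
    unfolding \<tau>_def series_operator_basis[OF that] ..
  have coeff: "has_coefficients \<tau> a"
    unfolding has_coefficients_def using spectral_sections[OF \<nu> a]
  proof eventually_elim
    case (elim l)
    show ?case
    proof (intro impI conjI allI)
      assume l: "l < 0"
      then have l0: "l \<noteq> 0" by simp
      show "constant_valued l (\<tau> l) (\<lambda>G. \<tau> l G 0)" by (rule cv[OF l0])
      have "S l" using elim l unfolding S_def by blast
      then show "\<tau> l (fock_basis \<bar>l\<bar> \<alpha>) 0 = a (\<alpha>, l)" for \<alpha> unfolding basis[OF l0] b_def by (rule if_P)
    qed
  qed
  have "\<tau> \<in> op_field_space \<nu>"
    unfolding op_field_space_def mem_Collect_eq
  proof (intro conjI allI impI ballI)
    fix \<alpha> \<beta> :: "'n \<Rightarrow> nat"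
    have "fock_inner l (\<tau> l (monomial \<alpha>)) (monomial \<beta>) = (if \<beta> = (\<lambda>_. 0) then b l \<alpha> / of_real (basis_scale \<bar>l\<bar> \<alpha>) else 0)"
      if l: "l \<noteq> 0" for l
    proof -
      have "b l \<alpha> = of_real (basis_scale \<bar>l\<bar> \<alpha>) * \<tau> l (monomial \<alpha>) 0"
        using hilbert_schmidt_basis[OF l hs[OF l], of \<alpha>] basis[OF l, of \<alpha>] by simp
      then show ?thesis using basis_scale_pos[of "\<bar>l\<bar>" \<alpha>] l
        by (subst const) (simp add: fock_inner_const_monomial)
    qed
    moreover have "(\<lambda>l. if \<beta> = (\<lambda>_. 0) then b l \<alpha> / of_real (basis_scale \<bar>l\<bar> \<alpha>) else 0) \<in> borel_measurable (lebesgue_on (UNIV - {0}))"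
      by (intro measurable_restrict_space1 measurable_completion) simp
    ultimately show "(\<lambda>l. fock_inner l (\<tau> l (monomial \<alpha>)) (monomial \<beta>)) \<in> borel_measurable (lebesgue_on (UNIV - {0}))"
      by (subst measurable_cong[where g = "\<lambda>l. if \<beta> = (\<lambda>_. 0) then b l \<alpha> / of_real (basis_scale \<bar>l\<bar> \<alpha>) else 0"]) auto
  next
    fix l :: real assume "l \<noteq> 0" then show "fock_hilbert_schmidt l (\<tau> l)" by (rule hs)
  next
    fix l :: real and G :: "complex ^ 'n \<Rightarrow> complex" assume "l > 0"
    then have "b l = (\<lambda>_. 0)" by (simp add: b_def S_def fun_eq_iff)
    then show "\<tau> l G = (\<lambda>_. 0)" by (simp add: \<tau>_def series_operator_def)
  next
    fix l :: real
    show "\<tau> l ` fock_space l \<subseteq> {(\<lambda>_. c) | c. True}" using const by blast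
  next
    show "set_integrable lebesgue {..<0} (\<lambda>l. (fock_hs_norm l (\<tau> l))\<^sup>2 * \<bar>l\<bar> powr (real CARD('n) - (\<nu> + 1)))"
      by (rule hs_norm_integrable[OF \<nu> a coeff])
  qed
  with coeff show ?thesis by (rule that[rotated])
qed

text \<open>
  The matrix coefficients of a field are Lebesgue measurable.  There are countably many of them, so
  Borel versions can be chosen that agree with all of them outside a single null set.
\<close>

lemma coefficients_of_op_field:
  fixes \<tau> :: "real \<Rightarrow> (complex ^ 'n \<Rightarrow> complex) \<Rightarrow> (complex ^ 'n \<Rightarrow> complex)"
  assumes \<nu>: "\<nu> > -1" and \<tau>: "\<tau> \<in> op_field_space \<nu>"
  obtains a where "a \<in> sq_integrable (spectral_measure \<nu>)" "has_coefficients \<tau> a"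
proof -
  let ?n = "CARD('n)"
  have hs: "fock_hilbert_schmidt l (\<tau> l)" and ran: "\<tau> l ` fock_space l \<subseteq> {(\<lambda>_. c) | c. True}" if "l \<noteq> 0" for l
    using \<tau> that unfolding op_field_space_def by auto
  have const: "\<tau> l G = (\<lambda>_. \<tau> l G 0)" if l: "l \<noteq> 0" and G: "G \<in> fock_set \<bar>l\<bar>" for l G
  proof -
    have "\<tau> l G \<in> {(\<lambda>_. c) | c. True}" using ran[OF l] G unfolding fock_space_eq_fock_set[OF l] by blast
    then show ?thesis by auto
  qed
  have cv: "constant_valued l (\<tau> l) (\<lambda>G. \<tau> l G 0)" if "l \<noteq> 0" for l
    by (rule constant_valued.intro[OF that hs[OF that]]) (rule const[OF that])
  define c where "c \<alpha> l = of_real (basis_scale \<bar>l\<bar> \<alpha>) * fock_inner l (\<tau> l (monomial \<alpha>)) (monomial (\<lambda>_. 0))" for \<alpha> :: "'n \<Rightarrow> nat" and l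
  have c: "\<tau> l (fock_basis \<bar>l\<bar> \<alpha>) 0 = c \<alpha> l" if l: "l \<noteq> 0" for l \<alpha>
  proof -
    have "fock_inner l (\<tau> l (monomial \<alpha>)) (monomial (\<lambda>_. 0)) = \<tau> l (monomial \<alpha>) 0"
      using l by (subst const[OF l monomial_fock_set]) (simp_all add: fock_inner_const_monomial)
    then show ?thesis unfolding c_def hilbert_schmidt_basis[OF l hs[OF l]] by simp
  qed
  have "\<exists>g. g \<in> borel_measurable borel \<and> (AE l in lborel. l \<noteq> 0 \<longrightarrow> c \<alpha> l = g l)" for \<alpha>
  proof -
    have "(\<lambda>l. fock_inner l (\<tau> l (monomial \<alpha>)) (monomial (\<lambda>_. 0))) \<in> borel_measurable (lebesgue_on (UNIV - {0}))"
      using \<tau> unfolding op_field_space_def by blast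
    moreover have "(\<lambda>l. complex_of_real (basis_scale \<bar>l\<bar> \<alpha>)) \<in> borel_measurable (lebesgue_on (UNIV - {0}))"
      by (intro measurable_restrict_space1 measurable_completion) simp
    ultimately have "c \<alpha> \<in> borel_measurable (lebesgue_on (UNIV - {0}))" unfolding c_def by (rule borel_measurable_times[rotated])
    then have "(\<lambda>l. indicator (UNIV - {0}) l *\<^sub>R c \<alpha> l) \<in> borel_measurable lebesgue"
      by (subst (asm) borel_measurable_restrict_space_iff) auto
    then obtain g where g: "g \<in> borel_measurable borel" "AE l in lborel. indicator (UNIV - {0}) l *\<^sub>R c \<alpha> l = g l"
      by (rule lebesgue_measurable_borel_version)
    from g(2) have "AE l in lborel. l \<noteq> 0 \<longrightarrow> c \<alpha> l = g l" by eventually_elim auto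
    with g(1) show ?thesis by blast
  qed
  then obtain g where g: "\<And>\<alpha>. g \<alpha> \<in> borel_measurable borel" "\<And>\<alpha>. AE l in lborel. l \<noteq> 0 \<longrightarrow> c \<alpha> l = g \<alpha> l" by metis
  define a where "a y = g (fst y) (snd y)" for y
  have am[measurable]: "a \<in> borel_measurable (spectral_measure \<nu>)" by (rule spectral_measurableI) (simp add: a_def g)
  have "AE l in lborel. \<forall>\<alpha>. l \<noteq> 0 \<longrightarrow> c \<alpha> l = g \<alpha> l" 
    unfolding AE_all_countable by (intro allI g(2))
  then have coeff: "has_coefficients \<tau> a"
    unfolding has_coefficients_def
  proof eventually_elim
    case (elim l)
    show ?case
    proof (intro impI conjI allI)
      assume "l < 0"
      then have l0: "l \<noteq> 0" by simp
      show "constant_valued l (\<tau> l) (\<lambda>G. \<tau> l G 0)" by (rule cv[OF l0])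
      show "\<tau> l (fock_basis \<bar>l\<bar> \<alpha>) 0 = a (\<alpha>, l)" for \<alpha>
        unfolding c[OF l0] a_def fst_conv snd_conv using elim l0 by blast
    qed
  qed
  define K where "K = Gamma (\<nu> + 1) / 2 powr (\<nu> + 1) * (1 / (2 * pi) ^ (?n + 1))"
  have K: "K > 0" using Gamma_real_pos[of "\<nu> + 1"] \<nu> by (simp add: K_def)
  define f where "f l = K * (indicator {..<0} l *\<^sub>R ((fock_hs_norm l (\<tau> l))\<^sup>2 * \<bar>l\<bar> powr (real ?n - (\<nu> + 1))))" for l
  have f: "integrable lebesgue f"
    using \<tau> unfolding f_def op_field_space_def set_integrable_def mem_Collect_eq by (intro integrable_mult_right) blast
  have "(\<integral>\<^sup>+y. ennreal ((cmod (a y))\<^sup>2) \<partial>spectral_measure \<nu>) = (\<integral>\<^sup>+l. ennreal (norm (f l)) \<partial>lborel)"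
  proof (subst nn_integral_spectral[OF \<nu>])
    show "(\<integral>\<^sup>+l. ennreal (spectral_weight \<nu> ?n l) * (\<integral>\<^sup>+\<alpha>. ennreal ((cmod (a (\<alpha>, l)))\<^sup>2) \<partial>count_space UNIV) \<partial>lborel) = (\<integral>\<^sup>+l. ennreal (norm (f l)) \<partial>lborel)"
    proof (rule nn_integral_cong_AE)
      show "AE l in lborel. ennreal (spectral_weight \<nu> ?n l) * (\<integral>\<^sup>+\<alpha>. ennreal ((cmod (a (\<alpha>, l)))\<^sup>2) \<partial>count_space UNIV) = ennreal (norm (f l))"
        using coeff unfolding has_coefficients_def
      proof eventually_elim
        case (elim l)
        show ?case
        proof (cases "l < 0")
          case True
          with elim have cvl: "constant_valued l (\<tau> l) (\<lambda>G. \<tau> l G 0)" and al: "\<And>\<alpha>. \<tau> l (fock_basis \<bar>l\<bar> \<alpha>) 0 = a (\<alpha>, l)" by auto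
          have s: "(\<lambda>\<alpha>. a (\<alpha>, l)) \<in> sq_integrable (count_space UNIV)"
            using constant_valued.coefficients_sq_integrable[OF cvl] by (simp add: al)
          have n: "sq_norm (count_space UNIV) (\<lambda>\<alpha>. a (\<alpha>, l)) = (fock_hs_norm l (\<tau> l))\<^sup>2"
            using constant_valued.hs_norm[OF cvl] by (simp add: al)
          have "norm (f l) = K * ((fock_hs_norm l (\<tau> l))\<^sup>2 * \<bar>l\<bar> powr (real ?n - (\<nu> + 1)))" using True K by (simp add: f_def)
          also have "\<dots> = spectral_weight \<nu> ?n l * (fock_hs_norm l (\<tau> l))\<^sup>2"
            unfolding spectral_weight_eq[OF True] K_def[symmetric] by simp
          finally have "norm (f l) = spectral_weight \<nu> ?n l * (fock_hs_norm l (\<tau> l))\<^sup>2" .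
          then show ?thesis
            unfolding nn_integral_count_sq[OF s] n by (simp add: spectral_weight_nonneg[OF \<nu>] ennreal_mult)
        qed (simp add: f_def spectral_weight_zero)
      qed
    qed
  qed measurable
  also have "\<dots> = (\<integral>\<^sup>+l. ennreal (norm (f l)) \<partial>lebesgue)" by (rule nn_integral_completion[symmetric])
  also have "\<dots> < \<infinity>" using f unfolding integrable_iff_bounded by blast
  finally have "a \<in> sq_integrable (spectral_measure \<nu>)"
    unfolding sq_integrable_def integrable_iff_bounded by simp
  then show ?thesis using coeff by (rule that)
qed


lemma bergman_space_cong:
  fixes F G :: "(complex ^ 'n) \<times> complex \<Rightarrow> complex"
  assumes "\<And>\<zeta>. \<zeta> \<in> siegel_space \<Longrightarrow> F \<zeta> = G \<zeta>"
  shows "F \<in> bergman_space \<nu> \<longleftrightarrow> G \<in> bergman_space \<nu>"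
proof -
  have "pair.hol_on siegel_space F \<longleftrightarrow> pair.hol_on siegel_space G"
    using pair.hol_on_cong[OF _ open_siegel, of F G] pair.hol_on_cong[OF _ open_siegel, of G F] assms by metis
  then show ?thesis unfolding bergman_space_iff
    using sq_integrable_cong[of "siegel_measure \<nu>" F G] assms by simp
qed

lemma bergman_norm_cong:
  assumes "\<And>\<zeta>. \<zeta> \<in> siegel_space \<Longrightarrow> F \<zeta> = G \<zeta>"
  shows "bergman_norm \<nu> F = bergman_norm \<nu> G"
  unfolding bergman_norm_def set_lebesgue_integral_def
  by (intro arg_cong[of _ _ sqrt] Bochner_Integration.integral_cong refl) (simp add: indicator_def assms)


section \<open>The Paley-Wiener theorem\<close>

theorem theorem1:
  fixes \<nu> :: real
  assumes "\<nu> > -1"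
  shows "(\<forall>F :: (complex ^ 'n) \<times> complex \<Rightarrow> complex. F \<in> bergman_space \<nu> \<longrightarrow>
            (\<exists>\<tau> \<in> op_field_space \<nu>.
               (\<forall>\<zeta>\<in>siegel_space.
                  set_integrable lebesgue {..<0} (inversion_integrand \<tau> \<zeta>) \<and>
                  F \<zeta> = inversion_integral \<tau> \<zeta>) \<and>
               (bergman_norm \<nu> F)\<^sup>2 =
                 Gamma (\<nu> + 1) / 2 powr (\<nu> + 1) * (op_field_norm \<nu> \<tau>)\<^sup>2)) \<and>
         (\<forall>\<tau> \<in> op_field_space \<nu>. \<forall>F :: (complex ^ 'n) \<times> complex \<Rightarrow> complex.
            (\<forall>\<zeta>\<in>siegel_space. set_integrable lebesgue {..<0} (inversion_integrand \<tau> \<zeta>)) \<and>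
            ((\<forall>\<zeta>\<in>siegel_space. F \<zeta> = inversion_integral \<tau> \<zeta>) \<longrightarrow>
               F \<in> bergman_space \<nu> \<and>
               (bergman_norm \<nu> F)\<^sup>2 =
                 Gamma (\<nu> + 1) / 2 powr (\<nu> + 1) * (op_field_norm \<nu> \<tau>)\<^sup>2))"
proof (intro conjI allI ballI impI)
  fix F :: "(complex ^ 'n) \<times> complex \<Rightarrow> complex" assume F: "F \<in> bergman_space \<nu>"
  obtain a :: "('n \<Rightarrow> nat) \<times> real \<Rightarrow> complex" where a: "a \<in> sq_integrable (spectral_measure \<nu>)"
    and Fa: "\<And>\<zeta>. \<zeta> \<in> siegel_space \<Longrightarrow> F \<zeta> = siegel_synthesis \<nu> a \<zeta>"
    using siegel_synthesis_surjective[OF assms F] by blast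
  obtain \<tau> :: "real \<Rightarrow> (complex ^ 'n \<Rightarrow> complex) \<Rightarrow> (complex ^ 'n \<Rightarrow> complex)" where \<tau>: "\<tau> \<in> op_field_space \<nu>" "has_coefficients \<tau> a"
    by (rule op_field_of_coefficients[OF assms a])
  have N: "bergman_norm \<nu> F = bergman_norm \<nu> (siegel_synthesis \<nu> a)" by (rule bergman_norm_cong) (rule Fa)
  show "\<exists>\<tau> \<in> op_field_space \<nu>.
      (\<forall>\<zeta>\<in>siegel_space. set_integrable lebesgue {..<0} (inversion_integrand \<tau> \<zeta>) \<and> F \<zeta> = inversion_integral \<tau> \<zeta>) \<and>
      (bergman_norm \<nu> F)\<^sup>2 = Gamma (\<nu> + 1) / 2 powr (\<nu> + 1) * (op_field_norm \<nu> \<tau>)\<^sup>2"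
  proof (intro bexI[OF _ \<tau>(1)] conjI ballI)
    fix \<zeta> :: "(complex ^ 'n) \<times> complex" assume \<zeta>: "\<zeta> \<in> siegel_space"
    show "set_integrable lebesgue {..<0} (inversion_integrand \<tau> \<zeta>)" by (rule inversion_integrand_integrable[OF assms a \<tau>(2) \<zeta>])
    show "F \<zeta> = inversion_integral \<tau> \<zeta>" unfolding inversion_integral_eq[OF assms a \<tau>(2) \<zeta>] by (rule Fa[OF \<zeta>])
  next
    show "(bergman_norm \<nu> F)\<^sup>2 = Gamma (\<nu> + 1) / 2 powr (\<nu> + 1) * (op_field_norm \<nu> \<tau>)\<^sup>2"
      unfolding N op_field_norm_eq[OF assms a \<tau>(2)] by (rule siegel_synthesis_isometry[OF assms a])
  qed
next
  fix \<tau> :: "real \<Rightarrow> (complex ^ 'n \<Rightarrow> complex) \<Rightarrow> (complex ^ 'n \<Rightarrow> complex)" and F :: "(complex ^ 'n) \<times> complex \<Rightarrow> complex"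
  assume \<tau>: "\<tau> \<in> op_field_space \<nu>"
  obtain a where a: "a \<in> sq_integrable (spectral_measure \<nu>)" "has_coefficients \<tau> a"
    by (rule coefficients_of_op_field[OF assms \<tau>])
  show "set_integrable lebesgue {..<0} (inversion_integrand \<tau> \<zeta>)" if "\<zeta> \<in> siegel_space" for \<zeta>
    by (rule inversion_integrand_integrable[OF assms a that])
  assume F: "\<forall>\<zeta>\<in>siegel_space. F \<zeta> = inversion_integral \<tau> \<zeta>"
  have Fa: "F \<zeta> = siegel_synthesis \<nu> a \<zeta>" if "\<zeta> \<in> siegel_space" for \<zeta>
    using F that by (simp add: inversion_integral_eq[OF assms a])
  show "F \<in> bergman_space \<nu>"
  proof -
    have "F \<in> bergman_space \<nu> \<longleftrightarrow> siegel_synthesis \<nu> a \<in> bergman_space \<nu>" by (rule bergman_space_cong) (rule Fa)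
    then show ?thesis using siegel_synthesis_bergman[OF assms a(1)] by (rule iffD2)
  qed
  have N: "bergman_norm \<nu> F = bergman_norm \<nu> (siegel_synthesis \<nu> a)" by (rule bergman_norm_cong) (rule Fa)
  show "(bergman_norm \<nu> F)\<^sup>2 = Gamma (\<nu> + 1) / 2 powr (\<nu> + 1) * (op_field_norm \<nu> \<tau>)\<^sup>2"
    unfolding N op_field_norm_eq[OF assms a] by (rule siegel_synthesis_isometry[OF assms a(1)])
qed

end
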